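(* Let $n\ge 1$, let $g \in H(\mathbb D^n)$, $g(z) = \sum_{k \in \mathbb Z_+^n} c_k z^k$. Let $\alpha>0$, $\beta>0$ and let $p,q,s,t$ be positive real numbers such that $t\leq 1$, $\frac{t}{2}< s \leq t < \infty$, $0 < \max(p,q) \leq s <\infty$, and $\beta+\frac{1}{t}<\alpha + \frac{1}{p} < \frac{2}{t}$. Let $m \in \mathbb N$ with $m > \frac{2}{t}-1$. Then: $1^\circ$. $\{ c_k \}_{k \in \mathbb Z_+^n} \in M_T(F^{p,q}_\alpha (\mathbb D^n), A^{t,s}_\beta(\mathbb D^n))$ if and only if $$\sup_{r \in I^n} M_t(D^mg, r)(1-r)^{m+1 - \frac{1}{p} + \beta - \alpha} < \infty.$$ $2^\circ$. $\{ c_k \}_{k \in \mathbb Z_+^n} \in M_T(A^{p,q}_\alpha (\mathbb D^n), A^{t,s}_\beta(\mathbb D^n))$ if and only if $$\sup_{r \in I^n} M_t(D^mg, r)(1-r)^{m+1 - \frac{1}{p} + \beta - \alpha} < \infty.$$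
   Context: Notation. $\mathbb D=\{z\in\mathbb C:|z|<1\}$, $\mathbb T=\partial\mathbb D$, $\mathbb D^n$ is the unit polydisc in $\mathbb C^n$, $\mathbb T^n$ its distinguished boundary with normalized Lebesgue measure $d\xi$, $I=[0,1)$, $\mathbb Z_+=\{0,1,2,\dots\}$, and $dR=dR_1\cdots dR_n$ is Lebesgue measure on $I^n$. $H(\mathbb D^n)$ is the space of holomorphic functions on $\mathbb D^n$. For $k\in\mathbb Z_+^n$ and $z\in\mathbb C^n$, $z^k=z_1^{k_1}\cdots z_n^{k_n}$. For $r\in I^n$ and $\gamma\in\mathbb R$, $(1-r)^\gamma=\prod_{j=1}^n(1-r_j)^\gamma$; for $r\in I^n$, $\xi\in\mathbb T^n$, $r\xi=(r_1\xi_1,\dots,r_n\xi_n)$. Fractional derivative: for $\beta>-1$ and $f(z)=\sum_{k\in\mathbb Z_+^n}a_kz^k\in H(\mathbb D^n)$, $$D^\beta f(z)=\sum_{k\in\mathbb Z_+^n}\left(\prod_{j=1}^n\frac{\Gamma(k_j+\beta+1)}{\Gamma(\beta+1)\Gamma(k_j+1)}\right)a_kz^k .$$ Integral means: for $0<p<\infty$, $r\in I^n$, $M_p(f,r)=\left(\int_{\mathbb T^n}|f(r\xi)|^p\,d\xi\right)^{1/p}$. Spaces, for $0<p,q<\infty$ and $\alpha>0$: $A^{p,q}_\alpha(\mathbb D^n)$ is the space of $f\in H(\mathbb D^n)$ with $$\|f\|_{A^{p,q}_\alpha}^q=\int_{I^n}M_p^q(f,R)(1-R)^{\alpha q-1}\,dR<\infty,$$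 and $F^{p,q}_\alpha(\mathbb D^n)$ is the space of $f\in H(\mathbb D^n)$ with $$\|f\|_{F^{p,q}_\alpha}^p=\int_{\mathbb T^n}\left(\int_{I^n}|f(R\xi)|^q(1-R)^{\alpha q-1}\,dR\right)^{p/q}d\xi<\infty.$$ Coefficient multipliers: for quasi-normed subspaces $X,Y$ of $H(\mathbb D^n)$, $M_T(X,Y)$ is the set of all sequences $c=\{c_k\}_{k\in\mathbb Z_+^n}$ such that for every $f(z)=\sum_k a_kz^k$ in $X$ the function $h(z)=\sum_k c_ka_kz^k$ belongs to $Y$. *)

theory Defs
  imports "HOL-Analysis.Analysis"
begin

text \<open>Points of n-dimensional complex space are vectors over a finite index type \<open>'n\<close>, with
  \<open>n = CARD('n)\<close>; multi-indices are vectors of natural numbers over the same index type.\<close>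

definition polydisc :: "(complex ^ 'n) set" where
  "polydisc = {z. \<forall>j. norm (z $ j) < 1}"

definition unit_torus :: "(complex ^ 'n) set" where
  "unit_torus = {z. \<forall>j. norm (z $ j) = 1}"

definition unit_cube :: "(real ^ 'n) set" where
  "unit_cube = {r. \<forall>j. 0 \<le> r $ j \<and> r $ j < 1}"

text \<open>The normalized Lebesgue measure on the torus is the law of \<open>(exp (i \<theta>\<^sub>j))\<^sub>j\<close> for \<open>\<theta>\<close>
  uniformly distributed in \<open>[0, 2\<pi>]\<^sup>n\<close>. Its underlying space is the torus and not the whole of
  the complex vector space, so that the values of a function away from the torus are irrelevant
  for measurability.\<close>

definition torus_measure :: "(complex ^ 'n) measure" where
  "torus_measure =
     distr (uniform_measure lborel (cbox 0 (\<chi> j. 2 * pi))) (restrict_space borel unit_torus)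
       (\<lambda>\<theta> :: real ^ 'n. \<chi> j. cis (\<theta> $ j))"

definition monom_pow :: "complex ^ 'n \<Rightarrow> nat ^ 'n \<Rightarrow> complex" where
  "monom_pow z k = (\<Prod>j\<in>UNIV. (z $ j) ^ (k $ j))"

definition radial_weight :: "real ^ 'n \<Rightarrow> real \<Rightarrow> real" where
  "radial_weight r \<gamma> = (\<Prod>j\<in>UNIV. (1 - r $ j) powr \<gamma>)"

definition scale_vec :: "real ^ 'n \<Rightarrow> complex ^ 'n \<Rightarrow> complex ^ 'n" where
  "scale_vec r \<xi> = (\<chi> j. complex_of_real (r $ j) * \<xi> $ j)"

text \<open>Holomorphy in several variables: continuous and holomorphic in each variable separately.
  Functions are total; only their values on the polydisc matter below.\<close>

definition hol_polydisc :: "(complex ^ 'n \<Rightarrow> complex) set" where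
  "hol_polydisc = {f. continuous_on polydisc f \<and>
     (\<forall>z\<in>polydisc. \<forall>j. (\<lambda>w. f (\<chi> i. if i = j then w else z $ i)) holomorphic_on ball 0 1)}"

definition has_power_series :: "(complex ^ 'n \<Rightarrow> complex) \<Rightarrow> (nat ^ 'n \<Rightarrow> complex) \<Rightarrow> bool" where
  "has_power_series f a \<longleftrightarrow> (\<forall>z\<in>polydisc. ((\<lambda>k. a k * monom_pow z k) has_sum f z) UNIV)"

text \<open>The coefficients exist and are unique for holomorphic \<open>f\<close>.\<close>

definition power_coeffs :: "(complex ^ 'n \<Rightarrow> complex) \<Rightarrow> nat ^ 'n \<Rightarrow> complex" where
  "power_coeffs f = (THE a. has_power_series f a)"

definition frac_deriv :: "real \<Rightarrow> (complex ^ 'n \<Rightarrow> complex) \<Rightarrow> complex ^ 'n \<Rightarrow> complex" where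
  "frac_deriv \<beta> f z =
     (\<Sum>\<^sub>\<infinity>k. complex_of_real
         (\<Prod>j\<in>UNIV. Gamma (real (k $ j) + \<beta> + 1) / (Gamma (\<beta> + 1) * Gamma (real (k $ j) + 1)))
       * power_coeffs f k * monom_pow z k)"

text \<open>Real powers of extended nonnegative reals; used for positive exponents only.\<close>

definition ennpowr :: "ennreal \<Rightarrow> real \<Rightarrow> ennreal" where
  "ennpowr x a = (if x = \<infinity> then \<infinity> else ennreal (enn2real x powr a))"

definition integral_mean :: "real \<Rightarrow> (complex ^ 'n \<Rightarrow> complex) \<Rightarrow> real ^ 'n \<Rightarrow> ennreal" where
  "integral_mean p f r =
     ennpowr (\<integral>\<^sup>+ \<xi>. ennreal (norm (f (scale_vec r \<xi>)) powr p) \<partial>torus_measure) (1 / p)"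

text \<open>The spaces \<open>A\<close> and \<open>F\<close>, each with (a power of) its quasi-norm.\<close>

definition A_norm_pow :: "real \<Rightarrow> real \<Rightarrow> real \<Rightarrow> (complex ^ 'n \<Rightarrow> complex) \<Rightarrow> ennreal" where
  "A_norm_pow p q \<alpha> f =
     (\<integral>\<^sup>+ R\<in>unit_cube. ennpowr (integral_mean p f R) q
        * ennreal (radial_weight R (\<alpha> * q - 1)) \<partial>lborel)"

definition A_space :: "real \<Rightarrow> real \<Rightarrow> real \<Rightarrow> (complex ^ 'n \<Rightarrow> complex) set" where
  "A_space p q \<alpha> = {f \<in> hol_polydisc. A_norm_pow p q \<alpha> f < \<infinity>}"

definition F_norm_pow :: "real \<Rightarrow> real \<Rightarrow> real \<Rightarrow> (complex ^ 'n \<Rightarrow> complex) \<Rightarrow> ennreal" where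
  "F_norm_pow p q \<alpha> f =
     (\<integral>\<^sup>+ \<xi>. ennpowr
        (\<integral>\<^sup>+ R\<in>unit_cube. ennreal (norm (f (scale_vec R \<xi>)) powr q)
           * ennreal (radial_weight R (\<alpha> * q - 1)) \<partial>lborel)
        (p / q) \<partial>torus_measure)"

definition F_space :: "real \<Rightarrow> real \<Rightarrow> real \<Rightarrow> (complex ^ 'n \<Rightarrow> complex) set" where
  "F_space p q \<alpha> = {f \<in> hol_polydisc. F_norm_pow p q \<alpha> f < \<infinity>}"

definition multipliers ::
  "(complex ^ 'n \<Rightarrow> complex) set \<Rightarrow> (complex ^ 'n \<Rightarrow> complex) set \<Rightarrow> (nat ^ 'n \<Rightarrow> complex) set" where
  "multipliers X Y =
     {c. \<forall>f\<in>X. \<exists>h\<in>Y. has_power_series h (\<lambda>k. c k * power_coeffs f k)}"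

end

theory Submission
  imports Defs "HOL-Complex_Analysis.Complex_Analysis" "HOL-Probability.Probability_Measure"
    "HOL-Computational_Algebra.Fundamental_Theorem_Algebra"
begin

text \<open>
  Sufficiency. By orthogonality on the torus, \<open>h (R z)\<close> is the integral over the radii \<open>\<rho>\<close> and the
  torus of \<open>D\<^sup>m g (R \<rho> z \<xi>\<inverse>) f (\<rho> \<xi>)\<close> against a weight in \<open>1 - \<rho>\<^sup>2\<close>. Subharmonicity of
  \<open>\<bar>f\<bar>\<^sup>\<kappa>\<close> bounds the integrand pointwise by its own \<open>t\<close>-th power mean, so \<open>\<bar>h\<bar>\<^sup>t\<close> is at most the
  integral of the \<open>t\<close>-th powers although \<open>t \<le> 1\<close>; the same device with exponent \<open>s / t\<close> handles the
  radial integral. This bounds the multiplier on \<open>A\<close> with indices \<open>t\<close>, \<open>s\<close>, \<open>\<alpha> + 1/p - 1/t\<close>, a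
  space into which both \<open>F\<close> and \<open>A\<close> with indices \<open>p\<close>, \<open>q\<close>, \<open>\<alpha>\<close> embed.

  Necessity. The normalised kernels \<open>\<Prod>\<^sub>j (1 - \<rho>\<^sub>j)\<^sup>e (1 - \<rho>\<^sub>j z\<^sub>j)\<^bsup>-(m+1)\<^esup>\<close> with
  \<open>e = m + 1 - \<alpha> - 1/p\<close> are bounded in both spaces, and the multiplier sends them to
  \<open>\<Prod>\<^sub>j (1 - \<rho>\<^sub>j)\<^sup>e D\<^sup>m g (\<rho> z)\<close>. A multiplier is not assumed to be bounded, so instead of a closed
  graph argument a gliding hump is used: if the supremum were infinite, a rapidly convergent
  superposition of kernels would be mapped outside the target space.
\<close>

section \<open>Powers and integral inequalities\<close>

text \<open>Members of either space grow at most like (1 - r)^(-(\<alpha> + 1/p)), and this sum is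
  what the embeddings preserve: passing from p to t replaces \<alpha> by \<alpha> + 1/p - 1/t. The
  bounds on m and on \<alpha> + 1/p serve to make exponents positive. From m > 2/t - 1 comes t(m +
  1) - 2 > 0, so that the radial weights of the t-th power integrals are integrable; from \<alpha> +
  1/p < 2/t < m + 1 it follows that the kernels carry a positive normalising exponent and that the
  growth order of D^m g in the criterion exceeds \<beta>, which is what the last radial integral of
  the sufficiency part needs. Subharmonicity of |f|^\<kappa> for small \<kappa> cannot be read off a
  holomorphic power of f, since f may have zeros; it is proved for polynomials, whose zeros can be
  treated one at a time, and passed to the limit. In the necessity part D^m g is seen only at
  \<open>\<rho> * \<rho>\<close>, one factor coming from the kernel and one from the torus on which
  the image is measured; since 1 - \<rho>^2 and 1 - \<rho> are comparable, nothing is lost.\<close>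

lemma ennpowr_top [simp]: "ennpowr \<infinity> a = \<infinity>" "ennpowr top a = top"
  by (simp_all add: ennpowr_def)

lemma ennpowr_ennreal: "0 \<le> x \<Longrightarrow> ennpowr (ennreal x) a = ennreal (x powr a)"
  by (simp add: ennpowr_def)

lemma ennpowr_0 [simp]: "ennpowr 0 a = 0"
  by (simp add: ennpowr_def)

lemma ennpowr_1 [simp]: "ennpowr x 1 = x"
  by (cases x) (simp_all add: ennpowr_ennreal)

lemma ennpowr_mono:
  assumes "x \<le> y" "0 \<le> a"
  shows "ennpowr x a \<le> ennpowr y a"
proof (cases y)
  case (real r)
  then obtain u where "x = ennreal u" "0 \<le> u"
    using assms(1) by (cases x) (auto simp: top_unique)
  then show ?thesis
    using real assms by (auto simp: ennpowr_ennreal intro!: ennreal_leI powr_mono2)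
qed simp

text \<open>Valid for every real exponent, even in the case 0 * top = 0, because
  \<open>0 powr a = 0\<close> for all \<open>a\<close> and \<open>top\<close> is sent to
  \<open>top\<close> whatever \<open>a\<close> is. This makes the later exponent calculus free of
  finiteness conditions.\<close>

lemma ennpowr_mult:
  "ennpowr (x * y) a = ennpowr x a * ennpowr y a"
proof (cases x; cases y)
  fix u v assume "x = ennreal u" "0 \<le> u" "y = ennreal v" "0 \<le> v"
  then show ?thesis
    by (simp add: ennpowr_ennreal powr_mult flip: ennreal_mult)
next
  fix u assume u: "x = ennreal u" "0 \<le> u" "y = top"
  then show ?thesis
    by (cases "u = 0") (auto simp: ennpowr_ennreal ennreal_mult_top)
next
  fix u assume u: "y = ennreal u" "0 \<le> u" "x = top"
  then show ?thesis
    by (cases "u = 0") (auto simp: ennpowr_ennreal ennreal_top_mult)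
qed auto

lemma ennpowr_ennpowr: "ennpowr (ennpowr x a) b = ennpowr x (a * b)"
  by (cases x) (simp_all add: ennpowr_ennreal powr_powr)

lemma ennpowr_add: "ennpowr x (a + b) = ennpowr x a * ennpowr x b"
  by (cases x) (simp_all add: ennpowr_ennreal powr_add flip: ennreal_mult)

lemma ennpowr_eq_top_iff [simp]: "ennpowr x a = top \<longleftrightarrow> x = top"
  by (cases x) (simp_all add: ennpowr_ennreal)

lemma ennpowr_less_top_iff [simp]: "ennpowr x a < top \<longleftrightarrow> x < top"
  by (simp add: less_top[symmetric])

lemma ennpowr_prod: "ennpowr (\<Prod>i\<in>A. f i) a = (\<Prod>i\<in>A. ennpowr (f i) a)"
  by (induction A rule: infinite_finite_induct)
     (simp_all add: ennpowr_mult flip: ennreal_1, simp_all add: ennpowr_ennreal del: ennreal_1)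

lemma measurable_ennpowr [measurable]:
  assumes [measurable]: "f \<in> borel_measurable M"
  shows "(\<lambda>x. ennpowr (f x) a) \<in> borel_measurable M"
  unfolding ennpowr_def by measurable

text \<open>Convexity: the tangent to x^Q at \<open>c\<close> lies below the graph. Both constants
  are kept on the side where they are added, since extended nonnegative reals have no useful
  subtraction.\<close>

lemma Young_ennpowr:
  assumes "1 \<le> Q" "0 \<le> c"
  shows "ennreal (Q * c powr (Q - 1)) * x \<le> ennpowr x Q + ennreal ((Q - 1) * c powr Q)"
proof (cases x)
  case (real r)
  have "Q * c powr (Q - 1) * r \<le> r powr Q + (Q - 1) * c powr Q"
  proof (cases "c = 0 \<or> r = 0")
    case True
    then show ?thesis using assms real by auto
  next
    case False
    have "(r powr Q) powr (1 / Q) * (c powr Q) powr (1 - 1 / Q) \<le> 1 / Q * r powr Q + (1 - 1 / Q) * c powr Q"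
      by (rule Youngs_inequality_0) (use False assms real in auto)
    then have "r * c powr (Q - 1) \<le> 1 / Q * r powr Q + (1 - 1 / Q) * c powr Q"
      using assms real by (simp add: powr_powr algebra_simps)
    then have "Q * (r * c powr (Q - 1)) \<le> Q * (1 / Q * r powr Q + (1 - 1 / Q) * c powr Q)"
      using assms by (intro mult_left_mono) auto
    also have "\<dots> = r powr Q + (Q - 1) * c powr Q"
      using assms by (simp add: field_simps)
    finally show ?thesis by (simp add: algebra_simps)
  qed
  then show ?thesis
    using assms real by (simp add: ennpowr_ennreal flip: ennreal_mult ennreal_plus)
qed auto

text \<open>Integrate the tangent inequality, with the tangent taken at the mean \<open>c\<close>
  itself. Total mass at most 1 is enough, because the constant term (Q - 1) c^Q of the tangent
  inequality is nonnegative.\<close>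

lemma Jensen_ennpowr:
  assumes Q: "1 \<le> Q" and [measurable]: "f \<in> borel_measurable M" "k \<in> borel_measurable M"
    and k: "(\<integral>\<^sup>+x. k x \<partial>M) \<le> 1"
  shows "ennpowr (\<integral>\<^sup>+x. f x * k x \<partial>M) Q \<le> (\<integral>\<^sup>+x. ennpowr (f x) Q * k x \<partial>M)"
proof -
  let ?J = "\<integral>\<^sup>+x. ennpowr (f x) Q * k x \<partial>M"
  have young: "ennreal (Q * c powr (Q - 1)) * (\<integral>\<^sup>+x. f x * k x \<partial>M) \<le> ?J + ennreal ((Q - 1) * c powr Q)"
    if "0 \<le> c" for c
  proof -
    have "ennreal (Q * c powr (Q - 1)) * (\<integral>\<^sup>+x. f x * k x \<partial>M)
        = (\<integral>\<^sup>+x. (ennreal (Q * c powr (Q - 1)) * f x) * k x \<partial>M)"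
      by (simp add: nn_integral_cmult mult.assoc)
    also have "\<dots> \<le> (\<integral>\<^sup>+x. (ennpowr (f x) Q + ennreal ((Q - 1) * c powr Q)) * k x \<partial>M)"
      by (intro nn_integral_mono mult_right_mono Young_ennpowr) (use Q that in auto)
    also have "\<dots> = ?J + ennreal ((Q - 1) * c powr Q) * (\<integral>\<^sup>+x. k x \<partial>M)"
      by (simp add: distrib_right nn_integral_add nn_integral_cmult)
    also have "\<dots> \<le> ?J + ennreal ((Q - 1) * c powr Q) * 1"
      by (intro add_left_mono mult_left_mono k) auto
    finally show ?thesis by simp
  qed
  show ?thesis
  proof (cases "\<integral>\<^sup>+x. f x * k x \<partial>M")
    case (real c)
    show ?thesis
    proof (cases "?J")
      case (real j)
      have "ennreal (Q * c powr (Q - 1)) * ennreal c \<le> ennreal j + ennreal ((Q - 1) * c powr Q)"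
        using young[of c] \<open>_ = ennreal c\<close> \<open>0 \<le> c\<close> real by simp
      then have "Q * (c powr (Q - 1)) * c \<le> j + (Q - 1) * c powr Q"
        using Q real \<open>0 \<le> c\<close> by (simp flip: ennreal_mult ennreal_plus)
      moreover have "c powr (Q - 1) * c = c powr Q"
        using \<open>0 \<le> c\<close> by (cases "c = 0") (auto simp: powr_diff)
      ultimately have "Q * c powr Q \<le> j + (Q - 1) * c powr Q"
        by (metis mult.assoc)
      then have "c powr Q \<le> j" by (simp add: left_diff_distrib)
      then show ?thesis
        using real \<open>_ = ennreal c\<close> \<open>0 \<le> c\<close> by (simp add: ennpowr_ennreal)
    qed simp
  next
    case top
    \<comment> \<open>For an infinite mean no tangent point is distinguished; \<open>c = 1\<close>
      serves, since its slope \<open>Q\<close> is positive and forces the right-hand side to be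
      infinite.\<close>
    then have "?J + ennreal (Q - 1) = top"
      using young[of 1] Q by (simp add: top_unique ennreal_mult_top)
    then show ?thesis by simp
  qed
qed

text \<open>The device by which integral inequalities with exponents below \<open>1\<close> are obtained: a pointwise
  bound of \<open>\<phi>\<close> by the integral \<open>J\<close> of \<open>\<phi>\<^sup>\<sigma>\<close> controls the surplus factor \<open>\<phi>\<^sup>1\<^sup>-\<^sup>\<sigma>\<close>.\<close>

lemma ennpowr_nn_integral_le:
  assumes \<sigma>: "0 < \<sigma>" "\<sigma> \<le> 1"
    and [measurable]: "\<phi> \<in> borel_measurable M" "v \<in> borel_measurable M"
    and w: "\<And>x. x \<in> space M \<Longrightarrow> w x = v x * ennpowr (y x) (1 - \<sigma>)"
    and J: "J = (\<integral>\<^sup>+x. ennpowr (\<phi> x) \<sigma> * v x \<partial>M)"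
    and bound: "\<And>x. x \<in> space M \<Longrightarrow> ennpowr (\<phi> x * y x) \<sigma> \<le> C * J"
  shows "ennpowr (\<integral>\<^sup>+x. \<phi> x * w x \<partial>M) \<sigma> \<le> ennpowr C (1 - \<sigma>) * J"
proof -
  \<comment> \<open>Since \<open>\<phi> * w\<close> is
    \<open>\<phi>^\<sigma> * v * (\<phi> * y)^(1 - \<sigma>)\<close>, the assumption
    \<open>bound\<close>, raised to the power \<open>(1 - \<sigma>) / \<sigma>\<close>, controls the
    last factor by the constant \<open>K\<close>. The power of \<open>J\<close> hidden in
    \<open>K\<close> is such that \<open>(J * K)^\<sigma>\<close> is again linear in
    \<open>J\<close>.\<close>
  define K where "K = ennpowr (C * J) ((1 - \<sigma>) / \<sigma>)"
  have "\<phi> x * w x \<le> ennpowr (\<phi> x) \<sigma> * v x * K" if "x \<in> space M" for x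
  proof -
    have "\<phi> x = ennpowr (\<phi> x) \<sigma> * ennpowr (\<phi> x) (1 - \<sigma>)"
      using ennpowr_add[of "\<phi> x" \<sigma> "1 - \<sigma>"] by simp
    then have "\<phi> x * w x = ennpowr (\<phi> x) \<sigma> * v x * (ennpowr (\<phi> x) (1 - \<sigma>) * ennpowr (y x) (1 - \<sigma>))"
      using w[OF that] by (metis mult.assoc mult.left_commute)
    also have "ennpowr (\<phi> x) (1 - \<sigma>) * ennpowr (y x) (1 - \<sigma>) = ennpowr (ennpowr (\<phi> x * y x) \<sigma>) ((1 - \<sigma>) / \<sigma>)"
      using \<sigma> by (simp add: ennpowr_ennpowr ennpowr_mult)
    also have "\<dots> \<le> K"
      unfolding K_def using bound[OF that] \<sigma> by (intro ennpowr_mono) auto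
    finally show ?thesis by (simp add: mult_left_mono)
  qed
  then have "(\<integral>\<^sup>+x. \<phi> x * w x \<partial>M) \<le> (\<integral>\<^sup>+x. ennpowr (\<phi> x) \<sigma> * v x * K \<partial>M)"
    by (intro nn_integral_mono) auto
  also have "\<dots> = J * K"
    unfolding J by (simp add: nn_integral_multc)
  finally have "ennpowr (\<integral>\<^sup>+x. \<phi> x * w x \<partial>M) \<sigma> \<le> ennpowr (J * K) \<sigma>"
    using \<sigma> by (intro ennpowr_mono) auto
  also have "\<dots> = ennpowr J \<sigma> * (ennpowr C (1 - \<sigma>) * ennpowr J (1 - \<sigma>))"
    using \<sigma> by (simp add: K_def ennpowr_mult ennpowr_ennpowr)
  also have "\<dots> = ennpowr C (1 - \<sigma>) * (ennpowr J \<sigma> * ennpowr J (1 - \<sigma>))"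
    by (simp add: mult_ac)
  also have "ennpowr J \<sigma> * ennpowr J (1 - \<sigma>) = J"
    using ennpowr_add[of J \<sigma> "1 - \<sigma>"] by simp
  finally show ?thesis .
qed

text \<open>The Weierstrass test gives uniform convergence of the finite partial sums, and on a
  finite measure space uniform convergence commutes with integration. The index type is arbitrary,
  so the partial sums form a net rather than a sequence.\<close>

lemma has_sum_integral:
  fixes F :: "'b \<Rightarrow> 'a \<Rightarrow> complex"
  assumes "finite_measure M"
    and [measurable]: "\<And>k. F k \<in> borel_measurable M"
    and bound: "\<And>k x. x \<in> space M \<Longrightarrow> norm (F k x) \<le> B k"
    and B: "B summable_on UNIV"
    and sum: "\<And>x. x \<in> space M \<Longrightarrow> ((\<lambda>k. F k x) has_sum G x) UNIV"
  shows "integrable M G" "((\<lambda>k. \<integral>x. F k x \<partial>M) has_sum (\<integral>x. G x \<partial>M)) UNIV"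
proof -
  interpret finite_measure M by fact
  have unif: "uniform_limit (space M) (\<lambda>X y. \<Sum>k\<in>X. F k y) G (finite_subsets_at_top UNIV)"
    by (rule Weierstrass_m_test_general'[OF _ _ B]) (use bound sum in auto)
  have intF: "integrable M (F k)" for k
    by (rule integrable_const_bound[where B = "B k"]) (use bound in auto)
  have near: "\<exists>X. finite X \<and> (\<forall>Y x. finite Y \<longrightarrow> X \<subseteq> Y \<longrightarrow> x \<in> space M \<longrightarrow> dist (\<Sum>k\<in>Y. F k x) (G x) < \<epsilon>)"
    if "\<epsilon> > 0" for \<epsilon>
    using uniform_limitD[OF unif that] by (auto simp: eventually_finite_subsets_at_top)
  \<comment> \<open>Measurability is inherited by limits of sequences, not of nets, so a sequence of
    finite index sets with errors below \<open>1 / Suc n\<close> is selected.\<close>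
  have "\<forall>n. \<exists>X. finite X \<and> (\<forall>x\<in>space M. dist (\<Sum>k\<in>X. F k x) (G x) < 1 / Suc n)"
  proof
    fix n show "\<exists>X. finite X \<and> (\<forall>x\<in>space M. dist (\<Sum>k\<in>X. F k x) (G x) < 1 / Suc n)"
      using near[of "1 / Suc n"] by auto
  qed
  then obtain X where X: "\<And>n. finite (X n)"
    "\<And>n x. x \<in> space M \<Longrightarrow> dist (\<Sum>k\<in>X n. F k x) (G x) < 1 / Suc n"
    by metis
  have [measurable]: "G \<in> borel_measurable M"
  proof (rule borel_measurable_LIMSEQ_metric)
    show "(\<lambda>n. \<Sum>k\<in>X n. F k x) \<longlonglongrightarrow> G x" if "x \<in> space M" for x
    proof (rule metric_LIMSEQ_I)
      fix r :: real assume "r > 0"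
      then obtain n where n: "1 / Suc n < r" using nat_approx_posE by blast
      have "dist (\<Sum>k\<in>X m. F k x) (G x) < r" if "n \<le> m" for m
      proof -
        have "1 / real (Suc m) \<le> 1 / real (Suc n)" using that by (simp add: field_simps)
        then show ?thesis using X(2)[OF \<open>x \<in> space M\<close>, of m] n by linarith
      qed
      then show "\<exists>n0. \<forall>m\<ge>n0. dist (\<Sum>k\<in>X m. F k x) (G x) < r" by auto
    qed
  qed measurable
  have G: "norm (G x) \<le> (\<Sum>\<^sub>\<infinity>k. B k)" if "x \<in> space M" for x
    by (rule norm_infsum_le[OF sum[OF that] has_sum_infsum[OF B]]) (use bound that in auto)
  show intG: "integrable M G"
    by (rule integrable_const_bound[where B = "\<Sum>\<^sub>\<infinity>k. B k"]) (use G in auto)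
  show "((\<lambda>k. \<integral>x. F k x \<partial>M) has_sum (\<integral>x. G x \<partial>M)) UNIV"
    unfolding has_sum_def
  proof (rule tendstoI)
    fix e :: real assume e: "e > 0"
    define m where "m = measure M (space M)"
    have "m \<ge> 0" by (simp add: m_def)
    define d where "d = e / (m + 1)"
    have d: "d > 0" "d * m < e"
      using e \<open>m \<ge> 0\<close> by (auto simp: d_def field_simps)
    obtain Z where Z: "finite Z"
      "\<And>Y x. finite Y \<Longrightarrow> Z \<subseteq> Y \<Longrightarrow> x \<in> space M \<Longrightarrow> dist (\<Sum>k\<in>Y. F k x) (G x) < d"
      using near[OF d(1)] by auto
    have "dist (\<Sum>k\<in>Y. \<integral>x. F k x \<partial>M) (\<integral>x. G x \<partial>M) < e" if "finite Y" "Z \<subseteq> Y" for Y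
    proof -
      have "(\<Sum>k\<in>Y. \<integral>x. F k x \<partial>M) - (\<integral>x. G x \<partial>M) = (\<integral>x. (\<Sum>k\<in>Y. F k x) - G x \<partial>M)"
        using intF intG by simp
      also have "norm \<dots> \<le> (\<integral>x. norm ((\<Sum>k\<in>Y. F k x) - G x) \<partial>M)"
        by (rule integral_norm_bound)
      also have "\<dots> \<le> (\<integral>x. d \<partial>M)"
      proof (rule integral_mono)
        show "integrable M (\<lambda>x. norm ((\<Sum>k\<in>Y. F k x) - G x))"
          using intF intG by auto
        show "norm ((\<Sum>k\<in>Y. F k x) - G x) \<le> d" if "x \<in> space M" for x
          using Z(2)[OF \<open>finite Y\<close> \<open>Z \<subseteq> Y\<close> that] by (simp add: dist_norm)
      qed simp
      also have "\<dots> = d * m" by (simp add: m_def)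
      finally show ?thesis using d by (simp add: dist_norm)
    qed
    then show "\<forall>\<^sub>F Y in finite_subsets_at_top UNIV. dist (\<Sum>k\<in>Y. \<integral>x. F k x \<partial>M) (\<integral>x. G x \<partial>M) < e"
      using Z(1) by (auto simp: eventually_finite_subsets_at_top)
  qed
qed

text \<open>Split at \<delta>: below it the maximum is \<delta> and the integral is
  \<delta>^(b-c)/b, above it the tail integral is \<delta>^(b-c)/(c-b). All kernel estimates below
  reduce to this one integral.\<close>

lemma nn_integral_powr_max_le:
  fixes b c \<delta> :: real
  assumes "0 < b" "b < c" "0 < \<delta>"
  shows "(\<integral>\<^sup>+x. ennreal (x powr (b - 1) * max \<delta> x powr (- c)) * indicator {0..} x \<partial>lborel)
           \<le> ennreal ((1 / b + 1 / (c - b)) * \<delta> powr (b - c))"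
proof -
  have 1: "(\<integral>\<^sup>+x. ennreal (indicator {0..\<delta>} x * (x powr (b - 1) * \<delta> powr (- c))) \<partial>lborel)
      = ennreal (\<delta> powr (b - 1 + 1) / (b - 1 + 1) * \<delta> powr (- c))"
    by (intro nn_integral_has_integral_lebesgue has_integral_mult_left has_integral_powr_from_0)
       (use assms in auto)
  have 2: "(\<integral>\<^sup>+x. ennreal (indicator {\<delta>..} x * (x powr (b - 1 - c))) \<partial>lborel)
      = ennreal (- (\<delta> powr (b - 1 - c + 1)) / (b - 1 - c + 1))"
    by (intro nn_integral_has_integral_lebesgue has_integral_powr_to_inf)
       (use assms in auto)
  have "(\<integral>\<^sup>+x. ennreal (x powr (b - 1) * max \<delta> x powr (- c)) * indicator {0..} x \<partial>lborel)
    \<le> (\<integral>\<^sup>+x. ennreal (indicator {0..\<delta>} x * (x powr (b - 1) * \<delta> powr (- c)))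
           + ennreal (indicator {\<delta>..} x * (x powr (b - 1 - c))) \<partial>lborel)"
    using assms
    by (intro nn_integral_mono)
       (auto simp: indicator_def max_def powr_diff powr_minus powr_add field_simps simp flip: ennreal_plus intro!: ennreal_leI)
  also have "\<dots> = ennreal (\<delta> powr (b - 1 + 1) / (b - 1 + 1) * \<delta> powr (- c))
        + ennreal (- (\<delta> powr (b - 1 - c + 1)) / (b - 1 - c + 1))"
    by (subst nn_integral_add) (auto simp: 1 2)
  also have "\<dots> = ennreal (\<delta> powr (b - 1 + 1) / (b - 1 + 1) * \<delta> powr (- c)
        + - (\<delta> powr (b - 1 - c + 1)) / (b - 1 - c + 1))"
    using assms by (subst ennreal_plus) (auto intro!: divide_nonneg_neg)
  also have "\<delta> powr (b - 1 + 1) / (b - 1 + 1) * \<delta> powr (- c)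
        + - (\<delta> powr (b - 1 - c + 1)) / (b - 1 - c + 1) = (1 / b + 1 / (c - b)) * \<delta> powr (b - c)"
  proof -
    have "b - 1 - c + 1 = - (c - b)" by simp
    then have 1: "- (\<delta> powr (b - 1 - c + 1)) / (b - 1 - c + 1) = \<delta> powr (b - c) / (c - b)"
      by (simp only: minus_divide_divide) simp
    have 2: "\<delta> powr (b - 1 + 1) / (b - 1 + 1) * \<delta> powr (- c) = \<delta> powr (b - c) / b"
      by (simp add: powr_diff powr_minus divide_simps)
    show ?thesis
      unfolding 1 2 by (simp add: distrib_right)
  qed
  finally show ?thesis .
qed

section \<open>The measures on the torus and on the cube\<close>

text \<open>Carried by the circle and not by the plane, in parallel with
  \<open>torus_measure\<close>; the torus measure then becomes a product of copies of it, with
  matching sigma-algebras.\<close>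

definition circle_measure :: "complex measure" where
  "circle_measure = distr (uniform_measure lborel {0..2 * pi}) (restrict_space borel (sphere 0 1)) cis"

definition unit_interval_measure :: "real measure" where
  "unit_interval_measure = restrict_space lborel {0..<1}"

definition cube_measure :: "(real ^ 'n) measure" where
  "cube_measure = restrict_space lborel unit_cube"

section \<open>Measurability and product structure of the measures\<close>

lemma measurable_vec_nth_borel [measurable]:
  "(\<lambda>x :: 'a::euclidean_space ^ 'n. x $ i) \<in> borel_measurable borel"
  by (intro borel_measurable_continuous_onI continuous_intros)

lemma measurable_vec_lambda_borel:
  assumes "\<And>i. (\<lambda>x. f x i) \<in> borel_measurable M"
  shows "(\<lambda>x. (\<chi> i. f x i) :: 'a::euclidean_space ^ 'n) \<in> borel_measurable M"
proof (subst borel_measurable_euclidean_space, intro ballI)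
  fix b :: "'a ^ 'n" assume "b \<in> Basis"
  then obtain i u where b: "b = axis i u" by (auto simp: Basis_vec_def)
  show "(\<lambda>x. (\<chi> i. f x i) \<bullet> b) \<in> borel_measurable M"
    using assms[of i] by (simp add: b inner_axis)
qed

text \<open>The two measures agree on open boxes, the basis vectors of \<open>real ^ 'n\<close>
  being the axes. This is the bridge from vectors to the function type on which product measures,
  and hence integrals of products, are available.\<close>

lemma lborel_vec_eq:
  "(lborel :: (real ^ 'n) measure) = distr (Pi\<^sub>M UNIV (\<lambda>_. lborel)) borel vec_lambda"
proof (rule lborel_eqI)
  interpret product_sigma_finite "\<lambda>_ :: 'n. lborel :: real measure" ..
  have [measurable]: "(vec_lambda :: _ \<Rightarrow> real ^ 'n) \<in> Pi\<^sub>M UNIV (\<lambda>_. lborel) \<rightarrow>\<^sub>M borel"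
    using measurable_vec_lambda_borel[of "\<lambda>x i. x i" "Pi\<^sub>M UNIV (\<lambda>_ :: 'n::finite. lborel :: real measure)"] by simp
  fix l u :: "real ^ 'n" assume le: "\<And>b. b \<in> Basis \<Longrightarrow> l \<bullet> b \<le> u \<bullet> b"
  have le': "l $ i \<le> u $ i" for i
    using le[of "axis i 1"] by (simp add: inner_axis axis_in_Basis_iff)
  have "vec_lambda -` box l u \<inter> space (Pi\<^sub>M UNIV (\<lambda>_. lborel)) = Pi\<^sub>E UNIV (\<lambda>i. {l $ i<..<u $ i})"
    by (auto simp: mem_box_cart space_PiM PiE_def Pi_def extensional_def)
  then have "emeasure (distr (Pi\<^sub>M UNIV (\<lambda>_. lborel)) borel vec_lambda) (box l u)
      = (\<Prod>i\<in>UNIV. emeasure lborel {l $ i<..<u $ i})"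
    by (simp add: emeasure_distr emeasure_PiM)
  also have "\<dots> = ennreal (\<Prod>i\<in>UNIV. (u - l) $ i)"
    using le' by (simp add: prod_ennreal)
  also have "(\<Prod>i\<in>UNIV. (u - l) $ i) = (\<Prod>b\<in>Basis. (u - l) \<bullet> b)"
    by (simp add: Basis_vec_def UNION_singleton_eq_range prod.reindex inj_on_def axis_eq_axis inner_axis)
  finally show "emeasure (distr (Pi\<^sub>M UNIV (\<lambda>_. lborel)) borel vec_lambda) (box l u) = (\<Prod>b\<in>Basis. (u - l) \<bullet> b)" .
qed simp

lemma emeasure_lborel_vec:
  assumes [measurable]: "\<And>i. B i \<in> sets borel"
  shows "emeasure lborel {x :: real ^ 'n. \<forall>i. x $ i \<in> B i} = (\<Prod>i\<in>UNIV. emeasure lborel (B i))"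
proof -
  interpret product_sigma_finite "\<lambda>_ :: 'n. lborel :: real measure" ..
  have [measurable]: "(vec_lambda :: _ \<Rightarrow> real ^ 'n) \<in> Pi\<^sub>M UNIV (\<lambda>_. lborel) \<rightarrow>\<^sub>M borel"
    using measurable_vec_lambda_borel[of "\<lambda>x i. x i" "Pi\<^sub>M UNIV (\<lambda>_ :: 'n::finite. lborel :: real measure)"] by simp
  have "{x :: real ^ 'n. \<forall>i. x $ i \<in> B i} = (\<Inter>i\<in>UNIV. (\<lambda>x. x $ i) -` B i \<inter> space borel)" by auto
  moreover have "(\<Inter>i\<in>UNIV. (\<lambda>x :: real ^ 'n. x $ i) -` B i \<inter> space borel) \<in> sets borel"
    by (intro sets.finite_INT measurable_sets[OF measurable_vec_nth_borel]) auto
  ultimately have m: "{x :: real ^ 'n. \<forall>i. x $ i \<in> B i} \<in> sets borel"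
    by (simp only:)
  have "vec_lambda -` {x :: real ^ 'n. \<forall>i. x $ i \<in> B i} \<inter> space (Pi\<^sub>M UNIV (\<lambda>_. lborel)) = Pi\<^sub>E UNIV B"
    by (auto simp: space_PiM PiE_def Pi_def extensional_def)
  then show ?thesis
    using m by (subst lborel_vec_eq) (simp add: emeasure_distr emeasure_PiM)
qed

lemma space_torus_measure [simp]: "space torus_measure = unit_torus"
  by (simp add: torus_measure_def space_restrict_space)

lemma space_cube_measure [simp]: "space cube_measure = unit_cube"
  by (simp add: cube_measure_def space_restrict_space)

lemma space_circle_measure [simp]: "space circle_measure = sphere 0 1"
  by (simp add: circle_measure_def space_restrict_space)

lemma space_unit_interval_measure [simp]: "space unit_interval_measure = {0..<1}"
  by (simp add: unit_interval_measure_def space_restrict_space)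

lemma sets_torus_measure: "sets torus_measure = sets (restrict_space borel unit_torus)"
  by (simp add: torus_measure_def)

lemma sets_circle_measure: "sets circle_measure = sets (restrict_space borel (sphere 0 1))"
  by (simp add: circle_measure_def)

lemma sets_cube_measure: "sets cube_measure = sets (restrict_space borel unit_cube)"
  by (simp add: cube_measure_def sets_restrict_space)

lemma sets_unit_interval_measure: "sets unit_interval_measure = sets (restrict_space borel {0..<1})"
  by (simp add: unit_interval_measure_def sets_restrict_space)

lemma unit_cube_sets: "(unit_cube :: (real ^ 'n) set) \<in> sets borel"
proof -
  have "unit_cube = (\<Inter>i\<in>UNIV. (\<lambda>x :: real ^ 'n. x $ i) -` {0..<1} \<inter> space borel)"
    by (auto simp: unit_cube_def)
  moreover have "(\<Inter>i\<in>UNIV. (\<lambda>x :: real ^ 'n. x $ i) -` {0..<1} \<inter> space borel) \<in> sets borel"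
    by (intro sets.finite_INT measurable_sets[OF measurable_vec_nth_borel]) auto
  ultimately show ?thesis by (simp only:)
qed

lemma measurable_vec_nth_torus [measurable]: "(\<lambda>x. x $ i) \<in> torus_measure \<rightarrow>\<^sub>M circle_measure"
  unfolding measurable_cong_sets[OF sets_torus_measure sets_circle_measure]
  by (intro measurable_restrict_space2 measurable_restrict_space1)
     (auto simp: space_restrict_space unit_torus_def)

lemma measurable_vec_nth_cube [measurable]: "(\<lambda>x. x $ i) \<in> cube_measure \<rightarrow>\<^sub>M unit_interval_measure"
  unfolding measurable_cong_sets[OF sets_cube_measure sets_unit_interval_measure]
  by (intro measurable_restrict_space2 measurable_restrict_space1)
     (auto simp: space_restrict_space unit_cube_def)

lemma measurable_circle_ident [measurable]: "(\<lambda>x. x) \<in> borel_measurable circle_measure"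
  unfolding measurable_cong_sets[OF sets_circle_measure refl] by (intro measurable_restrict_space1) simp

lemma measurable_unit_interval_ident [measurable]: "(\<lambda>x. x) \<in> borel_measurable unit_interval_measure"
  unfolding measurable_cong_sets[OF sets_unit_interval_measure refl] by (intro measurable_restrict_space1) simp

lemma measurable_torus_nth_borel [measurable]: "(\<lambda>x. x $ i) \<in> borel_measurable torus_measure"
  using measurable_compose[OF measurable_vec_nth_torus measurable_circle_ident] .

lemma measurable_cube_nth_borel [measurable]: "(\<lambda>x. x $ i) \<in> borel_measurable cube_measure"
  using measurable_compose[OF measurable_vec_nth_cube measurable_unit_interval_ident] .

lemma measurable_circleI:
  assumes "f \<in> borel_measurable M" "\<And>x. x \<in> space M \<Longrightarrow> norm (f x) = 1"
  shows "f \<in> M \<rightarrow>\<^sub>M circle_measure"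
  unfolding measurable_cong_sets[OF refl sets_circle_measure]
  using assms by (intro measurable_restrict_space2) auto

lemma measurable_vec_lambda_torus:
  assumes "\<And>i. (\<lambda>x. f x i) \<in> M \<rightarrow>\<^sub>M circle_measure"
  shows "(\<lambda>x. \<chi> i. f x i) \<in> M \<rightarrow>\<^sub>M torus_measure"
  unfolding measurable_cong_sets[OF refl sets_torus_measure]
proof (intro measurable_restrict_space2)
  show "(\<lambda>x. \<chi> i. f x i) \<in> space M \<rightarrow> unit_torus"
    using assms[THEN measurable_space] by (auto simp: unit_torus_def)
  show "(\<lambda>x. \<chi> i. f x i) \<in> borel_measurable M"
    using assms[THEN measurable_compose, OF measurable_circle_ident] by (rule measurable_vec_lambda_borel)
qed

lemma measurable_vec_lambda_cube:
  assumes "\<And>i. (\<lambda>x. f x i) \<in> M \<rightarrow>\<^sub>M unit_interval_measure"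
  shows "(\<lambda>x. \<chi> i. f x i) \<in> M \<rightarrow>\<^sub>M cube_measure"
  unfolding measurable_cong_sets[OF refl sets_cube_measure]
proof (intro measurable_restrict_space2)
  show "(\<lambda>x. \<chi> i. f x i) \<in> space M \<rightarrow> unit_cube"
    using assms[THEN measurable_space] by (auto simp: unit_cube_def)
  show "(\<lambda>x. \<chi> i. f x i) \<in> borel_measurable M"
    using assms[THEN measurable_compose, OF measurable_unit_interval_ident] by (rule measurable_vec_lambda_borel)
qed

lemma measurable_cis [measurable]: "cis \<in> borel \<rightarrow>\<^sub>M circle_measure"
  by (intro measurable_circleI borel_measurable_continuous_onI continuous_intros) simp

lemma prob_space_unit_interval: "prob_space unit_interval_measure"
  by (rule prob_spaceI) (simp add: unit_interval_measure_def emeasure_restrict_space)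

lemma measurable_circle_cong:
  "uniform_measure lborel {0..2 * pi} \<rightarrow>\<^sub>M restrict_space borel (sphere 0 1) = borel \<rightarrow>\<^sub>M circle_measure"
  by (rule measurable_cong_sets) (simp_all add: sets_circle_measure)

lemma prob_space_circle: "prob_space circle_measure"
  unfolding circle_measure_def
  by (intro prob_space.prob_space_distr prob_space_uniform_measure)
     (use measurable_cis measurable_circle_cong in simp_all)

lemma emeasure_circle:
  assumes "A \<in> sets circle_measure"
  shows "emeasure circle_measure A = emeasure lborel ({0..2 * pi} \<inter> cis -` A) / ennreal (2 * pi)"
proof -
  have c: "cis \<in> uniform_measure lborel {0..2 * pi} \<rightarrow>\<^sub>M restrict_space borel (sphere 0 1)"
    using measurable_cis measurable_circle_cong by simp
  show ?thesis
    using assms measurable_sets[OF measurable_cis assms] measurable_sets[OF c, of A]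
    by (simp add: circle_measure_def emeasure_distr[OF c])
qed

text \<open>By uniqueness of product measures only boxes have to be compared, and there the volume
  factorises. Together with the torus analogue it allows integrals of coordinatewise products to be
  computed factor by factor.\<close>

lemma distr_cube_measure:
  "distr cube_measure (Pi\<^sub>M UNIV (\<lambda>_. unit_interval_measure)) vec_nth = Pi\<^sub>M UNIV (\<lambda>_ :: 'n::finite. unit_interval_measure)"
proof -
  interpret prob_space unit_interval_measure by (rule prob_space_unit_interval)
  interpret product_sigma_finite "\<lambda>_ :: 'n. unit_interval_measure" ..
  have m: "vec_nth \<in> cube_measure \<rightarrow>\<^sub>M Pi\<^sub>M UNIV (\<lambda>_ :: 'n::finite. unit_interval_measure)"
    by (rule measurable_PiM_single') (auto simp: PiE_def unit_cube_def)
  show ?thesis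
  proof (rule PiM_eqI)
    fix A :: "'n \<Rightarrow> real set" assume A: "\<And>i. i \<in> UNIV \<Longrightarrow> A i \<in> sets unit_interval_measure"
    then have A': "A i \<subseteq> {0..<1}" "A i \<in> sets borel" for i
      using A[of i] by (auto simp: sets_unit_interval_measure sets_restrict_space_iff)
    have "vec_nth -` Pi\<^sub>E UNIV A \<inter> unit_cube = {x :: real ^ 'n. \<forall>i. x $ i \<in> A i}"
      using A' by (fastforce simp: unit_cube_def PiE_def Pi_def)
    then have "emeasure (distr cube_measure (Pi\<^sub>M UNIV (\<lambda>_. unit_interval_measure)) vec_nth) (Pi\<^sub>E UNIV A)
        = emeasure cube_measure {x :: real ^ 'n. \<forall>i. x $ i \<in> A i}"
      using A by (simp add: emeasure_distr[OF m] sets_PiM_I_finite)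
    also have "\<dots> = emeasure lborel {x :: real ^ 'n. \<forall>i. x $ i \<in> A i}"
      unfolding cube_measure_def
      by (rule emeasure_restrict_space) (use A' unit_cube_sets in \<open>fastforce simp: unit_cube_def\<close>)+
    also have "\<dots> = (\<Prod>i\<in>UNIV. emeasure lborel (A i))"
      using A' by (intro emeasure_lborel_vec) auto
    also have "\<dots> = (\<Prod>i\<in>UNIV. emeasure unit_interval_measure (A i))"
      using A' by (simp add: unit_interval_measure_def emeasure_restrict_space)
    finally show "emeasure (distr cube_measure (Pi\<^sub>M UNIV (\<lambda>_. unit_interval_measure)) vec_nth) (Pi\<^sub>E UNIV A)
        = (\<Prod>i\<in>UNIV. emeasure unit_interval_measure (A i))" .
  qed auto
qed

text \<open>The preimage of a box under the coordinatewise exponential map is again a box in angle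
  space, and the normalisation (2 pi)^n distributes over its n sides.\<close>

lemma distr_torus_measure:
  "distr torus_measure (Pi\<^sub>M UNIV (\<lambda>_. circle_measure)) vec_nth = Pi\<^sub>M UNIV (\<lambda>_ :: 'n::finite. circle_measure)"
proof -
  interpret prob_space circle_measure by (rule prob_space_circle)
  interpret product_sigma_finite "\<lambda>_ :: 'n. circle_measure" ..
  have m: "vec_nth \<in> torus_measure \<rightarrow>\<^sub>M Pi\<^sub>M UNIV (\<lambda>_ :: 'n::finite. circle_measure)"
    by (rule measurable_PiM_single') (auto simp: PiE_def unit_torus_def)
  have c: "(\<lambda>\<theta> :: real ^ 'n. \<chi> j. cis (\<theta> $ j)) \<in> borel \<rightarrow>\<^sub>M torus_measure"
    by (rule measurable_vec_lambda_torus) simp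
  then have c': "(\<lambda>\<theta> :: real ^ 'n. \<chi> j. cis (\<theta> $ j)) \<in> uniform_measure lborel (cbox 0 (\<chi> j. 2 * pi)) \<rightarrow>\<^sub>M restrict_space borel unit_torus"
    by (simp add: measurable_cong_sets[OF refl sets_torus_measure])
  show ?thesis
  proof (rule PiM_eqI)
    fix A :: "'n \<Rightarrow> complex set" assume A: "\<And>i. i \<in> UNIV \<Longrightarrow> A i \<in> sets circle_measure"
    have B: "{0..2 * pi} \<inter> cis -` A i \<in> sets borel" for i
      using measurable_sets[OF measurable_cis A] by simp
    have PA: "Pi\<^sub>E UNIV A \<in> sets (Pi\<^sub>M UNIV (\<lambda>_. circle_measure))"
      using A by (intro sets_PiM_I_finite) auto
    have vol: "emeasure lborel (cbox (0 :: real ^ 'n) (\<chi> j. 2 * pi)) = ennreal (2 * pi) ^ CARD('n)"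
    proof -
      have "cbox (0 :: real ^ 'n) (\<chi> j. 2 * pi) = {x. \<forall>i. x $ i \<in> {0..2*pi}}"
        by (auto simp: mem_box_cart)
      then show ?thesis
        using emeasure_lborel_vec[of "\<lambda>_ :: 'n. {0..2 * pi}"] by (simp del: atLeastAtMost_iff)
    qed
    have eq: "cbox 0 (\<chi> j. 2 * pi) \<inter> {\<theta>. (\<chi> j. cis (\<theta> $ j)) \<in> vec_nth -` Pi\<^sub>E UNIV A \<inter> unit_torus} 
        = {x :: real ^ 'n. \<forall>i. x $ i \<in> {0..2 * pi} \<inter> cis -` A i}"
      by (auto simp: mem_box_cart unit_torus_def PiE_def Pi_def extensional_def)
    have "emeasure torus_measure (vec_nth -` Pi\<^sub>E UNIV A \<inter> unit_torus)
       = emeasure (uniform_measure lborel (cbox (0 :: real ^ 'n) (\<chi> j. 2 * pi)))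
            {\<theta>. (\<chi> j. cis (\<theta> $ j)) \<in> vec_nth -` Pi\<^sub>E UNIV A \<inter> unit_torus}"
      using measurable_sets[OF m PA]
      unfolding torus_measure_def
      by (subst emeasure_distr[OF c']) (auto simp: sets_torus_measure torus_measure_def[symmetric] vimage_def)
    also have "\<dots> = emeasure lborel {x :: real ^ 'n. \<forall>i. x $ i \<in> {0..2 * pi} \<inter> cis -` A i} / ennreal (2 * pi) ^ CARD('n)"
    proof -
      have S: "{\<theta>. (\<chi> j. cis (\<theta> $ j)) \<in> vec_nth -` Pi\<^sub>E UNIV A \<inter> unit_torus} \<in> sets lborel"
        using measurable_sets[OF c measurable_sets[OF m PA]] by (simp add: vimage_def)
      show ?thesis
        by (subst emeasure_uniform_measure[OF _ S]) (simp, simp only: eq vol)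
    qed
    also have "\<dots> = (\<Prod>i\<in>UNIV. emeasure lborel ({0..2 * pi} \<inter> cis -` A i)) / ennreal (2 * pi) ^ CARD('n)"
      by (subst emeasure_lborel_vec[OF B]) simp
    also have "\<dots> = (\<Prod>i\<in>UNIV. emeasure circle_measure (A i))"
      using A by (simp add: emeasure_circle divide_ennreal_def prod.distrib ennreal_inverse_power)
    finally show "emeasure (distr torus_measure (Pi\<^sub>M UNIV (\<lambda>_. circle_measure)) vec_nth) (Pi\<^sub>E UNIV A)
        = (\<Prod>i\<in>UNIV. emeasure circle_measure (A i))"
      using PA by (simp add: emeasure_distr[OF m])
  qed auto
qed

lemma measurable_vec_nth_PiM_torus [measurable]:
  "vec_nth \<in> torus_measure \<rightarrow>\<^sub>M Pi\<^sub>M UNIV (\<lambda>_ :: 'n::finite. circle_measure)"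
  by (rule measurable_PiM_single') (auto simp: PiE_def unit_torus_def)

lemma measurable_vec_lambda_PiM_torus [measurable]:
  "vec_lambda \<in> Pi\<^sub>M UNIV (\<lambda>_ :: 'n::finite. circle_measure) \<rightarrow>\<^sub>M torus_measure"
  using measurable_vec_lambda_torus[of "\<lambda>x i. x i" "Pi\<^sub>M UNIV (\<lambda>_ :: 'n::finite. circle_measure)"] by simp

lemma measurable_vec_nth_PiM_cube [measurable]:
  "vec_nth \<in> cube_measure \<rightarrow>\<^sub>M Pi\<^sub>M UNIV (\<lambda>_ :: 'n::finite. unit_interval_measure)"
  by (rule measurable_PiM_single') (auto simp: PiE_def unit_cube_def)

lemma measurable_vec_lambda_PiM_cube [measurable]:
  "vec_lambda \<in> Pi\<^sub>M UNIV (\<lambda>_ :: 'n::finite. unit_interval_measure) \<rightarrow>\<^sub>M cube_measure"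
  using measurable_vec_lambda_cube[of "\<lambda>x i. x i" "Pi\<^sub>M UNIV (\<lambda>_ :: 'n::finite. unit_interval_measure)"] by simp

lemma torus_measure_eq_distr:
  "torus_measure = distr (Pi\<^sub>M UNIV (\<lambda>_ :: 'n::finite. circle_measure)) torus_measure vec_lambda"
proof -
  have "distr (Pi\<^sub>M UNIV (\<lambda>_ :: 'n::finite. circle_measure)) torus_measure vec_lambda
      = distr (distr torus_measure (Pi\<^sub>M UNIV (\<lambda>_. circle_measure)) vec_nth) torus_measure vec_lambda"
    by (simp only: distr_torus_measure)
  also have "\<dots> = torus_measure"
    by (simp add: distr_distr comp_def)
  finally show ?thesis ..
qed

lemma cube_measure_eq_distr:
  "cube_measure = distr (Pi\<^sub>M UNIV (\<lambda>_ :: 'n::finite. unit_interval_measure)) cube_measure vec_lambda"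
proof -
  have "distr (Pi\<^sub>M UNIV (\<lambda>_ :: 'n::finite. unit_interval_measure)) cube_measure vec_lambda
      = distr (distr cube_measure (Pi\<^sub>M UNIV (\<lambda>_. unit_interval_measure)) vec_nth) cube_measure vec_lambda"
    by (simp only: distr_cube_measure)
  also have "\<dots> = cube_measure"
    by (simp add: distr_distr comp_def)
  finally show ?thesis ..
qed

interpretation circle: prob_space circle_measure
  by (rule prob_space_circle)

interpretation unit_interval: prob_space unit_interval_measure
  by (rule prob_space_unit_interval)

lemma emeasure_torus_box:
  assumes "\<And>i. A i \<in> sets circle_measure"
  shows "emeasure torus_measure {\<xi> \<in> unit_torus. \<forall>i. \<xi> $ i \<in> A i} = (\<Prod>i\<in>UNIV. emeasure circle_measure (A i))"
proof -
  interpret product_sigma_finite "\<lambda>_. circle_measure" ..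
  have "vec_nth -` Pi\<^sub>E UNIV A \<inter> space torus_measure = {\<xi> \<in> unit_torus. \<forall>i. \<xi> $ i \<in> A i}"
    by (auto simp: PiE_def)
  then have "emeasure torus_measure {\<xi> \<in> unit_torus. \<forall>i. \<xi> $ i \<in> A i}
      = emeasure (distr torus_measure (Pi\<^sub>M UNIV (\<lambda>_. circle_measure)) vec_nth) (Pi\<^sub>E UNIV A)"
    using assms by (simp add: emeasure_distr sets_PiM_I_finite)
  then show ?thesis
    using assms emeasure_PiM[of UNIV A] by (simp add: distr_torus_measure)
qed

interpretation torus: prob_space "torus_measure :: (complex ^ 'n) measure"
proof (rule prob_spaceI)
  have "sphere 0 1 \<in> sets circle_measure"
    using sets.top[of circle_measure] by simp
  moreover have "emeasure circle_measure (sphere 0 1) = 1"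
    using circle.emeasure_space_1 by simp
  moreover have "{\<xi> \<in> unit_torus. \<forall>i. \<xi> $ i \<in> sphere 0 1} = (unit_torus :: (complex ^ 'n) set)"
    by (auto simp: unit_torus_def)
  ultimately show "emeasure (torus_measure :: (complex ^ 'n) measure) (space torus_measure) = 1"
    using emeasure_torus_box[of "\<lambda>_ :: 'n. sphere 0 1"] by simp
qed

interpretation cube: prob_space "cube_measure :: (real ^ 'n) measure"
proof (rule prob_spaceI)
  have "{x. \<forall>i. x $ i \<in> {0..<1}} = (unit_cube :: (real ^ 'n) set)"
    by (auto simp: unit_cube_def)
  then show "emeasure (cube_measure :: (real ^ 'n) measure) (space cube_measure) = 1"
    using emeasure_lborel_vec[of "\<lambda>_ :: 'n. {0..<1}"]
    by (simp add: cube_measure_def emeasure_restrict_space unit_cube_sets space_restrict_space del: atLeastLessThan_iff)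
qed

lemma nn_integral_torus_prod:
  assumes [measurable]: "\<And>j. h j \<in> borel_measurable circle_measure"
  shows "(\<integral>\<^sup>+\<xi>. (\<Prod>j\<in>UNIV. h j (\<xi> $ j)) \<partial>torus_measure) = (\<Prod>j\<in>UNIV. \<integral>\<^sup>+u. h j u \<partial>circle_measure)"
proof -
  interpret product_sigma_finite "\<lambda>_. circle_measure" ..
  show ?thesis
    by (subst torus_measure_eq_distr) (simp add: nn_integral_distr product_nn_integral_prod)
qed

lemma nn_integral_cube_prod:
  assumes [measurable]: "\<And>j. h j \<in> borel_measurable unit_interval_measure"
  shows "(\<integral>\<^sup>+R. (\<Prod>j\<in>UNIV. h j (R $ j)) \<partial>cube_measure) = (\<Prod>j\<in>UNIV. \<integral>\<^sup>+u. h j u \<partial>unit_interval_measure)"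
proof -
  interpret product_sigma_finite "\<lambda>_. unit_interval_measure" ..
  show ?thesis
    by (subst cube_measure_eq_distr) (simp add: nn_integral_distr product_nn_integral_prod)
qed

lemma integral_torus_prod:
  fixes h :: "'n::finite \<Rightarrow> complex \<Rightarrow> complex"
  assumes "\<And>j. integrable circle_measure (h j)"
  shows "(\<integral>\<xi>. (\<Prod>j\<in>UNIV. h j (\<xi> $ j)) \<partial>torus_measure) = (\<Prod>j\<in>UNIV. \<integral>u. h j u \<partial>circle_measure)"
proof -
  interpret product_sigma_finite "\<lambda>_. circle_measure" ..
  have [measurable]: "h j \<in> borel_measurable circle_measure" for j using assms by auto
  show ?thesis
    by (subst torus_measure_eq_distr) (simp add: integral_distr product_integral_prod assms)
qed

lemma integral_cube_prod:
  fixes h :: "'n::finite \<Rightarrow> real \<Rightarrow> complex"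
  assumes "\<And>j. integrable unit_interval_measure (h j)"
  shows "(\<integral>R. (\<Prod>j\<in>UNIV. h j (R $ j)) \<partial>cube_measure) = (\<Prod>j\<in>UNIV. \<integral>u. h j u \<partial>unit_interval_measure)"
proof -
  interpret product_sigma_finite "\<lambda>_. unit_interval_measure" ..
  have [measurable]: "h j \<in> borel_measurable unit_interval_measure" for j using assms by auto
  show ?thesis
    by (subst cube_measure_eq_distr) (simp add: integral_distr product_integral_prod assms)
qed



text \<open>Uniqueness of the product measure in a form suited to invariance statements: only the
  mass of boxes has to be computed.\<close>

lemma torus_measure_eqI:
  fixes f :: "'a \<Rightarrow> complex ^ 'n"
  assumes f: "f \<in> M \<rightarrow>\<^sub>M torus_measure"
    and eq: "\<And>A. (\<And>i. A i \<in> sets circle_measure) \<Longrightarrow>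
      emeasure M {x \<in> space M. \<forall>i. f x $ i \<in> A i} = (\<Prod>i\<in>UNIV. emeasure circle_measure (A i))"
  shows "distr M torus_measure f = torus_measure"
proof -
  interpret product_sigma_finite "\<lambda>_. circle_measure" ..
  have "distr M (Pi\<^sub>M UNIV (\<lambda>_ :: 'n::finite. circle_measure)) (\<lambda>x. vec_nth (f x)) = Pi\<^sub>M UNIV (\<lambda>_. circle_measure)"
  proof (rule PiM_eqI)
    fix A :: "'n \<Rightarrow> complex set" assume A: "\<And>i. i \<in> UNIV \<Longrightarrow> A i \<in> sets circle_measure"
    have "(\<lambda>x. vec_nth (f x)) -` Pi\<^sub>E UNIV A \<inter> space M = {x \<in> space M. \<forall>i. f x $ i \<in> A i}"
      by (auto simp: PiE_def)
    moreover have "(\<lambda>x. vec_nth (f x)) \<in> M \<rightarrow>\<^sub>M Pi\<^sub>M UNIV (\<lambda>_. circle_measure)"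
      using f by measurable
    ultimately show "emeasure (distr M (Pi\<^sub>M UNIV (\<lambda>_. circle_measure)) (\<lambda>x. vec_nth (f x))) (Pi\<^sub>E UNIV A)
        = (\<Prod>i\<in>UNIV. emeasure circle_measure (A i))"
      using A by (simp add: emeasure_distr sets_PiM_I_finite eq)
  qed auto
  then have "torus_measure = distr (distr M (Pi\<^sub>M UNIV (\<lambda>_. circle_measure)) (\<lambda>x. vec_nth (f x))) torus_measure vec_lambda"
    using torus_measure_eq_distr by simp
  also have "\<dots> = distr M torus_measure f"
    using f by (subst distr_distr) (auto simp: comp_def)
  finally show ?thesis ..
qed

text \<open>Replacing one coordinate by an independent uniform point of the circle does not change
  the law. This substitutes for splitting off a circle factor, which an arbitrary finite index type
  does not permit, and drives the coordinatewise inductions for the Cauchy and Poisson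
  formulas.\<close>

lemma distr_torus_resample:
  fixes j :: "'n::finite"
  shows "distr (torus_measure \<Otimes>\<^sub>M circle_measure) torus_measure (\<lambda>(\<xi>, u). \<chi> i. if i = j then u else \<xi> $ i)
    = (torus_measure :: (complex ^ 'n) measure)"
proof (rule torus_measure_eqI)
  show "(\<lambda>(\<xi>, u). \<chi> i. if i = j then u else \<xi> $ i) \<in> torus_measure \<Otimes>\<^sub>M circle_measure \<rightarrow>\<^sub>M (torus_measure :: (complex ^ 'n) measure)"
    unfolding split_beta' by (intro measurable_vec_lambda_torus) simp
  fix A :: "'n \<Rightarrow> complex set" assume A: "\<And>i. A i \<in> sets circle_measure"
  \<comment> \<open>The old value of coordinate \<open>j\<close> is discarded, so its constraint
    becomes the full circle and the constraint \<open>A j\<close> moves to the new point.\<close>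
  define B where "B i = (if i = j then sphere 0 1 else A i)" for i
  have "sphere 0 1 \<in> sets circle_measure"
    using sets.top[of circle_measure] by simp
  then have B: "B i \<in> sets circle_measure" for i using A by (simp add: B_def)
  let ?B = "{\<xi> \<in> unit_torus. \<forall>i. \<xi> $ i \<in> B i}"
  have Bs: "?B \<in> sets torus_measure"
  proof -
    have "?B = vec_nth -` Pi\<^sub>E UNIV B \<inter> space torus_measure" by (auto simp: PiE_def)
    also have "\<dots> \<in> sets torus_measure"
      using B by (intro measurable_sets[OF measurable_vec_nth_PiM_torus] sets_PiM_I_finite) auto
    finally show ?thesis .
  qed
  have "{x \<in> space (torus_measure \<Otimes>\<^sub>M circle_measure). \<forall>i. (case x of (\<xi>, u) \<Rightarrow> \<chi> i. if i = j then u else \<xi> $ i) $ i \<in> A i}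
      = ?B \<times> A j"
  proof -
    have "(\<forall>i. (if i = j then b else a $ i) \<in> A i) \<longleftrightarrow> b \<in> A j \<and> (\<forall>i. i \<noteq> j \<longrightarrow> a $ i \<in> A i)" for a b
      by metis
    then show ?thesis
      using sets.sets_into_space[OF A[of j]]
      by (auto simp: space_pair_measure B_def unit_torus_def)
  qed
  moreover have "(\<Prod>i\<in>UNIV. emeasure circle_measure (B i)) * emeasure circle_measure (A j)
     = (\<Prod>i\<in>UNIV. emeasure circle_measure (A i))"
  proof -
    have "(\<Prod>i\<in>UNIV. emeasure circle_measure (B i)) = emeasure circle_measure (B j) * (\<Prod>i\<in>UNIV - {j}. emeasure circle_measure (B i))"
      by (rule prod.remove) auto
    also have "(\<Prod>i\<in>UNIV - {j}. emeasure circle_measure (B i)) = (\<Prod>i\<in>UNIV - {j}. emeasure circle_measure (A i))"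
      by (intro prod.cong) (auto simp: B_def)
    also have "emeasure circle_measure (B j) = 1"
      using circle.emeasure_space_1 by (simp add: B_def)
    finally show ?thesis
      using prod.remove[of UNIV j "\<lambda>i. emeasure circle_measure (A i)"] by (simp add: mult.commute)
  qed
  ultimately show "emeasure (torus_measure \<Otimes>\<^sub>M circle_measure) {x \<in> space (torus_measure \<Otimes>\<^sub>M circle_measure). \<forall>i. (case x of (\<xi>, u) \<Rightarrow> \<chi> i. if i = j then u else \<xi> $ i) $ i \<in> A i} =
         (\<Prod>i\<in>UNIV. emeasure circle_measure (A i))"
    using A B Bs by (simp add: circle.emeasure_pair_measure_Times emeasure_torus_box)
qed

lemma measurable_torus_upd [measurable]:
  assumes "f \<in> M \<rightarrow>\<^sub>M torus_measure" "g \<in> M \<rightarrow>\<^sub>M circle_measure"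
  shows "(\<lambda>x. \<chi> i. if i = j then g x else f x $ i) \<in> M \<rightarrow>\<^sub>M torus_measure"
  using assms by (intro measurable_vec_lambda_torus) simp

lemma nn_integral_torus_resample:
  fixes K :: "complex ^ 'n \<Rightarrow> ennreal"
  assumes [measurable]: "K \<in> borel_measurable torus_measure"
  shows "(\<integral>\<^sup>+\<xi>. K \<xi> \<partial>torus_measure) = (\<integral>\<^sup>+\<xi>. \<integral>\<^sup>+u. K (\<chi> i. if i = j then u else \<xi> $ i) \<partial>circle_measure \<partial>torus_measure)"
  by (subst distr_torus_resample[of j, symmetric])
     (simp add: nn_integral_distr circle.nn_integral_fst[symmetric] split_beta' cong: if_cong)

lemma integral_torus_resample:
  fixes K :: "complex ^ 'n \<Rightarrow> complex"
  assumes K: "integrable torus_measure K"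
  shows "(\<integral>\<xi>. K \<xi> \<partial>torus_measure) = (\<integral>\<xi>. \<integral>u. K (\<chi> i. if i = j then u else \<xi> $ i) \<partial>circle_measure \<partial>torus_measure)"
proof -
  interpret pair_sigma_finite "torus_measure :: (complex ^ 'n) measure" circle_measure ..
  have [measurable]: "K \<in> borel_measurable torus_measure" using K by simp
  have "integrable (distr (torus_measure \<Otimes>\<^sub>M circle_measure) torus_measure (\<lambda>(\<xi>, u). \<chi> i. if i = j then u else \<xi> $ i)) K"
    using K by (simp only: distr_torus_resample)
  then have int: "integrable (torus_measure \<Otimes>\<^sub>M circle_measure) (\<lambda>(\<xi>, u). K (\<chi> i. if i = j then u else \<xi> $ i))"
    by (subst (asm) integrable_distr_eq) (simp_all add: split_beta')
  show ?thesis
    by (subst distr_torus_resample[of j, symmetric], subst integral_distr)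
       (use integral_fst'[OF int] in \<open>simp_all add: split_beta' cong: if_cong\<close>)
qed

section \<open>Rotation invariance\<close>

lemma emeasure_lborel_shift:
  assumes [measurable]: "S \<in> sets borel"
  shows "emeasure lborel {x :: real. a + x \<in> S} = emeasure lborel S"
  by (subst (2) lborel_distr_plus[of a, symmetric]) (simp add: emeasure_distr vimage_def)

text \<open>A rotation by the angle \<open>a\<close> turns the interval [0, 2 pi] into
  [a, a + 2 pi]; the part beyond 2 pi is moved back by periodicity.\<close>

lemma distr_circle_rotate:
  assumes "norm c = 1"
  shows "distr circle_measure circle_measure (\<lambda>u. c * u) = circle_measure"
proof (rule measure_eqI)
  obtain a where a: "0 \<le> a" "a < 2 * pi" "c = cis a"
    using assms by (metis Arg2pi_ge_0 Arg2pi_lt_2pi cis_conv_exp Arg2pi_eq mult_1 of_real_1)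
  have m: "(\<lambda>u. c * u) \<in> circle_measure \<rightarrow>\<^sub>M circle_measure"
    using assms by (intro measurable_circleI) (auto simp: norm_mult)
  fix A assume "A \<in> sets (distr circle_measure circle_measure (\<lambda>u. c * u))"
  then have A: "A \<in> sets circle_measure" by simp
  define B where "B = cis -` A"
  have B [measurable]: "B \<in> sets borel"
    using measurable_sets[OF measurable_cis A] by (simp add: B_def)
  have per: "2 * pi + x \<in> B \<longleftrightarrow> x \<in> B" for x
    by (simp add: B_def cis_mult[symmetric])
  have shift: "emeasure lborel {x. a + x \<in> {a..a + 2 * pi} \<inter> B} = emeasure lborel ({a..a + 2 * pi} \<inter> B)"
    by (rule emeasure_lborel_shift) simp
  have "{a..a + 2 * pi} \<inter> B = ({a..2*pi} \<inter> B) \<union> ({2*pi<..2*pi+a} \<inter> B)"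
    using a by auto
  then have "emeasure lborel ({a..a + 2 * pi} \<inter> B)
      = emeasure lborel ({a..2*pi} \<inter> B) + emeasure lborel ({2*pi<..2*pi+a} \<inter> B)"
    by (simp only:) (rule plus_emeasure[symmetric], auto)
  also have "emeasure lborel ({2*pi<..2*pi+a} \<inter> B) = emeasure lborel {x. 2 * pi + x \<in> {2*pi<..2*pi+a} \<inter> B}"
    by (rule emeasure_lborel_shift[symmetric]) simp
  also have "{x. 2 * pi + x \<in> {2*pi<..2*pi+a} \<inter> B} = {0<..a} \<inter> B" by (auto simp: per)
  \<comment> \<open>The piece moved back has the wrong endpoint included; single points are
    null.\<close>
  also have "emeasure lborel ({0<..a} \<inter> B) = emeasure lborel ({0..<a} \<inter> B)"
  proof (rule emeasure_eq_AE)
    show "AE x in lborel. x \<in> {0<..a} \<inter> B \<longleftrightarrow> x \<in> {0..<a} \<inter> B"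
      using AE_lborel_singleton[of 0] AE_lborel_singleton[of a] by eventually_elim auto
  qed auto
  also have "emeasure lborel ({a..2*pi} \<inter> B) + emeasure lborel ({0..<a} \<inter> B) = emeasure lborel ({0..2 * pi} \<inter> B)"
  proof -
    have "{0..2 * pi} \<inter> B = ({a..2*pi} \<inter> B) \<union> ({0..<a} \<inter> B)" using a by auto
    then show ?thesis by (simp only:) (rule plus_emeasure, auto)
  qed
  finally have eq: "emeasure lborel {x. a + x \<in> {a..a + 2 * pi} \<inter> B} = emeasure lborel ({0..2 * pi} \<inter> B)"
    using shift by simp
  have "emeasure (distr circle_measure circle_measure (\<lambda>u. c * u)) A
      = emeasure lborel ({0..2 * pi} \<inter> cis -` ((\<lambda>u. c * u) -` A \<inter> space circle_measure)) / ennreal (2 * pi)"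
    using A m measurable_sets[OF m A] by (simp add: emeasure_distr emeasure_circle)
  also have "{0..2 * pi} \<inter> cis -` ((\<lambda>u. c * u) -` A \<inter> space circle_measure) = {x. a + x \<in> {a..a + 2 * pi} \<inter> B}"
    by (auto simp: B_def a cis_mult)
  also note eq
  finally show "emeasure (distr circle_measure circle_measure (\<lambda>u. c * u)) A = emeasure circle_measure A"
    using A by (simp add: emeasure_circle B_def)
qed simp

lemma measurable_torus_mult [measurable]:
  assumes [measurable]: "f \<in> M \<rightarrow>\<^sub>M torus_measure" "g \<in> M \<rightarrow>\<^sub>M torus_measure"
  shows "(\<lambda>x. f x * g x) \<in> M \<rightarrow>\<^sub>M torus_measure"
proof -
  have "f x \<in> unit_torus" "g x \<in> unit_torus" if "x \<in> space M" for x
    using assms[THEN measurable_space, OF that] by auto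
  then have "(\<lambda>x. f x $ i * g x $ i) \<in> M \<rightarrow>\<^sub>M circle_measure" for i
    by (intro measurable_circleI) (auto simp: norm_mult unit_torus_def)
  then show ?thesis
    unfolding times_vec_def by (rule measurable_vec_lambda_torus)
qed

lemma distr_torus_rotate:
  assumes "\<eta> \<in> unit_torus"
  shows "distr torus_measure torus_measure (\<lambda>\<xi>. \<eta> * \<xi>) = torus_measure"
proof (rule torus_measure_eqI)
  show m: "(\<lambda>\<xi>. \<eta> * \<xi>) \<in> torus_measure \<rightarrow>\<^sub>M torus_measure"
    by (intro measurable_torus_mult measurable_const measurable_ident_sets) (simp_all add: assms)
  fix A :: "'a \<Rightarrow> complex set" assume A: "\<And>i. A i \<in> sets circle_measure"
  have norm: "norm (\<eta> $ i) = 1" for i using assms by (simp add: unit_torus_def)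
  have m1: "(\<lambda>u. \<eta> $ i * u) \<in> circle_measure \<rightarrow>\<^sub>M circle_measure" for i
    by (intro measurable_circleI) (auto simp: norm_mult norm)
  have "{\<xi> \<in> space torus_measure. \<forall>i. (\<eta> * \<xi>) $ i \<in> A i}
     = {\<xi> \<in> unit_torus. \<forall>i. \<xi> $ i \<in> (\<lambda>u. \<eta> $ i * u) -` A i \<inter> space circle_measure}"
    by (auto simp: unit_torus_def)
  then have "emeasure torus_measure {\<xi> \<in> space torus_measure. \<forall>i. (\<eta> * \<xi>) $ i \<in> A i}
      = (\<Prod>i\<in>UNIV. emeasure circle_measure ((\<lambda>u. \<eta> $ i * u) -` A i \<inter> space circle_measure))"
    using emeasure_torus_box[OF measurable_sets[OF m1 A]] by (simp only:)
  also have "\<dots> = (\<Prod>i\<in>UNIV. emeasure circle_measure (A i))"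
  proof (rule prod.cong)
    show "emeasure circle_measure ((\<lambda>u. \<eta> $ i * u) -` A i \<inter> space circle_measure) = emeasure circle_measure (A i)" for i
      using emeasure_distr[OF m1 A, of i i] by (simp add: distr_circle_rotate norm)
  qed simp
  finally show "emeasure torus_measure {\<xi> \<in> space torus_measure. \<forall>i. (\<eta> * \<xi>) $ i \<in> A i}
      = (\<Prod>i\<in>UNIV. emeasure circle_measure (A i))" .
qed

lemma nn_integral_torus_rotate:
  assumes "\<eta> \<in> unit_torus" and [measurable]: "K \<in> borel_measurable torus_measure"
  shows "(\<integral>\<^sup>+\<xi>. K (\<eta> * \<xi>) \<partial>torus_measure) = (\<integral>\<^sup>+\<xi>. K \<xi> \<partial>torus_measure)"
proof -
  have [measurable]: "(\<lambda>\<xi>. \<eta> * \<xi>) \<in> torus_measure \<rightarrow>\<^sub>M torus_measure"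
    by (intro measurable_torus_mult measurable_const measurable_ident_sets) (simp_all add: assms)
  show ?thesis
    by (subst (2) distr_torus_rotate[OF assms(1), symmetric]) (simp add: nn_integral_distr)
qed

section \<open>The Poisson inequality in the disc\<close>

lemma borel_measurable_circle_continuous:
  "continuous_on (sphere 0 1) K \<Longrightarrow> K \<in> borel_measurable circle_measure"
  unfolding measurable_cong_sets[OF sets_circle_measure refl]
  by (rule borel_measurable_continuous_on_restrict)

lemma integrable_circle_continuous:
  fixes K :: "complex \<Rightarrow> 'a::{banach, second_countable_topology}"
  assumes "continuous_on (sphere 0 1) K"
  shows "integrable circle_measure K"
proof -
  have "compact (K ` sphere 0 1)"
    by (rule compact_continuous_image[OF assms]) simp
  from compact_imp_bounded[OF this] obtain B where "\<forall>u \<in> sphere 0 1. norm (K u) \<le> B"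
    by (auto simp: bounded_iff)
  then have "AE u in circle_measure. norm (K u) \<le> B"
    by (intro AE_I2) simp
  then show ?thesis
    by (rule circle.integrable_const_bound) (rule borel_measurable_circle_continuous[OF assms])
qed

lemma integral_circle_eq:
  fixes K :: "complex \<Rightarrow> complex"
  assumes K: "continuous_on (sphere 0 1) K" and I: "((\<lambda>\<theta>. K (cis \<theta>)) has_integral I) {0..2 * pi}"
  shows "(\<integral>u. K u \<partial>circle_measure) = I / (2 * pi)"
proof -
  have [measurable]: "K \<in> borel_measurable circle_measure"
    by (rule borel_measurable_circle_continuous[OF K])
  have c: "cis \<in> uniform_measure lborel {0..2 * pi} \<rightarrow>\<^sub>M restrict_space borel (sphere 0 1)"
    using measurable_cis measurable_circle_cong by simp
  have K': "K \<in> borel_measurable (restrict_space borel (sphere 0 1))"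
    by (rule borel_measurable_continuous_on_restrict[OF K])
  have m [measurable]: "(\<lambda>\<theta>. K (cis \<theta>)) \<in> borel_measurable borel"
    by measurable
  have int: "integrable lborel (\<lambda>\<theta>. indicator {0..2 * pi} \<theta> *\<^sub>R K (cis \<theta>))"
    by (rule borel_integrable_compact)
       (auto intro!: continuous_on_compose2[OF K] continuous_intros)
  have un: "uniform_measure lborel {0..2 * pi} = density lborel (\<lambda>\<theta>. ennreal (indicator {0..2 * pi} \<theta> / (2 * pi)))"
    by (auto simp: uniform_measure_def divide_ennreal[symmetric] ennreal_indicator intro!: arg_cong[of _ _ "density lborel"])
  have "(\<integral>u. K u \<partial>circle_measure) = (\<integral>\<theta>. K (cis \<theta>) \<partial>uniform_measure lborel {0..2 * pi})"
    unfolding circle_measure_def by (rule integral_distr[OF c K'])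
  also have "\<dots> = (\<integral>\<theta>. (indicator {0..2 * pi} \<theta> / (2 * pi)) *\<^sub>R K (cis \<theta>) \<partial>lborel)"
    unfolding un by (subst integral_density) auto
  also have "\<dots> = (\<integral>\<theta>. (1 / (2 * pi)) *\<^sub>R (indicator {0..2 * pi} \<theta> *\<^sub>R K (cis \<theta>)) \<partial>lborel)"
    by (intro Bochner_Integration.integral_cong) (auto simp: indicator_def)
  also have "\<dots> = (1 / (2 * pi)) *\<^sub>R (\<integral>\<theta>. indicator {0..2 * pi} \<theta> *\<^sub>R K (cis \<theta>) \<partial>lborel)"
    using int by (intro integral_scaleR_right)
  also have "(\<integral>\<theta>. indicator {0..2 * pi} \<theta> *\<^sub>R K (cis \<theta>) \<partial>lborel) = I"
    using set_borel_integral_eq_integral(2)[of "{0..2 * pi}" "\<lambda>\<theta>. K (cis \<theta>)"] int I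
    by (simp add: set_integrable_def set_lebesgue_integral_def integral_unique)
  finally show ?thesis by (simp add: scaleR_conv_of_real)
qed

text \<open>With z = R u the differential dz becomes i z d\<theta>, so that against the normalised
  measure the Cauchy kernel reads Ru / (Ru - w).\<close>

lemma Cauchy_circle:
  assumes f: "continuous_on (cball 0 R) f" "f holomorphic_on ball 0 R" and w: "norm w < R"
  shows "(\<integral>u. f (of_real R * u) * (of_real R * u / (of_real R * u - w)) \<partial>circle_measure) = f w"
proof -
  have R: "0 < R" using w norm_ge_zero[of w] by linarith
  have "((\<lambda>u. f u / (u - w)) has_contour_integral (2 * of_real pi * \<i> * f w)) (circlepath 0 R)"
    by (rule Cauchy_integral_circlepath) (use f w in auto)
  then have "((\<lambda>t. f (of_real R * cis t) / (of_real R * cis t - w) * R * \<i> * cis t) has_integral (2 * of_real pi * \<i> * f w)) {0..2 * pi}"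
    unfolding circlepath_def by (subst (asm) has_contour_integral_part_circlepath_iff) auto
  then have "((\<lambda>t. (f (of_real R * cis t) / (of_real R * cis t - w) * R * \<i> * cis t) * (1 / \<i>)) has_integral (2 * of_real pi * \<i> * f w) * (1 / \<i>)) {0..2 * pi}"
    by (rule has_integral_mult_left)
  then have I: "((\<lambda>t. f (of_real R * cis t) * (of_real R * cis t / (of_real R * cis t - w))) has_integral (2 * of_real pi * f w)) {0..2 * pi}"
    by (simp add: mult_ac)
  have ne: "of_real R * u \<noteq> w" if "norm u = 1" for u
    using that w R by (auto simp: norm_mult)
  have "continuous_on (sphere 0 1) (\<lambda>u. f (of_real R * u) * (of_real R * u / (of_real R * u - w)))"
    by (intro continuous_intros continuous_on_compose2[OF f(1)])
       (use R ne in \<open>auto simp: norm_mult\<close>)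
  from integral_circle_eq[OF this I] show ?thesis by simp
qed

text \<open>The Poisson kernel of the disc of radius \<open>R\<close> at the real point
  \<open>r\<close>. Real points suffice: in \<open>Poisson_torus_le\<close> the phase \<xi> is
  absorbed by evaluating the function at \<open>\<eta> * \<xi>\<close>.\<close>

definition poisson :: "real \<Rightarrow> real \<Rightarrow> complex \<Rightarrow> real" where
  "poisson r R u = (R\<^sup>2 - r\<^sup>2) / (norm (of_real R * u - of_real r))\<^sup>2"

lemma poisson_nonneg: "0 \<le> r \<Longrightarrow> r \<le> R \<Longrightarrow> 0 \<le> poisson r R u"
  by (simp add: poisson_def power_mono)

lemma poisson_den:
  fixes u :: complex
  assumes "0 \<le> r" "r < R" "norm u = 1"
  shows "R - r \<le> norm (of_real R * u - of_real r)"
  using norm_triangle_ineq2[of "of_real R * u" "of_real r"] assms by (simp add: norm_mult)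

lemma continuous_poisson:
  assumes "0 \<le> r" "r < R"
  shows "continuous_on (sphere 0 1) (poisson r R)"
  unfolding poisson_def using poisson_den[OF assms] assms
  by (intro continuous_intros) fastforce

lemma measurable_poisson [measurable]: "poisson r R \<in> borel_measurable borel"
  unfolding poisson_def by measurable

text \<open>The maximum of the kernel over the circle is (R + r)/(R - r), and R - r is at least (1 -
  r)/2 once \<open>R\<close> has passed the midpoint between \<open>r\<close> and 1.\<close>

lemma poisson_le:
  assumes "0 \<le> r" "r < 1" "(1 + r) / 2 \<le> R" "R < 1" "norm u = 1"
  shows "poisson r R u \<le> 4 / (1 - r)"
proof -
  have rR: "r < R" using assms by auto
  have "poisson r R u \<le> (R\<^sup>2 - r\<^sup>2) / (R - r)\<^sup>2"
    unfolding poisson_def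
    using poisson_den[OF assms(1) rR assms(5)] rR assms
    by (intro divide_left_mono power_mono mult_pos_pos) (auto simp: power_mono intro!: zero_less_power)
  also have "\<dots> = (R + r) / (R - r)"
    using rR by (simp add: power2_eq_square square_diff_square_factored)
  also have "\<dots> \<le> 2 / ((1 - r) / 2)"
    using assms by (intro frac_le) auto
  finally show ?thesis by simp
qed

text \<open>A Harnack-type comparison with the smallest admissible radius R0 = (1 + r)/2. The
  numerator grows by a factor of at most 6, and since R - R0 is at most half of |Ru - r|, the
  modulus in the denominator shrinks by a factor of at most 3/2; 6 * 9/4 = 13.5. Its purpose is to
  provide one kernel common to a whole band of radii.\<close>

lemma poisson_compare:
  assumes r: "0 \<le> r" "r < 1" and R: "(1 + r) / 2 \<le> R" "R \<le> (3 + r) / 4" and u: "norm u = 1"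
  shows "poisson r R u \<le> 14 * poisson r ((1 + r) / 2) u"
proof -
  define R0 where "R0 = (1 + r) / 2"
  let ?d = "norm (of_real R * u - of_real r)" and ?e = "norm (of_real R0 * u - of_real r)"
  have "r < R0" using r by (simp add: R0_def)
  have d: "R - r \<le> ?d" "R0 - r \<le> ?e"
    using poisson_den[of r R u] poisson_den[of r R0 u] assms \<open>r < R0\<close> by simp_all
  have pos: "0 < ?d" "0 < ?e"
    using d R r by (auto simp: R0_def)
  have "?e \<le> ?d + norm (of_real (R - R0) * u)"
    using norm_triangle_ineq4[of "of_real R * u - of_real r" "of_real (R - R0) * u"] by (simp add: algebra_simps)
  also have "norm (of_real (R - R0) * u) = R - R0"
    using R u by (simp add: norm_mult R0_def del: of_real_diff)
  also have "R - R0 \<le> ?d / 2"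
  proof -
    have "R - R0 \<le> (R - r) / 2"
      using R r by (simp add: R0_def field_simps)
    also have "\<dots> \<le> ?d / 2"
      using d(1) by (rule divide_right_mono) simp
    finally show ?thesis .
  qed
  finally have "?e \<le> 3 / 2 * ?d" by simp
  then have "?e\<^sup>2 \<le> (3 / 2 * ?d)\<^sup>2"
    by (intro power_mono) auto
  then have dd: "?e\<^sup>2 \<le> 9 / 4 * ?d\<^sup>2"
    by (simp add: power_mult_distrib power2_eq_square)
  have nn: "R\<^sup>2 - r\<^sup>2 \<le> 6 * (R0\<^sup>2 - r\<^sup>2)"
  proof -
    have "R\<^sup>2 - r\<^sup>2 = (R - r) * (R + r)" by (simp add: power2_eq_square algebra_simps)
    also have "\<dots> \<le> (3 / 4 * (1 - r)) * 2"
      using R r by (intro mult_mono) auto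
    also have "\<dots> = 6 * ((1 - r) / 2 * (1 / 2))" by simp
    also have "\<dots> \<le> 6 * ((R0 - r) * (R0 + r))"
      using R r by (intro mult_left_mono mult_mono) (auto simp: R0_def field_simps)
    finally show ?thesis by (simp add: power2_eq_square algebra_simps)
  qed
  have "0 \<le> R0\<^sup>2 - r\<^sup>2" using r by (simp add: R0_def power_mono)
  then have "(R\<^sup>2 - r\<^sup>2) * ?e\<^sup>2 \<le> (6 * (R0\<^sup>2 - r\<^sup>2)) * (9 / 4 * ?d\<^sup>2)"
    using nn dd by (intro mult_mono) auto
  also have "6 * (R0\<^sup>2 - r\<^sup>2) * (9 / 4 * ?d\<^sup>2) = 27 / 2 * ((R0\<^sup>2 - r\<^sup>2) * ?d\<^sup>2)"
    using mult.assoc[of 6 "R0\<^sup>2 - r\<^sup>2" "9 / 4 * ?d\<^sup>2"] by simp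
  also have "\<dots> \<le> 14 * ((R0\<^sup>2 - r\<^sup>2) * ?d\<^sup>2)"
    using \<open>0 \<le> R0\<^sup>2 - r\<^sup>2\<close> by (intro mult_right_mono mult_nonneg_nonneg) auto
  finally have "(R\<^sup>2 - r\<^sup>2) * ?e\<^sup>2 \<le> 14 * ((R0\<^sup>2 - r\<^sup>2) * ?d\<^sup>2)" .
  moreover have *: "A * e \<le> 14 * (B * d) \<Longrightarrow> 0 < d \<Longrightarrow> 0 < e \<Longrightarrow> A / d \<le> 14 * (B / e)" for A B d e :: real
    by (simp add: field_simps)
  ultimately show ?thesis
    unfolding poisson_def R0_def[symmetric] using pos by (intro *) auto
qed

text \<open>Cauchy's formula applied to f times the factor (R^2 - r^2)/(R^2 - r w), which is
  holomorphic on the closed disc, equals 1 at w = r, and turns the Cauchy kernel into the Poisson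
  kernel on the circle.\<close>

lemma Poisson_circle:
  assumes f: "continuous_on (cball 0 R) f" "f holomorphic_on ball 0 R" and r: "0 \<le> r" "r < R"
  shows "(\<integral>u. of_real (poisson r R u) * f (of_real R * u) \<partial>circle_measure) = f (of_real r)"
proof -
  have ne: "of_real (R\<^sup>2) - of_real r * w \<noteq> 0" if "norm w \<le> R" for w :: complex
  proof
    assume "of_real (R\<^sup>2) - of_real r * w = 0"
    then have "norm (of_real (R\<^sup>2) :: complex) = norm (of_real r * w)" by simp
    then have "R * R = r * norm w" using r by (simp add: norm_mult power2_eq_square)
    also have "\<dots> \<le> r * R" using that r by (intro mult_left_mono) auto
    finally show False using r by simp
  qed
  define F where "F w = f w * (complex_of_real (R\<^sup>2 - r\<^sup>2) / (of_real (R\<^sup>2) - of_real r * w))" for w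
  have "continuous_on (cball 0 R) F" "F holomorphic_on ball 0 R"
    unfolding F_def using ne by (auto intro!: continuous_intros holomorphic_intros f)
  then have "(\<integral>u. F (of_real R * u) * (of_real R * u / (of_real R * u - of_real r)) \<partial>circle_measure) = F (of_real r)"
    by (rule Cauchy_circle) (use r in auto)
  also have "F (of_real r) = f (of_real r)"
  proof -
    have "complex_of_real (R\<^sup>2) - of_real r * of_real r = of_real (R\<^sup>2 - r\<^sup>2)" by (simp add: power2_eq_square)
    moreover have "R\<^sup>2 - r\<^sup>2 \<noteq> 0"
      using power_strict_mono[of r R 2] r by auto
    moreover have "complex_of_real (R\<^sup>2 - r\<^sup>2) / of_real (R\<^sup>2 - r\<^sup>2) = 1"
      using calculation(2) by (simp del: of_real_diff)
    ultimately show ?thesis by (simp only: F_def mult_1_right)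
  qed
  also have "(\<integral>u. F (of_real R * u) * (of_real R * u / (of_real R * u - of_real r)) \<partial>circle_measure)
      = (\<integral>u. of_real (poisson r R u) * f (of_real R * u) \<partial>circle_measure)"
  proof (rule Bochner_Integration.integral_cong)
    fix u assume "u \<in> space circle_measure"
    then have u: "norm u = 1" by simp
    then have uu: "u * cnj u = 1" using complex_norm_square[of u] by simp
    \<comment> \<open>On |u| = 1 one has R^2 = Ru * conj(Ru); this produces the conjugate of the
      Cauchy denominator and thus the squared modulus.\<close>
    have "of_real (R\<^sup>2) - of_real r * (of_real R * u) = of_real R * u * cnj (of_real R * u - of_real r)"
      using uu by (simp add: power2_eq_square algebra_simps)
    moreover have "of_real R * u \<noteq> 0" using r u by auto
    moreover have "X \<noteq> 0 \<Longrightarrow> a * (A / (X * c)) * (X / d) = A / (d * c) * a" for X a A c d :: complex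
      by (simp add: divide_simps)
    ultimately show "F (of_real R * u) * (of_real R * u / (of_real R * u - of_real r)) = of_real (poisson r R u) * f (of_real R * u)"
      unfolding F_def poisson_def of_real_divide complex_norm_square by (simp only: not_False_eq_True)
  qed simp
  finally show ?thesis .
qed

lemma nn_integral_poisson:
  assumes "0 \<le> r" "r < R"
  shows "(\<integral>\<^sup>+u. ennreal (poisson r R u) \<partial>circle_measure) = 1"
proof -
  have "(\<integral>u. complex_of_real (poisson r R u) \<partial>circle_measure) = 1"
    using Poisson_circle[of R "\<lambda>_. 1" r] assms by simp
  then have "(\<integral>u. poisson r R u \<partial>circle_measure) = 1"
    by (metis integral_complex_of_real of_real_eq_1_iff)
  then show ?thesis
    using assms integrable_circle_continuous[OF continuous_poisson[OF assms]]
    by (subst nn_integral_eq_integral) (auto intro!: poisson_nonneg)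
qed

text \<open>Outer majorant of \<open>\<bar>p\<bar>\<^sup>\<kappa>\<close>: every root inside the disc is reflected in the circle, after which
  each linear factor has a holomorphic power.\<close>

lemma poly_power_majorant:
  fixes p :: "complex poly"
  assumes R: "0 < R" and \<kappa>: "0 < \<kappa>"
  shows "\<exists>v. continuous_on (cball 0 R) v \<and> v holomorphic_on ball 0 R \<and>
     (\<forall>z\<in>ball 0 R. norm (poly p z) powr \<kappa> \<le> norm (v z)) \<and>
     (\<forall>z\<in>sphere 0 R. norm (v z) = norm (poly p z) powr \<kappa>)"
proof (induction "degree p" arbitrary: p rule: less_induct)
  case less
  show ?case
  proof (cases "degree p = 0")
    case True
    then obtain c where "p = [:c:]" by (metis degree_eq_zeroE)
    then show ?thesis
      by (intro exI[of _ "\<lambda>_. of_real (norm c powr \<kappa>)"]) auto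
  next
    case False
    then have "\<not> constant (poly p)" by (simp add: constant_degree)
    then obtain a where "poly p a = 0" using fundamental_theorem_of_algebra by blast
    then obtain q where q: "p = [:- a, 1:] * q" by (auto simp: poly_eq_0_iff_dvd dvd_def)
    then have "q \<noteq> 0" using False by auto
    then have "degree p = degree q + 1" unfolding q by (subst degree_mult_eq) auto
    then obtain v where v: "continuous_on (cball 0 R) v" "v holomorphic_on ball 0 R"
       "\<And>z. z \<in> ball 0 R \<Longrightarrow> norm (poly q z) powr \<kappa> \<le> norm (v z)"
       "\<And>z. z \<in> sphere 0 R \<Longrightarrow> norm (v z) = norm (poly q z) powr \<kappa>"
      using less[of q] by auto
    have "\<exists>w. continuous_on (cball 0 R) w \<and> w holomorphic_on ball 0 R \<and>
       (\<forall>z\<in>ball 0 R. norm (z - a) powr \<kappa> \<le> norm (w z)) \<and>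
       (\<forall>z\<in>sphere 0 R. norm (w z) = norm (z - a) powr \<kappa>)"
    proof -
      \<comment> \<open>A root inside the disc gives l(1 - bz) = (R^2 - conj(a) z)/R, the linear
        factor of the reflected root. A root outside or on the circle gives a - z up to a unimodular
        constant. In both cases 1 - bz has its values in a half-plane on which a power can be
        taken.\<close>
      define b l where "b = (if norm a < R then cnj a / R\<^sup>2 else 1 / a)"
        and "l = (if norm a < R then R else norm a)"
      have bR: "norm b * R \<le> 1"
      proof -
        have "norm b = (if norm a < R then norm a / R\<^sup>2 else 1 / norm a)"
          by (simp add: b_def norm_divide norm_power)
        then show ?thesis using R by (auto simp: power2_eq_square divide_simps)
      qed
      have re: "0 \<le> Re (1 - b * z)" if "norm z \<le> R" for z
      proof -
        have "Re (b * z) \<le> norm b * norm z" by (metis complex_Re_le_cmod norm_mult)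
        also have "\<dots> \<le> norm b * R" using that by (intro mult_left_mono) auto
        finally show ?thesis using bR by simp
      qed
      \<comment> \<open>Strict positivity in the open disc keeps the principal branch holomorphic;
        on the closed disc only Re at least 0 holds, which is enough for continuity of the power
        since the exponent is positive.\<close>
      have re': "0 < Re (1 - b * z)" if "norm z < R" for z
      proof (cases "b = 0")
        case False
        have "Re (b * z) \<le> norm b * norm z" by (metis complex_Re_le_cmod norm_mult)
        also have "\<dots> < norm b * R" using that False by (intro mult_strict_left_mono) auto
        finally show ?thesis using bR by simp
      qed simp
      define w where "w z = of_real (l powr \<kappa>) * (1 - b * z) powr of_real \<kappa>" for z
      have l: "0 < l" using R by (auto simp: l_def)
      have norm_w: "norm (w z) = norm (of_real l * (1 - b * z)) powr \<kappa>" if "norm z \<le> R" for z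
      proof -
        have "norm ((1 - b * z) powr of_real \<kappa>) = norm (1 - b * z) powr \<kappa>"
          using norm_powr_real_powr'[of "of_real \<kappa>"] by (cases "1 - b * z = 0") (auto simp: norm_powr_real_powr')
        then show ?thesis using l by (simp add: w_def norm_mult powr_mult)
      qed
      have out: "of_real l * (1 - b * z) = (of_real (norm a) / a) * (a - z)" if "\<not> norm a < R" for z
      proof -
        have "a \<noteq> 0" using that R by auto
        then show ?thesis using that by (simp add: b_def l_def field_simps)
      qed
      have out': "norm (of_real l * (1 - b * z)) = norm (z - a)" if "\<not> norm a < R" for z
      proof -
        have "a \<noteq> 0" using that R by auto
        then show ?thesis unfolding out[OF that] by (simp add: norm_mult norm_divide norm_minus_commute)
      qed
      \<comment> \<open>The identity behind Blaschke factors: |R^2 - conj(a) z|^2 - R^2 |z - a|^2 =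
        (R^2 - |a|^2)(R^2 - |z|^2). It vanishes on the circle and is nonnegative inside.\<close>
      have inn: "(norm (of_real l * (1 - b * z)))\<^sup>2 - (norm (z - a))\<^sup>2 = (R\<^sup>2 - (norm a)\<^sup>2) * (R\<^sup>2 - (norm z)\<^sup>2) / R\<^sup>2"
        if "norm a < R" for z
      proof -
        have "of_real ((norm (of_real (R\<^sup>2) - cnj a * z))\<^sup>2 - R\<^sup>2 * (norm (z - a))\<^sup>2)
           = complex_of_real ((R\<^sup>2 - (norm a)\<^sup>2) * (R\<^sup>2 - (norm z)\<^sup>2))"
          unfolding of_real_diff of_real_mult complex_norm_square
          by (simp add: algebra_simps power2_eq_square)
        then have 1: "(norm (of_real (R\<^sup>2) - cnj a * z))\<^sup>2 - R\<^sup>2 * (norm (z - a))\<^sup>2 = (R\<^sup>2 - (norm a)\<^sup>2) * (R\<^sup>2 - (norm z)\<^sup>2)"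
          by (simp only: of_real_eq_iff)
        have "of_real l * (1 - b * z) = (of_real (R\<^sup>2) - cnj a * z) / of_real R"
          using R that by (simp add: b_def l_def divide_simps power2_eq_square)
        then have "(norm (of_real l * (1 - b * z)))\<^sup>2 = (norm (of_real (R\<^sup>2) - cnj a * z))\<^sup>2 / R\<^sup>2"
          by (simp add: norm_divide power_divide)
        then show ?thesis unfolding 1[symmetric] using R by (simp add: field_simps)
      qed
      have eq: "norm (of_real l * (1 - b * z)) = norm (z - a)" if "norm z = R" for z
      proof (cases "norm a < R")
        case True
        then show ?thesis using inn[OF True, of z] that by (simp add: power2_eq_iff_nonneg)
      qed (rule out')
      have le: "norm (z - a) \<le> norm (of_real l * (1 - b * z))" if "norm z < R" for z
      proof (cases "norm a < R")
        case True
        have "0 \<le> (R\<^sup>2 - (norm a)\<^sup>2) * (R\<^sup>2 - (norm z)\<^sup>2) / R\<^sup>2"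
          using True that R by (intro divide_nonneg_nonneg mult_nonneg_nonneg) (auto simp: power_mono)
        then have "(norm (z - a))\<^sup>2 \<le> (norm (of_real l * (1 - b * z)))\<^sup>2" using inn[OF True, of z] by linarith
        then show ?thesis by (rule power2_le_imp_le) simp
      qed (simp add: out')
      have "continuous_on (cball 0 R) w"
        unfolding w_def using re \<kappa>
        by (intro continuous_intros continuous_on_powr_complex) auto
      moreover have "w holomorphic_on ball 0 R"
        unfolding w_def
        by (intro holomorphic_intros) (use re' in \<open>auto simp: complex_nonpos_Reals_iff not_le\<close>)
      moreover have "norm (z - a) powr \<kappa> \<le> norm (w z)" if "z \<in> ball 0 R" for z
        using le[of z] norm_w[of z] that \<kappa> by (auto intro!: powr_mono2)
      moreover have "norm (w z) = norm (z - a) powr \<kappa>" if "z \<in> sphere 0 R" for z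
        using eq[of z] norm_w[of z] that by simp
      ultimately show ?thesis by blast
    qed
    then obtain w where w: "continuous_on (cball 0 R) w" "w holomorphic_on ball 0 R"
       "\<And>z. z \<in> ball 0 R \<Longrightarrow> norm (z - a) powr \<kappa> \<le> norm (w z)"
       "\<And>z. z \<in> sphere 0 R \<Longrightarrow> norm (w z) = norm (z - a) powr \<kappa>" by blast
    have split: "norm (poly p z) powr \<kappa> = norm (z - a) powr \<kappa> * norm (poly q z) powr \<kappa>" for z
    proof -
      have "poly p z = (z - a) * poly q z" by (simp add: q algebra_simps)
      then show ?thesis by (simp add: norm_mult powr_mult)
    qed
    show ?thesis
    proof (intro exI[of _ "\<lambda>z. w z * v z"] conjI ballI)
      show "norm (poly p z) powr \<kappa> \<le> norm (w z * v z)" if "z \<in> ball 0 R" for z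
        unfolding split norm_mult using v(3)[OF that] w(3)[OF that] by (intro mult_mono) auto
      show "norm (w z * v z) = norm (poly p z) powr \<kappa>" if "z \<in> sphere 0 R" for z
        unfolding split norm_mult using v(4)[OF that] w(4)[OF that] by simp
    qed (use v w in \<open>auto intro!: continuous_intros holomorphic_intros\<close>)
  qed
qed

text \<open>The outer majorant has the modulus |p|^\<kappa> on the circle and dominates it inside,
  so the Poisson formula for the majorant gives the inequality at once.\<close>

lemma Poisson_poly_le:
  fixes p :: "complex poly"
  assumes \<kappa>: "0 < \<kappa>" and r: "0 \<le> r" "r < R"
  shows "norm (poly p (of_real r)) powr \<kappa> \<le> (\<integral>u. poisson r R u * norm (poly p (of_real R * u)) powr \<kappa> \<partial>circle_measure)"
proof -
  obtain v where v: "continuous_on (cball 0 R) v" "v holomorphic_on ball 0 R"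
       "\<And>z. z \<in> ball 0 R \<Longrightarrow> norm (poly p z) powr \<kappa> \<le> norm (v z)"
       "\<And>z. z \<in> sphere 0 R \<Longrightarrow> norm (v z) = norm (poly p z) powr \<kappa>"
    using poly_power_majorant[of R \<kappa> p] r \<kappa> by auto
  have "norm (poly p (of_real r)) powr \<kappa> \<le> norm (v (of_real r))"
    using r by (intro v(3)) auto
  also have "v (of_real r) = (\<integral>u. of_real (poisson r R u) * v (of_real R * u) \<partial>circle_measure)"
    using Poisson_circle[OF v(1,2) r] by simp
  also have "norm \<dots> \<le> (\<integral>u. norm (of_real (poisson r R u) * v (of_real R * u)) \<partial>circle_measure)"
    by (rule integral_norm_bound)
  also have "\<dots> = (\<integral>u. poisson r R u * norm (poly p (of_real R * u)) powr \<kappa> \<partial>circle_measure)"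
    using r v(4) by (intro Bochner_Integration.integral_cong) (auto simp: norm_mult poisson_nonneg)
  finally show ?thesis .
qed

text \<open>The Taylor polynomials are uniformly bounded on the circle of radius \<open>R\<close>
  and converge pointwise there, so both sides of the polynomial inequality pass to the limit by
  dominated convergence.\<close>

lemma Poisson_holomorphic_le:
  assumes f: "f holomorphic_on ball 0 1" and \<kappa>: "0 < \<kappa>" and r: "0 \<le> r" "r < R" "R < 1"
  shows "ennreal (norm (f (of_real r)) powr \<kappa>) \<le> (\<integral>\<^sup>+u. ennreal (poisson r R u) * ennreal (norm (f (of_real R * u)) powr \<kappa>) \<partial>circle_measure)"
proof -
  define a where "a n = (deriv ^^ n) f 0 / fact n" for n
  have sums: "(\<lambda>n. a n * w ^ n) sums f w" if "norm w < 1" for w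
    using holomorphic_power_series[OF f, of w] that by (simp add: a_def)
  define p where "p N = (\<Sum>n<N. monom (a n) n)" for N
  have p: "poly (p N) w = (\<Sum>n<N. a n * w ^ n)" for N w
    by (simp add: p_def poly_sum poly_monom)
  have lim: "(\<lambda>N. poly (p N) w) \<longlonglongrightarrow> f w" if "norm w < 1" for w
    using sums[OF that] by (simp add: p sums_def)
  \<comment> \<open>Convergence of the series at the larger radius \<open>R'\<close> yields absolute
    convergence at \<open>R\<close>, hence the bound \<open>B\<close>.\<close>
  obtain R' where R': "R < R'" "R' < 1" using r dense by blast
  have "summable (\<lambda>n. norm (a n * of_real R ^ n))"
    by (rule powser_insidea[of _ "of_real R'"])
       (use R' r sums[of "of_real R'"] in \<open>auto simp: sums_iff\<close>)
  then have summ: "summable (\<lambda>n. norm (a n) * R ^ n)"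
    using r by (simp add: norm_mult norm_power)
  define B where "B = (\<Sum>n. norm (a n) * R ^ n)"
  have bound: "norm (poly (p N) (of_real R * u)) \<le> B" if "norm u = 1" for N u
  proof -
    have "norm (poly (p N) (of_real R * u)) \<le> (\<Sum>n<N. norm (a n) * R ^ n)"
      unfolding p using r that by (intro order_trans[OF norm_sum] sum_mono) (simp add: norm_mult norm_power)
    also have "\<dots> \<le> B" unfolding B_def using r by (intro sum_le_suminf summ) auto
    finally show ?thesis .
  qed
  have cont_f: "continuous_on (sphere 0 1) (\<lambda>u. f (of_real R * u))"
    by (rule continuous_on_compose2[OF holomorphic_on_imp_continuous_on[OF f]])
       (use r in \<open>auto intro!: continuous_intros simp: norm_mult\<close>)
  have cont: "continuous_on (sphere 0 1) (\<lambda>u. poisson r R u * norm (f (of_real R * u)) powr \<kappa>)"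
    using r \<kappa> by (intro continuous_intros continuous_poisson continuous_on_powr' cont_f) auto
  have contp: "continuous_on (sphere 0 1) (\<lambda>u. poisson r R u * norm (poly (p N) (of_real R * u)) powr \<kappa>)" for N
    using r \<kappa> by (intro continuous_intros continuous_poisson continuous_on_powr') auto
  have "(\<lambda>N. \<integral>u. poisson r R u * norm (poly (p N) (of_real R * u)) powr \<kappa> \<partial>circle_measure)
      \<longlonglongrightarrow> (\<integral>u. poisson r R u * norm (f (of_real R * u)) powr \<kappa> \<partial>circle_measure)"
  proof (rule integral_dominated_convergence[where w = "\<lambda>u. poisson r R u * B powr \<kappa>"])
    show "integrable circle_measure (\<lambda>u. poisson r R u * B powr \<kappa>)"
      using r by (intro integrable_mult_left integrable_circle_continuous continuous_poisson) auto
    show "AE u in circle_measure. (\<lambda>N. poisson r R u * norm (poly (p N) (of_real R * u)) powr \<kappa>)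
        \<longlonglongrightarrow> poisson r R u * norm (f (of_real R * u)) powr \<kappa>"
      using r \<kappa> by (intro AE_I2 tendsto_intros tendsto_powr' lim) (auto simp: norm_mult)
    show "AE u in circle_measure. norm (poisson r R u * norm (poly (p N) (of_real R * u)) powr \<kappa>) \<le> poisson r R u * B powr \<kappa>" for N
      using r \<kappa> bound by (intro AE_I2) (auto simp: abs_mult poisson_nonneg intro!: mult_left_mono powr_mono2)
  qed (use borel_measurable_circle_continuous cont contp in auto)
  moreover have "(\<lambda>N. norm (poly (p N) (of_real r)) powr \<kappa>) \<longlonglongrightarrow> norm (f (of_real r)) powr \<kappa>"
    using r \<kappa> by (intro tendsto_powr' tendsto_intros lim) auto
  ultimately have le: "norm (f (of_real r)) powr \<kappa> \<le> (\<integral>u. poisson r R u * norm (f (of_real R * u)) powr \<kappa> \<partial>circle_measure)"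
    using Poisson_poly_le[OF \<kappa> r(1,2)] by (intro LIMSEQ_le) auto
  have "ennreal (\<integral>u. poisson r R u * norm (f (of_real R * u)) powr \<kappa> \<partial>circle_measure)
      = (\<integral>\<^sup>+u. ennreal (poisson r R u * norm (f (of_real R * u)) powr \<kappa>) \<partial>circle_measure)"
    using r by (intro nn_integral_eq_integral[symmetric] integrable_circle_continuous cont) (auto simp: poisson_nonneg)
  with ennreal_leI[OF le] show ?thesis
    using r by (simp add: ennreal_mult poisson_nonneg)
qed

no_notation fps_nth (infixl "$" 75)

section \<open>Power series on the polydisc\<close>

lemma scale_vec_nth [simp]: "scale_vec R \<xi> $ j = of_real (R $ j) * \<xi> $ j"
  by (simp add: scale_vec_def)

lemma monom_pow_mult: "monom_pow (x * y) k = monom_pow x k * monom_pow y k"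
  by (simp add: monom_pow_def power_mult_distrib prod.distrib)

lemma norm_monom_pow: "norm (monom_pow z k) = (\<Prod>j\<in>UNIV. norm (z $ j) ^ (k $ j))"
  by (simp add: monom_pow_def prod_norm[symmetric] norm_power)

lemma monom_pow_scale_vec:
  "monom_pow (scale_vec R \<xi>) k = of_real (\<Prod>j\<in>UNIV. R $ j ^ (k $ j)) * monom_pow \<xi> k"
  by (simp add: monom_pow_def power_mult_distrib prod.distrib)

lemma norm_monom_pow_torus: "\<xi> \<in> unit_torus \<Longrightarrow> norm (monom_pow \<xi> k) = 1"
  by (simp add: norm_monom_pow unit_torus_def)

lemma norm_monom_pow_le:
  fixes z :: "complex ^ 'n"
  assumes "\<And>j. norm (z $ j) \<le> r"
  shows "norm (monom_pow z k) \<le> r ^ (\<Sum>j\<in>UNIV. k $ j)"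
  unfolding norm_monom_pow power_sum using assms by (intro prod_mono) (auto intro: power_mono)

lemma scale_vec_in_polydisc:
  assumes "R \<in> unit_cube" "\<xi> \<in> unit_torus"
  shows "scale_vec R \<xi> \<in> polydisc"
  using assms by (simp add: unit_cube_def unit_torus_def polydisc_def norm_mult)

lemma measurable_monom_pow [measurable]: "(\<lambda>\<xi>. monom_pow \<xi> k) \<in> borel_measurable torus_measure"
  unfolding monom_pow_def by measurable

lemma measurable_cnj_monom_pow [measurable]: "(\<lambda>\<xi>. cnj (monom_pow \<xi> k)) \<in> borel_measurable torus_measure"
  by (rule measurable_compose[OF measurable_monom_pow]) (intro borel_measurable_continuous_onI continuous_intros)

lemma polydisc_radius:
  fixes z :: "complex ^ 'n"
  assumes "z \<in> polydisc"
  obtains r where "0 < r" "r < 1" "\<And>j. norm (z $ j) < r"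
proof -
  define m where "m = Max (range (\<lambda>j. norm (z $ j)))"
  have m: "norm (z $ j) \<le> m" for j unfolding m_def by (intro Max_ge) auto
  have "m < 1" using assms unfolding m_def by (subst Max_less_iff) (auto simp: polydisc_def)
  moreover have "0 \<le> m" using m[of undefined] norm_ge_zero order_trans by blast
  moreover have "norm (z $ j) < (m + 1) / 2" for j using m[of j] \<open>m < 1\<close> by (simp add: field_simps)
  ultimately show ?thesis using that[of "(m + 1) / 2"] by simp
qed

lemma bij_vec_nth: "bij (vec_nth :: 'a ^ 'n::finite \<Rightarrow> _)"
  by (metis bijI' vec_nth_inject vec_lambda_inverse UNIV_I)

lemma has_sum_prod_vec:
  fixes f :: "'n::finite \<Rightarrow> nat \<Rightarrow> complex"
  assumes f: "\<And>j. (\<lambda>n. norm (f j n)) summable_on UNIV"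
  shows "(\<lambda>k :: nat ^ 'n. norm (\<Prod>j\<in>UNIV. f j (k $ j))) summable_on UNIV"
    and "((\<lambda>k :: nat ^ 'n. \<Prod>j\<in>UNIV. f j (k $ j)) has_sum (\<Prod>j\<in>UNIV. \<Sum>\<^sub>\<infinity>n. f j n)) UNIV"
proof -
  have "(\<lambda>g. norm (\<Prod>j\<in>UNIV. f j (g j))) summable_on PiE UNIV (\<lambda>_ :: 'n. UNIV)"
    unfolding abs_summable_equivalent
    by (rule Infinite_Set_Sum.abs_summable_on_prod_PiE)
       (use f in \<open>auto simp: abs_summable_equivalent[symmetric]\<close>)
  then have P: "(\<lambda>g. norm (\<Prod>j\<in>UNIV. f j (g j))) summable_on UNIV"
    by simp
  show s: "(\<lambda>k :: nat ^ 'n. norm (\<Prod>j\<in>UNIV. f j (k $ j))) summable_on UNIV"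
    using summable_on_reindex_bij_betw[OF bij_vec_nth, of "\<lambda>g. norm (\<Prod>j\<in>UNIV. f j (g j))"] P by simp
  have "(\<Sum>\<^sub>\<infinity>k :: nat ^ 'n. \<Prod>j\<in>UNIV. f j (k $ j)) = (\<Sum>\<^sub>\<infinity>g. \<Prod>j\<in>UNIV. f j (g j))"
    using infsum_reindex_bij_betw[OF bij_vec_nth, of "\<lambda>g. (\<Prod>j\<in>UNIV. f j (g j))"] by simp
  also have "\<dots> = (\<Prod>j\<in>UNIV. \<Sum>\<^sub>\<infinity>n. f j n)"
    using infsum_prod_PiE_abs[of UNIV f "\<lambda>_. UNIV"] f by simp
  finally show "((\<lambda>k :: nat ^ 'n. \<Prod>j\<in>UNIV. f j (k $ j)) has_sum (\<Prod>j\<in>UNIV. \<Sum>\<^sub>\<infinity>n. f j n)) UNIV"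
    using abs_summable_summable[OF s] by (simp add: has_sum_iff)
qed

lemma has_sum_geometric_vec:
  fixes x :: "'n::finite \<Rightarrow> complex"
  assumes "\<And>j. norm (x j) < 1"
  shows "(\<lambda>k :: nat ^ 'n. norm (\<Prod>j\<in>UNIV. x j ^ (k $ j))) summable_on UNIV"
    and "((\<lambda>k :: nat ^ 'n. \<Prod>j\<in>UNIV. x j ^ (k $ j)) has_sum (\<Prod>j\<in>UNIV. 1 / (1 - x j))) UNIV"
proof -
  have n: "(\<lambda>n. norm (x j ^ n)) summable_on UNIV" for j
    using assms[of j] by (subst summable_on_UNIV_nonneg_real_iff) (auto simp: norm_power)
  have "(\<Sum>\<^sub>\<infinity>n. x j ^ n) = 1 / (1 - x j)" for j
  proof (rule infsumI, rule norm_summable_imp_has_sum)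
    show "summable (\<lambda>n. norm (x j ^ n))" using assms[of j] by (simp add: norm_power)
    show "(\<lambda>n. x j ^ n) sums (1 / (1 - x j))" using assms by (rule geometric_sums)
  qed
  then show "(\<lambda>k :: nat ^ 'n. norm (\<Prod>j\<in>UNIV. x j ^ (k $ j))) summable_on UNIV"
    "((\<lambda>k :: nat ^ 'n. \<Prod>j\<in>UNIV. x j ^ (k $ j)) has_sum (\<Prod>j\<in>UNIV. 1 / (1 - x j))) UNIV"
    using has_sum_prod_vec[OF n] by simp_all
qed

text \<open>The coefficient condition equivalent to convergence of the power series on the whole
  polydisc. Unlike convergence itself it is visibly stable under pointwise products, the operation
  performed by multipliers and by \<open>frac_deriv\<close>.\<close>

definition subexponential :: "(nat ^ 'n \<Rightarrow> complex) \<Rightarrow> bool" where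
  "subexponential a \<longleftrightarrow> (\<forall>r. 0 < r \<longrightarrow> r < 1 \<longrightarrow> (\<exists>C. \<forall>k. norm (a k) * r ^ (\<Sum>j\<in>UNIV. k $ j) \<le> C))"

lemma subexponential_summable:
  fixes a :: "nat ^ 'n \<Rightarrow> complex"
  assumes a: "subexponential a" and s: "0 \<le> s" "s < 1"
  shows "(\<lambda>k. norm (a k) * s ^ (\<Sum>j\<in>UNIV. k $ j)) summable_on UNIV"
proof -
  obtain r where r: "s < r" "r < 1" using s dense by blast
  then obtain C where C: "\<And>k. norm (a k) * r ^ (\<Sum>j\<in>UNIV. k $ j) \<le> C"
    using a s unfolding subexponential_def by (metis le_less_trans)
  have "(\<lambda>k :: nat ^ 'n. norm (\<Prod>j\<in>UNIV. (\<lambda>_. of_real (s / r) :: complex) j ^ (k $ j))) summable_on UNIV"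
    by (rule has_sum_geometric_vec) (use r s in \<open>simp add: norm_divide\<close>)
  then have "(\<lambda>k :: nat ^ 'n. C * norm (\<Prod>j\<in>UNIV. (of_real (s / r) :: complex) ^ (k $ j))) summable_on UNIV"
    by (intro summable_on_cmult_right) simp
  then show ?thesis
  proof (rule summable_on_comparison_test)
    fix k :: "nat ^ 'n"
    have "norm (a k) * s ^ (\<Sum>j\<in>UNIV. k $ j) = (norm (a k) * r ^ (\<Sum>j\<in>UNIV. k $ j)) * (s / r) ^ (\<Sum>j\<in>UNIV. k $ j)"
      using r s by (simp add: power_divide)
    also have "\<dots> \<le> C * (s / r) ^ (\<Sum>j\<in>UNIV. k $ j)"
      using r s by (intro mult_right_mono C) auto
    also have "(s / r) ^ (\<Sum>j\<in>UNIV. k $ j) = norm (\<Prod>j\<in>UNIV. (of_real (s / r) :: complex) ^ (k $ j))"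
      using r s by (simp add: power_sum prod_norm[symmetric] norm_power norm_divide)
    finally show "norm (a k) * s ^ (\<Sum>j\<in>UNIV. k $ j) \<le> C * norm (\<Prod>j\<in>UNIV. (of_real (s / r) :: complex) ^ (k $ j))" .
  qed (use s in auto)
qed

lemma subexponential_summable_vec:
  assumes a: "subexponential a" and R: "R \<in> unit_cube"
  shows "(\<lambda>k. norm (a k) * (\<Prod>j\<in>UNIV. R $ j ^ (k $ j))) summable_on UNIV"
proof -
  have R0: "0 \<le> R $ j" for j using R by (simp add: unit_cube_def)
  have "((\<chi> j. of_real (R $ j)) :: complex ^ 'a) \<in> polydisc"
    using R by (simp add: unit_cube_def polydisc_def)
  then obtain r where r: "0 < r" "r < 1" "\<And>j. norm ((\<chi> j. complex_of_real (R $ j)) $ j) < r"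
    by (rule polydisc_radius) blast
  have rr: "R $ j \<le> r" for j using r(3)[of j] by simp
  have "(\<lambda>k. norm (a k) * r ^ (\<Sum>j\<in>UNIV. k $ j)) summable_on UNIV"
    by (rule subexponential_summable[OF a]) (use r in auto)
  then show ?thesis
  proof (rule summable_on_comparison_test)
    fix k :: "nat ^ 'a"
    have "(\<Prod>j\<in>UNIV. R $ j ^ (k $ j)) \<le> (\<Prod>j\<in>UNIV. r ^ (k $ j))"
      by (intro prod_mono conjI zero_le_power power_mono R0 rr)
    then show "norm (a k) * (\<Prod>j\<in>UNIV. R $ j ^ (k $ j)) \<le> norm (a k) * r ^ (\<Sum>j\<in>UNIV. k $ j)"
      unfolding power_sum by (rule mult_left_mono) simp
    show "0 \<le> norm (a k) * (\<Prod>j\<in>UNIV. R $ j ^ (k $ j))"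
      by (intro mult_nonneg_nonneg prod_nonneg zero_le_power R0 ballI norm_ge_zero)
  qed
qed

lemma subexponential_has_sum:
  assumes "subexponential a" "z \<in> polydisc"
  shows "((\<lambda>k. a k * monom_pow z k) has_sum (\<Sum>\<^sub>\<infinity>k. a k * monom_pow z k)) UNIV"
proof -
  have "(\<chi> j. norm (z $ j)) \<in> unit_cube"
    using assms(2) by (simp add: unit_cube_def polydisc_def)
  from subexponential_summable_vec[OF assms(1) this]
  have "(\<lambda>k. norm (a k * monom_pow z k)) summable_on UNIV"
    by (simp add: norm_mult norm_monom_pow)
  then show ?thesis by (rule has_sum_infsum[OF abs_summable_summable])
qed

lemma has_power_series_infsum:
  "subexponential a \<Longrightarrow> has_power_series (\<lambda>z. \<Sum>\<^sub>\<infinity>k. a k * monom_pow z k) a"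
  unfolding has_power_series_def using subexponential_has_sum by blast

lemma has_power_series_subexponential:
  assumes "has_power_series f a"
  shows "subexponential a"
  unfolding subexponential_def
proof (intro allI impI)
  fix r :: real assume r: "0 < r" "r < 1"
  let ?z = "(\<chi> j. of_real r) :: complex ^ 'a"
  have "((\<lambda>k. a k * monom_pow ?z k) has_sum f ?z) UNIV"
    using assms r unfolding has_power_series_def by (auto simp: polydisc_def)
  then have s: "(\<lambda>k. norm (a k * monom_pow ?z k)) summable_on UNIV"
    by (simp add: has_sum_imp_summable flip: summable_on_iff_abs_summable_on_complex)
  have "norm (a k) * r ^ (\<Sum>j\<in>UNIV. k $ j) \<le> (\<Sum>\<^sub>\<infinity>k. norm (a k * monom_pow ?z k))" for k
  proof -
    have "norm (a k * monom_pow ?z k) = norm (a k) * r ^ (\<Sum>j\<in>UNIV. k $ j)"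
      using r by (simp add: norm_mult norm_monom_pow power_sum)
    moreover have "norm (a k * monom_pow ?z k) \<le> (\<Sum>\<^sub>\<infinity>k. norm (a k * monom_pow ?z k))"
      using finite_sum_le_infsum[OF s, of "{k}"] by simp
    ultimately show ?thesis by simp
  qed
  then show "\<exists>C. \<forall>k. norm (a k) * r ^ (\<Sum>j\<in>UNIV. k $ j) \<le> C" by blast
qed

text \<open>Split the radius as \<open>r = s * s\<close> and give one factor \<open>s\<close> to
  each sequence.\<close>

lemma subexponential_mult:
  assumes "subexponential a" "subexponential b"
  shows "subexponential (\<lambda>k. a k * b k)"
  unfolding subexponential_def
proof (intro allI impI)
  fix r :: real assume r: "0 < r" "r < 1"
  define s where "s = sqrt r"
  have s: "0 < s" "s < 1" "r = s * s" using r by (auto simp: s_def)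
  obtain C where C: "\<And>k. norm (a k) * s ^ (\<Sum>j\<in>UNIV. k $ j) \<le> C"
    using assms(1) s unfolding subexponential_def by blast
  obtain D where D: "\<And>k. norm (b k) * s ^ (\<Sum>j\<in>UNIV. k $ j) \<le> D"
    using assms(2) s unfolding subexponential_def by blast
  have "norm (a k * b k) * r ^ (\<Sum>j\<in>UNIV. k $ j) \<le> C * D" for k
  proof -
    have "norm (a k * b k) * r ^ (\<Sum>j\<in>UNIV. k $ j)
       = (norm (a k) * s ^ (\<Sum>j\<in>UNIV. k $ j)) * (norm (b k) * s ^ (\<Sum>j\<in>UNIV. k $ j))"
      by (simp add: s(3) norm_mult power_mult_distrib)
    also have "\<dots> \<le> C * D"
      using C[of k] D[of k] s by (intro mult_mono) (auto intro: order_trans[rotated])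
    finally show ?thesis .
  qed
  then show "\<exists>C. \<forall>k. norm (a k * b k) * r ^ (\<Sum>j\<in>UNIV. k $ j) \<le> C" by blast
qed

section \<open>Orthogonality of monomials and uniqueness of coefficients\<close>

lemma circle_integral_power: "(\<integral>u. u ^ n \<partial>circle_measure) = (if n = 0 then 1 else 0)"
proof -
  have "(\<integral>u. u ^ n \<partial>circle_measure) = (\<integral>u. (of_real 1 * u) ^ n * (of_real 1 * u / (of_real 1 * u - 0)) \<partial>circle_measure)"
    by (intro Bochner_Integration.integral_cong) auto
  also have "\<dots> = 0 ^ n"
    by (rule Cauchy_circle) (auto intro!: continuous_intros holomorphic_intros)
  finally show ?thesis by (simp add: power_0_left)
qed

lemma circle_orthogonal: "(\<integral>u. u ^ k * cnj u ^ l \<partial>circle_measure) = (if k = l then 1 else 0)"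
proof -
  have *: "(\<integral>u. u ^ k * cnj u ^ l \<partial>circle_measure) = (\<integral>u. u ^ (k - l) \<partial>circle_measure)" if "l \<le> k" for k l
  proof (rule Bochner_Integration.integral_cong)
    fix u assume "u \<in> space circle_measure"
    then have "u * cnj u = 1" using complex_norm_square[of u] by simp
    then have "u ^ l * cnj u ^ l = 1" by (simp flip: power_mult_distrib)
    moreover have "u ^ k = u ^ (k - l) * u ^ l" using that by (simp flip: power_add)
    ultimately show "u ^ k * cnj u ^ l = u ^ (k - l)" by (simp add: mult.assoc)
  qed simp
  show ?thesis
  proof (cases "l \<le> k")
    case True
    then show ?thesis using *[OF True] by (simp add: circle_integral_power)
  next
    case False
    have "cnj (\<integral>u. u ^ l * cnj u ^ k \<partial>circle_measure) = (\<integral>u. cnj (u ^ l * cnj u ^ k) \<partial>circle_measure)"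
      by (rule Bochner_Integration.integral_cnj[symmetric])
    also have "\<dots> = (\<integral>u. u ^ k * cnj u ^ l \<partial>circle_measure)"
      by (simp add: mult.commute)
    finally have "cnj (\<integral>u. u ^ l * cnj u ^ k \<partial>circle_measure) = (\<integral>u. u ^ k * cnj u ^ l \<partial>circle_measure)" .
    then show ?thesis using *[of k l] False by (simp add: circle_integral_power)
  qed
qed

lemma torus_orthogonal:
  "(\<integral>\<xi>. monom_pow \<xi> k * cnj (monom_pow \<xi> l) \<partial>torus_measure) = (if k = l then 1 else 0)"
proof -
  have "(\<integral>\<xi>. monom_pow \<xi> k * cnj (monom_pow \<xi> l) \<partial>torus_measure)
     = (\<integral>\<xi>. (\<Prod>j\<in>UNIV. (\<xi> $ j) ^ (k $ j) * cnj (\<xi> $ j) ^ (l $ j)) \<partial>torus_measure)"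
    by (simp add: monom_pow_def prod.distrib)
  also have "\<dots> = (\<Prod>j\<in>UNIV. if k $ j = l $ j then 1 else 0)"
    by (subst integral_torus_prod)
       (auto intro!: integrable_circle_continuous continuous_intros simp: circle_orthogonal)
  also have "\<dots> = (if k = l then 1 else 0)"
    by (auto simp: vec_eq_iff)
  finally show ?thesis .
qed

lemma torus_coefficient:
  fixes b :: "nat ^ 'n \<Rightarrow> complex"
  assumes b: "(\<lambda>k. norm (b k)) summable_on UNIV"
    and G: "\<And>\<xi>. \<xi> \<in> unit_torus \<Longrightarrow> ((\<lambda>k. b k * monom_pow \<xi> k) has_sum G \<xi>) UNIV"
  shows "(\<integral>\<xi>. G \<xi> * cnj (monom_pow \<xi> l) \<partial>torus_measure) = b l"
proof -
  have "((\<lambda>k. \<integral>\<xi>. b k * monom_pow \<xi> k * cnj (monom_pow \<xi> l) \<partial>torus_measure) has_sum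
      (\<integral>\<xi>. G \<xi> * cnj (monom_pow \<xi> l) \<partial>torus_measure)) UNIV"
  proof (rule has_sum_integral(2))
    show "finite_measure (torus_measure :: (complex ^ 'n) measure)"
      by (rule torus.finite_measure_axioms)
    show "norm (b k * monom_pow \<xi> k * cnj (monom_pow \<xi> l)) \<le> norm (b k)" if "\<xi> \<in> space torus_measure" for k \<xi>
      using that by (simp add: norm_mult norm_monom_pow_torus)
    show "((\<lambda>k. b k * monom_pow \<xi> k * cnj (monom_pow \<xi> l)) has_sum G \<xi> * cnj (monom_pow \<xi> l)) UNIV"
      if "\<xi> \<in> space torus_measure" for \<xi>
      using G[of \<xi>] that by (intro has_sum_cmult_left) simp
    show "(\<lambda>\<xi>. b k * monom_pow \<xi> k * cnj (monom_pow \<xi> l)) \<in> borel_measurable torus_measure" for k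
      by (intro borel_measurable_times borel_measurable_const measurable_monom_pow measurable_cnj_monom_pow)
  qed (rule b)
  moreover have "(\<integral>\<xi>. b k * monom_pow \<xi> k * cnj (monom_pow \<xi> l) \<partial>torus_measure) = (if k = l then b l else 0)" for k
    by (simp add: mult.assoc torus_orthogonal)
  moreover have "((\<lambda>k. if k = l then b l else 0) has_sum b l) UNIV"
    using has_sum_cong_neutral[of UNIV "{l}" "\<lambda>k. if k = l then b l else 0" "\<lambda>k. if k = l then b l else 0" "b l"]
    by (simp add: has_sum_finite_iff)
  ultimately show ?thesis using has_sum_unique by fastforce
qed

lemma power_series_coefficient:
  assumes f: "has_power_series f a" and R: "R \<in> unit_cube"
  shows "(\<integral>\<xi>. f (scale_vec R \<xi>) * cnj (monom_pow \<xi> l) \<partial>torus_measure) = a l * of_real (\<Prod>j\<in>UNIV. R $ j ^ (l $ j))"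
proof (rule torus_coefficient)
  have R0: "0 \<le> R $ j" for j using R by (simp add: unit_cube_def)
  show "(\<lambda>k. norm (a k * of_real (\<Prod>j\<in>UNIV. R $ j ^ (k $ j)))) summable_on UNIV"
    using subexponential_summable_vec[OF has_power_series_subexponential[OF f] R]
    by (simp add: norm_mult prod_norm[symmetric] norm_power R0)
  show "((\<lambda>k. a k * of_real (\<Prod>j\<in>UNIV. R $ j ^ (k $ j)) * monom_pow \<xi> k) has_sum f (scale_vec R \<xi>)) UNIV"
    if "\<xi> \<in> unit_torus" for \<xi>
  proof -
    have "((\<lambda>k. a k * monom_pow (scale_vec R \<xi>) k) has_sum f (scale_vec R \<xi>)) UNIV"
      using f scale_vec_in_polydisc[OF R that] by (simp add: has_power_series_def)
    then show ?thesis by (simp add: monom_pow_scale_vec mult.assoc)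
  qed
qed

lemma has_power_series_unique:
  assumes "has_power_series f a" "has_power_series f b"
  shows "a = b"
proof
  fix l
  \<comment> \<open>Any polyradius with positive coordinates would do; the power of it multiplying
    the coefficient has to be nonzero.\<close>
  have R: "(\<chi> j. 1 / 2) \<in> (unit_cube :: (real ^ 'a) set)" by (simp add: unit_cube_def)
  show "a l = b l"
    using power_series_coefficient[OF assms(1) R, of l] power_series_coefficient[OF assms(2) R, of l] by simp
qed

lemma power_coeffs_eqI: "has_power_series f a \<Longrightarrow> power_coeffs f = a"
  unfolding power_coeffs_def using has_power_series_unique by blast

section \<open>Holomorphic functions on the polydisc\<close>

lemma emeasure_unit_torus [simp]: "emeasure torus_measure unit_torus = 1"
  using torus.emeasure_space_1 by simp

lemma measure_unit_torus [simp]: "measure torus_measure unit_torus = 1"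
  using torus.prob_space by simp

lemma hol_polydisc_holomorphic:
  "f \<in> hol_polydisc \<Longrightarrow> z \<in> polydisc \<Longrightarrow> (\<lambda>w. f (\<chi> i. if i = j then w else z $ i)) holomorphic_on ball 0 1"
  by (simp add: hol_polydisc_def)

lemma hol_polydisc_continuous: "f \<in> hol_polydisc \<Longrightarrow> continuous_on polydisc f"
  by (simp add: hol_polydisc_def)

lemma measurable_hol_polydisc:
  assumes f: "f \<in> hol_polydisc" and g: "g \<in> borel_measurable M" "\<And>x. x \<in> space M \<Longrightarrow> g x \<in> polydisc"
  shows "(\<lambda>x. f (g x)) \<in> borel_measurable M"
proof -
  have "f \<in> borel_measurable (restrict_space borel polydisc)"
    by (rule borel_measurable_continuous_on_restrict[OF hol_polydisc_continuous[OF f]])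
  moreover have "g \<in> M \<rightarrow>\<^sub>M restrict_space borel polydisc"
    using g by (intro measurable_restrict_space2) auto
  ultimately show ?thesis by (rule measurable_compose[rotated])
qed

lemma measurable_scale_vec:
  assumes g: "g \<in> M \<rightarrow>\<^sub>M cube_measure" and h: "h \<in> M \<rightarrow>\<^sub>M torus_measure"
  shows "(\<lambda>x. scale_vec (g x) (h x)) \<in> borel_measurable M"
proof -
  have [measurable]: "(\<lambda>x. g x $ j) \<in> borel_measurable M" "(\<lambda>x. h x $ j) \<in> borel_measurable M" for j
    using measurable_compose[OF g measurable_cube_nth_borel] measurable_compose[OF h measurable_torus_nth_borel] by auto
  show ?thesis unfolding scale_vec_def by (rule measurable_vec_lambda_borel) measurable
qed

lemma measurable_hol_scale_vec:
  assumes f: "f \<in> hol_polydisc" and g: "g \<in> M \<rightarrow>\<^sub>M cube_measure" and h: "h \<in> M \<rightarrow>\<^sub>M torus_measure"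
  shows "(\<lambda>x. f (scale_vec (g x) (h x))) \<in> borel_measurable M"
  by (rule measurable_hol_polydisc[OF f measurable_scale_vec[OF g h]])
     (use measurable_space[OF g] measurable_space[OF h] scale_vec_in_polydisc in auto)

lemma hol_polydisc_bounded:
  fixes f :: "complex ^ 'n \<Rightarrow> complex"
  assumes f: "f \<in> hol_polydisc" and r: "r < 1"
  obtains B where "\<And>z. (\<And>j. norm (z $ j) \<le> r) \<Longrightarrow> norm (f z) \<le> B"
proof -
  let ?K = "{z :: complex ^ 'n. \<forall>j. norm (z $ j) \<le> r}"
  have "closed ?K"
    by (intro closed_Collect_all closed_Collect_le continuous_intros)
  moreover have "bounded ?K"
  proof (rule boundedI)
    fix z assume "z \<in> ?K"
    then have "(\<Sum>j\<in>UNIV. norm (z $ j)) \<le> (\<Sum>j\<in>(UNIV :: 'n set). r)" by (intro sum_mono) auto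
    then show "norm z \<le> (\<Sum>j\<in>(UNIV :: 'n set). r)"
      unfolding norm_vec_def using L2_set_le_sum[of UNIV "\<lambda>j. norm (z $ j)"] by simp
  qed
  ultimately have "compact ?K" by (simp add: compact_eq_bounded_closed)
  moreover have "continuous_on ?K f"
    using r by (intro continuous_on_subset[OF hol_polydisc_continuous[OF f]]) (auto simp: polydisc_def intro: le_less_trans)
  ultimately have "bounded (f ` ?K)" by (intro compact_imp_bounded compact_continuous_image)
  then obtain B where "\<forall>z\<in>?K. norm (f z) \<le> B" by (auto simp: bounded_iff)
  then show ?thesis using that by blast
qed

text \<open>On every closed polydisc of radius below 1 the partial sums converge uniformly, so
  continuity and holomorphy in each variable pass to the limit.\<close>

lemma has_power_series_hol_polydisc:
  fixes f :: "complex ^ 'n \<Rightarrow> complex"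
  assumes f: "has_power_series f a"
  shows "f \<in> hol_polydisc"
proof -
  have a: "subexponential a" by (rule has_power_series_subexponential[OF f])
  have unif: "uniform_limit {z. \<forall>j. norm (z $ j) \<le> r} (\<lambda>X z. \<Sum>k\<in>X. a k * monom_pow z k) f (finite_subsets_at_top UNIV)"
    if "0 \<le> r" "r < 1" for r
  proof (rule Weierstrass_m_test_general')
    show "norm (a k * monom_pow z k) \<le> norm (a k) * r ^ (\<Sum>j\<in>UNIV. k $ j)"
      if "z \<in> {z. \<forall>j. norm (z $ j) \<le> r}" for k z
      using that norm_monom_pow_le[of z r k] by (auto simp: norm_mult intro!: mult_left_mono)
    show "((\<lambda>k. a k * monom_pow z k) has_sum f z) UNIV" if "z \<in> {z. \<forall>j. norm (z $ j) \<le> r}" for z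
    proof -
      have "z \<in> polydisc" using that \<open>r < 1\<close> by (auto simp: polydisc_def intro: le_less_trans)
      then show ?thesis using f by (simp add: has_power_series_def)
    qed
  qed (rule subexponential_summable[OF a that])
  have open_r: "open {z :: complex ^ 'n. \<forall>j. norm (z $ j) < r}" for r
  proof -
    have "{z :: complex ^ 'n. \<forall>j. norm (z $ j) < r} = (\<Inter>j\<in>UNIV. {z. norm (z $ j) < r})" by auto
    moreover have "open (\<Inter>j\<in>UNIV. {z :: complex ^ 'n. norm (z $ j) < r})"
      by (intro open_INT ballI open_Collect_less continuous_intros) simp
    ultimately show ?thesis by (simp only:)
  qed
  have "continuous_on polydisc f"
  proof (rule continuous_at_imp_continuous_on, rule ballI)
    fix z :: "complex ^ 'n" assume "z \<in> polydisc"
    then obtain r where r: "0 < r" "r < 1" "\<And>j. norm (z $ j) < r" using polydisc_radius by blast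
    have "continuous_on {z. \<forall>j. norm (z $ j) \<le> r} f"
      by (rule uniform_limit_theorem[OF _ unif])
         (use r in \<open>auto simp: monom_pow_def intro!: always_eventually continuous_intros\<close>)
    then have "continuous_on {z. \<forall>j. norm (z $ j) < r} f"
      by (rule continuous_on_subset) (auto intro: less_imp_le)
    then show "isCont f z"
      using r(3) by (simp add: continuous_on_eq_continuous_at[OF open_r])
  qed
  moreover have "(\<lambda>w. f (\<chi> i. if i = j then w else z $ i)) holomorphic_on ball 0 1" if z: "z \<in> polydisc" for z j
  proof -
    \<comment> \<open>The radius must exceed all the moduli |z_j|, so that the slice stays in a
      polydisc of uniform convergence. Such radii exhaust the unit disc of the variable
      \<open>w\<close>.\<close>
    have "(\<lambda>w. f (\<chi> i. if i = j then w else z $ i)) holomorphic_on ball 0 r" if r: "\<And>j. norm (z $ j) < r" "0 < r" "r < 1" for r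
    proof -
      have ul: "uniform_limit (cball 0 r) (\<lambda>X w. \<Sum>k\<in>X. a k * monom_pow (\<chi> i. if i = j then w else z $ i) k)
         (\<lambda>w. f (\<chi> i. if i = j then w else z $ i)) (finite_subsets_at_top UNIV)"
        by (rule uniform_limit_compose'[OF unif[of r]]) (use r in \<open>auto intro: less_imp_le[OF r(1)]\<close>)
      have hol: "(\<lambda>w. \<Sum>k\<in>X. a k * monom_pow (\<chi> i. if i = j then w else z $ i) k) holomorphic_on UNIV" for X
      proof -
        have "(\<lambda>w. (if i = j then w else z $ i) ^ n) holomorphic_on UNIV" for i n
          by (cases "i = j") (auto intro!: holomorphic_intros)
        then show ?thesis
          unfolding monom_pow_def vec_lambda_beta
          by (intro holomorphic_on_sum holomorphic_on_mult holomorphic_on_const holomorphic_on_prod)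
      qed
      show ?thesis
      proof (rule holomorphic_uniform_limit[OF _ ul])
        show "\<forall>\<^sub>F X in finite_subsets_at_top UNIV.
            continuous_on (cball 0 r) (\<lambda>w. \<Sum>k\<in>X. a k * monom_pow (\<chi> i. if i = j then w else z $ i) k) \<and>
            (\<lambda>w. \<Sum>k\<in>X. a k * monom_pow (\<chi> i. if i = j then w else z $ i) k) holomorphic_on ball 0 r"
          by (intro always_eventually allI conjI holomorphic_on_imp_continuous_on holomorphic_on_subset[OF hol]) auto
      qed auto
    qed note small = this
    obtain r0 where r0: "0 < r0" "r0 < 1" "\<And>j. norm (z $ j) < r0" using polydisc_radius[OF z] by blast
    have "(\<lambda>w. f (\<chi> i. if i = j then w else z $ i)) holomorphic_on (\<Union>r\<in>{r0<..<1}. ball 0 r)"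
      by (rule holomorphic_on_UN_open, rule small) (use r0 in \<open>auto intro: less_trans\<close>)
    moreover have "ball 0 1 \<subseteq> (\<Union>r\<in>{r0<..<1}. ball (0 :: complex) r)"
    proof
      fix w :: complex assume "w \<in> ball 0 1"
      then have "max r0 (norm w) < 1" using r0 by simp
      then obtain r where "max r0 (norm w) < r" "r < 1" using dense by blast
      then show "w \<in> (\<Union>r\<in>{r0<..<1}. ball (0 :: complex) r)" by auto
    qed
    ultimately show ?thesis by (rule holomorphic_on_subset)
  qed
  ultimately show ?thesis by (simp add: hol_polydisc_def)
qed

lemma integrable_torus_bounded:
  fixes K :: "complex ^ 'n \<Rightarrow> complex"
  assumes "K \<in> borel_measurable torus_measure" "\<And>\<xi>. \<xi> \<in> unit_torus \<Longrightarrow> norm (K \<xi>) \<le> B"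
  shows "integrable torus_measure K"
  by (rule torus.integrable_const_bound[where B = B]) (use assms in \<open>auto intro!: AE_I2\<close>)

text \<open>Induction on the set \<open>A\<close> of coordinates already moved to the circle of
  radius \<open>r\<close>, the others still resting at \<open>z\<close>. Moving coordinate
  \<open>j\<close> means resampling it and applying the one-variable formula to the slice through
  \<open>w A \<xi>\<close>.\<close>

lemma Cauchy_torus:
  fixes f :: "complex ^ 'n \<Rightarrow> complex"
  assumes f: "f \<in> hol_polydisc" and r: "0 < r" "r < 1" and z: "\<And>j. norm (z $ j) < r"
  shows "(\<integral>\<xi>. f (\<chi> j. of_real r * \<xi> $ j) * (\<Prod>j\<in>UNIV. of_real r * \<xi> $ j / (of_real r * \<xi> $ j - z $ j)) \<partial>torus_measure) = f z"
proof -
  define w where "w A \<xi> = (\<chi> j. if j \<in> A then of_real r * \<xi> $ j else z $ j)" for A and \<xi> :: "complex ^ 'n"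
  define C where "C A \<xi> = (\<Prod>j\<in>A. of_real r * \<xi> $ j / (of_real r * \<xi> $ j - z $ j))" for A and \<xi> :: "complex ^ 'n"
  have wr: "norm (w A \<xi> $ j) \<le> r" if "\<xi> \<in> unit_torus" for A \<xi> j
    using that r z[of j] by (auto simp: w_def norm_mult unit_torus_def intro: less_imp_le)
  have wp: "w A \<xi> \<in> polydisc" if "\<xi> \<in> unit_torus" for A \<xi>
    using le_less_trans[OF wr[OF that] r(2)] by (simp add: polydisc_def)
  obtain B where B: "\<And>z. (\<And>j. norm (z $ j) \<le> r) \<Longrightarrow> norm (f z) \<le> B"
    using hol_polydisc_bounded[OF f r(2)] by blast
  have B0: "0 \<le> B" using B[of z] z norm_ge_zero[of "f z"] by (meson less_imp_le order_trans)
  have wm: "w A \<in> borel_measurable torus_measure" for A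
  proof -
    have "(\<lambda>\<xi>. if j \<in> A then of_real r * \<xi> $ j else z $ j) \<in> borel_measurable torus_measure" for j
      by (cases "j \<in> A") simp_all
    then show ?thesis unfolding w_def by (rule measurable_vec_lambda_borel)
  qed
  have fm: "(\<lambda>\<xi>. f (w A \<xi>)) \<in> borel_measurable torus_measure" for A
    using wp by (intro measurable_hol_polydisc[OF f wm]) simp
  have Cm: "C A \<in> borel_measurable torus_measure" for A
    unfolding C_def by measurable
  have Cb: "norm (C A \<xi>) \<le> (\<Prod>j\<in>A. r / (r - norm (z $ j)))" if "\<xi> \<in> unit_torus" for A \<xi>
    unfolding C_def prod_norm[symmetric]
  proof (rule prod_mono, safe)
    fix j
    have x: "norm (of_real r * \<xi> $ j) = r" using that r by (simp add: unit_torus_def norm_mult)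
    have "r - norm (z $ j) \<le> norm (of_real r * \<xi> $ j - z $ j)"
      using norm_triangle_ineq2[of "of_real r * \<xi> $ j" "z $ j"] x by simp
    then show "norm (of_real r * \<xi> $ j / (of_real r * \<xi> $ j - z $ j)) \<le> r / (r - norm (z $ j))"
      unfolding norm_divide x using z[of j] r by (intro divide_left_mono mult_pos_pos) auto
  qed simp
  have int: "integrable torus_measure (\<lambda>\<xi>. f (w A \<xi>) * C A \<xi>)" for A
  proof (rule integrable_torus_bounded[where B = "B * (\<Prod>j\<in>A. r / (r - norm (z $ j)))"])
    show "norm (f (w A \<xi>) * C A \<xi>) \<le> B * (\<Prod>j\<in>A. r / (r - norm (z $ j)))" if "\<xi> \<in> unit_torus" for \<xi>
      unfolding norm_mult using B[OF wr[OF that]] Cb[OF that] B0 by (intro mult_mono) auto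
  qed (intro borel_measurable_times fm Cm)
  have "(\<integral>\<xi>. f (w A \<xi>) * C A \<xi> \<partial>torus_measure) = f z" if "finite A" for A
    using that
  proof (induction A rule: finite_induct)
    case empty
    have "w {} \<xi> = z" for \<xi> by (simp add: w_def)
    then show ?case by (simp add: C_def)
  next
    case (insert j A)
    let ?u = "\<lambda>\<xi> u. (\<chi> i. if i = j then u else \<xi> $ i) :: complex ^ 'n"
    have "(\<integral>\<xi>. f (w (insert j A) \<xi>) * C (insert j A) \<xi> \<partial>torus_measure)
       = (\<integral>\<xi>. \<integral>u. f (w (insert j A) (?u \<xi> u)) * C (insert j A) (?u \<xi> u) \<partial>circle_measure \<partial>torus_measure)"
      by (rule integral_torus_resample[OF int])
    also have "\<dots> = (\<integral>\<xi>. f (w A \<xi>) * C A \<xi> \<partial>torus_measure)"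
    proof (rule Bochner_Integration.integral_cong)
      fix \<xi> :: "complex ^ 'n" assume "\<xi> \<in> space torus_measure"
      then have \<xi>: "\<xi> \<in> unit_torus" by simp
      define g where "g x = f (\<chi> i. if i = j then x else w A \<xi> $ i)" for x
      have w: "w (insert j A) (?u \<xi> u) = (\<chi> i. if i = j then of_real r * u else w A \<xi> $ i)" for u
        using insert.hyps by (auto simp: w_def vec_eq_iff)
      have C: "C (insert j A) (?u \<xi> u) = of_real r * u / (of_real r * u - z $ j) * C A \<xi>" for u
        using insert.hyps unfolding C_def by (subst prod.insert) (auto intro!: prod.cong)
      have "g holomorphic_on ball 0 1"
        unfolding g_def by (rule hol_polydisc_holomorphic[OF f wp[OF \<xi>]])
      then have g: "continuous_on (cball 0 r) g" "g holomorphic_on ball 0 r"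
        using r by (auto intro!: holomorphic_on_imp_continuous_on elim: holomorphic_on_subset)
      have "(\<integral>u. f (w (insert j A) (?u \<xi> u)) * C (insert j A) (?u \<xi> u) \<partial>circle_measure)
         = (\<integral>u. g (of_real r * u) * (of_real r * u / (of_real r * u - z $ j)) * C A \<xi> \<partial>circle_measure)"
        unfolding w C g_def by (simp add: mult.assoc)
      also have "\<dots> = (\<integral>u. g (of_real r * u) * (of_real r * u / (of_real r * u - z $ j)) \<partial>circle_measure) * C A \<xi>"
        by (rule integral_mult_left_zero)
      also have "\<dots> = g (z $ j) * C A \<xi>"
        using Cauchy_circle[OF g z] by simp
      also have "g (z $ j) = f (w A \<xi>)"
        using insert.hyps unfolding g_def by (intro arg_cong[of _ _ f]) (auto simp: vec_eq_iff w_def)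
      finally show "(\<integral>u. f (w (insert j A) (?u \<xi> u)) * C (insert j A) (?u \<xi> u) \<partial>circle_measure) = f (w A \<xi>) * C A \<xi>" .
    qed simp
    finally show ?case using insert.IH by simp
  qed
  from this[of UNIV] show ?thesis by (simp add: w_def C_def)
qed

text \<open>Expanding the Cauchy kernel into a geometric series gives coefficients
  \<open>c r\<close> that a priori depend on the radius \<open>r\<close> of the torus; comparing
  Fourier coefficients on one small torus removes this dependence.\<close>

lemma hol_polydisc_has_power_series:
  fixes f :: "complex ^ 'n \<Rightarrow> complex"
  assumes f: "f \<in> hol_polydisc"
  shows "has_power_series f (power_coeffs f)"
proof -
  define c where "c r k = (\<integral>\<xi>. f (\<chi> j. of_real r * \<xi> $ j) * cnj (monom_pow \<xi> k) \<partial>torus_measure) / of_real r ^ (\<Sum>j\<in>UNIV. k $ j)"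
    for r :: real and k :: "nat ^ 'n"
  have expand: "((\<lambda>k. c r k * monom_pow z k) has_sum f z) UNIV"
    if r: "0 < r" "r < 1" and z: "\<And>j. norm (z $ j) < r" for r z
  proof -
    obtain B where B: "\<And>z. (\<And>j. norm (z $ j) \<le> r) \<Longrightarrow> norm (f z) \<le> B"
      using hol_polydisc_bounded[OF f r(2)] by blast
    have g: "norm (f (\<chi> j. of_real r * \<xi> $ j)) \<le> B" if "\<xi> \<in> unit_torus" for \<xi>
      using that r by (intro B) (simp add: unit_torus_def norm_mult)
    have gm: "(\<lambda>\<xi>. f (\<chi> j. of_real r * \<xi> $ j)) \<in> borel_measurable torus_measure"
      using r by (intro measurable_hol_polydisc[OF f] measurable_vec_lambda_borel)
         (auto simp: polydisc_def unit_torus_def norm_mult)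
    define q where "q j = z $ j / of_real r" for j
    have q: "norm (q j) < 1" for j using z[of j] r by (simp add: q_def norm_divide)
    let ?F = "\<lambda>k \<xi>. f (\<chi> j. of_real r * \<xi> $ j) * ((\<Prod>j\<in>UNIV. q j ^ (k $ j)) * cnj (monom_pow \<xi> k))"
    have "((\<lambda>k. \<integral>\<xi>. ?F k \<xi> \<partial>torus_measure) has_sum
      (\<integral>\<xi>. f (\<chi> j. of_real r * \<xi> $ j) * (\<Prod>j\<in>UNIV. of_real r * \<xi> $ j / (of_real r * \<xi> $ j - z $ j)) \<partial>torus_measure)) UNIV"
    proof (rule has_sum_integral(2)[OF torus.finite_measure_axioms])
      show "?F k \<in> borel_measurable torus_measure" for k
        by (intro borel_measurable_times borel_measurable_const gm measurable_cnj_monom_pow)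
      show "norm (?F k \<xi>) \<le> B * norm (\<Prod>j\<in>UNIV. q j ^ (k $ j))" if "\<xi> \<in> space torus_measure" for k \<xi>
        using that g[of \<xi>] by (simp add: norm_mult norm_monom_pow_torus mult_right_mono)
      show "(\<lambda>k :: nat ^ 'n. B * norm (\<Prod>j\<in>UNIV. q j ^ (k $ j))) summable_on UNIV"
        using q by (intro summable_on_cmult_right has_sum_geometric_vec(1))
      show "((\<lambda>k. ?F k \<xi>) has_sum f (\<chi> j. of_real r * \<xi> $ j) * (\<Prod>j\<in>UNIV. of_real r * \<xi> $ j / (of_real r * \<xi> $ j - z $ j))) UNIV"
        if "\<xi> \<in> space torus_measure" for \<xi>
      proof -
        have \<xi>: "norm (\<xi> $ j) = 1" for j using that by (simp add: unit_torus_def)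
        then have one: "\<xi> $ j * cnj (\<xi> $ j) = 1" for j using complex_norm_square[of "\<xi> $ j"] by simp
        have eq: "1 / (1 - q j * cnj (\<xi> $ j)) = of_real r * \<xi> $ j / (of_real r * \<xi> $ j - z $ j)" for j
        proof -
          have "of_real r * \<xi> $ j * (1 - q j * cnj (\<xi> $ j)) = of_real r * \<xi> $ j - of_real r * q j * (\<xi> $ j * cnj (\<xi> $ j))"
            by (simp add: algebra_simps)
          also have "\<dots> = of_real r * \<xi> $ j - z $ j"
            using r by (simp add: one q_def)
          finally have "of_real r * \<xi> $ j / (of_real r * \<xi> $ j - z $ j)
             = (of_real r * \<xi> $ j) / (of_real r * \<xi> $ j * (1 - q j * cnj (\<xi> $ j)))" by simp
          also have "\<dots> = 1 / (1 - q j * cnj (\<xi> $ j))"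
            using r \<xi>[of j] by (intro nonzero_divide_mult_cancel_left) auto
          finally show ?thesis ..
        qed
        have "((\<lambda>k :: nat ^ 'n. \<Prod>j\<in>UNIV. (q j * cnj (\<xi> $ j)) ^ (k $ j)) has_sum (\<Prod>j\<in>UNIV. 1 / (1 - q j * cnj (\<xi> $ j)))) UNIV"
          by (rule has_sum_geometric_vec) (use q \<xi> in \<open>simp add: norm_mult\<close>)
        then show ?thesis
          unfolding eq by (intro has_sum_cmult_right) (simp add: power_mult_distrib prod.distrib monom_pow_def)
      qed
    qed
    also have "(\<lambda>k. \<integral>\<xi>. ?F k \<xi> \<partial>torus_measure) = (\<lambda>k. c r k * monom_pow z k)"
    proof
      fix k
      have "(\<integral>\<xi>. ?F k \<xi> \<partial>torus_measure)
        = (\<integral>\<xi>. (\<Prod>j\<in>UNIV. q j ^ (k $ j)) * (f (\<chi> j. of_real r * \<xi> $ j) * cnj (monom_pow \<xi> k)) \<partial>torus_measure)"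
        by (simp add: mult_ac)
      also have "\<dots> = (\<Prod>j\<in>UNIV. q j ^ (k $ j)) * (\<integral>\<xi>. f (\<chi> j. of_real r * \<xi> $ j) * cnj (monom_pow \<xi> k) \<partial>torus_measure)"
        by (rule integral_mult_right_zero)
      finally have e: "(\<integral>\<xi>. ?F k \<xi> \<partial>torus_measure)
          = (\<Prod>j\<in>UNIV. q j ^ (k $ j)) * (\<integral>\<xi>. f (\<chi> j. of_real r * \<xi> $ j) * cnj (monom_pow \<xi> k) \<partial>torus_measure)" .
      have q': "(\<Prod>j\<in>UNIV. q j ^ (k $ j)) = monom_pow z k / of_real r ^ (\<Sum>j\<in>UNIV. k $ j)"
        by (simp add: q_def monom_pow_def power_divide prod_dividef power_sum)
      show "(\<integral>\<xi>. ?F k \<xi> \<partial>torus_measure) = c r k * monom_pow z k"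
        by (subst e, subst q') (simp add: c_def)
    qed
    also have "(\<integral>\<xi>. f (\<chi> j. of_real r * \<xi> $ j) * (\<Prod>j\<in>UNIV. of_real r * \<xi> $ j / (of_real r * \<xi> $ j - z $ j)) \<partial>torus_measure) = f z"
      by (rule Cauchy_torus[OF f r z])
    finally show ?thesis .
  qed
  \<comment> \<open>The torus of radius 1/4 lies inside the polydisc of radius \<open>r\<close> for
    every r at least 1/2, so all these expansions represent f on it and must have the same Fourier
    coefficients there.\<close>
  have c_eq: "c r l * of_real (1 / 4) ^ (\<Sum>j\<in>UNIV. l $ j) = (\<integral>\<xi>. f (\<chi> j. of_real (1 / 4) * \<xi> $ j) * cnj (monom_pow \<xi> l) \<partial>torus_measure)"
    if r: "1 / 2 \<le> r" "r < 1" for r l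
  proof (rule torus_coefficient[symmetric])
    have mono: "monom_pow (\<chi> j. of_real (1 / 4) * \<xi> $ j) k = of_real (1 / 4) ^ (\<Sum>j\<in>UNIV. k $ j) * monom_pow \<xi> k" for \<xi> and k :: "nat ^ 'n"
      unfolding monom_pow_def by (simp only: vec_lambda_beta power_mult_distrib prod.distrib power_sum)
    have hs: "((\<lambda>k. c r k * of_real (1 / 4) ^ (\<Sum>j\<in>UNIV. k $ j) * monom_pow \<xi> k) has_sum f (\<chi> j. of_real (1 / 4) * \<xi> $ j)) UNIV"
      if "\<xi> \<in> unit_torus" for \<xi>
      using expand[of r "\<chi> j. of_real (1 / 4) * \<xi> $ j"] r that unfolding mono
      by (simp add: unit_torus_def norm_mult norm_divide mult.assoc)
    show "((\<lambda>k. c r k * of_real (1 / 4) ^ (\<Sum>j\<in>UNIV. k $ j) * monom_pow \<xi> k) has_sum f (\<chi> j. of_real (1 / 4) * \<xi> $ j)) UNIV"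
      if "\<xi> \<in> unit_torus" for \<xi> using hs[OF that] .
    have "(\<lambda>k. c r k * of_real (1 / 4) ^ (\<Sum>j\<in>UNIV. k $ j) * monom_pow (\<chi> j. 1) k) summable_on UNIV"
      using hs[of "\<chi> j. 1"] by (simp add: unit_torus_def has_sum_imp_summable)
    then show "(\<lambda>k. norm (c r k * of_real (1 / 4) ^ (\<Sum>j\<in>UNIV. k $ j))) summable_on UNIV"
      unfolding monom_pow_def by (simp flip: summable_on_iff_abs_summable_on_complex)
  qed
  have c_indep: "c r = c (1 / 2)" if "1 / 2 \<le> r" "r < 1" for r
  proof
    fix l
    have "c r l * of_real (1 / 4) ^ (\<Sum>j\<in>UNIV. l $ j) = c (1 / 2) l * of_real (1 / 4) ^ (\<Sum>j\<in>UNIV. l $ j)"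
      using c_eq[OF that, of l] c_eq[of "1 / 2" l] by simp
    then show "c r l = c (1 / 2) l" by simp
  qed
  have "has_power_series f (c (1 / 2))"
    unfolding has_power_series_def
  proof
    fix z :: "complex ^ 'n" assume "z \<in> polydisc"
    then obtain r where r: "0 < r" "r < 1" "\<And>j. norm (z $ j) < r" using polydisc_radius by blast
    have z': "norm (z $ j) < max r (1 / 2)" for j using r(3)[of j] by simp
    have "((\<lambda>k. c (max r (1 / 2)) k * monom_pow z k) has_sum f z) UNIV"
      using r by (intro expand z') auto
    also have "c (max r (1 / 2)) = c (1 / 2)"
      using r by (intro c_indep) auto
    finally show "((\<lambda>k. c (1 / 2) k * monom_pow z k) has_sum f z) UNIV" .
  qed
  then show ?thesis using power_coeffs_eqI by metis
qed

text \<open>The induction of \<open>Cauchy_torus\<close> again, with \<open>A\<close> the set of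
  coordinates already moved from radius \<open>r\<close> to radius \<open>R\<close>. The slice
  function includes the rotation by \<open>\<xi> $ j\<close>, which brings the evaluation point to
  the real axis.\<close>

lemma Poisson_torus_le:
  fixes f :: "complex ^ 'n \<Rightarrow> complex"
  assumes f: "f \<in> hol_polydisc" and \<kappa>: "0 < \<kappa>"
    and R: "\<And>j. 0 \<le> r $ j" "\<And>j. r $ j < R $ j" "\<And>j. R $ j < 1" and \<xi>: "\<xi> \<in> unit_torus"
  shows "ennreal (norm (f (scale_vec r \<xi>)) powr \<kappa>)
    \<le> (\<integral>\<^sup>+\<eta>. (\<Prod>j\<in>UNIV. ennreal (poisson (r $ j) (R $ j) (\<eta> $ j))) * ennreal (norm (f (scale_vec R (\<eta> * \<xi>))) powr \<kappa>) \<partial>torus_measure)"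
proof -
  define w where "w A \<eta> = (\<chi> j. if j \<in> A then of_real (R $ j) * (\<eta> $ j * \<xi> $ j) else of_real (r $ j) * \<xi> $ j)" for A and \<eta> :: "complex ^ 'n"
  define C where "C A \<eta> = (\<Prod>j\<in>A. ennreal (poisson (r $ j) (R $ j) (\<eta> $ j)))" for A and \<eta> :: "complex ^ 'n"
  have r1: "r $ j < 1" "0 \<le> R $ j" for j using R[of j] by linarith+
  have \<xi>1: "norm (\<xi> $ j) = 1" for j using \<xi> by (simp add: unit_torus_def)
  have wp: "w A \<eta> \<in> polydisc" if "\<eta> \<in> unit_torus" for A \<eta>
    using that R r1 by (simp add: polydisc_def w_def unit_torus_def norm_mult \<xi>1)
  have wm: "w A \<in> borel_measurable torus_measure" for A
  proof -
    have "(\<lambda>\<eta>. if j \<in> A then of_real (R $ j) * (\<eta> $ j * \<xi> $ j) else of_real (r $ j) * \<xi> $ j) \<in> borel_measurable torus_measure" for j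
      by (cases "j \<in> A") simp_all
    then show ?thesis unfolding w_def by (rule measurable_vec_lambda_borel)
  qed
  have fm [measurable]: "(\<lambda>\<eta>. f (w A \<eta>)) \<in> borel_measurable torus_measure" for A
    using wp by (intro measurable_hol_polydisc[OF f wm]) simp
  have Cm [measurable]: "C A \<in> borel_measurable torus_measure" for A
    unfolding C_def by measurable
  have "ennreal (norm (f (scale_vec r \<xi>)) powr \<kappa>) \<le> (\<integral>\<^sup>+\<eta>. C A \<eta> * ennreal (norm (f (w A \<eta>)) powr \<kappa>) \<partial>torus_measure)"
    if "finite A" for A
    using that
  proof (induction A rule: finite_induct)
    case empty
    have "w {} \<eta> = scale_vec r \<xi>" for \<eta> by (simp add: w_def scale_vec_def)
    then show ?case by (simp add: C_def)
  next
    case (insert j A)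
    let ?u = "\<lambda>\<eta> u. (\<chi> i. if i = j then u else \<eta> $ i) :: complex ^ 'n"
    note insert.IH
    also have "(\<integral>\<^sup>+\<eta>. C A \<eta> * ennreal (norm (f (w A \<eta>)) powr \<kappa>) \<partial>torus_measure)
      \<le> (\<integral>\<^sup>+\<eta>. \<integral>\<^sup>+u. C (insert j A) (?u \<eta> u) * ennreal (norm (f (w (insert j A) (?u \<eta> u))) powr \<kappa>) \<partial>circle_measure \<partial>torus_measure)"
    proof (rule nn_integral_mono)
      fix \<eta> :: "complex ^ 'n" assume "\<eta> \<in> space torus_measure"
      then have \<eta>: "\<eta> \<in> unit_torus" by simp
      define g where "g x = f (\<chi> i. if i = j then x * \<xi> $ j else w A \<eta> $ i)" for x
      have w: "w (insert j A) (?u \<eta> u) = (\<chi> i. if i = j then (of_real (R $ j) * u) * \<xi> $ j else w A \<eta> $ i)" for u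
        using insert.hyps by (auto simp: w_def vec_eq_iff)
      have C: "C (insert j A) (?u \<eta> u) = C A \<eta> * ennreal (poisson (r $ j) (R $ j) u)" for u
      proof -
        have "C A (?u \<eta> u) = C A \<eta>"
          unfolding C_def using insert.hyps by (intro prod.cong) auto
        then show ?thesis
          using insert.hyps by (simp add: C_def mult.commute)
      qed
      have "g holomorphic_on ball 0 1"
      proof -
        have "(\<lambda>x. f (\<chi> i. if i = j then x else w A \<eta> $ i)) holomorphic_on ball 0 1"
          by (rule hol_polydisc_holomorphic[OF f wp[OF \<eta>]])
        moreover have "(\<lambda>x. x * \<xi> $ j) holomorphic_on ball 0 1" by (intro holomorphic_intros)
        moreover have "(\<lambda>x. x * \<xi> $ j) ` ball 0 1 \<subseteq> ball 0 1" by (auto simp: norm_mult \<xi>1)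
        ultimately show ?thesis unfolding g_def
          using holomorphic_on_compose_gen[of "\<lambda>x. x * \<xi> $ j" "ball 0 1" "\<lambda>x. f (\<chi> i. if i = j then x else w A \<eta> $ i)" "ball 0 1"]
          by (simp add: comp_def)
      qed
      then have "ennreal (norm (g (of_real (r $ j))) powr \<kappa>)
          \<le> (\<integral>\<^sup>+u. ennreal (poisson (r $ j) (R $ j) u) * ennreal (norm (g (of_real (R $ j) * u)) powr \<kappa>) \<partial>circle_measure)"
        by (rule Poisson_holomorphic_le[OF _ \<kappa> R(1-3)])
      moreover have "g (of_real (r $ j)) = f (w A \<eta>)"
        using insert.hyps unfolding g_def by (intro arg_cong[of _ _ f]) (auto simp: vec_eq_iff w_def)
      ultimately have "C A \<eta> * ennreal (norm (f (w A \<eta>)) powr \<kappa>) \<le> C A \<eta> *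
           (\<integral>\<^sup>+u. ennreal (poisson (r $ j) (R $ j) u) * ennreal (norm (g (of_real (R $ j) * u)) powr \<kappa>) \<partial>circle_measure)"
        by (simp add: mult_left_mono)
      also have "\<dots> = (\<integral>\<^sup>+u. C A \<eta> * (ennreal (poisson (r $ j) (R $ j) u) * ennreal (norm (g (of_real (R $ j) * u)) powr \<kappa>)) \<partial>circle_measure)"
      proof (rule nn_integral_cmult[symmetric])
        have "continuous_on (sphere 0 1) (\<lambda>u. g (of_real (R $ j) * u))"
          using R(3)[of j] r1(2)[of j] \<open>g holomorphic_on ball 0 1\<close>
          by (intro continuous_on_compose2[OF holomorphic_on_imp_continuous_on[of g "ball 0 1"]] continuous_intros) (auto simp: norm_mult)
        then have [measurable]: "(\<lambda>u. g (of_real (R $ j) * u)) \<in> borel_measurable circle_measure"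
          by (rule borel_measurable_circle_continuous)
        show "(\<lambda>u. ennreal (poisson (r $ j) (R $ j) u) * ennreal (norm (g (of_real (R $ j) * u)) powr \<kappa>)) \<in> borel_measurable circle_measure"
          by measurable
      qed
      also have "\<dots> = (\<integral>\<^sup>+u. C (insert j A) (?u \<eta> u) * ennreal (norm (f (w (insert j A) (?u \<eta> u))) powr \<kappa>) \<partial>circle_measure)"
        unfolding w C g_def by (simp add: mult.assoc)
      finally show "C A \<eta> * ennreal (norm (f (w A \<eta>)) powr \<kappa>)
        \<le> (\<integral>\<^sup>+u. C (insert j A) (?u \<eta> u) * ennreal (norm (f (w (insert j A) (?u \<eta> u))) powr \<kappa>) \<partial>circle_measure)" .
    qed
    also have "\<dots> = (\<integral>\<^sup>+\<eta>. C (insert j A) \<eta> * ennreal (norm (f (w (insert j A) \<eta>)) powr \<kappa>) \<partial>torus_measure)"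
      by (rule nn_integral_torus_resample[symmetric]) measurable
    finally show ?case .
  qed
  from this[of UNIV] show ?thesis by (simp add: w_def C_def scale_vec_def)
qed

section \<open>Power means over tori: monotonicity in the radius and pointwise bounds\<close>

definition power_mean :: "real \<Rightarrow> (complex ^ 'n \<Rightarrow> complex) \<Rightarrow> real ^ 'n \<Rightarrow> ennreal" where
  "power_mean \<kappa> f R = (\<integral>\<^sup>+\<xi>. ennreal (norm (f (scale_vec R \<xi>)) powr \<kappa>) \<partial>torus_measure)"

lemma measurable_unit_torus_rotate:
  "\<xi> \<in> unit_torus \<Longrightarrow> (\<lambda>\<eta>. \<eta> * \<xi>) \<in> torus_measure \<rightarrow>\<^sub>M torus_measure"
  by (intro measurable_torus_mult measurable_const measurable_ident_sets) simp_all

lemma measurable_hol_fixed [measurable]: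
  assumes "f \<in> hol_polydisc" "R \<in> unit_cube"
  shows "(\<lambda>\<xi>. f (scale_vec R \<xi>)) \<in> borel_measurable torus_measure"
  by (rule measurable_hol_scale_vec[OF assms(1)]) (use assms(2) in \<open>auto intro: measurable_ident_sets\<close>)

lemma measurable_hol_fixed2 [measurable]:
  assumes "f \<in> hol_polydisc" "R \<in> unit_cube"
  shows "(\<lambda>(\<xi>, \<eta>). f (scale_vec R (\<eta> * \<xi>))) \<in> borel_measurable (torus_measure \<Otimes>\<^sub>M torus_measure)"
  unfolding split_beta'
  by (rule measurable_hol_scale_vec[OF assms(1)]) (use assms(2) in auto)

lemma measurable_hol_cube_torus [measurable]:
  assumes "f \<in> hol_polydisc"
  shows "(\<lambda>(R, \<xi>). f (scale_vec R \<xi>)) \<in> borel_measurable (cube_measure \<Otimes>\<^sub>M torus_measure)"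
  unfolding split_beta'
  by (rule measurable_hol_scale_vec[OF assms(1)]) auto

lemma power_mean_rotate:
  assumes "f \<in> hol_polydisc" "R \<in> unit_cube" "\<eta> \<in> unit_torus"
  shows "(\<integral>\<^sup>+\<xi>. ennreal (norm (f (scale_vec R (\<eta> * \<xi>))) powr \<kappa>) \<partial>torus_measure) = power_mean \<kappa> f R"
  unfolding power_mean_def
  by (rule nn_integral_torus_rotate[OF assms(3)]) (use assms in measurable)

text \<open>Integrate the Poisson inequality over \<xi> first: by rotation invariance the inner
  integral no longer depends on \<eta>, and the remaining Poisson kernels have mass 1. The kernels
  require the strict inequality between the radii.\<close>

lemma power_mean_mono:
  fixes f :: "complex ^ 'n \<Rightarrow> complex"
  assumes f: "f \<in> hol_polydisc" and \<kappa>: "0 < \<kappa>"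
    and R: "\<And>j. 0 \<le> r $ j" "\<And>j. r $ j < R $ j" "\<And>j. R $ j < 1"
  shows "power_mean \<kappa> f r \<le> power_mean \<kappa> f R"
proof -
  have "0 \<le> R $ j" for j using R(1)[of j] R(2)[of j] by linarith
  then have RI: "R \<in> unit_cube" using R(3) by (simp add: unit_cube_def)
  interpret pair_sigma_finite "torus_measure :: (complex ^ 'n) measure" "torus_measure :: (complex ^ 'n) measure" ..
  have [measurable]: "(\<lambda>(\<xi>, \<eta>). f (scale_vec R (\<eta> * \<xi>))) \<in> borel_measurable (torus_measure \<Otimes>\<^sub>M torus_measure)"
    by (rule measurable_hol_fixed2[OF f RI])
  let ?P = "\<lambda>\<eta> :: complex ^ 'n. \<Prod>j\<in>UNIV. ennreal (poisson (r $ j) (R $ j) (\<eta> $ j))"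
  let ?K = "\<lambda>\<xi> \<eta>. ennreal (norm (f (scale_vec R (\<eta> * \<xi>))) powr \<kappa>)"
  have "power_mean \<kappa> f r \<le> (\<integral>\<^sup>+\<xi>. \<integral>\<^sup>+\<eta>. ?P \<eta> * ?K \<xi> \<eta> \<partial>torus_measure \<partial>torus_measure)"
    unfolding power_mean_def by (intro nn_integral_mono Poisson_torus_le f \<kappa> R) simp
  also have "\<dots> = (\<integral>\<^sup>+\<eta>. \<integral>\<^sup>+\<xi>. ?P \<eta> * ?K \<xi> \<eta> \<partial>torus_measure \<partial>torus_measure)"
    by (intro Fubini'[symmetric]) measurable
  also have "\<dots> = (\<integral>\<^sup>+\<eta>. ?P \<eta> * power_mean \<kappa> f R \<partial>torus_measure)"
  proof (rule nn_integral_cong)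
    fix \<eta> :: "complex ^ 'n" assume \<eta>: "\<eta> \<in> space torus_measure"
    have "(\<lambda>\<xi>. f (scale_vec R (\<eta> * \<xi>))) \<in> borel_measurable torus_measure"
      using measurable_compose[OF measurable_Pair2'[OF \<eta>] measurable_hol_fixed2[OF f RI]]
        measurable_hol_scale_vec[OF f, of "\<lambda>_. R" torus_measure "\<lambda>\<xi>. \<eta> * \<xi>"] RI \<eta> measurable_unit_torus_rotate[of \<eta>]
      by (simp add: mult.commute)
    note [measurable] = this
    have "(\<integral>\<^sup>+\<xi>. ?P \<eta> * ?K \<xi> \<eta> \<partial>torus_measure) = ?P \<eta> * (\<integral>\<^sup>+\<xi>. ?K \<xi> \<eta> \<partial>torus_measure)"
      by (intro nn_integral_cmult) measurable
    then show "(\<integral>\<^sup>+\<xi>. ?P \<eta> * ?K \<xi> \<eta> \<partial>torus_measure) = ?P \<eta> * power_mean \<kappa> f R"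
      using power_mean_rotate[OF f RI, of \<eta> \<kappa>] \<eta> by simp
  qed
  also have "\<dots> = (\<integral>\<^sup>+\<eta>. ?P \<eta> \<partial>torus_measure) * power_mean \<kappa> f R"
    by (rule nn_integral_multc) measurable
  also have "(\<integral>\<^sup>+\<eta>. ?P \<eta> \<partial>torus_measure) = (\<Prod>j\<in>UNIV. \<integral>\<^sup>+u. ennreal (poisson (r $ j) (R $ j) u) \<partial>circle_measure)"
    by (rule nn_integral_torus_prod[of "\<lambda>j u. ennreal (poisson (r $ j) (R $ j) u)"]) measurable
  also have "\<dots> = 1"
    using R by (simp add: nn_integral_poisson)
  finally show ?thesis by simp
qed

lemma radial_weight_nonneg [simp]: "0 \<le> radial_weight R a"
  by (simp add: radial_weight_def prod_nonneg)

lemma radial_weight_add: "radial_weight R (a + b) = radial_weight R a * radial_weight R b"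
  by (simp add: radial_weight_def powr_add prod.distrib)

lemma radial_weight_powr:
  shows "radial_weight R a powr b = radial_weight R (a * b)"
proof -
  have "(\<Prod>j\<in>A. (1 - R $ j) powr a) powr b = (\<Prod>j\<in>A. (1 - R $ j) powr (a * b))" if "finite A" for A
    using that by (induction A rule: finite_induct) (auto simp: powr_mult powr_powr prod_nonneg)
  then show ?thesis by (simp add: radial_weight_def)
qed

lemma ennpowr_radial_weight: "ennpowr (ennreal (radial_weight R a)) b = ennreal (radial_weight R (a * b))"
  by (simp add: ennpowr_ennreal radial_weight_powr)

lemma ennreal_radial_weight_add:
  "ennreal (radial_weight R (a + b)) = ennreal (radial_weight R a) * ennreal (radial_weight R b)"
  by (simp add: radial_weight_add ennreal_mult)

lemma measurable_radial_weight [measurable]: "(\<lambda>R. radial_weight R a) \<in> borel_measurable cube_measure"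
  unfolding radial_weight_def by measurable

text \<open>Each Poisson factor is replaced by its maximum 4/(1 - r_j), after which the integral is
  the mean itself.\<close>

lemma pointwise_le_power_mean:
  fixes f :: "complex ^ 'n \<Rightarrow> complex"
  assumes f: "f \<in> hol_polydisc" and \<kappa>: "0 < \<kappa>" and r: "r \<in> unit_cube" and R: "R \<in> unit_cube"
    and rR: "\<And>j. (1 + r $ j) / 2 \<le> R $ j" and \<xi>: "\<xi> \<in> unit_torus"
  shows "ennreal (norm (f (scale_vec r \<xi>)) powr \<kappa>) * ennreal (radial_weight r 1) \<le> 4 ^ CARD('n) * power_mean \<kappa> f R"
proof -
  have r': "0 \<le> r $ j" "r $ j < 1" "R $ j < 1" for j
    using r R by (simp_all add: unit_cube_def)
  have rR': "r $ j < R $ j" for j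
    using r'(2)[of j] rR[of j] by (simp add: field_simps)
  have "ennreal (norm (f (scale_vec r \<xi>)) powr \<kappa>)
     \<le> (\<integral>\<^sup>+\<eta>. (\<Prod>j\<in>UNIV. ennreal (poisson (r $ j) (R $ j) (\<eta> $ j))) * ennreal (norm (f (scale_vec R (\<eta> * \<xi>))) powr \<kappa>) \<partial>torus_measure)"
    by (rule Poisson_torus_le[OF f \<kappa> _ _ _ \<xi>]) (use r' rR' in auto)
  also have "\<dots> \<le> (\<integral>\<^sup>+\<eta>. (\<Prod>j\<in>UNIV. ennreal (4 / (1 - r $ j))) * ennreal (norm (f (scale_vec R (\<eta> * \<xi>))) powr \<kappa>) \<partial>torus_measure)"
    by (intro nn_integral_mono mult_right_mono prod_mono_ennreal ennreal_leI poisson_le)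
       (use r' rR in \<open>auto simp: unit_torus_def\<close>)
  also have "\<dots> = (\<Prod>j\<in>UNIV. ennreal (4 / (1 - r $ j))) * power_mean \<kappa> f R"
    using power_mean_rotate[OF f R \<xi>] measurable_hol_fixed[OF f R]
      measurable_compose[OF measurable_unit_torus_rotate[OF \<xi>] measurable_hol_fixed[OF f R]]
    by (subst nn_integral_cmult) (auto simp: mult.commute)
  finally have "ennreal (norm (f (scale_vec r \<xi>)) powr \<kappa>) * ennreal (radial_weight r 1)
     \<le> (\<Prod>j\<in>UNIV. ennreal (4 / (1 - r $ j))) * power_mean \<kappa> f R * ennreal (radial_weight r 1)"
    by (rule mult_right_mono) simp
  also have "\<dots> = (\<Prod>j\<in>UNIV. ennreal (4 / (1 - r $ j)) * ennreal (1 - r $ j)) * power_mean \<kappa> f R"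
    using r' by (simp add: radial_weight_def prod.distrib prod_ennreal[symmetric] less_imp_le mult_ac)
  also have "(\<Prod>j\<in>UNIV. ennreal (4 / (1 - r $ j)) * ennreal (1 - r $ j)) = 4 ^ CARD('n)"
  proof -
    have "ennreal (4 / (1 - r $ j)) * ennreal (1 - r $ j) = ennreal (4 / (1 - r $ j) * (1 - r $ j))" for j
      using r'(2)[of j] by (intro ennreal_mult[symmetric]) auto
    moreover have "4 / (1 - r $ j) * (1 - r $ j) = 4" for j
      using r'(2)[of j] by (simp add: field_simps)
    ultimately show ?thesis by simp
  qed
  finally show ?thesis .
qed

declare measurable_circle_ident [measurable del] measurable_unit_interval_ident [measurable del]

lemma measurable_unit_intervalI: "f \<in> borel_measurable borel \<Longrightarrow> f \<in> borel_measurable unit_interval_measure"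
  using measurable_compose[OF measurable_unit_interval_ident] .

lemma measurable_circle_borelI: "f \<in> borel_measurable borel \<Longrightarrow> f \<in> borel_measurable circle_measure"
  using measurable_compose[OF measurable_circle_ident] .

section \<open>Kernel estimates\<close>

lemma nn_integral_unit_interval:
  "(\<integral>\<^sup>+x. h x \<partial>unit_interval_measure) = (\<integral>\<^sup>+x. h x * indicator {0..<1} x \<partial>lborel)"
  unfolding unit_interval_measure_def by (rule nn_integral_restrict_space) simp

lemma nn_integral_unit_interval_flip:
  assumes [measurable]: "h \<in> borel_measurable borel"
  shows "(\<integral>\<^sup>+x. h (1 - x) \<partial>unit_interval_measure) = (\<integral>\<^sup>+y. h y * indicator {0<..1} y \<partial>lborel)"
proof -
  have "(\<integral>\<^sup>+y. h y * indicator {0<..1} y \<partial>lborel) = ennreal \<bar>- 1\<bar> * (\<integral>\<^sup>+x. h (1 + - 1 * x) * indicator {0<..1} (1 + - 1 * x) \<partial>lborel)"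
    by (rule nn_integral_real_affine) auto
  also have "\<dots> = (\<integral>\<^sup>+x. h (1 - x) * indicator {0..<1} x \<partial>lborel)"
    by (auto intro!: nn_integral_cong simp: indicator_def)
  finally show ?thesis by (simp add: nn_integral_unit_interval)
qed

lemma nn_integral_unit_interval_tail:
  assumes "0 < e" "0 \<le> a" "a < 1"
  shows "(\<integral>\<^sup>+x. ennreal ((1 - x) powr (e - 1)) * indicator {a..} x \<partial>unit_interval_measure) = ennreal ((1 - a) powr e / e)"
proof -
  have "(\<integral>\<^sup>+x. ennreal ((1 - x) powr (e - 1)) * indicator {a..} x \<partial>unit_interval_measure)
     = (\<integral>\<^sup>+x. ennreal ((1 - x) powr (e - 1)) * indicator {..1 - a} (1 - x) \<partial>unit_interval_measure)"
    by (intro nn_integral_cong) (auto simp: indicator_def)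
  also have "\<dots> = (\<integral>\<^sup>+y. ennreal (y powr (e - 1)) * indicator {..1 - a} y * indicator {0<..1} y \<partial>lborel)"
    by (rule nn_integral_unit_interval_flip) simp
  also have "\<dots> = (\<integral>\<^sup>+y. ennreal (indicator {0..1 - a} y * y powr (e - 1)) \<partial>lborel)"
    using assms by (intro nn_integral_cong) (auto simp: indicator_def)
  also have "\<dots> = ennreal ((1 - a) powr (e - 1 + 1) / (e - 1 + 1))"
    by (intro nn_integral_has_integral_lebesgue has_integral_powr_from_0) (use assms in auto)
  finally show ?thesis by simp
qed

text \<open>The last two bounds together say that |1 - aRu| is at least the maximum of |1 - au|/2
  and 1 - R, which is the shape treated by \<open>nn_integral_powr_max_le\<close>.\<close>

lemma kernel_lower:
  assumes "0 \<le> a" "a \<le> 1" "0 \<le> R" "R \<le> 1" "norm (u :: complex) = 1"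
  shows "1 - a \<le> norm (1 - of_real a * u)" "norm (1 - of_real a * u) \<le> 2 * norm (1 - of_real (a * R) * u)"
    "1 - R \<le> norm (1 - of_real (a * R) * u)"
proof -
  have *: "1 - x \<le> norm (1 - of_real x * u)" if "0 \<le> x" for x
    using norm_triangle_ineq2[of 1 "of_real x * u"] that assms by (simp add: norm_mult)
  show "1 - a \<le> norm (1 - of_real a * u)" using * assms by simp
  have aR: "a * R \<le> R" using assms by (simp add: mult_left_le_one_le)
  then have 1: "1 - R \<le> 1 - a * R" by simp
  also have "\<dots> \<le> norm (1 - of_real (a * R) * u)" using assms by (intro *) simp
  finally show 2: "1 - R \<le> norm (1 - of_real (a * R) * u)" .
  have "norm (1 - of_real a * u) \<le> norm (1 - of_real (a * R) * u) + norm (of_real (a - a * R) * u)"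
    using norm_triangle_ineq4[of "1 - of_real (a * R) * u" "of_real (a - a * R) * u"] by (simp add: algebra_simps)
  also have "norm (of_real (a - a * R) * u) = a * (1 - R)"
  proof -
    have "0 \<le> a * (1 - R)" using assms by simp
    then have "norm (of_real (a * (1 - R)) * u) = a * (1 - R)" using assms by (simp add: norm_mult del: of_real_mult)
    then show ?thesis by (simp add: algebra_simps)
  qed
  also have "\<dots> \<le> 1 - R" using assms by (simp add: mult_left_le_one_le)
  also note 2
  finally show "norm (1 - of_real a * u) \<le> 2 * norm (1 - of_real (a * R) * u)" by simp
qed

text \<open>By \<open>kernel_lower\<close> the integrand is dominated by a power of 1 - R times a
  power of max(\<delta>, 1 - R) with \<delta> = |1 - au|/2. The halving in \<delta> accounts for the
  factor 2^(c-b).\<close>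

lemma nn_integral_radial_kernel_le:
  assumes bc: "0 < b" "b < c" and a: "0 \<le> a" "a < 1" and u: "norm (u :: complex) = 1"
  shows "(\<integral>\<^sup>+R. ennreal ((1 - R) powr (b - 1) * norm (1 - of_real (a * R) * u) powr (- c)) \<partial>unit_interval_measure)
    \<le> ennreal ((1 / b + 1 / (c - b)) * 2 powr (c - b) * norm (1 - of_real a * u) powr (b - c))"
proof -
  define \<delta> where "\<delta> = norm (1 - of_real a * u) / 2"
  have "0 < 1 - a" using a by simp
  also have "1 - a \<le> norm (1 - of_real a * u)" using kernel_lower(1)[of a 0 u] a u by simp
  finally have \<delta>: "0 < \<delta>" unfolding \<delta>_def by (rule half_gt_zero)
  have "(\<integral>\<^sup>+R. ennreal ((1 - R) powr (b - 1) * norm (1 - of_real (a * R) * u) powr (- c)) \<partial>unit_interval_measure)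
     \<le> (\<integral>\<^sup>+R. ennreal ((1 - R) powr (b - 1) * max \<delta> (1 - R) powr (- c)) \<partial>unit_interval_measure)"
  proof (intro nn_integral_mono ennreal_leI mult_left_mono powr_mono2')
    fix R assume "R \<in> space unit_interval_measure"
    then show "max \<delta> (1 - R) \<le> norm (1 - of_real (a * R) * u)"
      using kernel_lower[of a R u] a u by (auto simp: \<delta>_def)
  qed (use bc \<delta> in auto)
  also have "\<dots> = (\<integral>\<^sup>+y. ennreal (y powr (b - 1) * max \<delta> y powr (- c)) * indicator {0<..1} y \<partial>lborel)"
    by (rule nn_integral_unit_interval_flip) measurable
  also have "\<dots> \<le> (\<integral>\<^sup>+y. ennreal (y powr (b - 1) * max \<delta> y powr (- c)) * indicator {0..} y \<partial>lborel)"
    by (intro nn_integral_mono) (auto simp: indicator_def)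
  also have "\<dots> \<le> ennreal ((1 / b + 1 / (c - b)) * \<delta> powr (b - c))"
    by (rule nn_integral_powr_max_le[OF bc \<delta>])
  also have "\<delta> powr (b - c) = 2 powr (c - b) * norm (1 - of_real a * u) powr (b - c)"
    using powr_minus_divide[of 2 "c - b"] by (simp add: \<delta>_def powr_divide)
  finally show ?thesis by (simp add: mult.assoc)
qed

lemma sin_ge_linear:
  assumes "0 \<le> x" "x \<le> pi / 2"
  shows "2 * x / pi \<le> sin x"
proof -
  have "concave_on {0..pi / 2} sin"
  proof (rule f''_le0_imp_concave)
    show "DERIV sin x :> cos x" for x :: real by (rule DERIV_sin)
    show "DERIV cos x :> - sin x" for x :: real by (rule DERIV_cos)
    show "- sin x \<le> 0" if "x \<in> {0..pi / 2}" for x :: real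
      using sin_ge_zero[of x] that pi_gt_zero by auto
  qed simp
  from concave_onD_Icc'[OF this, of x] assms show ?thesis by simp
qed

text \<open>Jordan's inequality applied to |1 - cis \<theta>| = 2 sin(\<theta>/2) gives
  2\<theta>/pi. Shrinking the point 1 to the radius \<open>a\<close> costs a factor 2, by the second
  part of \<open>kernel_lower\<close> with its radii taken as 1 and \<open>a\<close>.\<close>

lemma kernel_cis_lower:
  assumes "0 \<le> a" "a \<le> 1" "0 \<le> \<theta>" "\<theta> \<le> pi"
  shows "\<theta> / pi \<le> norm (1 - of_real a * cis \<theta>)"
proof -
  have "(norm (1 - cis \<theta>))\<^sup>2 = (2 * sin (\<theta> / 2))\<^sup>2"
  proof -
    have "(norm (1 - cis \<theta>))\<^sup>2 = (1 - cos \<theta>)\<^sup>2 + (sin \<theta>)\<^sup>2"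
      by (simp add: cmod_power2)
    also have "\<dots> = 2 - 2 * cos \<theta>"
      using sin_cos_squared_add[of \<theta>] by (simp add: power2_eq_square algebra_simps)
    also have "cos \<theta> = 1 - 2 * (sin (\<theta> / 2))\<^sup>2"
      using cos_double_sin[of "\<theta> / 2"] by simp
    finally show ?thesis by (simp add: power2_eq_square)
  qed
  moreover have "0 \<le> 2 * sin (\<theta> / 2)"
    using assms sin_ge_zero[of "\<theta> / 2"] by simp
  ultimately have "norm (1 - cis \<theta>) = 2 * sin (\<theta> / 2)"
    using power2_eq_imp_eq norm_ge_zero by blast
  moreover have "2 * (\<theta> / 2) / pi \<le> sin (\<theta> / 2)"
    using assms by (intro sin_ge_linear) auto
  moreover have "norm (1 - of_real 1 * cis \<theta>) \<le> 2 * norm (1 - of_real (1 * a) * cis \<theta>)"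
    by (rule kernel_lower(2)) (use assms in auto)
  ultimately show ?thesis by simp
qed

lemma nn_integral_circle:
  assumes "K \<in> borel_measurable circle_measure"
  shows "(\<integral>\<^sup>+u. K u \<partial>circle_measure) = (\<integral>\<^sup>+\<theta>. K (cis \<theta>) * indicator {0..2 * pi} \<theta> \<partial>lborel) / ennreal (2 * pi)"
proof -
  have c: "cis \<in> uniform_measure lborel {0..2 * pi} \<rightarrow>\<^sub>M restrict_space borel (sphere 0 1)"
    using measurable_cis measurable_circle_cong by simp
  have K: "K \<in> borel_measurable (restrict_space borel (sphere 0 1))"
    using assms measurable_cong_sets[OF sets_circle_measure refl] by blast
  have "(\<lambda>\<theta>. K (cis \<theta>)) \<in> borel_measurable borel"
    using measurable_compose[OF measurable_cis assms] .
  then show ?thesis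
    unfolding circle_measure_def
    using K by (subst nn_integral_distr[OF c]) (simp_all add: nn_integral_uniform_measure)
qed

text \<open>On the upper half-circle |1 - a cis \<theta>| is at least max(1 - a, \<theta>)/pi, and
  the lower half is its mirror image. This leaves \<open>nn_integral_powr_max_le\<close> with
  \<open>b = 1\<close>, whence the condition c > 1.\<close>

lemma nn_integral_circle_kernel_le:
  assumes c: "1 < c" and a: "0 \<le> a" "a < 1"
  shows "(\<integral>\<^sup>+u. ennreal (norm (1 - of_real a * u) powr (- c)) \<partial>circle_measure)
    \<le> ennreal (pi powr (c - 1) * (1 + 1 / (c - 1)) * (1 - a) powr (1 - c))"
proof -
  define \<delta> where "\<delta> = 1 - a"
  have \<delta>: "0 < \<delta>" using a by (simp add: \<delta>_def)
  define h where "h x = pi powr c * max \<delta> x powr (- c)" for x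
  have h0: "0 \<le> h x" for x by (simp add: h_def)
  have [measurable]: "h \<in> borel_measurable borel" unfolding h_def by measurable
  have half: "norm (1 - of_real a * cis \<theta>) powr (- c) \<le> h \<theta>" if "0 \<le> \<theta>" "\<theta> \<le> pi" for \<theta>
  proof -
    have "max \<delta> \<theta> / pi \<le> norm (1 - of_real a * cis \<theta>)"
    proof (cases "\<theta> \<le> \<delta>")
      case True
      have "\<delta> / pi \<le> \<delta> / 1" using \<delta> pi_ge_two by (intro divide_left_mono) auto
      also have "\<dots> \<le> norm (1 - of_real a * cis \<theta>)" using kernel_lower(1)[of a 0 "cis \<theta>"] a by (simp add: \<delta>_def)
      finally show ?thesis using True by (simp add: max_def)
    next
      case False
      then show ?thesis using kernel_cis_lower[of a \<theta>] a that by (simp add: max_def)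
    qed
    then have "norm (1 - of_real a * cis \<theta>) powr (- c) \<le> (max \<delta> \<theta> / pi) powr (- c)"
      using c \<delta> pi_gt_zero by (intro powr_mono2') (auto simp: max_def)
    also have "\<dots> = h \<theta>" by (simp add: h_def powr_divide powr_minus field_simps)
    finally show ?thesis .
  qed
  have bound: "norm (1 - of_real a * cis \<theta>) powr (- c) \<le> h \<theta> + h (2 * pi - \<theta>)" if "0 \<le> \<theta>" "\<theta> \<le> 2 * pi" for \<theta>
  proof (cases "\<theta> \<le> pi")
    case True
    then show ?thesis using half[of \<theta>] that h0[of "2 * pi - \<theta>"] by linarith
  next
    case False
    have "cis (2 * pi - \<theta>) = cnj (cis \<theta>)" by (simp add: complex_eq_iff cos_diff sin_diff)
    then have "norm (1 - of_real a * cis (2 * pi - \<theta>)) = norm (cnj (1 - of_real a * cis \<theta>))" by simp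
    then have "norm (1 - of_real a * cis (2 * pi - \<theta>)) = norm (1 - of_real a * cis \<theta>)" by (simp only: complex_mod_cnj)
    then show ?thesis using half[of "2 * pi - \<theta>"] False that h0[of \<theta>] by simp
  qed
  have H: "(\<integral>\<^sup>+x. ennreal (h x) * indicator {0..} x \<partial>lborel) \<le> ennreal (pi powr c * ((1 + 1 / (c - 1)) * \<delta> powr (1 - c)))"
  proof -
    have "(\<integral>\<^sup>+x. ennreal (h x) * indicator {0..} x \<partial>lborel)
       \<le> (\<integral>\<^sup>+x. ennreal (pi powr c) * (ennreal (x powr (1 - 1) * max \<delta> x powr (- c)) * indicator {0..} x) \<partial>lborel)"
    \<comment> \<open>Only almost everywhere: \<open>x powr (1 - 1)\<close> is 0, not 1, at x =
      0.\<close>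
    proof (rule nn_integral_mono_AE)
      show "AE x in lborel. ennreal (h x) * indicator {0..} x \<le> ennreal (pi powr c) * (ennreal (x powr (1 - 1) * max \<delta> x powr (- c)) * indicator {0..} x)"
        using AE_lborel_singleton[of 0] by eventually_elim (auto simp: h_def indicator_def simp flip: ennreal_mult)
    qed
    also have "\<dots> = ennreal (pi powr c) * (\<integral>\<^sup>+x. ennreal (x powr (1 - 1) * max \<delta> x powr (- c)) * indicator {0..} x \<partial>lborel)"
      by (rule nn_integral_cmult) measurable
    also have "\<dots> \<le> ennreal (pi powr c) * ennreal ((1 / 1 + 1 / (c - 1)) * \<delta> powr (1 - c))"
      by (intro mult_left_mono nn_integral_powr_max_le) (use c \<delta> in auto)
    finally show ?thesis using c by (simp flip: ennreal_mult)
  qed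
  have "(\<integral>\<^sup>+\<theta>. ennreal (norm (1 - of_real a * cis \<theta>) powr (- c)) * indicator {0..2 * pi} \<theta> \<partial>lborel)
      \<le> (\<integral>\<^sup>+\<theta>. ennreal (h \<theta>) * indicator {0..} \<theta> + ennreal (h (2 * pi + - 1 * \<theta>)) * indicator {0..} (2 * pi + - 1 * \<theta>) \<partial>lborel)"
    using bound h0 by (intro nn_integral_mono) (auto simp: indicator_def simp flip: ennreal_plus intro!: ennreal_leI)
  also have "\<dots> = (\<integral>\<^sup>+\<theta>. ennreal (h \<theta>) * indicator {0..} \<theta> \<partial>lborel) + (\<integral>\<^sup>+\<theta>. ennreal (h (2 * pi + - 1 * \<theta>)) * indicator {0..} (2 * pi + - 1 * \<theta>) \<partial>lborel)"
    by (rule nn_integral_add) measurable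
  also have "(\<integral>\<^sup>+\<theta>. ennreal (h (2 * pi + - 1 * \<theta>)) * indicator {0..} (2 * pi + - 1 * \<theta>) \<partial>lborel) = (\<integral>\<^sup>+\<theta>. ennreal (h \<theta>) * indicator {0..} \<theta> \<partial>lborel)"
    using nn_integral_real_affine[of "\<lambda>\<theta>. ennreal (h \<theta>) * indicator {0..} \<theta>" "- 1" "2 * pi"] by simp
  also have "(\<integral>\<^sup>+\<theta>. ennreal (h \<theta>) * indicator {0..} \<theta> \<partial>lborel) + (\<integral>\<^sup>+\<theta>. ennreal (h \<theta>) * indicator {0..} \<theta> \<partial>lborel)
     \<le> ennreal (pi powr c * ((1 + 1 / (c - 1)) * \<delta> powr (1 - c))) + ennreal (pi powr c * ((1 + 1 / (c - 1)) * \<delta> powr (1 - c)))"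
    by (intro add_mono H)
  also have "\<dots> = ennreal (pi powr (c - 1) * (1 + 1 / (c - 1)) * \<delta> powr (1 - c) * (2 * pi))"
  proof -
    define Y where "Y = (1 + 1 / (c - 1)) * \<delta> powr (1 - c)"
    have "0 \<le> Y" using c by (simp add: Y_def)
    then have "ennreal (pi powr c * Y) + ennreal (pi powr c * Y) = ennreal (pi powr c * Y + pi powr c * Y)"
      by (intro ennreal_plus[symmetric]) auto
    also have "pi powr c * Y + pi powr c * Y = pi powr (c - 1) * Y * (2 * pi)"
      by (simp add: powr_diff)
    finally show ?thesis by (simp add: Y_def mult.assoc)
  qed
  finally have "(\<integral>\<^sup>+\<theta>. ennreal (norm (1 - of_real a * cis \<theta>) powr (- c)) * indicator {0..2 * pi} \<theta> \<partial>lborel) / ennreal (2 * pi)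
     \<le> ennreal (pi powr (c - 1) * (1 + 1 / (c - 1)) * \<delta> powr (1 - c) * (2 * pi)) / ennreal (2 * pi)"
    by (rule divide_right_mono_ennreal)
  also have "\<dots> = ennreal (pi powr (c - 1) * (1 + 1 / (c - 1)) * \<delta> powr (1 - c))"
    using c by (subst divide_ennreal) auto
  finally show ?thesis
    unfolding \<delta>_def by (subst nn_integral_circle, intro measurable_circle_borelI) auto
qed

section \<open>Integrals over the cube\<close>

abbreviation (input) wt :: "real ^ 'n \<Rightarrow> real \<Rightarrow> ennreal" where
  "wt R a \<equiv> ennreal (radial_weight R a)"

lemma wt_prod: "wt R a = (\<Prod>j\<in>UNIV. ennreal ((1 - R $ j) powr a))"
  by (simp add: radial_weight_def prod_ennreal)

lemma wt_0: "R \<in> unit_cube \<Longrightarrow> wt R 0 = 1"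
  by (auto simp: radial_weight_def unit_cube_def intro!: prod.neutral) (metis less_irrefl)

lemma wt_cancel: "R \<in> unit_cube \<Longrightarrow> wt R a * wt R (- a) = 1"
  using ennreal_radial_weight_add[of R a "- a"] wt_0[of R] by simp

text \<open>Integrate only over the box where every R_j lies beyond the midpoint of r_j and 1. Its
  weighted volume is the product of ((1 - r_j)/2)^e / e, whose reciprocal gives the constant. This
  is how monotone quantities with a finite weighted integral acquire a growth bound.\<close>

lemma weighted_integral_ge:
  fixes r :: "real ^ 'n"
  assumes [measurable]: "\<Phi> \<in> borel_measurable cube_measure" and r: "r \<in> unit_cube" and e: "0 < e"
    and le: "\<And>R. R \<in> unit_cube \<Longrightarrow> (\<And>j. (1 + r $ j) / 2 \<le> R $ j) \<Longrightarrow> X \<le> \<Phi> R"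
  shows "X * wt r e \<le> ennreal ((e * 2 powr e) ^ CARD('n)) * (\<integral>\<^sup>+R. \<Phi> R * wt R (e - 1) \<partial>cube_measure)"
proof -
  have r': "0 \<le> r $ j" "r $ j < 1" for j using r by (auto simp: unit_cube_def)
  let ?T = "\<lambda>j x. ennreal ((1 - x) powr (e - 1)) * indicator {(1 + r $ j) / 2..} x"
  have "X * (\<Prod>j\<in>UNIV. ennreal (((1 - r $ j) / 2) powr e / e)) = X * (\<Prod>j\<in>UNIV. \<integral>\<^sup>+x. ?T j x \<partial>unit_interval_measure)"
  proof -
    have "(\<integral>\<^sup>+x. ?T j x \<partial>unit_interval_measure) = ennreal ((1 - (1 + r $ j) / 2) powr e / e)" for j
      by (rule nn_integral_unit_interval_tail) (use e r'[of j] in auto)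
    moreover have "1 - (1 + r $ j) / 2 = (1 - r $ j) / 2" for j by (simp add: field_simps)
    ultimately show ?thesis by simp
  qed
  also have "(\<Prod>j\<in>UNIV. \<integral>\<^sup>+x. ?T j x \<partial>unit_interval_measure) = (\<integral>\<^sup>+R. (\<Prod>j\<in>UNIV. ?T j (R $ j)) \<partial>cube_measure)"
    by (rule nn_integral_cube_prod[symmetric], rule measurable_unit_intervalI) measurable
  also have "X * \<dots> = (\<integral>\<^sup>+R. X * (\<Prod>j\<in>UNIV. ?T j (R $ j)) \<partial>cube_measure)"
    by (rule nn_integral_cmult[symmetric]) measurable
  also have "\<dots> \<le> (\<integral>\<^sup>+R. \<Phi> R * wt R (e - 1) \<partial>cube_measure)"
  proof (rule nn_integral_mono)
    fix R :: "real ^ 'n" assume R: "R \<in> space cube_measure"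
    show "X * (\<Prod>j\<in>UNIV. ?T j (R $ j)) \<le> \<Phi> R * wt R (e - 1)"
    proof (cases "\<forall>j. (1 + r $ j) / 2 \<le> R $ j")
      case True
      then show ?thesis using le[of R] R by (simp add: wt_prod mult_right_mono)
    next
      case False
      then obtain j where "\<not> (1 + r $ j) / 2 \<le> R $ j" by blast
      then have "?T j (R $ j) = 0" by (auto simp: indicator_def)
      then have "(\<Prod>j\<in>UNIV. ?T j (R $ j)) = 0" by (intro prod_zero) auto
      then show ?thesis by (simp only: mult_zero_right zero_le)
    qed
  qed
  finally have main: "X * (\<Prod>j\<in>UNIV. ennreal (((1 - r $ j) / 2) powr e / e)) \<le> (\<integral>\<^sup>+R. \<Phi> R * wt R (e - 1) \<partial>cube_measure)" .
  have each: "ennreal (e * 2 powr e) * ennreal (((1 - r $ j) / 2) powr e / e) = ennreal ((1 - r $ j) powr e)" for j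
    using e r'[of j] by (simp add: powr_divide flip: ennreal_mult)
  have "wt r e = (\<Prod>j\<in>(UNIV :: 'n set). ennreal (e * 2 powr e) * ennreal (((1 - r $ j) / 2) powr e / e))"
    by (simp only: each wt_prod)
  also have "\<dots> = ennreal ((e * 2 powr e) ^ CARD('n)) * (\<Prod>j\<in>UNIV. ennreal (((1 - r $ j) / 2) powr e / e))"
    using e by (simp add: prod.distrib ennreal_power)
  finally have "X * wt r e = ennreal ((e * 2 powr e) ^ CARD('n)) * (X * (\<Prod>j\<in>UNIV. ennreal (((1 - r $ j) / 2) powr e / e)))"
    by (simp add: mult_ac)
  also have "\<dots> \<le> ennreal ((e * 2 powr e) ^ CARD('n)) * (\<integral>\<^sup>+R. \<Phi> R * wt R (e - 1) \<partial>cube_measure)"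
    by (rule mult_left_mono[OF main]) simp
  finally show ?thesis .
qed

text \<open>The indicator of the \<open>R\<close> for which each 1 - R_j lies between (1 - r_j)/4
  and (1 - r_j)/2. Written as a product of one-variable factors, so that integrals in
  \<open>R\<close> and in \<open>r\<close> both factorise. On a band all weights at \<open>r\<close>
  and at \<open>R\<close> are comparable.\<close>

definition band :: "real ^ 'n \<Rightarrow> real ^ 'n \<Rightarrow> ennreal" where
  "band r R = (\<Prod>j\<in>UNIV. if (1 + r $ j) / 2 \<le> R $ j \<and> R $ j \<le> (3 + r $ j) / 4 then 1 else 0)"

lemma band_cases: "band r R = 1 \<and> (\<forall>j. (1 + r $ j) / 2 \<le> R $ j \<and> R $ j \<le> (3 + r $ j) / 4) \<or> band r R = 0"
proof (cases "\<forall>j. (1 + r $ j) / 2 \<le> R $ j \<and> R $ j \<le> (3 + r $ j) / 4")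
  case True
  then show ?thesis by (simp add: band_def)
next
  case False
  then have "band r R = 0" unfolding band_def by (intro prod_zero) auto
  then show ?thesis by simp
qed

lemma measurable_band [measurable]:
  assumes [measurable]: "f \<in> M \<rightarrow>\<^sub>M cube_measure" "g \<in> M \<rightarrow>\<^sub>M cube_measure"
  shows "(\<lambda>x. band (f x) (g x)) \<in> borel_measurable M"
proof -
  have [measurable]: "(\<lambda>x. f x $ j) \<in> borel_measurable M" "(\<lambda>x. g x $ j) \<in> borel_measurable M" for j
    using measurable_compose[OF assms(1) measurable_cube_nth_borel] measurable_compose[OF assms(2) measurable_cube_nth_borel] by auto
  show ?thesis unfolding band_def by measurable
qed

lemma band_integral_ge:
  fixes r :: "real ^ 'n"
  assumes [measurable]: "Y \<in> borel_measurable cube_measure" and r: "r \<in> unit_cube"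
    and le: "\<And>R. R \<in> unit_cube \<Longrightarrow> (\<And>j. (1 + r $ j) / 2 \<le> R $ j) \<Longrightarrow> (\<And>j. R $ j \<le> (3 + r $ j) / 4) \<Longrightarrow> X \<le> Y R"
  shows "X * wt r 1 \<le> 4 ^ CARD('n) * (\<integral>\<^sup>+R. Y R * band r R \<partial>cube_measure)"
proof -
  have r': "0 \<le> r $ j" "r $ j < 1" for j using r by (auto simp: unit_cube_def)
  let ?T = "\<lambda>j x. indicator {(1 + r $ j) / 2..(3 + r $ j) / 4} x :: ennreal"
  have T: "(\<integral>\<^sup>+x. ?T j x \<partial>unit_interval_measure) = ennreal ((1 - r $ j) / 4)" for j
  proof -
    have "(\<integral>\<^sup>+x. ?T j x \<partial>unit_interval_measure) = (\<integral>\<^sup>+x. ?T j x \<partial>lborel)"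
      unfolding nn_integral_unit_interval using r'[of j]
      by (intro nn_integral_cong) (auto simp: indicator_def field_simps)
    also have "\<dots> = ennreal ((3 + r $ j) / 4 - (1 + r $ j) / 2)"
      using r'[of j] by (simp add: field_simps)
    also have "(3 + r $ j) / 4 - (1 + r $ j) / 2 = (1 - r $ j) / 4" by (simp add: field_simps)
    finally show ?thesis .
  qed
  have "X * (\<Prod>j\<in>UNIV. ennreal ((1 - r $ j) / 4)) = X * (\<integral>\<^sup>+R. (\<Prod>j\<in>UNIV. ?T j (R $ j)) \<partial>cube_measure)"
    unfolding T[symmetric] by (subst nn_integral_cube_prod, rule measurable_unit_intervalI) simp_all
  also have "\<dots> = (\<integral>\<^sup>+R. X * (\<Prod>j\<in>UNIV. ?T j (R $ j)) \<partial>cube_measure)"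
    by (rule nn_integral_cmult[symmetric]) measurable
  also have "\<dots> \<le> (\<integral>\<^sup>+R. Y R * band r R \<partial>cube_measure)"
  proof (rule nn_integral_mono)
    fix R :: "real ^ 'n" assume R: "R \<in> space cube_measure"
    have "(\<Prod>j\<in>UNIV. ?T j (R $ j)) = band r R"
      unfolding band_def by (intro prod.cong) (auto simp: indicator_def)
    then show "X * (\<Prod>j\<in>UNIV. ?T j (R $ j)) \<le> Y R * band r R"
      using band_cases[of r R] le[of R] R by auto
  qed
  finally have main: "X * (\<Prod>j\<in>UNIV. ennreal ((1 - r $ j) / 4)) \<le> (\<integral>\<^sup>+R. Y R * band r R \<partial>cube_measure)" .
  have each: "4 * ennreal ((1 - r $ j) / 4) = ennreal ((1 - r $ j) powr 1)" for j
  proof -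
    have "4 * ennreal ((1 - r $ j) / 4) = ennreal 4 * ennreal ((1 - r $ j) / 4)" by simp
    also have "\<dots> = ennreal (4 * ((1 - r $ j) / 4))" by (rule ennreal_mult[symmetric]) (use r'[of j] in auto)
    finally show ?thesis using r'[of j] by simp
  qed
  have "wt r 1 = (\<Prod>j\<in>(UNIV :: 'n set). 4 * ennreal ((1 - r $ j) / 4))"
    by (simp only: each wt_prod)
  also have "\<dots> = 4 ^ CARD('n) * (\<Prod>j\<in>UNIV. ennreal ((1 - r $ j) / 4))"
    by (simp only: prod.distrib prod_constant)
  finally have "X * wt r 1 = 4 ^ CARD('n) * (X * (\<Prod>j\<in>UNIV. ennreal ((1 - r $ j) / 4)))"
    by (simp add: mult_ac)
  also have "\<dots> \<le> 4 ^ CARD('n) * (\<integral>\<^sup>+R. Y R * band r R \<partial>cube_measure)"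
    by (rule mult_left_mono[OF main]) simp
  finally show ?thesis .
qed

text \<open>Read from the side of \<open>R\<close>, with s = 1 - R_j, the band is the interval of
  r_j with 1 - r_j between 2s and 4s. It has length 2s, and on it (1 - r_j)^(x-1) is at most 4^|x-1|
  s^(x-1) whatever the sign of x - 1.\<close>

lemma band_integral_le:
  fixes R :: "real ^ 'n"
  assumes R: "R \<in> unit_cube"
  shows "(\<integral>\<^sup>+r. wt r (x - 1) * band r R \<partial>cube_measure) \<le> ennreal ((2 * 4 powr \<bar>x - 1\<bar>) ^ CARD('n)) * wt R x"
proof -
  have R': "0 \<le> R $ j" "R $ j < 1" for j using R by (auto simp: unit_cube_def)
  let ?T = "\<lambda>j r. ennreal ((1 - r) powr (x - 1)) * (if (1 + r) / 2 \<le> R $ j \<and> R $ j \<le> (3 + r) / 4 then 1 else 0)"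
  have each: "(\<integral>\<^sup>+r. ?T j r \<partial>unit_interval_measure) \<le> ennreal (2 * 4 powr \<bar>x - 1\<bar>) * ennreal ((1 - R $ j) powr x)" for j
  proof -
    define s where "s = 1 - R $ j"
    have s: "0 < s" using R'[of j] by (simp add: s_def)
    have "?T j r \<le> ennreal (4 powr \<bar>x - 1\<bar> * s powr (x - 1)) * indicator {1 - 4 * s..1 - 2 * s} r" for r
    proof (cases "(1 + r) / 2 \<le> R $ j \<and> R $ j \<le> (3 + r) / 4")
      case True
      then have rs: "2 * s \<le> 1 - r" "1 - r \<le> 4 * s" by (auto simp: s_def)
      have "(1 - r) powr (x - 1) \<le> 4 powr \<bar>x - 1\<bar> * s powr (x - 1)"
      proof (cases "1 \<le> x")
        case True
        have "(1 - r) powr (x - 1) \<le> (4 * s) powr (x - 1)"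
          using rs s True by (intro powr_mono2) auto
        then show ?thesis using True s by (simp add: powr_mult)
      next
        case False
        have "(1 - r) powr (x - 1) \<le> s powr (x - 1)"
          using rs s False by (intro powr_mono2') auto
        also have "\<dots> \<le> 4 powr \<bar>x - 1\<bar> * s powr (x - 1)"
          using ge_one_powr_ge_zero[of 4 "\<bar>x - 1\<bar>"] mult_right_mono[of 1 "4 powr \<bar>x - 1\<bar>" "s powr (x - 1)"] by simp
        finally show ?thesis .
      qed
      then show ?thesis using True rs by (simp add: ennreal_leI)
    qed auto
    then have "(\<integral>\<^sup>+r. ?T j r \<partial>unit_interval_measure) \<le> (\<integral>\<^sup>+r. ennreal (4 powr \<bar>x - 1\<bar> * s powr (x - 1)) * indicator {1 - 4 * s..1 - 2 * s} r \<partial>unit_interval_measure)"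
      by (intro nn_integral_mono) simp
    also have "\<dots> \<le> (\<integral>\<^sup>+r. ennreal (4 powr \<bar>x - 1\<bar> * s powr (x - 1)) * indicator {1 - 4 * s..1 - 2 * s} r \<partial>lborel)"
      unfolding nn_integral_unit_interval by (intro nn_integral_mono) (auto simp: indicator_def)
    also have "\<dots> = ennreal (4 powr \<bar>x - 1\<bar> * s powr (x - 1)) * ennreal (2 * s)"
      using s by (simp add: nn_integral_cmult_indicator)
    also have "\<dots> = ennreal (2 * 4 powr \<bar>x - 1\<bar>) * ennreal (s powr x)"
      using s by (simp add: powr_diff flip: ennreal_mult)
    finally show ?thesis by (simp add: s_def)
  qed
  have "(\<integral>\<^sup>+r. wt r (x - 1) * band r R \<partial>cube_measure) = (\<integral>\<^sup>+r. (\<Prod>j\<in>UNIV. ?T j (r $ j)) \<partial>cube_measure)"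
    by (simp only: wt_prod band_def prod.distrib)
  also have "\<dots> = (\<Prod>j\<in>UNIV. \<integral>\<^sup>+r. ?T j r \<partial>unit_interval_measure)"
    by (rule nn_integral_cube_prod, rule measurable_unit_intervalI) measurable
  also have "\<dots> \<le> (\<Prod>j\<in>(UNIV :: 'n set). ennreal (2 * 4 powr \<bar>x - 1\<bar>) * ennreal ((1 - R $ j) powr x))"
    by (intro prod_mono_ennreal each)
  also have "\<dots> = ennreal ((2 * 4 powr \<bar>x - 1\<bar>) ^ CARD('n)) * wt R x"
    by (simp only: prod.distrib prod_constant wt_prod) (simp add: ennreal_power)
  finally show ?thesis .
qed

text \<open>A domination by band averages is turned, via Tonelli, into a domination of weighted
  integrals, for every weight exponent at once. It is needed because the pointwise estimates always
  lose some radius when passing from \<open>r\<close> to \<open>R\<close>.\<close>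

lemma averaging_le:
  fixes G :: "real ^ 'n \<Rightarrow> ennreal"
  assumes [measurable]: "G \<in> borel_measurable cube_measure" "H \<in> borel_measurable cube_measure"
    and le: "\<And>r. r \<in> unit_cube \<Longrightarrow> H r * wt r 1 \<le> K * (\<integral>\<^sup>+R. G R * band r R \<partial>cube_measure)"
  shows "(\<integral>\<^sup>+r. H r * wt r x \<partial>cube_measure)
    \<le> K * (ennreal ((2 * 4 powr \<bar>x - 1\<bar>) ^ CARD('n)) * (\<integral>\<^sup>+R. G R * wt R x \<partial>cube_measure))"
proof -
  interpret pair_sigma_finite "cube_measure :: (real ^ 'n) measure" "cube_measure :: (real ^ 'n) measure" ..
  have "(\<integral>\<^sup>+r. H r * wt r x \<partial>cube_measure) = (\<integral>\<^sup>+r. (H r * wt r 1) * wt r (x - 1) \<partial>cube_measure)"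
    by (intro nn_integral_cong) (simp add: mult.assoc flip: ennreal_radial_weight_add)
  also have "\<dots> \<le> (\<integral>\<^sup>+r. (K * (\<integral>\<^sup>+R. G R * band r R \<partial>cube_measure)) * wt r (x - 1) \<partial>cube_measure)"
    using le by (intro nn_integral_mono mult_right_mono) auto
  also have "\<dots> = (\<integral>\<^sup>+r. K * (\<integral>\<^sup>+R. G R * (wt r (x - 1) * band r R) \<partial>cube_measure) \<partial>cube_measure)"
    by (intro nn_integral_cong) (simp add: nn_integral_cmult[symmetric] nn_integral_multc[symmetric] mult_ac)
  also have "\<dots> = K * (\<integral>\<^sup>+r. \<integral>\<^sup>+R. G R * (wt r (x - 1) * band r R) \<partial>cube_measure \<partial>cube_measure)"
    by (rule nn_integral_cmult) measurable
  also have "(\<integral>\<^sup>+r. \<integral>\<^sup>+R. G R * (wt r (x - 1) * band r R) \<partial>cube_measure \<partial>cube_measure)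
     = (\<integral>\<^sup>+R. \<integral>\<^sup>+r. G R * (wt r (x - 1) * band r R) \<partial>cube_measure \<partial>cube_measure)"
    by (rule Fubini'[symmetric]) measurable
  also have "\<dots> = (\<integral>\<^sup>+R. G R * (\<integral>\<^sup>+r. wt r (x - 1) * band r R \<partial>cube_measure) \<partial>cube_measure)"
    by (intro nn_integral_cong nn_integral_cmult) measurable
  also have "\<dots> \<le> (\<integral>\<^sup>+R. G R * (ennreal ((2 * 4 powr \<bar>x - 1\<bar>) ^ CARD('n)) * wt R x) \<partial>cube_measure)"
    by (intro nn_integral_mono mult_left_mono band_integral_le) auto
  also have "\<dots> = (\<integral>\<^sup>+R. ennreal ((2 * 4 powr \<bar>x - 1\<bar>) ^ CARD('n)) * (G R * wt R x) \<partial>cube_measure)"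
    by (simp add: mult_ac)
  also have "\<dots> = ennreal ((2 * 4 powr \<bar>x - 1\<bar>) ^ CARD('n)) * (\<integral>\<^sup>+R. G R * wt R x \<partial>cube_measure)"
    by (rule nn_integral_cmult) measurable
  finally show ?thesis by (simp add: mult_left_mono)
qed

section \<open>Embeddings between the mixed norm spaces\<close>

declare measurable_band [measurable del]

lemma measurable_band_right: "r \<in> unit_cube \<Longrightarrow> band r \<in> borel_measurable cube_measure"
  by (rule measurable_band[of "\<lambda>_. r" _ "\<lambda>R. R"]) simp_all

lemma nn_integral_cube_measure:
  "(\<integral>\<^sup>+R\<in>unit_cube. F R \<partial>lborel) = (\<integral>\<^sup>+R. F R \<partial>cube_measure)"
  unfolding cube_measure_def by (rule nn_integral_restrict_space[symmetric]) (simp add: unit_cube_sets)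

lemma ennpowr_integral_mean: "0 < p \<Longrightarrow> ennpowr (integral_mean p f R) q = ennpowr (power_mean p f R) (q / p)"
  by (simp add: integral_mean_def power_mean_def ennpowr_ennpowr)

lemma A_norm_pow_eq:
  "0 < p \<Longrightarrow> A_norm_pow p q \<alpha> f = (\<integral>\<^sup>+R. ennpowr (power_mean p f R) (q / p) * wt R (\<alpha> * q - 1) \<partial>cube_measure)"
  by (simp add: A_norm_pow_def nn_integral_cube_measure ennpowr_integral_mean)

lemma F_norm_pow_eq:
  "F_norm_pow p q \<alpha> f = (\<integral>\<^sup>+\<xi>. ennpowr (\<integral>\<^sup>+R. ennreal (norm (f (scale_vec R \<xi>)) powr q) * wt R (\<alpha> * q - 1) \<partial>cube_measure) (p / q) \<partial>torus_measure)"
  by (simp add: F_norm_pow_def nn_integral_cube_measure)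

lemma measurable_power_mean [measurable]:
  assumes [measurable]: "f \<in> hol_polydisc"
  shows "power_mean p f \<in> borel_measurable cube_measure"
proof -
  have [measurable]: "(\<lambda>(R, \<xi>). f (scale_vec R \<xi>)) \<in> borel_measurable (cube_measure \<Otimes>\<^sub>M torus_measure)"
    by (rule measurable_hol_cube_torus[OF assms])
  show ?thesis
    unfolding power_mean_def by (rule torus.borel_measurable_nn_integral) measurable
qed

lemma half_less:
  assumes "(r :: real ^ 'n) \<in> unit_cube" "(1 + r $ j) / 2 \<le> R $ j"
  shows "0 \<le> r $ j" "r $ j < R $ j"
proof -
  have "0 \<le> r $ j" "r $ j < 1" using assms(1) by (auto simp: unit_cube_def)
  then show "0 \<le> r $ j" "r $ j < R $ j" using assms(2) by (simp_all add: field_simps)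
qed

lemma power_mean_mono_half:
  assumes f: "f \<in> hol_polydisc" and \<kappa>: "0 < \<kappa>" and r: "r \<in> unit_cube" and R: "R \<in> unit_cube"
    and rR: "\<And>j. (1 + r $ j) / 2 \<le> R $ j"
  shows "power_mean \<kappa> f r \<le> power_mean \<kappa> f R"
  by (rule power_mean_mono[OF f \<kappa>]) (use half_less[OF r rR] R in \<open>auto simp: unit_cube_def\<close>)

lemma power_mean_A_growth:
  fixes f :: "complex ^ 'n \<Rightarrow> complex"
  assumes f: "f \<in> hol_polydisc" and p: "0 < p" and q: "0 < q" and \<alpha>: "0 < \<alpha>" and r: "r \<in> unit_cube"
  shows "ennpowr (power_mean p f r) (q / p) * wt r (\<alpha> * q)
    \<le> ennreal ((\<alpha> * q * 2 powr (\<alpha> * q)) ^ CARD('n)) * A_norm_pow p q \<alpha> f"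
  unfolding A_norm_pow_eq[OF p]
  by (rule weighted_integral_ge[OF _ r])
     (use f p q \<alpha> r in \<open>auto intro!: measurable_ennpowr measurable_power_mean ennpowr_mono power_mean_mono_half\<close>)

text \<open>Write |f|^t as |f|^p times (|f|^p)^((t-p)/p) and estimate the second factor by its
  supremum with \<open>pointwise_le_power_mean\<close>; the weight records what the supremum
  costs.\<close>

lemma power_mean_raise_exponent:
  fixes f :: "complex ^ 'n \<Rightarrow> complex"
  assumes f: "f \<in> hol_polydisc" and p: "0 < p" "p \<le> t" and r: "r \<in> unit_cube" and R: "R \<in> unit_cube"
    and rR: "\<And>j. (1 + r $ j) / 2 \<le> R $ j"
  shows "power_mean t f r * wt r ((t - p) / p) \<le> ennpowr (4 ^ CARD('n)) ((t - p) / p) * ennpowr (power_mean p f R) (t / p)"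
proof -
  let ?E = "(t - p) / p"
  let ?B = "ennpowr (4 ^ CARD('n) * power_mean p f R) ?E"
  have [measurable]: "(\<lambda>\<xi>. f (scale_vec r \<xi>)) \<in> borel_measurable torus_measure"
    by (rule measurable_hol_fixed[OF f r])
  have "ennreal (norm (f (scale_vec r \<xi>)) powr t) * wt r ?E \<le> ennreal (norm (f (scale_vec r \<xi>)) powr p) * ?B"
    if "\<xi> \<in> unit_torus" for \<xi>
  proof -
    let ?x = "norm (f (scale_vec r \<xi>))"
    have "ennreal (?x powr t) = ennreal (?x powr p) * ennpowr (ennreal (?x powr p)) ?E"
      using p by (simp add: ennpowr_ennreal powr_powr flip: ennreal_mult powr_add)
    moreover have "wt r ?E = ennpowr (wt r 1) ?E" by (simp add: ennpowr_radial_weight)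
    ultimately have "ennreal (?x powr t) * wt r ?E = ennreal (?x powr p) * ennpowr (ennreal (?x powr p) * wt r 1) ?E"
      by (simp add: ennpowr_mult mult.assoc)
    also have "\<dots> \<le> ennreal (?x powr p) * ?B"
      using p by (intro mult_left_mono ennpowr_mono pointwise_le_power_mean f r R rR that) auto
    finally show ?thesis .
  qed
  then have "(\<integral>\<^sup>+\<xi>. ennreal (norm (f (scale_vec r \<xi>)) powr t) * wt r ?E \<partial>torus_measure)
     \<le> (\<integral>\<^sup>+\<xi>. ennreal (norm (f (scale_vec r \<xi>)) powr p) * ?B \<partial>torus_measure)"
    by (intro nn_integral_mono) simp
  then have "power_mean t f r * wt r ?E \<le> power_mean p f r * ?B"
    by (simp add: power_mean_def nn_integral_multc)
  also have "\<dots> \<le> power_mean p f R * ?B"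
    by (intro mult_right_mono power_mean_mono_half f p r R rR) auto
  also have "\<dots> = ennpowr (4 ^ CARD('n)) ?E * (ennpowr (power_mean p f R) 1 * ennpowr (power_mean p f R) ?E)"
    by (simp add: ennpowr_mult mult_ac)
  also have "ennpowr (power_mean p f R) 1 * ennpowr (power_mean p f R) ?E = ennpowr (power_mean p f R) (t / p)"
  proof -
    have "1 + (t - p) / p = t / p" using p by (simp add: field_simps)
    then show ?thesis by (metis ennpowr_add)
  qed
  finally show ?thesis .
qed

lemma power_const_less_top: "(4 :: ennreal) ^ n < top"
  by (simp add: power_less_top_ennreal)

text \<open>Raising p to t costs the weight exponent s/p - s/t by
  \<open>power_mean_raise_exponent\<close>. Raising q to s uses the growth bound
  \<open>power_mean_A_growth\<close> for the surplus power s - q of the mean, at the cost \<alpha>(s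
  - q). The first cost is the shift of the index, the second is balanced by the change of \<alpha>q
  - 1 into \<alpha>s - 1.\<close>

lemma A_space_embedding:
  fixes f :: "complex ^ 'n \<Rightarrow> complex"
  assumes f: "f \<in> hol_polydisc" and p: "0 < p" "p \<le> t" and q: "0 < q" "q \<le> s" and \<alpha>: "0 < \<alpha>"
    and fin: "A_norm_pow p q \<alpha> f < \<infinity>"
  shows "A_norm_pow t s (\<alpha> + 1 / p - 1 / t) f < \<infinity>"
proof -
  have t: "0 < t" and s: "0 < s" using p q by auto
  \<comment> \<open>The bound of \<open>power_mean_A_growth\<close>: N dominates the (q/p)-th power
    of the mean times the weight of exponent \<alpha>q at every polyradius.\<close>
  define N where "N = ennreal ((\<alpha> * q * 2 powr (\<alpha> * q)) ^ CARD('n)) * A_norm_pow p q \<alpha> f"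
  define C where "C = ennpowr (ennpowr (4 ^ CARD('n)) ((t - p) / p)) (s / t)"
  define G where "G R = ennpowr (power_mean p f R) (q / p) * wt R (- (\<alpha> * (s - q)))" for R
  define K where "K = C * ennpowr N ((s - q) / q) * 4 ^ CARD('n)"
  have C: "C < top" by (simp add: C_def power_const_less_top)
  have N: "N < top" using fin by (simp add: N_def ennreal_mult_less_top)
  have K: "K < top" using C N by (simp add: K_def ennreal_mult_less_top power_const_less_top)
  have [measurable]: "power_mean p f \<in> borel_measurable cube_measure" "power_mean t f \<in> borel_measurable cube_measure"
    by (intro measurable_power_mean f)+
  have [measurable]: "G \<in> borel_measurable cube_measure" unfolding G_def by measurable
  define H where "H r = ennpowr (power_mean t f r) (s / t) * wt r (s / p - s / t)" for r
  have [measurable]: "H \<in> borel_measurable cube_measure" unfolding H_def by measurable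
  have HG: "H r \<le> C * ennpowr N ((s - q) / q) * G R"
    if r: "r \<in> unit_cube" and R: "R \<in> unit_cube" and rR: "\<And>j. (1 + r $ j) / 2 \<le> R $ j" for r R
  proof -
    have "H r = ennpowr (power_mean t f r * wt r ((t - p) / p)) (s / t)"
    proof -
      have "(t - p) / p * (s / t) = s / p - s / t" using p t by (simp add: field_simps)
      then show ?thesis by (simp add: H_def ennpowr_mult ennpowr_radial_weight)
    qed
    also have "\<dots> \<le> ennpowr (ennpowr (4 ^ CARD('n)) ((t - p) / p) * ennpowr (power_mean p f R) (t / p)) (s / t)"
      using s t by (intro ennpowr_mono power_mean_raise_exponent f p r R rR) auto
    also have "\<dots> = C * ennpowr (power_mean p f R) (s / p)"
      using t by (simp add: C_def ennpowr_mult ennpowr_ennpowr)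
    also have "ennpowr (power_mean p f R) (s / p) = ennpowr (power_mean p f R) (q / p) * ennpowr (power_mean p f R) ((s - q) / p)"
      by (simp add: diff_divide_distrib flip: ennpowr_add)
    finally have 1: "H r \<le> C * (ennpowr (power_mean p f R) (q / p) * ennpowr (power_mean p f R) ((s - q) / p))" .
    have "ennpowr (power_mean p f R) ((s - q) / p)
      = ennpowr (ennpowr (power_mean p f R) (q / p) * wt R (\<alpha> * q)) ((s - q) / q) * wt R (- (\<alpha> * (s - q)))"
      using q p wt_cancel[OF R, of "\<alpha> * (s - q)"] by (simp add: ennpowr_mult ennpowr_ennpowr ennpowr_radial_weight mult.assoc)
    also have "\<dots> \<le> ennpowr N ((s - q) / q) * wt R (- (\<alpha> * (s - q)))"
      unfolding N_def using q by (intro mult_right_mono ennpowr_mono power_mean_A_growth f p q \<alpha> R) auto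
    finally have "C * (ennpowr (power_mean p f R) (q / p) * ennpowr (power_mean p f R) ((s - q) / p))
      \<le> C * (ennpowr (power_mean p f R) (q / p) * (ennpowr N ((s - q) / q) * wt R (- (\<alpha> * (s - q)))))"
      by (intro mult_left_mono) auto
    with 1 show ?thesis
      by (simp add: G_def mult_ac)
  qed
  have band: "H r * wt r 1 \<le> K * (\<integral>\<^sup>+R. G R * band r R \<partial>cube_measure)" if r: "r \<in> unit_cube" for r
  proof -
    have "H r * wt r 1 \<le> 4 ^ CARD('n) * (\<integral>\<^sup>+R. (C * ennpowr N ((s - q) / q) * G R) * band r R \<partial>cube_measure)"
      by (rule band_integral_ge[OF _ r]) (use HG[OF r] r in auto)
    also have "(\<integral>\<^sup>+R. (C * ennpowr N ((s - q) / q) * G R) * band r R \<partial>cube_measure)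
       = (\<integral>\<^sup>+R. (C * ennpowr N ((s - q) / q)) * (G R * band r R) \<partial>cube_measure)"
      by (simp add: mult.assoc)
    also have "\<dots> = (C * ennpowr N ((s - q) / q)) * (\<integral>\<^sup>+R. G R * band r R \<partial>cube_measure)"
      by (intro nn_integral_cmult borel_measurable_times_ennreal measurable_band_right r) simp
    finally show ?thesis by (simp add: K_def mult_ac)
  qed
  have "A_norm_pow t s (\<alpha> + 1 / p - 1 / t) f = (\<integral>\<^sup>+r. H r * wt r (\<alpha> * s - 1) \<partial>cube_measure)"
    unfolding A_norm_pow_eq[OF t] H_def
  proof (intro nn_integral_cong)
    fix r
    have "(\<alpha> + 1 / p - 1 / t) * s - 1 = (s / p - s / t) + (\<alpha> * s - 1)" by (simp add: algebra_simps)
    then show "ennpowr (power_mean t f r) (s / t) * wt r ((\<alpha> + 1 / p - 1 / t) * s - 1)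
       = ennpowr (power_mean t f r) (s / t) * wt r (s / p - s / t) * wt r (\<alpha> * s - 1)"
      by (simp only: ennreal_radial_weight_add mult.assoc)
  qed
  also have "\<dots> \<le> K * (ennreal ((2 * 4 powr \<bar>\<alpha> * s - 1 - 1\<bar>) ^ CARD('n)) * (\<integral>\<^sup>+R. G R * wt R (\<alpha> * s - 1) \<partial>cube_measure))"
    by (rule averaging_le) (use band in auto)
  also have "(\<integral>\<^sup>+R. G R * wt R (\<alpha> * s - 1) \<partial>cube_measure) = A_norm_pow p q \<alpha> f"
    unfolding A_norm_pow_eq[OF p(1)] G_def
  proof (intro nn_integral_cong)
    fix r
    have "\<alpha> * q - 1 = - (\<alpha> * (s - q)) + (\<alpha> * s - 1)" by (simp add: algebra_simps)
    then show "ennpowr (power_mean p f r) (q / p) * wt r (- (\<alpha> * (s - q))) * wt r (\<alpha> * s - 1)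
       = ennpowr (power_mean p f r) (q / p) * wt r (\<alpha> * q - 1)"
      by (simp only: ennreal_radial_weight_add mult.assoc)
  qed
  also have "K * (ennreal ((2 * 4 powr \<bar>\<alpha> * s - 1 - 1\<bar>) ^ CARD('n)) * A_norm_pow p q \<alpha> f) < \<infinity>"
    using K fin by (simp add: ennreal_mult_less_top)
  finally show ?thesis .
qed

section \<open>From the spaces F to the spaces A\<close>

lemma ennreal_mult_inverse: "x \<noteq> 0 \<Longrightarrow> x < top \<Longrightarrow> x * inverse x = (1 :: ennreal)"
  using ennreal_divide_self[of x] by (simp add: divide_ennreal_def)

lemma F_inner_measurable [measurable]:
  assumes f: "f \<in> hol_polydisc"
  shows "(\<lambda>\<xi>. \<integral>\<^sup>+R. ennreal (norm (f (scale_vec R \<xi>)) powr q) * wt R a \<partial>cube_measure) \<in> borel_measurable torus_measure"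
proof -
  have [measurable]: "(\<lambda>(\<xi>, R). f (scale_vec R \<xi>)) \<in> borel_measurable (torus_measure \<Otimes>\<^sub>M cube_measure)"
    unfolding split_beta' by (rule measurable_hol_scale_vec[OF f]) auto
  show ?thesis by (rule cube.borel_measurable_nn_integral) measurable
qed

text \<open>For \<open>p \<le> q\<close> this is Minkowski's integral inequality, which is Jensen's inequality for the
  probability density \<open>h / \<integral>h\<close> on the torus.\<close>

lemma F_subset_A_le:
  fixes f :: "complex ^ 'n \<Rightarrow> complex"
  assumes f: "f \<in> hol_polydisc" and p: "0 < p" "p \<le> q" and fin: "F_norm_pow p q \<alpha> f < \<infinity>"
  shows "A_norm_pow p q \<alpha> f < \<infinity>"
proof -
  have q: "0 < q" using p by auto
  interpret pair_sigma_finite "cube_measure :: (real ^ 'n) measure" "torus_measure :: (complex ^ 'n) measure" ..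
  define Q where "Q = q / p"
  have Q: "1 \<le> Q" using p by (simp add: Q_def)
  define u where "u \<xi> = (\<integral>\<^sup>+R. ennreal (norm (f (scale_vec R \<xi>)) powr q) * wt R (\<alpha> * q - 1) \<partial>cube_measure)" for \<xi>
  \<comment> \<open>The added 1 keeps \<open>h\<close> away from 0, so that it may be inverted; it
    raises the total mass \<open>A\<close> only by 1.\<close>
  define h where "h \<xi> = ennpowr (u \<xi>) (p / q) + 1" for \<xi>
  define A where "A = (\<integral>\<^sup>+\<xi>. h \<xi> \<partial>torus_measure)"
  have [measurable]: "u \<in> borel_measurable torus_measure"
    unfolding u_def by (rule F_inner_measurable[OF f])
  then have [measurable]: "h \<in> borel_measurable torus_measure"
    unfolding h_def by measurable
  have [measurable]: "(\<lambda>(R, \<xi>). f (scale_vec R \<xi>)) \<in> borel_measurable (cube_measure \<Otimes>\<^sub>M torus_measure)"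
    by (rule measurable_hol_cube_torus[OF f])
  have A_eq: "A = F_norm_pow p q \<alpha> f + 1"
    unfolding A_def h_def F_norm_pow_eq u_def[symmetric] by (subst nn_integral_add) auto
  have A: "A < top" "A \<noteq> 0" using fin by (auto simp: A_eq)
  have "AE \<xi> in torus_measure. h \<xi> \<noteq> \<infinity>"
    by (rule nn_integral_PInf_AE) (use A in \<open>auto simp: A_def\<close>)
  then have h_top: "AE \<xi> in torus_measure. h \<xi> \<noteq> top" by simp
  \<comment> \<open>\<open>k\<close> is a probability density and \<open>g\<close> its reciprocal
    wherever \<open>h\<close> is finite, hence almost everywhere. Inserting \<open>g * k = 1\<close>
    into the mean prepares it for Jensen with the convex power Q.\<close>
  define k where "k \<xi> = h \<xi> * inverse A" for \<xi>
  define g where "g \<xi> = A * inverse (h \<xi>)" for \<xi>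
  have [measurable]: "k \<in> borel_measurable torus_measure" "g \<in> borel_measurable torus_measure"
    unfolding k_def g_def by measurable
  have k1: "(\<integral>\<^sup>+\<xi>. k \<xi> \<partial>torus_measure) = 1"
    unfolding k_def using A by (simp add: nn_integral_multc A_def[symmetric] ennreal_mult_inverse less_top)
  have gk: "g \<xi> * k \<xi> = 1" if "h \<xi> \<noteq> top" for \<xi>
  proof -
    have "h \<xi> \<noteq> 0" by (simp add: h_def)
    then have "h \<xi> * inverse (h \<xi>) = 1" using that by (simp add: ennreal_mult_inverse less_top)
    moreover have "A * inverse A = 1" using A by (simp add: ennreal_mult_inverse less_top)
    moreover have "g \<xi> * k \<xi> = (A * inverse A) * (h \<xi> * inverse (h \<xi>))" by (simp add: g_def k_def mult_ac)
    ultimately show ?thesis by simp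
  qed
  have mean: "ennpowr (power_mean p f R) Q \<le> (\<integral>\<^sup>+\<xi>. ennreal (norm (f (scale_vec R \<xi>)) powr q) * (ennpowr (g \<xi>) Q * k \<xi>) \<partial>torus_measure)"
    if R: "R \<in> unit_cube" for R
  proof -
    have [measurable]: "(\<lambda>\<xi>. f (scale_vec R \<xi>)) \<in> borel_measurable torus_measure"
      by (rule measurable_hol_fixed[OF f R])
    have "power_mean p f R = (\<integral>\<^sup>+\<xi>. (ennreal (norm (f (scale_vec R \<xi>)) powr p) * g \<xi>) * k \<xi> \<partial>torus_measure)"
      unfolding power_mean_def
      by (rule nn_integral_cong_AE) (use h_top in \<open>eventually_elim, simp add: mult.assoc gk\<close>)
    then have "ennpowr (power_mean p f R) Q \<le> (\<integral>\<^sup>+\<xi>. ennpowr (ennreal (norm (f (scale_vec R \<xi>)) powr p) * g \<xi>) Q * k \<xi> \<partial>torus_measure)"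
      using k1 by (simp only:) (intro Jensen_ennpowr Q, auto)
    also have "\<dots> = (\<integral>\<^sup>+\<xi>. ennreal (norm (f (scale_vec R \<xi>)) powr q) * (ennpowr (g \<xi>) Q * k \<xi>) \<partial>torus_measure)"
      using p by (simp add: ennpowr_mult ennpowr_ennreal powr_powr Q_def mult.assoc)
    finally show ?thesis .
  qed
  have "A_norm_pow p q \<alpha> f = (\<integral>\<^sup>+R. ennpowr (power_mean p f R) Q * wt R (\<alpha> * q - 1) \<partial>cube_measure)"
    by (simp add: A_norm_pow_eq[OF p(1)] Q_def)
  also have "\<dots> \<le> (\<integral>\<^sup>+R. (\<integral>\<^sup>+\<xi>. ennreal (norm (f (scale_vec R \<xi>)) powr q) * (ennpowr (g \<xi>) Q * k \<xi>) \<partial>torus_measure) * wt R (\<alpha> * q - 1) \<partial>cube_measure)"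
    using mean by (intro nn_integral_mono mult_right_mono) auto
  also have "\<dots> = (\<integral>\<^sup>+R. \<integral>\<^sup>+\<xi>. (ennreal (norm (f (scale_vec R \<xi>)) powr q) * wt R (\<alpha> * q - 1)) * (ennpowr (g \<xi>) Q * k \<xi>) \<partial>torus_measure \<partial>cube_measure)"
  proof (rule nn_integral_cong)
    fix R :: "real ^ 'n" assume "R \<in> space cube_measure"
    then have [measurable]: "(\<lambda>\<xi>. f (scale_vec R \<xi>)) \<in> borel_measurable torus_measure"
      using measurable_hol_fixed[OF f] by simp
    show "(\<integral>\<^sup>+\<xi>. ennreal (norm (f (scale_vec R \<xi>)) powr q) * (ennpowr (g \<xi>) Q * k \<xi>) \<partial>torus_measure) * wt R (\<alpha> * q - 1)
      = (\<integral>\<^sup>+\<xi>. (ennreal (norm (f (scale_vec R \<xi>)) powr q) * wt R (\<alpha> * q - 1)) * (ennpowr (g \<xi>) Q * k \<xi>) \<partial>torus_measure)"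
      by (subst nn_integral_multc[symmetric]) (auto simp: mult_ac)
  qed
  also have "\<dots> = (\<integral>\<^sup>+\<xi>. \<integral>\<^sup>+R. (ennreal (norm (f (scale_vec R \<xi>)) powr q) * wt R (\<alpha> * q - 1)) * (ennpowr (g \<xi>) Q * k \<xi>) \<partial>cube_measure \<partial>torus_measure)"
    by (rule Fubini'[symmetric]) measurable
  also have "\<dots> \<le> (\<integral>\<^sup>+\<xi>. ennpowr A Q * k \<xi> \<partial>torus_measure)"
  proof (rule nn_integral_mono)
    fix \<xi> :: "complex ^ 'n" assume \<xi>: "\<xi> \<in> space torus_measure"
    have [measurable]: "(\<lambda>R. f (scale_vec R \<xi>)) \<in> borel_measurable cube_measure"
      by (rule measurable_hol_scale_vec[OF f]) (use \<xi> in auto)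
    have "(\<integral>\<^sup>+R. (ennreal (norm (f (scale_vec R \<xi>)) powr q) * wt R (\<alpha> * q - 1)) * (ennpowr (g \<xi>) Q * k \<xi>) \<partial>cube_measure)
       = u \<xi> * (ennpowr (g \<xi>) Q * k \<xi>)"
      unfolding u_def by (rule nn_integral_multc) measurable
    also have "\<dots> = u \<xi> * ennpowr (g \<xi>) Q * k \<xi>"
      by (simp add: mult.assoc)
    also have "\<dots> \<le> ennpowr A Q * k \<xi>"
    proof (rule mult_right_mono)
      \<comment> \<open>The density was chosen for this: \<open>u\<close> is at most
        \<open>h^Q\<close>, so \<open>u * g^Q\<close> is at most the constant \<open>A^Q\<close> and
        only the mass of \<open>k\<close> remains to be integrated.\<close>
      have "u \<xi> = ennpowr (ennpowr (u \<xi>) (p / q)) Q" using p q by (simp add: ennpowr_ennpowr Q_def)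
      also have "\<dots> \<le> ennpowr (h \<xi>) Q" unfolding h_def using Q by (intro ennpowr_mono) auto
      finally have "u \<xi> * ennpowr (g \<xi>) Q \<le> ennpowr (h \<xi>) Q * ennpowr (g \<xi>) Q" by (rule mult_right_mono) simp
      also have "\<dots> = ennpowr (A * (h \<xi> * inverse (h \<xi>))) Q"
        by (simp add: g_def mult_ac flip: ennpowr_mult)
      also have "\<dots> \<le> ennpowr A Q"
      proof (rule ennpowr_mono)
        have "h \<xi> * inverse (h \<xi>) \<le> 1"
          by (cases "h \<xi> = top") (auto simp: ennreal_mult_inverse less_top h_def)
        then show "A * (h \<xi> * inverse (h \<xi>)) \<le> A" using mult_left_mono[of _ 1 A] by simp
      qed (use Q in simp)
      finally show "u \<xi> * ennpowr (g \<xi>) Q \<le> ennpowr A Q" .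
    qed simp
    finally show "(\<integral>\<^sup>+R. (ennreal (norm (f (scale_vec R \<xi>)) powr q) * wt R (\<alpha> * q - 1)) * (ennpowr (g \<xi>) Q * k \<xi>) \<partial>cube_measure) \<le> ennpowr A Q * k \<xi>" .
  qed
  also have "\<dots> = ennpowr A Q" by (simp add: nn_integral_cmult k1)
  also have "\<dots> < \<infinity>" using A by simp
  finally show ?thesis .
qed

text \<open>For \<open>q < p\<close> the inner function is replaced by its Poisson average over a band of radii
  comparable to \<open>r\<close>; the averages have a common kernel, so Jensen's inequality applies on each torus
  and no maximal function is needed.\<close>

lemma Poisson_band_le:
  fixes f :: "complex ^ 'n \<Rightarrow> complex"
  assumes f: "f \<in> hol_polydisc" and q: "0 < q" and r: "r \<in> unit_cube" and R: "R \<in> unit_cube"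
    and rR: "\<And>j. (1 + r $ j) / 2 \<le> R $ j" "\<And>j. R $ j \<le> (3 + r $ j) / 4" and \<xi>: "\<xi> \<in> unit_torus"
  shows "ennreal (norm (f (scale_vec r \<xi>)) powr q)
    \<le> 14 ^ CARD('n) * (\<integral>\<^sup>+\<eta>. ennreal (norm (f (scale_vec R (\<eta> * \<xi>))) powr q)
         * (\<Prod>j\<in>UNIV. ennreal (poisson (r $ j) ((1 + r $ j) / 2) (\<eta> $ j))) \<partial>torus_measure)"
proof -
  have r': "0 \<le> r $ j" "r $ j < 1" "R $ j < 1" for j
    using r R by (simp_all add: unit_cube_def)
  have m [measurable]: "(\<lambda>\<eta>. f (scale_vec R (\<eta> * \<xi>))) \<in> borel_measurable torus_measure"
    by (rule measurable_compose[OF measurable_unit_torus_rotate[OF \<xi>] measurable_hol_fixed[OF f R]])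
  have "ennreal (norm (f (scale_vec r \<xi>)) powr q)
     \<le> (\<integral>\<^sup>+\<eta>. (\<Prod>j\<in>UNIV. ennreal (poisson (r $ j) (R $ j) (\<eta> $ j))) * ennreal (norm (f (scale_vec R (\<eta> * \<xi>))) powr q) \<partial>torus_measure)"
    by (rule Poisson_torus_le[OF f q _ _ _ \<xi>]) (use r' half_less[OF r rR(1)] in auto)
  also have "\<dots> \<le> (\<integral>\<^sup>+\<eta>. (\<Prod>j\<in>(UNIV :: 'n set). ennreal (14 * poisson (r $ j) ((1 + r $ j) / 2) (\<eta> $ j))) * ennreal (norm (f (scale_vec R (\<eta> * \<xi>))) powr q) \<partial>torus_measure)"
    by (intro nn_integral_mono mult_right_mono prod_mono_ennreal ennreal_leI poisson_compare)
       (use r' rR in \<open>auto simp: unit_torus_def\<close>)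
  also have "\<dots> = (\<integral>\<^sup>+\<eta>. 14 ^ CARD('n) * (ennreal (norm (f (scale_vec R (\<eta> * \<xi>))) powr q)
         * (\<Prod>j\<in>UNIV. ennreal (poisson (r $ j) ((1 + r $ j) / 2) (\<eta> $ j)))) \<partial>torus_measure)"
  proof (intro nn_integral_cong)
    fix \<eta> :: "complex ^ 'n"
    have "ennreal (14 * poisson (r $ j) ((1 + r $ j) / 2) (\<eta> $ j)) = 14 * ennreal (poisson (r $ j) ((1 + r $ j) / 2) (\<eta> $ j))" for j
      using poisson_nonneg[of "r $ j" "(1 + r $ j) / 2" "\<eta> $ j"] r'[of j] by (simp add: ennreal_mult field_simps)
    then show "(\<Prod>j\<in>(UNIV :: 'n set). ennreal (14 * poisson (r $ j) ((1 + r $ j) / 2) (\<eta> $ j))) * ennreal (norm (f (scale_vec R (\<eta> * \<xi>))) powr q)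
      = 14 ^ CARD('n) * (ennreal (norm (f (scale_vec R (\<eta> * \<xi>))) powr q) * (\<Prod>j\<in>UNIV. ennreal (poisson (r $ j) ((1 + r $ j) / 2) (\<eta> $ j))))"
      by (simp add: prod.distrib mult_ac)
  qed
  also have "\<dots> = 14 ^ CARD('n) * (\<integral>\<^sup>+\<eta>. ennreal (norm (f (scale_vec R (\<eta> * \<xi>))) powr q)
         * (\<Prod>j\<in>UNIV. ennreal (poisson (r $ j) ((1 + r $ j) / 2) (\<eta> $ j))) \<partial>torus_measure)"
    by (rule nn_integral_cmult) measurable
  finally show ?thesis .
qed

lemma wt_band_le:
  fixes r R :: "real ^ 'n"
  assumes r: "r \<in> unit_cube" and rR: "\<And>j. (1 + r $ j) / 2 \<le> R $ j" "\<And>j. R $ j \<le> (3 + r $ j) / 4"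
  shows "wt r a \<le> ennreal ((4 powr \<bar>a\<bar>) ^ CARD('n)) * wt R a"
proof -
  have "ennreal ((1 - r $ j) powr a) \<le> ennreal (4 powr \<bar>a\<bar>) * ennreal ((1 - R $ j) powr a)" for j
  proof -
    define x where "x = 1 - R $ j"
    have r': "r $ j < 1" using r by (simp add: unit_cube_def)
    then have x: "0 < x" "1 - r $ j \<le> 4 * x" "x \<le> 1 - r $ j" using rR(1)[of j] rR(2)[of j] by (simp_all add: x_def field_simps)
    have "(1 - r $ j) powr a \<le> 4 powr \<bar>a\<bar> * x powr a"
    proof (cases "0 \<le> a")
      case True
      have "(1 - r $ j) powr a \<le> (4 * x) powr a" using x True r' by (intro powr_mono2) auto
      then show ?thesis using True x by (simp add: powr_mult)
    next
      case False
      have "(1 - r $ j) powr a \<le> x powr a" using x False by (intro powr_mono2') auto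
      also have "\<dots> \<le> 4 powr \<bar>a\<bar> * x powr a"
        using ge_one_powr_ge_zero[of 4 "\<bar>a\<bar>"] mult_right_mono[of 1 "4 powr \<bar>a\<bar>" "x powr a"] by simp
      finally show ?thesis .
    qed
    then show ?thesis by (simp add: x_def ennreal_leI flip: ennreal_mult)
  qed
  then have "wt r a \<le> (\<Prod>j\<in>(UNIV :: 'n set). ennreal (4 powr \<bar>a\<bar>) * ennreal ((1 - R $ j) powr a))"
    unfolding wt_prod by (intro prod_mono_ennreal)
  also have "\<dots> = ennreal ((4 powr \<bar>a\<bar>) ^ CARD('n)) * wt R a"
    by (simp add: prod.distrib wt_prod ennreal_power)
  finally show ?thesis .
qed

text \<open>With P = p/q, the power P of the band average \<open>b\<close> is split as b^(P-1) * b.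
  The first factor is bounded, up to weights, by u^(P-1), where \<open>u\<close> is the full inner
  integral; the second integrates back to \<open>u\<close>, which leaves the integral of u^P, that
  is the F-norm. The second index becomes p, since both integrations are then of the same power and
  may be interchanged.\<close>

lemma F_subset_A_gt:
  fixes f :: "complex ^ 'n \<Rightarrow> complex"
  assumes f: "f \<in> hol_polydisc" and q: "0 < q" "q < p" and fin: "F_norm_pow p q \<alpha> f < \<infinity>"
  shows "A_norm_pow p p \<alpha> f < \<infinity>"
proof -
  have p: "0 < p" using q by auto
  interpret pair_sigma_finite "cube_measure :: (real ^ 'n) measure" "torus_measure :: (complex ^ 'n) measure" ..
  interpret TT: pair_sigma_finite "torus_measure :: (complex ^ 'n) measure" "torus_measure :: (complex ^ 'n) measure" ..
  define P where "P = p / q"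
  have P: "1 \<le> P" using q by (simp add: P_def)
  have Pq: "q * P = p" using q by (simp add: P_def)
  define a where "a = \<alpha> * q - 1"
  define \<phi> where "\<phi> R \<xi> = ennreal (norm (f (scale_vec R \<xi>)) powr q)" for R \<xi>
  define u where "u \<xi> = (\<integral>\<^sup>+R. \<phi> R \<xi> * wt R a \<partial>cube_measure)" for \<xi>
  have [measurable]: "(\<lambda>(R, \<xi>). f (scale_vec R \<xi>)) \<in> borel_measurable (cube_measure \<Otimes>\<^sub>M torus_measure)"
    by (rule measurable_hol_cube_torus[OF f])
  have \<phi>m [measurable]: "(\<lambda>(R, \<xi>). \<phi> R \<xi>) \<in> borel_measurable (cube_measure \<Otimes>\<^sub>M torus_measure)"
    unfolding \<phi>_def by measurable
  have [measurable]: "u \<in> borel_measurable torus_measure"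
    unfolding u_def \<phi>_def by (rule F_inner_measurable[OF f])
  have \<phi>R [measurable]: "(\<lambda>R. \<phi> R \<xi>) \<in> borel_measurable cube_measure" if "\<xi> \<in> unit_torus" for \<xi>
  proof -
    have [measurable]: "(\<lambda>R. f (scale_vec R \<xi>)) \<in> borel_measurable cube_measure"
      by (rule measurable_hol_scale_vec[OF f]) (use that in auto)
    show ?thesis unfolding \<phi>_def by measurable
  qed
  define b where "b r \<xi> = (\<integral>\<^sup>+R. \<phi> R \<xi> * band r R \<partial>cube_measure)" for r \<xi>
  have bm: "b r \<in> borel_measurable torus_measure" if "r \<in> unit_cube" for r
  proof -
    have [measurable]: "(\<lambda>(\<xi>, R). \<phi> R \<xi>) \<in> borel_measurable (torus_measure \<Otimes>\<^sub>M cube_measure)"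
      using measurable_compose[OF measurable_pair_swap' \<phi>m] by (simp add: split_beta')
    have [measurable]: "band r \<in> borel_measurable cube_measure" by (rule measurable_band_right[OF that])
    show ?thesis unfolding b_def by (rule cube.borel_measurable_nn_integral) measurable
  qed
  note bandm = measurable_band_right
  define K where "K r \<eta> = (\<Prod>j\<in>UNIV. ennreal (poisson (r $ j) ((1 + r $ j) / 2) (\<eta> $ j)))" for r and \<eta> :: "complex ^ 'n"
  have Km [measurable]: "K r \<in> borel_measurable torus_measure" for r unfolding K_def by measurable
  have K1: "(\<integral>\<^sup>+\<eta>. K r \<eta> \<partial>torus_measure) = 1" if "r \<in> unit_cube" for r
  proof -
    have r': "0 \<le> r $ j" "r $ j < (1 + r $ j) / 2" for j using that by (auto simp: unit_cube_def field_simps)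
    have "(\<integral>\<^sup>+\<eta>. K r \<eta> \<partial>torus_measure) = (\<Prod>j\<in>(UNIV :: 'n set). \<integral>\<^sup>+u. ennreal (poisson (r $ j) ((1 + r $ j) / 2) u) \<partial>circle_measure)"
      unfolding K_def
      by (rule nn_integral_torus_prod[of "\<lambda>j u. ennreal (poisson (r $ j) ((1 + r $ j) / 2) u)"])
         (intro measurable_circle_borelI, measurable)
    then show ?thesis using r' by (simp add: nn_integral_poisson)
  qed
  define c where "c = (4 :: ennreal) ^ CARD('n) * 14 ^ CARD('n)"
  have c: "c < top" unfolding c_def by (simp add: power_less_top_ennreal ennreal_mult_less_top)
  have point: "\<phi> r \<xi> * wt r 1 \<le> c * (\<integral>\<^sup>+\<eta>. b r (\<eta> * \<xi>) * K r \<eta> \<partial>torus_measure)"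
    if r: "r \<in> unit_cube" and \<xi>: "\<xi> \<in> unit_torus" for r \<xi>
  proof -
    have rot: "(\<lambda>x. (fst x, snd x * \<xi>)) \<in> cube_measure \<Otimes>\<^sub>M torus_measure \<rightarrow>\<^sub>M cube_measure \<Otimes>\<^sub>M torus_measure"
      using \<xi> by (intro measurable_Pair measurable_torus_mult) auto
    have [measurable]: "(\<lambda>(R, \<eta>). \<phi> R (\<eta> * \<xi>)) \<in> borel_measurable (cube_measure \<Otimes>\<^sub>M torus_measure)"
      using measurable_compose[OF rot \<phi>m] by (simp add: split_beta')
    have [measurable]: "band r \<in> borel_measurable cube_measure" by (rule bandm[OF r])
    have "\<phi> r \<xi> * wt r 1 \<le> 4 ^ CARD('n) * (\<integral>\<^sup>+R. (14 ^ CARD('n) * (\<integral>\<^sup>+\<eta>. \<phi> R (\<eta> * \<xi>) * K r \<eta> \<partial>torus_measure)) * band r R \<partial>cube_measure)"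
    proof (rule band_integral_ge[OF _ r])
      show "(\<lambda>R. 14 ^ CARD('n) * (\<integral>\<^sup>+\<eta>. \<phi> R (\<eta> * \<xi>) * K r \<eta> \<partial>torus_measure)) \<in> borel_measurable cube_measure"
        by measurable
      show "\<phi> r \<xi> \<le> 14 ^ CARD('n) * (\<integral>\<^sup>+\<eta>. \<phi> R (\<eta> * \<xi>) * K r \<eta> \<partial>torus_measure)"
        if "R \<in> unit_cube" "\<And>j. (1 + r $ j) / 2 \<le> R $ j" "\<And>j. R $ j \<le> (3 + r $ j) / 4" for R
        unfolding \<phi>_def K_def by (rule Poisson_band_le[OF f q(1) r that \<xi>])
    qed
    also have "(\<integral>\<^sup>+R. (14 ^ CARD('n) * (\<integral>\<^sup>+\<eta>. \<phi> R (\<eta> * \<xi>) * K r \<eta> \<partial>torus_measure)) * band r R \<partial>cube_measure)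
      = 14 ^ CARD('n) * (\<integral>\<^sup>+R. (\<integral>\<^sup>+\<eta>. \<phi> R (\<eta> * \<xi>) * K r \<eta> \<partial>torus_measure) * band r R \<partial>cube_measure)"
      by (subst nn_integral_cmult[symmetric]) (auto simp: mult.assoc)
    also have "(\<integral>\<^sup>+R. (\<integral>\<^sup>+\<eta>. \<phi> R (\<eta> * \<xi>) * K r \<eta> \<partial>torus_measure) * band r R \<partial>cube_measure)
      = (\<integral>\<^sup>+R. \<integral>\<^sup>+\<eta>. (\<phi> R (\<eta> * \<xi>) * band r R) * K r \<eta> \<partial>torus_measure \<partial>cube_measure)"
    proof (rule nn_integral_cong)
      fix R :: "real ^ 'n" assume "R \<in> space cube_measure"
      then have "(\<lambda>\<eta>. \<phi> R (\<eta> * \<xi>)) \<in> borel_measurable torus_measure"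
        unfolding \<phi>_def using measurable_compose[OF measurable_unit_torus_rotate[OF \<xi>] measurable_hol_fixed[OF f]] by simp
      then show "(\<integral>\<^sup>+\<eta>. \<phi> R (\<eta> * \<xi>) * K r \<eta> \<partial>torus_measure) * band r R = (\<integral>\<^sup>+\<eta>. (\<phi> R (\<eta> * \<xi>) * band r R) * K r \<eta> \<partial>torus_measure)"
        by (subst nn_integral_multc[symmetric]) (auto simp: mult_ac)
    qed
    also have "\<dots> = (\<integral>\<^sup>+\<eta>. \<integral>\<^sup>+R. (\<phi> R (\<eta> * \<xi>) * band r R) * K r \<eta> \<partial>cube_measure \<partial>torus_measure)"
      by (rule Fubini'[symmetric]) measurable
    also have "\<dots> = (\<integral>\<^sup>+\<eta>. b r (\<eta> * \<xi>) * K r \<eta> \<partial>torus_measure)"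
    proof (rule nn_integral_cong)
      fix \<eta> :: "complex ^ 'n" assume "\<eta> \<in> space torus_measure"
      then have [measurable]: "(\<lambda>R. \<phi> R (\<eta> * \<xi>)) \<in> borel_measurable cube_measure"
        using \<xi> by (intro \<phi>R) (simp add: unit_torus_def norm_mult)
      show "(\<integral>\<^sup>+R. (\<phi> R (\<eta> * \<xi>) * band r R) * K r \<eta> \<partial>cube_measure) = b r (\<eta> * \<xi>) * K r \<eta>"
        unfolding b_def by (rule nn_integral_multc) measurable
    qed
    finally show ?thesis by (simp add: c_def mult.assoc)
  qed
  define C where "C = ennpowr c P"
  have mean: "power_mean p f r * wt r P \<le> C * (\<integral>\<^sup>+\<xi>. ennpowr (b r \<xi>) P \<partial>torus_measure)" if r: "r \<in> unit_cube" for r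
  proof -
    have [measurable]: "b r \<in> borel_measurable torus_measure" by (rule bm[OF r])
    have brot [measurable]: "(\<lambda>(\<xi>, \<eta>). b r (\<eta> * \<xi>)) \<in> borel_measurable (torus_measure \<Otimes>\<^sub>M torus_measure)"
      unfolding split_beta' by (rule measurable_compose[OF _ bm[OF r]]) auto
    have [measurable]: "(\<lambda>\<xi>. f (scale_vec r \<xi>)) \<in> borel_measurable torus_measure"
      by (rule measurable_hol_fixed[OF f r])
    have "power_mean p f r * wt r P = (\<integral>\<^sup>+\<xi>. ennpowr (\<phi> r \<xi> * wt r 1) P \<partial>torus_measure)"
      by (simp add: power_mean_def nn_integral_multc[symmetric] ennpowr_mult ennpowr_radial_weight \<phi>_def ennpowr_ennreal powr_powr Pq)
    also have "\<dots> \<le> (\<integral>\<^sup>+\<xi>. C * (\<integral>\<^sup>+\<eta>. ennpowr (b r (\<eta> * \<xi>)) P * K r \<eta> \<partial>torus_measure) \<partial>torus_measure)"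
    proof (rule nn_integral_mono)
      fix \<xi> :: "complex ^ 'n" assume "\<xi> \<in> space torus_measure"
      then have \<xi>: "\<xi> \<in> unit_torus" by simp
      have [measurable]: "(\<lambda>\<eta>. b r (\<eta> * \<xi>)) \<in> borel_measurable torus_measure"
        by (rule measurable_compose[OF measurable_unit_torus_rotate[OF \<xi>] bm[OF r]])
      have "ennpowr (\<phi> r \<xi> * wt r 1) P \<le> ennpowr (c * (\<integral>\<^sup>+\<eta>. b r (\<eta> * \<xi>) * K r \<eta> \<partial>torus_measure)) P"
        using P by (intro ennpowr_mono point r \<xi>) auto
      also have "\<dots> = C * ennpowr (\<integral>\<^sup>+\<eta>. b r (\<eta> * \<xi>) * K r \<eta> \<partial>torus_measure) P"
        by (simp add: ennpowr_mult C_def)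
      also have "\<dots> \<le> C * (\<integral>\<^sup>+\<eta>. ennpowr (b r (\<eta> * \<xi>)) P * K r \<eta> \<partial>torus_measure)"
        by (intro mult_left_mono Jensen_ennpowr P) (auto simp: K1[OF r])
      finally show "ennpowr (\<phi> r \<xi> * wt r 1) P \<le> C * (\<integral>\<^sup>+\<eta>. ennpowr (b r (\<eta> * \<xi>)) P * K r \<eta> \<partial>torus_measure)" .
    qed
    also have "\<dots> = C * (\<integral>\<^sup>+\<xi>. \<integral>\<^sup>+\<eta>. ennpowr (b r (\<eta> * \<xi>)) P * K r \<eta> \<partial>torus_measure \<partial>torus_measure)"
      by (rule nn_integral_cmult) measurable
    also have "(\<integral>\<^sup>+\<xi>. \<integral>\<^sup>+\<eta>. ennpowr (b r (\<eta> * \<xi>)) P * K r \<eta> \<partial>torus_measure \<partial>torus_measure)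
      = (\<integral>\<^sup>+\<eta>. \<integral>\<^sup>+\<xi>. ennpowr (b r (\<eta> * \<xi>)) P * K r \<eta> \<partial>torus_measure \<partial>torus_measure)"
      by (rule TT.Fubini'[symmetric]) measurable
    also have "\<dots> = (\<integral>\<^sup>+\<eta>. (\<integral>\<^sup>+\<xi>. ennpowr (b r \<xi>) P \<partial>torus_measure) * K r \<eta> \<partial>torus_measure)"
    proof (rule nn_integral_cong)
      fix \<eta> :: "complex ^ 'n" assume \<eta>: "\<eta> \<in> space torus_measure"
      have "(\<lambda>\<xi>. \<eta> * \<xi>) \<in> torus_measure \<rightarrow>\<^sub>M torus_measure"
        by (intro measurable_torus_mult measurable_const measurable_ident_sets) (use \<eta> in simp_all)
      then have [measurable]: "(\<lambda>\<xi>. b r (\<eta> * \<xi>)) \<in> borel_measurable torus_measure"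
        by (rule measurable_compose[OF _ bm[OF r]])
      have "(\<integral>\<^sup>+\<xi>. ennpowr (b r (\<eta> * \<xi>)) P * K r \<eta> \<partial>torus_measure) = (\<integral>\<^sup>+\<xi>. ennpowr (b r (\<eta> * \<xi>)) P \<partial>torus_measure) * K r \<eta>"
        by (rule nn_integral_multc) measurable
      also have "(\<integral>\<^sup>+\<xi>. ennpowr (b r (\<eta> * \<xi>)) P \<partial>torus_measure) = (\<integral>\<^sup>+\<xi>. ennpowr (b r \<xi>) P \<partial>torus_measure)"
        using \<eta> by (intro nn_integral_torus_rotate) auto
      finally show "(\<integral>\<^sup>+\<xi>. ennpowr (b r (\<eta> * \<xi>)) P * K r \<eta> \<partial>torus_measure) = (\<integral>\<^sup>+\<xi>. ennpowr (b r \<xi>) P \<partial>torus_measure) * K r \<eta>" .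
    qed
    also have "\<dots> = (\<integral>\<^sup>+\<xi>. ennpowr (b r \<xi>) P \<partial>torus_measure)"
      by (simp add: nn_integral_cmult K1[OF r])
    finally show ?thesis .
  qed
  \<comment> \<open>The weight is nearly constant on a band, up to the factor \<open>d\<close>, so
    the weighted band average is at most the full inner integral \<open>u\<close>.\<close>
  define d where "d = ennreal ((4 powr \<bar>a\<bar>) ^ CARD('n))"
  have b_le: "b r \<xi> * wt r a \<le> d * u \<xi>" if r: "r \<in> unit_cube" and \<xi>: "\<xi> \<in> unit_torus" for r \<xi>
  proof -
    have [measurable]: "(\<lambda>R. \<phi> R \<xi>) \<in> borel_measurable cube_measure" "band r \<in> borel_measurable cube_measure"
      using \<phi>R[OF \<xi>] bandm[OF r] by auto
    have "b r \<xi> * wt r a = (\<integral>\<^sup>+R. (\<phi> R \<xi> * band r R) * wt r a \<partial>cube_measure)"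
      unfolding b_def by (rule nn_integral_multc[symmetric]) measurable
    also have "\<dots> \<le> (\<integral>\<^sup>+R. d * (\<phi> R \<xi> * wt R a) \<partial>cube_measure)"
    proof (rule nn_integral_mono)
      fix R :: "real ^ 'n"
      show "(\<phi> R \<xi> * band r R) * wt r a \<le> d * (\<phi> R \<xi> * wt R a)"
        using band_cases[of r R] wt_band_le[OF r, of R a] by (auto simp: d_def mult.left_commute intro!: mult_left_mono)
    qed
    also have "\<dots> = d * u \<xi>"
      unfolding u_def by (rule nn_integral_cmult) measurable
    finally show ?thesis .
  qed
  define G where "G R = (\<integral>\<^sup>+\<xi>. ennpowr (u \<xi>) (P - 1) * \<phi> R \<xi> \<partial>torus_measure)" for R
  have Gm [measurable]: "G \<in> borel_measurable cube_measure"
    unfolding G_def by (rule torus.borel_measurable_nn_integral) measurable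
  define D where "D = ennpowr d (P - 1)"
  have H: "(power_mean p f r * wt r (\<alpha> * p - \<alpha> * q)) * wt r 1 \<le> C * D * (\<integral>\<^sup>+R. G R * band r R \<partial>cube_measure)" if r: "r \<in> unit_cube" for r
  proof -
    have [measurable]: "b r \<in> borel_measurable torus_measure" "band r \<in> borel_measurable cube_measure"
      using bm[OF r] bandm[OF r] by auto
    \<comment> \<open>P units of weight pay for replacing |f|^p by the power P of the band average,
      and a(P - 1) units are those needed to bound the factor b^(P-1).\<close>
    have "\<alpha> * p - \<alpha> * q + 1 = P + a * (P - 1)"
      using q by (simp add: P_def a_def field_simps)
    then have "(power_mean p f r * wt r (\<alpha> * p - \<alpha> * q)) * wt r 1 = (power_mean p f r * wt r P) * wt r (a * (P - 1))"
      by (simp only: mult.assoc flip: ennreal_radial_weight_add)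
    also have "\<dots> \<le> C * (\<integral>\<^sup>+\<xi>. ennpowr (b r \<xi>) P \<partial>torus_measure) * wt r (a * (P - 1))"
      by (intro mult_right_mono mean r) auto
    also have "\<dots> = C * (\<integral>\<^sup>+\<xi>. ennpowr (b r \<xi>) P * wt r (a * (P - 1)) \<partial>torus_measure)"
      by (simp add: nn_integral_multc mult.assoc)
    also have "\<dots> \<le> C * (\<integral>\<^sup>+\<xi>. D * (ennpowr (u \<xi>) (P - 1) * b r \<xi>) \<partial>torus_measure)"
    proof (intro mult_left_mono nn_integral_mono)
      fix \<xi> :: "complex ^ 'n" assume "\<xi> \<in> space torus_measure"
      then have \<xi>: "\<xi> \<in> unit_torus" by simp
      have "ennpowr (b r \<xi>) P = ennpowr (b r \<xi>) 1 * ennpowr (b r \<xi>) (P - 1)" by (simp flip: ennpowr_add del: ennpowr_1)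
      then have "ennpowr (b r \<xi>) P * wt r (a * (P - 1)) = b r \<xi> * ennpowr (b r \<xi> * wt r a) (P - 1)"
        by (simp add: ennpowr_mult ennpowr_radial_weight mult.assoc)
      also have "\<dots> \<le> b r \<xi> * ennpowr (d * u \<xi>) (P - 1)"
        using P by (intro mult_left_mono ennpowr_mono b_le r \<xi>) auto
      finally show "ennpowr (b r \<xi>) P * wt r (a * (P - 1)) \<le> D * (ennpowr (u \<xi>) (P - 1) * b r \<xi>)"
        by (simp add: ennpowr_mult D_def mult_ac)
    qed simp
    also have "\<dots> = C * D * (\<integral>\<^sup>+\<xi>. ennpowr (u \<xi>) (P - 1) * b r \<xi> \<partial>torus_measure)"
      by (simp add: nn_integral_cmult mult.assoc)
    also have "(\<integral>\<^sup>+\<xi>. ennpowr (u \<xi>) (P - 1) * b r \<xi> \<partial>torus_measure)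
      = (\<integral>\<^sup>+\<xi>. \<integral>\<^sup>+R. ennpowr (u \<xi>) (P - 1) * (\<phi> R \<xi> * band r R) \<partial>cube_measure \<partial>torus_measure)"
      unfolding b_def by (intro nn_integral_cong nn_integral_cmult[symmetric] borel_measurable_times_ennreal bandm[OF r] \<phi>R) simp
    also have "\<dots> = (\<integral>\<^sup>+R. \<integral>\<^sup>+\<xi>. ennpowr (u \<xi>) (P - 1) * (\<phi> R \<xi> * band r R) \<partial>torus_measure \<partial>cube_measure)"
      by (rule Fubini') measurable
    also have "\<dots> = (\<integral>\<^sup>+R. G R * band r R \<partial>cube_measure)"
    proof (rule nn_integral_cong)
      fix R :: "real ^ 'n" assume "R \<in> space cube_measure"
      then have "(\<lambda>\<xi>. f (scale_vec R \<xi>)) \<in> borel_measurable torus_measure"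
        using measurable_hol_fixed[OF f] by simp
      then have [measurable]: "\<phi> R \<in> borel_measurable torus_measure"
        unfolding \<phi>_def by measurable
      show "(\<integral>\<^sup>+\<xi>. ennpowr (u \<xi>) (P - 1) * (\<phi> R \<xi> * band r R) \<partial>torus_measure) = G R * band r R"
        unfolding G_def by (subst nn_integral_multc[symmetric]) (auto simp: mult.assoc)
    qed
    finally show ?thesis .
  qed
  have [measurable]: "power_mean p f \<in> borel_measurable cube_measure" by (rule measurable_power_mean[OF f])
  have "A_norm_pow p p \<alpha> f = (\<integral>\<^sup>+r. (power_mean p f r * wt r (\<alpha> * p - \<alpha> * q)) * wt r a \<partial>cube_measure)"
    unfolding A_norm_pow_eq[OF p] a_def
    using p by (intro nn_integral_cong) (simp add: mult.assoc flip: ennreal_radial_weight_add)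
  also have "\<dots> \<le> C * D * (ennreal ((2 * 4 powr \<bar>a - 1\<bar>) ^ CARD('n)) * (\<integral>\<^sup>+R. G R * wt R a \<partial>cube_measure))"
    by (rule averaging_le) (use H in auto)
  also have "(\<integral>\<^sup>+R. G R * wt R a \<partial>cube_measure) = (\<integral>\<^sup>+R. \<integral>\<^sup>+\<xi>. ennpowr (u \<xi>) (P - 1) * (\<phi> R \<xi> * wt R a) \<partial>torus_measure \<partial>cube_measure)"
  proof (rule nn_integral_cong)
    fix R :: "real ^ 'n" assume "R \<in> space cube_measure"
    then have "(\<lambda>\<xi>. f (scale_vec R \<xi>)) \<in> borel_measurable torus_measure"
      using measurable_hol_fixed[OF f] by simp
    then have [measurable]: "\<phi> R \<in> borel_measurable torus_measure"
      unfolding \<phi>_def by measurable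
    show "G R * wt R a = (\<integral>\<^sup>+\<xi>. ennpowr (u \<xi>) (P - 1) * (\<phi> R \<xi> * wt R a) \<partial>torus_measure)"
      unfolding G_def by (subst nn_integral_multc[symmetric]) (auto simp: mult.assoc)
  qed
  also have "\<dots> = (\<integral>\<^sup>+\<xi>. \<integral>\<^sup>+R. ennpowr (u \<xi>) (P - 1) * (\<phi> R \<xi> * wt R a) \<partial>cube_measure \<partial>torus_measure)"
    by (rule Fubini'[symmetric]) measurable
  also have "\<dots> = (\<integral>\<^sup>+\<xi>. ennpowr (u \<xi>) (P - 1) * u \<xi> \<partial>torus_measure)"
    unfolding u_def by (intro nn_integral_cong nn_integral_cmult borel_measurable_times_ennreal \<phi>R) auto
  also have "\<dots> = (\<integral>\<^sup>+\<xi>. ennpowr (u \<xi>) P \<partial>torus_measure)"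
  proof (intro nn_integral_cong)
    fix \<xi>
    have "ennpowr (u \<xi>) (P - 1 + 1) = ennpowr (u \<xi>) (P - 1) * ennpowr (u \<xi>) 1" by (rule ennpowr_add)
    then show "ennpowr (u \<xi>) (P - 1) * u \<xi> = ennpowr (u \<xi>) P" by simp
  qed
  also have "\<dots> = F_norm_pow p q \<alpha> f"
    by (simp add: F_norm_pow_eq u_def \<phi>_def a_def P_def)
  also have "C * D * (ennreal ((2 * 4 powr \<bar>a - 1\<bar>) ^ CARD('n)) * F_norm_pow p q \<alpha> f) < \<infinity>"
    using fin c by (simp add: C_def D_def d_def ennreal_mult_less_top)
  finally show ?thesis .
qed

text \<open>According to the order of p and q the function lies in A with second index q or p. Both
  are at most s, and this is where the maximum in the hypothesis is used.\<close>

lemma F_space_embedding: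
  fixes f :: "complex ^ 'n \<Rightarrow> complex"
  assumes f: "f \<in> hol_polydisc" and p: "0 < p" "p \<le> t" and q: "0 < q" and s: "max p q \<le> s" and \<alpha>: "0 < \<alpha>"
    and fin: "F_norm_pow p q \<alpha> f < \<infinity>"
  shows "A_norm_pow t s (\<alpha> + 1 / p - 1 / t) f < \<infinity>"
proof (cases "p \<le> q")
  case True
  then show ?thesis
    using F_subset_A_le[OF f p(1) True fin] s by (intro A_space_embedding[OF f p q _ \<alpha>]) auto
next
  case False
  then show ?thesis
    using F_subset_A_gt[OF f q _ fin] s by (intro A_space_embedding[OF f p p(1) _ \<alpha>]) auto
qed

section \<open>The fractional derivative and the multiplier transform\<close>

text \<open>For integer m this is the Gamma quotient of the fractional derivative, and at the same
  time the coefficient sequence of the product of the (1 - z_j)^(-(m+1)). The second reading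
  provides the test functions of the necessity part.\<close>

definition binom_coeff :: "nat \<Rightarrow> nat ^ 'n \<Rightarrow> real" where
  "binom_coeff m k = (\<Prod>j\<in>UNIV. real ((k $ j + m) choose m))"

lemma binom_coeff_pos: "0 < binom_coeff m k"
  unfolding binom_coeff_def by (intro prod_pos) simp

lemma frac_deriv_eq:
  "frac_deriv (real m) f z = (\<Sum>\<^sub>\<infinity>k. of_real (binom_coeff m k) * power_coeffs f k * monom_pow z k)"
proof -
  have "Gamma (real k + real m + 1) / (Gamma (real m + 1) * Gamma (real k + 1)) = real ((k + m) choose m)" for k
    using Gamma_fact[of "k + m", where 'a = real] Gamma_fact[of m, where 'a = real] Gamma_fact[of k, where 'a = real]
    by (simp add: binomial_fact add_ac)
  then show ?thesis
    by (simp only: frac_deriv_def binom_coeff_def)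
qed

lemma negative_binomial_series:
  fixes x :: complex
  assumes "norm x < 1"
  shows "(\<lambda>k. norm (of_nat ((k + m) choose m) * x ^ k)) summable_on UNIV"
    and "(\<Sum>\<^sub>\<infinity>k. of_nat ((k + m) choose m) * x ^ k) = 1 / (1 - x) ^ (m + 1)"
proof -
  have sums: "(\<lambda>k. of_nat ((k + m) choose m) * x ^ k) sums (1 / (1 - x) ^ (m + 1))" if "norm x < 1" for x :: complex
  proof -
    have "(\<lambda>k. ((- of_nat (m + 1)) gchoose k) * (- x) ^ k) sums (1 + - x) powr (- of_nat (m + 1))"
      by (rule gen_binomial_complex) (use that in simp)
    moreover have "((- of_nat (m + 1)) gchoose k) * (- x) ^ k = of_nat ((k + m) choose m) * x ^ k" for k
    proof -
      have "(- of_nat (m + 1) :: complex) gchoose k = (- 1) ^ k * (of_nat (k + m) gchoose k)"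
        using gbinomial_minus[of "of_nat (m + 1) :: complex" k] by (simp add: add_ac)
      also have "of_nat (k + m) gchoose k = (of_nat ((k + m) choose k) :: complex)"
        by (rule binomial_gbinomial[symmetric])
      also have "(k + m) choose k = (k + m) choose m"
        by (subst binomial_symmetric) auto
      finally have "((- of_nat (m + 1)) gchoose k) * (- x) ^ k = of_nat ((k + m) choose m) * ((- 1) ^ k * (- x) ^ k)"
        by (simp add: mult_ac)
      then show ?thesis by (simp flip: power_mult_distrib)
    qed
    moreover have "(1 + - x) powr (- of_nat (m + 1)) = 1 / (1 - x) ^ (m + 1)"
    proof -
      have "1 - x \<noteq> 0" using that by auto
      then have "(1 - x) powr (of_nat (m + 1)) = (1 - x) ^ (m + 1)" by (intro powr_nat') simp
      then show ?thesis by (simp only: powr_minus diff_conv_add_uminus[symmetric] inverse_eq_divide)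
    qed
    ultimately show ?thesis by simp
  qed
  have "summable (\<lambda>k. complex_of_real (real ((k + m) choose m) * norm x ^ k))"
    using sums[of "of_real (norm x)"] assms by (auto simp: sums_iff)
  then have "summable (\<lambda>k. real ((k + m) choose m) * norm x ^ k)"
    by (simp only: summable_of_real_iff)
  then have s: "summable (\<lambda>k. norm (of_nat ((k + m) choose m) * x ^ k))"
    by (simp add: norm_mult norm_power)
  then show "(\<lambda>k. norm (of_nat ((k + m) choose m) * x ^ k)) summable_on UNIV"
    by (subst summable_on_UNIV_nonneg_real_iff) auto
  show "(\<Sum>\<^sub>\<infinity>k. of_nat ((k + m) choose m) * x ^ k) = 1 / (1 - x) ^ (m + 1)"
    by (rule infsumI, rule norm_summable_imp_has_sum[OF s sums[OF assms]])
qed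

lemma has_sum_binom_coeff:
  fixes x :: "'n::finite \<Rightarrow> complex"
  assumes "\<And>j. norm (x j) < 1"
  shows "((\<lambda>k :: nat ^ 'n. of_real (binom_coeff m k) * (\<Prod>j\<in>UNIV. x j ^ (k $ j))) has_sum (\<Prod>j\<in>UNIV. 1 / (1 - x j) ^ (m + 1))) UNIV"
  using has_sum_prod_vec(2)[of "\<lambda>j k. of_nat ((k + m) choose m) * x j ^ k"] negative_binomial_series[OF assms]
  by (simp add: binom_coeff_def prod.distrib)

lemma subexponential_binom_coeff: "subexponential (\<lambda>k :: nat ^ 'n. of_real (binom_coeff m k))"
proof (rule has_power_series_subexponential)
  show "has_power_series (\<lambda>z :: complex ^ 'n. \<Prod>j\<in>UNIV. 1 / (1 - z $ j) ^ (m + 1)) (\<lambda>k. of_real (binom_coeff m k))"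
    unfolding has_power_series_def monom_pow_def
    by (intro ballI has_sum_binom_coeff) (simp add: polydisc_def)
qed

lemma has_power_series_frac_deriv:
  assumes "has_power_series g c"
  shows "has_power_series (frac_deriv (real m) g) (\<lambda>k. of_real (binom_coeff m k) * c k)"
  unfolding frac_deriv_eq[abs_def] power_coeffs_eqI[OF assms]
  by (intro has_power_series_infsum subexponential_mult subexponential_binom_coeff has_power_series_subexponential[OF assms])

section \<open>Beta integrals and the integral formula for a coefficient multiplier\<close>

lemma integral_unit_interval_power:
  "(\<integral>x. x ^ n \<partial>unit_interval_measure) = 1 / real (n + 1)"
proof -
  have "(\<integral>x. x ^ n \<partial>unit_interval_measure) = (\<integral>x. indicator {0..<1} x *\<^sub>R x ^ n \<partial>lborel)"
    unfolding unit_interval_measure_def by (rule integral_restrict_space) simp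
  also have "\<dots> = (\<integral>x. x ^ n * indicator {0..1} x \<partial>lborel)"
  proof (rule integral_cong_AE)
    show "AE x in lborel. indicator {0..<1} x *\<^sub>R x ^ n = x ^ n * indicator {0..1::real} x"
      using AE_lborel_singleton[of 1] by eventually_elim (auto simp: indicator_def)
  qed auto
  also have "\<dots> = 1 / real (n + 1)"
    by (subst integral_power) auto
  finally show ?thesis .
qed

lemma integrable_unit_interval_bounded:
  fixes h :: "real \<Rightarrow> 'a::{banach, second_countable_topology}"
  assumes "h \<in> borel_measurable borel" "\<And>x. 0 \<le> x \<Longrightarrow> x < 1 \<Longrightarrow> norm (h x) \<le> B"
  shows "integrable unit_interval_measure h"
  by (rule unit_interval.integrable_const_bound[where B = B])
     (use assms in \<open>auto intro!: AE_I2 measurable_unit_intervalI\<close>)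

text \<open>Half the Beta integral B(k + 1, m + 1) after the substitution x^2. The recursion (1 -
  x^2)^(m+1) = (1 - x^2)^m - x^2 (1 - x^2)^m relates m + 1 at k to m at k and at k + 1, so the
  induction is over all k.\<close>

lemma integral_unit_interval_beta:
  "(\<integral>x. x ^ (2 * k + 1) * (1 - x\<^sup>2) ^ m \<partial>unit_interval_measure) = fact k * fact m / (2 * fact (k + m + 1))"
proof (induction m arbitrary: k)
  case 0
  have "(\<integral>x. x ^ (2 * k + 1) \<partial>unit_interval_measure) = 1 / (2 * real k + 2)"
    by (subst integral_unit_interval_power) (simp add: add_ac)
  also have "\<dots> = fact k * fact 0 / (2 * fact (k + 0 + 1))"
    by (simp add: divide_simps)
  finally show ?case by simp
next
  case (Suc m)
  have int: "integrable unit_interval_measure (\<lambda>x. x ^ i * (1 - x\<^sup>2) ^ m)" for i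
  proof (rule integrable_unit_interval_bounded[where B = 1])
    show "norm (x ^ i * (1 - x\<^sup>2) ^ m) \<le> 1" if "0 \<le> x" "x < 1" for x :: real
      using that by (auto simp: norm_mult norm_power abs_square_le_1 intro!: mult_le_one power_le_one)
  qed measurable
  have "(\<integral>x. x ^ (2 * k + 1) * (1 - x\<^sup>2) ^ Suc m \<partial>unit_interval_measure)
     = (\<integral>x. x ^ (2 * k + 1) * (1 - x\<^sup>2) ^ m - x ^ (2 * Suc k + 1) * (1 - x\<^sup>2) ^ m \<partial>unit_interval_measure)"
    by (intro Bochner_Integration.integral_cong refl) (simp add: power2_eq_square algebra_simps)
  also have "\<dots> = (\<integral>x. x ^ (2 * k + 1) * (1 - x\<^sup>2) ^ m \<partial>unit_interval_measure) - (\<integral>x. x ^ (2 * Suc k + 1) * (1 - x\<^sup>2) ^ m \<partial>unit_interval_measure)"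
    by (rule Bochner_Integration.integral_diff[OF int int])
  also have "\<dots> = fact k * fact m / (2 * fact (k + m + 1)) - fact (Suc k) * fact m / (2 * fact (Suc k + m + 1))"
    unfolding Suc.IH ..
  also have "\<dots> = fact k * fact (Suc m) / (2 * fact (k + Suc m + 1))"
  proof -
    define F :: real where "F = fact (k + m + 1)"
    have F: "F \<noteq> 0" by (simp add: F_def)
    have 1: "fact (Suc k + m + 1) = (real k + real m + 2) * F" "fact (k + Suc m + 1) = (real k + real m + 2) * F"
      unfolding F_def using fact_Suc[of "k + m + 1", where 'a = real] by (simp_all add: add_ac)
    have 2: "fact (Suc k) = (real k + 1) * fact k" "fact (Suc m) = (real m + 1) * fact m"
      by (simp_all add: add_ac)
    have "real k + real m + 2 \<noteq> 0" by linarith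
    then show ?thesis unfolding 1 2 F_def[symmetric] using F by (simp add: divide_simps) (simp add: algebra_simps)
  qed
  finally show ?case .
qed

lemma abs_scaled_le: "0 \<le> y \<Longrightarrow> y \<le> 1 \<Longrightarrow> \<bar>2 * real m * y\<bar> \<le> 2 * real m"
  by (simp add: abs_mult mult_left_le)

text \<open>The weight 2m \<rho> (1 - \<rho>^2)^(m-1) is the one whose moments of order 2k are the
  reciprocals of the coefficients of D^m. In the exponent 2k + 1, one k comes from each of two power
  series and 1 from the weight.\<close>

lemma integral_radial_weight_power:
  assumes m: "1 \<le> m"
  shows "(\<integral>\<rho>. (\<Prod>j\<in>UNIV. complex_of_real (2 * real m * \<rho> $ j ^ (2 * k $ j + 1) * (1 - (\<rho> $ j)\<^sup>2) ^ (m - 1))) \<partial>cube_measure)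
     = 1 / of_real (binom_coeff m k)"
proof -
  have one: "(\<integral>x. complex_of_real (2 * real m * x ^ (2 * i + 1) * (1 - x\<^sup>2) ^ (m - 1)) \<partial>unit_interval_measure) = 1 / of_nat ((i + m) choose m)" for i
  proof -
    have "(\<integral>x. 2 * real m * x ^ (2 * i + 1) * (1 - x\<^sup>2) ^ (m - 1) \<partial>unit_interval_measure)
        = 2 * real m * (\<integral>x. x ^ (2 * i + 1) * (1 - x\<^sup>2) ^ (m - 1) \<partial>unit_interval_measure)"
      by (simp only: mult.assoc integral_mult_right_zero)
    also have "\<dots> = 2 * real m * (fact i * fact (m - 1) / (2 * fact (i + m)))"
      unfolding integral_unit_interval_beta using m by simp
    also have "\<dots> = fact i * fact m / fact (i + m)"
      using m fact_reduce[of m, where 'a = real] by (simp add: field_simps)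
    also have "\<dots> = 1 / real ((i + m) choose m)"
      using binomial_fact[of m "i + m", where 'a = real] by simp
    finally show ?thesis
      by (simp only: integral_complex_of_real) simp
  qed
  have "integrable unit_interval_measure (\<lambda>x. complex_of_real (2 * real m * x ^ (2 * i + 1) * (1 - x\<^sup>2) ^ (m - 1)))" for i
  proof (rule integrable_unit_interval_bounded[where B = "2 * real m"])
    show "norm (complex_of_real (2 * real m * x ^ (2 * i + 1) * (1 - x\<^sup>2) ^ (m - 1))) \<le> 2 * real m" if "0 \<le> x" "x < 1" for x :: real
    proof -
      have "x ^ (2 * i + 1) * (1 - x\<^sup>2) ^ (m - 1) \<le> 1" "0 \<le> x ^ (2 * i + 1) * (1 - x\<^sup>2) ^ (m - 1)"
        using that by (auto simp: abs_square_le_1 power_le_one intro!: mult_le_one)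
      from abs_scaled_le[OF this(2,1), of m] show ?thesis by (simp only: norm_of_real mult.assoc)
    qed
  qed measurable
  then show ?thesis
    by (subst integral_cube_prod[of "\<lambda>j x. complex_of_real (2 * real m * x ^ (2 * k $ j + 1) * (1 - x\<^sup>2) ^ (m - 1))"])
       (auto simp only: one binom_coeff_def of_real_prod of_real_of_nat_eq prod_dividef prod.neutral_const)
qed

definition cnj_vec :: "complex ^ 'n \<Rightarrow> complex ^ 'n" where
  "cnj_vec z = (\<chi> j. cnj (z $ j))"

lemma cnj_vec_nth [simp]: "cnj_vec z $ j = cnj (z $ j)"
  by (simp add: cnj_vec_def)

lemma monom_pow_cnj_vec: "monom_pow (cnj_vec z) k = cnj (monom_pow z k)"
  by (simp add: monom_pow_def)

lemma cnj_vec_torus: "cnj_vec \<xi> \<in> unit_torus \<longleftrightarrow> \<xi> \<in> unit_torus"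
  by (simp add: unit_torus_def)

lemma times_torus: "\<xi> \<in> unit_torus \<Longrightarrow> \<eta> \<in> unit_torus \<Longrightarrow> \<xi> * \<eta> \<in> unit_torus"
  by (simp add: unit_torus_def norm_mult)

lemma times_cube: "R \<in> unit_cube \<Longrightarrow> \<rho> \<in> unit_cube \<Longrightarrow> R * \<rho> \<in> unit_cube"
proof -
  assume "R \<in> unit_cube" "\<rho> \<in> unit_cube"
  then have *: "0 \<le> R $ j" "R $ j < 1" "\<rho> $ j \<le> 1" "0 \<le> \<rho> $ j" for j
    by (auto simp: unit_cube_def intro: less_imp_le)
  have "R $ j * \<rho> $ j < 1" for j
    using mult_left_le[OF *(3,1), of j j] *(2)[of j] by linarith
  then show ?thesis using * by (simp add: unit_cube_def)
qed

lemma measurable_cnj_vec [measurable]: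
  assumes h: "h \<in> M \<rightarrow>\<^sub>M torus_measure"
  shows "(\<lambda>x. cnj_vec (h x)) \<in> M \<rightarrow>\<^sub>M torus_measure"
  unfolding cnj_vec_def
proof (intro measurable_vec_lambda_torus measurable_circleI)
  show "(\<lambda>x. cnj (h x $ i)) \<in> borel_measurable M" for i
    by (rule measurable_compose[OF measurable_compose[OF h measurable_torus_nth_borel]])
       (intro borel_measurable_continuous_onI continuous_intros)
  show "norm (cnj (h x $ i)) = 1" if "x \<in> space M" for x i
    using measurable_space[OF h that] by (simp add: unit_torus_def)
qed

lemma measurable_times_cube [measurable]:
  assumes R: "R \<in> unit_cube" and g: "g \<in> M \<rightarrow>\<^sub>M cube_measure"
  shows "(\<lambda>x. R * g x) \<in> M \<rightarrow>\<^sub>M cube_measure"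
  unfolding measurable_cong_sets[OF refl sets_cube_measure]
proof (intro measurable_restrict_space2)
  show "(\<lambda>x. R * g x) \<in> space M \<rightarrow> unit_cube"
    using measurable_space[OF g] R by (auto intro: times_cube)
  have [measurable]: "(\<lambda>x. g x $ j) \<in> borel_measurable M" for j
    by (rule measurable_compose[OF g measurable_cube_nth_borel])
  show "(\<lambda>x. R * g x) \<in> borel_measurable M"
    unfolding times_vec_def by (rule measurable_vec_lambda_borel) measurable
qed

text \<open>Here \<open>g\<close> stands for the derivative D^m of the original symbol.
  Orthogonality on the torus keeps the diagonal terms, each with the factor \<rho>^(2k), and the
  radial integral converts this factor into the reciprocal of \<open>binom_coeff m k\<close>,
  undoing the derivative. The integrability claims feed the norm estimates for Bochner
  integrals.\<close>

lemma multiplier_formula: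
  fixes f g h :: "complex ^ 'n \<Rightarrow> complex"
  assumes f: "has_power_series f a" and g: "has_power_series g (\<lambda>k. of_real (binom_coeff m k) * c k)"
    and h: "has_power_series h (\<lambda>k. c k * a k)" and m: "1 \<le> m"
    and R: "R \<in> unit_cube" and z: "z \<in> unit_torus"
  defines "V \<equiv> \<lambda>\<rho>. (\<Prod>j\<in>UNIV. complex_of_real (2 * real m * \<rho> $ j * (1 - (\<rho> $ j)\<^sup>2) ^ (m - 1)))"
    and "L \<equiv> \<lambda>\<rho> :: real ^ 'n. (\<integral>\<xi>. g (scale_vec (R * \<rho>) (z * cnj_vec \<xi>)) * f (scale_vec \<rho> \<xi>) \<partial>torus_measure)"
  shows "integrable cube_measure (\<lambda>\<rho>. V \<rho> * L \<rho>)" "h (scale_vec R z) = (\<integral>\<rho>. V \<rho> * L \<rho> \<partial>cube_measure)"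
    and "\<And>\<rho>. \<rho> \<in> unit_cube \<Longrightarrow> integrable torus_measure (\<lambda>\<xi>. g (scale_vec (R * \<rho>) (z * cnj_vec \<xi>)) * f (scale_vec \<rho> \<xi>))"
proof -
  have R0: "0 \<le> R $ j" for j using R by (simp add: unit_cube_def)
  have hf: "f \<in> hol_polydisc" by (rule has_power_series_hol_polydisc[OF f])
  have nz: "norm (monom_pow z k) = 1" for k by (rule norm_monom_pow_torus[OF z])
  define RR where "RR R k = (\<Prod>j\<in>UNIV. R $ j ^ (k $ j))" for R :: "real ^ 'n" and k
  have RR0: "0 \<le> RR \<rho> k" if "\<rho> \<in> unit_cube" for \<rho> k
    using that unfolding RR_def by (intro prod_nonneg) (auto simp: unit_cube_def)
  have RR1: "RR \<rho> k \<le> 1" if "\<rho> \<in> unit_cube" for \<rho> k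
    using that unfolding RR_def by (intro prod_le_1 conjI power_le_one zero_le_power) (auto simp: unit_cube_def intro: less_imp_le)
  have RRm: "RR (R * \<rho>) k = RR R k * RR \<rho> k" for \<rho> k
    by (simp add: RR_def power_mult_distrib prod.distrib)
  define d where "d k = of_real (binom_coeff m k) * c k" for k
  have dsub: "subexponential d" unfolding d_def by (rule has_power_series_subexponential[OF g])
  have inner: "integrable torus_measure (\<lambda>\<xi>. g (scale_vec (R * \<rho>) (z * cnj_vec \<xi>)) * f (scale_vec \<rho> \<xi>))"
    "((\<lambda>k. d k * of_real (RR (R * \<rho>) k) * monom_pow z k * (a k * of_real (RR \<rho> k))) has_sum L \<rho>) UNIV" if \<rho>: "\<rho> \<in> unit_cube" for \<rho>
  proof -
    have R\<rho>: "R * \<rho> \<in> unit_cube" by (rule times_cube[OF R \<rho>])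
    have "Max (range (\<lambda>j. \<rho> $ j)) < 1" using \<rho> by (subst Max_less_iff) (auto simp: unit_cube_def)
    then obtain B where B: "\<And>w. (\<And>j. norm (w $ j) \<le> Max (range (\<lambda>j. \<rho> $ j))) \<Longrightarrow> norm (f w) \<le> B"
      using hol_polydisc_bounded[OF hf] by blast
    have fB: "norm (f (scale_vec \<rho> \<xi>)) \<le> B" if "\<xi> \<in> unit_torus" for \<xi>
    proof (rule B)
      fix j
      have "norm (scale_vec \<rho> \<xi> $ j) = \<rho> $ j" using that \<rho> by (simp add: unit_torus_def unit_cube_def norm_mult)
      then show "norm (scale_vec \<rho> \<xi> $ j) \<le> Max (range (\<lambda>j. \<rho> $ j))" by simp
    qed
    have fm: "(\<lambda>\<xi>. f (scale_vec \<rho> \<xi>)) \<in> borel_measurable torus_measure" by (rule measurable_hol_fixed[OF hf \<rho>])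
    define b where "b k = d k * of_real (RR (R * \<rho>) k) * monom_pow z k" for k
    have nb: "norm (b k) = norm (d k) * RR (R * \<rho>) k" for k
      using RR0[OF R\<rho>] by (simp add: b_def norm_mult nz)
    let ?F = "\<lambda>k \<xi>. b k * (f (scale_vec \<rho> \<xi>) * cnj (monom_pow \<xi> k))"
    have F: "?F k \<in> borel_measurable torus_measure" for k
      by (intro borel_measurable_times borel_measurable_const fm measurable_cnj_monom_pow)
    have Fb: "norm (?F k \<xi>) \<le> norm (b k) * B" if "\<xi> \<in> space torus_measure" for k \<xi>
      using that fB[of \<xi>] by (auto simp: norm_mult norm_monom_pow_torus intro!: mult_left_mono)
    have Bs: "(\<lambda>k. norm (b k) * B) summable_on UNIV"
      unfolding nb using subexponential_summable_vec[OF dsub R\<rho>] by (intro summable_on_cmult_left) (simp add: RR_def)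
    have Fs: "((\<lambda>k. ?F k \<xi>) has_sum g (scale_vec (R * \<rho>) (z * cnj_vec \<xi>)) * f (scale_vec \<rho> \<xi>)) UNIV"
      if "\<xi> \<in> space torus_measure" for \<xi>
    proof -
      have \<xi>: "\<xi> \<in> unit_torus" using that by simp
      have "((\<lambda>k. d k * monom_pow (scale_vec (R * \<rho>) (z * cnj_vec \<xi>)) k) has_sum g (scale_vec (R * \<rho>) (z * cnj_vec \<xi>))) UNIV"
        using g scale_vec_in_polydisc[OF R\<rho> times_torus[OF z]] \<xi> unfolding has_power_series_def d_def
        by (simp add: cnj_vec_torus)
      from has_sum_cmult_left[OF this, of "f (scale_vec \<rho> \<xi>)"] show ?thesis
        by (simp add: b_def RR_def monom_pow_scale_vec monom_pow_mult monom_pow_cnj_vec mult_ac)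
    qed
    show "integrable torus_measure (\<lambda>\<xi>. g (scale_vec (R * \<rho>) (z * cnj_vec \<xi>)) * f (scale_vec \<rho> \<xi>))"
      by (rule has_sum_integral(1)[OF torus.finite_measure_axioms F Fb Bs Fs])
    have "((\<lambda>k. \<integral>\<xi>. ?F k \<xi> \<partial>torus_measure) has_sum L \<rho>) UNIV"
      unfolding L_def by (rule has_sum_integral(2)[OF torus.finite_measure_axioms F Fb Bs Fs])
    moreover have "(\<integral>\<xi>. ?F k \<xi> \<partial>torus_measure) = b k * (a k * of_real (RR \<rho> k))" for k
      unfolding integral_mult_right_zero power_series_coefficient[OF f \<rho>] RR_def ..
    ultimately show "((\<lambda>k. d k * of_real (RR (R * \<rho>) k) * monom_pow z k * (a k * of_real (RR \<rho> k))) has_sum L \<rho>) UNIV"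
      unfolding b_def by (simp only:)
  qed
  show "\<And>\<rho>. \<rho> \<in> unit_cube \<Longrightarrow> integrable torus_measure (\<lambda>\<xi>. g (scale_vec (R * \<rho>) (z * cnj_vec \<xi>)) * f (scale_vec \<rho> \<xi>))"
    by (rule inner(1))
  define e where "e k = d k * a k * of_real (RR R k) * monom_pow z k" for k
  let ?G = "\<lambda>k \<rho>. V \<rho> * of_real (RR \<rho> k * RR \<rho> k) * e k"
  have Vb: "norm (V \<rho>) \<le> (2 * real m) ^ CARD('n)" if "\<rho> \<in> unit_cube" for \<rho>
  proof -
    have "norm (V \<rho>) = (\<Prod>j\<in>(UNIV :: 'n set). norm (2 * real m * \<rho> $ j * (1 - (\<rho> $ j)\<^sup>2) ^ (m - 1)))"
      unfolding V_def by (simp add: prod_norm[symmetric] del: of_real_mult of_real_power of_real_diff)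
    also have "\<dots> \<le> (\<Prod>j\<in>(UNIV :: 'n set). 2 * real m)"
    proof (intro prod_mono conjI)
      fix j
      have r: "0 \<le> \<rho> $ j" "\<rho> $ j \<le> 1" using that by (auto simp: unit_cube_def less_imp_le)
      then have "\<rho> $ j * (1 - (\<rho> $ j)\<^sup>2) ^ (m - 1) \<le> 1" "0 \<le> \<rho> $ j * (1 - (\<rho> $ j)\<^sup>2) ^ (m - 1)"
        by (auto simp: abs_square_le_1 power_le_one intro!: mult_le_one)
      from abs_scaled_le[OF this(2,1), of m]
      show "norm (2 * real m * \<rho> $ j * (1 - (\<rho> $ j)\<^sup>2) ^ (m - 1)) \<le> 2 * real m"
        by (simp only: real_norm_def mult.assoc)
    qed simp
    finally show ?thesis by simp
  qed
  have RRmeas: "(\<lambda>\<rho>. RR \<rho> k) \<in> borel_measurable cube_measure" for k unfolding RR_def by measurable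
  have Vm: "V \<in> borel_measurable cube_measure" unfolding V_def by measurable
  have G: "?G k \<in> borel_measurable cube_measure" for k
    using RRmeas[of k] Vm by measurable
  have esum: "(\<lambda>k. (2 * real m) ^ CARD('n) * norm (e k)) summable_on UNIV"
  proof -
    have "subexponential (\<lambda>k. d k * a k)"
      by (intro subexponential_mult dsub has_power_series_subexponential[OF f])
    from subexponential_summable_vec[OF this R] have "(\<lambda>k. norm (d k * a k) * RR R k) summable_on UNIV"
      by (simp only: RR_def)
    then show ?thesis
      using RR0[OF R] by (intro summable_on_cmult_right) (simp add: e_def norm_mult nz)
  qed
  have Gb: "norm (?G k \<rho>) \<le> (2 * real m) ^ CARD('n) * norm (e k)" if "\<rho> \<in> space cube_measure" for k \<rho>
  proof -
    have \<rho>: "\<rho> \<in> unit_cube" using that by simp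
    have "norm (complex_of_real (RR \<rho> k * RR \<rho> k)) \<le> 1"
      using RR0[OF \<rho>, of k] RR1[OF \<rho>, of k] by (simp add: norm_mult mult_le_one)
    then have "norm (V \<rho>) * norm (complex_of_real (RR \<rho> k * RR \<rho> k)) \<le> (2 * real m) ^ CARD('n) * 1"
      by (intro mult_mono Vb \<rho>) auto
    then show ?thesis by (simp only: norm_mult) (simp add: mult_right_mono)
  qed
  have Gs: "((\<lambda>k. ?G k \<rho>) has_sum V \<rho> * L \<rho>) UNIV" if "\<rho> \<in> space cube_measure" for \<rho>
    using has_sum_cmult_right[OF inner(2)[of \<rho>], of "V \<rho>"] that by (simp add: e_def RRm mult_ac)
  show "integrable cube_measure (\<lambda>\<rho>. V \<rho> * L \<rho>)"
    by (rule has_sum_integral(1)[OF cube.finite_measure_axioms G Gb esum Gs])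
  have int: "((\<lambda>k. \<integral>\<rho>. ?G k \<rho> \<partial>cube_measure) has_sum (\<integral>\<rho>. V \<rho> * L \<rho> \<partial>cube_measure)) UNIV"
    by (rule has_sum_integral(2)[OF cube.finite_measure_axioms G Gb esum Gs])
  have eq: "(\<integral>\<rho>. ?G k \<rho> \<partial>cube_measure) = c k * a k * monom_pow (scale_vec R z) k" for k
  proof -
    have "V \<rho> * of_real (RR \<rho> k * RR \<rho> k) = (\<Prod>j\<in>UNIV. complex_of_real (2 * real m * \<rho> $ j ^ (2 * k $ j + 1) * (1 - (\<rho> $ j)\<^sup>2) ^ (m - 1)))" for \<rho>
    proof -
      have *: "2 * real m * x * X * (x ^ l * x ^ l) = 2 * real m * x ^ (2 * l + 1) * X" for x X :: real and l
      proof -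
        have "x ^ (2 * l + 1) = x * (x ^ l * x ^ l)"
          by (simp add: power_mult power2_eq_square power_mult_distrib)
        then show ?thesis by (simp only: mult_ac)
      qed
      have "V \<rho> * of_real (RR \<rho> k * RR \<rho> k) = complex_of_real (\<Prod>j\<in>UNIV. 2 * real m * \<rho> $ j * (1 - (\<rho> $ j)\<^sup>2) ^ (m - 1) * (\<rho> $ j ^ (k $ j) * \<rho> $ j ^ (k $ j)))"
        unfolding V_def RR_def by (simp only: of_real_prod[symmetric] of_real_mult[symmetric] prod.distrib[symmetric])
      then show ?thesis by (simp only: * of_real_prod)
    qed
    then have "(\<integral>\<rho>. ?G k \<rho> \<partial>cube_measure) = (\<integral>\<rho>. (\<Prod>j\<in>UNIV. complex_of_real (2 * real m * \<rho> $ j ^ (2 * k $ j + 1) * (1 - (\<rho> $ j)\<^sup>2) ^ (m - 1))) \<partial>cube_measure) * e k"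
      by (simp only: integral_mult_left_zero)
    also have "\<dots> = e k / of_real (binom_coeff m k)"
      by (simp only: integral_radial_weight_power[OF m]) simp
    also have "\<dots> = c k * a k * monom_pow (scale_vec R z) k"
      using binom_coeff_pos[of m k] by (simp add: e_def d_def monom_pow_scale_vec RR_def)
    finally show ?thesis .
  qed
  have "((\<lambda>k. c k * a k * monom_pow (scale_vec R z) k) has_sum h (scale_vec R z)) UNIV"
    using h scale_vec_in_polydisc[OF R z] by (simp add: has_power_series_def)
  then show "h (scale_vec R z) = (\<integral>\<rho>. V \<rho> * L \<rho> \<partial>cube_measure)"
    by (rule has_sum_unique) (use int in \<open>simp only: eq\<close>)
qed

section \<open>Sufficiency\<close>

lemma hol_polydisc_mult: "f \<in> hol_polydisc \<Longrightarrow> g \<in> hol_polydisc \<Longrightarrow> (\<lambda>z. f z * g z) \<in> hol_polydisc"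
  unfolding hol_polydisc_def by (auto intro!: continuous_intros holomorphic_intros)

text \<open>The argument conj(v) makes g antiholomorphic in v, and the outer conjugate repairs this
  without changing the modulus. Thus the integrand of \<open>multiplier_formula\<close> has the
  modulus of a holomorphic function of the integration variable, to which subharmonicity
  applies.\<close>

lemma has_power_series_reflect:
  fixes g :: "complex ^ 'n \<Rightarrow> complex"
  assumes g: "has_power_series g d" and w: "w \<in> polydisc"
  shows "has_power_series (\<lambda>v. cnj (g (w * cnj_vec v))) (\<lambda>k. cnj (d k * monom_pow w k))"
  unfolding has_power_series_def
proof
  fix v :: "complex ^ 'n" assume v: "v \<in> polydisc"
  have "norm (w $ j * cnj (v $ j)) < 1" for j
  proof -
    have "norm (w $ j) < 1" "norm (v $ j) < 1" using v w by (auto simp: polydisc_def)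
    then have "norm (w $ j) * norm (v $ j) < 1 * 1" by (intro mult_strict_mono') auto
    then show ?thesis by (simp add: norm_mult)
  qed
  then have "w * cnj_vec v \<in> polydisc" by (simp add: polydisc_def)
  then have "((\<lambda>k. d k * monom_pow (w * cnj_vec v) k) has_sum g (w * cnj_vec v)) UNIV"
    using g by (simp add: has_power_series_def)
  then have "((\<lambda>k. cnj (d k * monom_pow (w * cnj_vec v) k)) has_sum cnj (g (w * cnj_vec v))) UNIV"
    by (simp only: has_sum_cnj_iff)
  then show "((\<lambda>k. cnj (d k * monom_pow w k) * monom_pow v k) has_sum cnj (g (w * cnj_vec v))) UNIV"
    by (simp add: monom_pow_mult monom_pow_cnj_vec mult.assoc)
qed

text \<open>The case \<sigma> = t of \<open>ennpowr_nn_integral_le\<close> on the product of cube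
  and torus. Its pointwise hypothesis costs one unit of weight for passing from a value to a mean
  and \<open>e\<close> units for passing from the mean to its weighted integral; together these are
  t(m + 1).\<close>

lemma integral_power_le_mean:
  fixes F :: "complex ^ 'n \<Rightarrow> complex"
  assumes F: "F \<in> hol_polydisc" and t: "0 < t" "t \<le> 1" and m: "2 < t * (m + 1)"
  shows "ennpowr (\<integral>\<^sup>+\<rho>. \<integral>\<^sup>+\<xi>. ennreal (norm (F (scale_vec \<rho> \<xi>))) * wt \<rho> (m - 1) \<partial>torus_measure \<partial>cube_measure) t
    \<le> ennpowr (4 ^ CARD('n) * ennreal (((m * t + t - 1) * 2 powr (m * t + t - 1)) ^ CARD('n))) (1 - t)
      * (\<integral>\<^sup>+\<rho>. power_mean t F \<rho> * wt \<rho> (m * t + t - 2) \<partial>cube_measure)"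
proof -
  define e where "e = m * t + t - 1"
  have e: "0 < e" using m by (simp add: e_def algebra_simps)
  have [measurable]: "(\<lambda>(R, \<xi>). F (scale_vec R \<xi>)) \<in> borel_measurable (cube_measure \<Otimes>\<^sub>M torus_measure)"
    by (rule measurable_hol_cube_torus[OF F])
  define J where "J = (\<integral>\<^sup>+\<rho>. power_mean t F \<rho> * wt \<rho> (e - 1) \<partial>cube_measure)"
  define C where "C = 4 ^ CARD('n) * ennreal ((e * 2 powr e) ^ CARD('n))"
  let ?M = "cube_measure \<Otimes>\<^sub>M torus_measure :: ((real ^ 'n) \<times> (complex ^ 'n)) measure"
  let ?\<phi> = "\<lambda>x :: (real ^ 'n) \<times> (complex ^ 'n). ennreal (norm (F (scale_vec (fst x) (snd x))))"
  have [measurable]: "(\<lambda>x. F (scale_vec (fst x) (snd x))) \<in> borel_measurable ?M"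
    using measurable_hol_cube_torus[OF F] by (simp add: split_beta')
  have [measurable]: "power_mean t F \<in> borel_measurable cube_measure" by (rule measurable_power_mean[OF F])
  have J: "J = (\<integral>\<^sup>+x. ennpowr (?\<phi> x) t * wt (fst x) (e - 1) \<partial>?M)"
  proof -
    have "(\<integral>\<^sup>+x. ennpowr (?\<phi> x) t * wt (fst x) (e - 1) \<partial>?M) = (\<integral>\<^sup>+\<rho>. \<integral>\<^sup>+\<xi>. ennpowr (?\<phi> (\<rho>, \<xi>)) t * wt (fst (\<rho>, \<xi>)) (e - 1) \<partial>torus_measure \<partial>cube_measure)"
      by (rule torus.nn_integral_fst[symmetric]) measurable
    also have "\<dots> = J"
      unfolding J_def
    proof (rule nn_integral_cong)
      fix \<rho> :: "real ^ 'n" assume "\<rho> \<in> space cube_measure"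
      then have [measurable]: "(\<lambda>\<xi>. F (scale_vec \<rho> \<xi>)) \<in> borel_measurable torus_measure"
        using measurable_hol_fixed[OF F] by simp
      show "(\<integral>\<^sup>+\<xi>. ennpowr (?\<phi> (\<rho>, \<xi>)) t * wt (fst (\<rho>, \<xi>)) (e - 1) \<partial>torus_measure) = power_mean t F \<rho> * wt \<rho> (e - 1)"
        by (simp add: power_mean_def nn_integral_multc ennpowr_ennreal)
    qed
    finally show ?thesis ..
  qed
  have bound: "ennpowr (?\<phi> x * wt (fst x) (m + 1)) t \<le> C * J" if x: "x \<in> space ?M" for x
  proof -
    obtain \<rho> \<xi> where xx: "x = (\<rho>, \<xi>)" "\<rho> \<in> unit_cube" "\<xi> \<in> unit_torus"
      using x by (auto simp: space_pair_measure)
    let ?X = "ennreal (norm (F (scale_vec \<rho> \<xi>)) powr t) * wt \<rho> 1"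
    have "?X * wt \<rho> e \<le> ennreal ((e * 2 powr e) ^ CARD('n)) * (\<integral>\<^sup>+R. (4 ^ CARD('n) * power_mean t F R) * wt R (e - 1) \<partial>cube_measure)"
      by (rule weighted_integral_ge[OF _ xx(2) e])
         (use pointwise_le_power_mean[OF F t(1) xx(2) _ _ xx(3)] in auto)
    also have "(\<integral>\<^sup>+R. (4 ^ CARD('n) * power_mean t F R) * wt R (e - 1) \<partial>cube_measure) = 4 ^ CARD('n) * J"
      unfolding J_def mult.assoc by (rule nn_integral_cmult) measurable
    also have "?X * wt \<rho> e = ennpowr (?\<phi> x * wt (fst x) (m + 1)) t"
    proof -
      have "(m + 1) * t = 1 + e" by (simp add: e_def algebra_simps)
      then have "wt \<rho> ((m + 1) * t) = wt \<rho> 1 * wt \<rho> e"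
        by (simp only: ennreal_radial_weight_add)
      moreover have "ennpowr (?\<phi> x * wt (fst x) (m + 1)) t = ennreal (norm (F (scale_vec \<rho> \<xi>)) powr t) * wt \<rho> ((m + 1) * t)"
        unfolding xx(1) fst_conv snd_conv ennpowr_mult ennpowr_radial_weight by (simp add: ennpowr_ennreal)
      ultimately show ?thesis by (simp only: mult.assoc)
    qed
    finally show ?thesis by (simp add: C_def mult_ac)
  qed
  have main: "ennpowr (\<integral>\<^sup>+x. ?\<phi> x * wt (fst x) (m - 1) \<partial>?M) t \<le> ennpowr C (1 - t) * J"
  proof (rule ennpowr_nn_integral_le[OF t _ _ _ J bound])
    show "wt (fst x) (m - 1) = wt (fst x) (e - 1) * ennpowr (wt (fst x) (m + 1)) (1 - t)" for x :: "(real ^ 'n) \<times> (complex ^ 'n)"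
    proof -
      \<comment> \<open>The weight m - 1 is divided into the part e - 1 kept in \<open>J\<close> and
        the part that accompanies the surplus power 1 - t of the integrand.\<close>
      have "m - 1 = (e - 1) + (m + 1) * (1 - t)" by (simp add: e_def algebra_simps)
      then show ?thesis
        unfolding ennpowr_radial_weight ennreal_radial_weight_add[symmetric] by (simp only:)
    qed
  qed measurable
  have fubini: "(\<integral>\<^sup>+x. ?\<phi> x * wt (fst x) (m - 1) \<partial>?M)
     = (\<integral>\<^sup>+\<rho>. \<integral>\<^sup>+\<xi>. ennreal (norm (F (scale_vec \<rho> \<xi>))) * wt \<rho> (m - 1) \<partial>torus_measure \<partial>cube_measure)"
    by (subst torus.nn_integral_fst[symmetric]) simp_all
  have "m * t + t - 2 = e - 1" by (simp add: e_def)
  then show ?thesis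
    unfolding e_def[symmetric] C_def[symmetric] fubini[symmetric] using main by (simp only: J_def)
qed

text \<open>Absolute values in \<open>multiplier_formula\<close>. Since 1 - \<rho>^2 is at most 2(1
  - \<rho>), each radial factor is at most 2m * 2^(m-1) (1 - \<rho>)^(m-1), which gives the constant
  2^m m per coordinate.\<close>

lemma norm_multiplier_le:
  fixes f g h :: "complex ^ 'n \<Rightarrow> complex"
  assumes f: "has_power_series f a" and g: "has_power_series g (\<lambda>k. of_real (binom_coeff m k) * c k)"
    and h: "has_power_series h (\<lambda>k. c k * a k)" and m: "1 \<le> m"
    and R: "R \<in> unit_cube" and z: "z \<in> unit_torus"
  shows "ennreal (norm (h (scale_vec R z))) \<le> ennreal ((2 ^ m * real m) ^ CARD('n)) *
    (\<integral>\<^sup>+\<rho>. \<integral>\<^sup>+\<xi>. ennreal (norm (f (scale_vec \<rho> \<xi>) * cnj (g (scale_vec R z * cnj_vec (scale_vec \<rho> \<xi>))))) * wt \<rho> (real m - 1) \<partial>torus_measure \<partial>cube_measure)"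
proof -
  define V where "V \<rho> = (\<Prod>j\<in>UNIV. complex_of_real (2 * real m * \<rho> $ j * (1 - (\<rho> $ j)\<^sup>2) ^ (m - 1)))" for \<rho> :: "real ^ 'n"
  define G where "G \<rho> \<xi> = g (scale_vec (R * \<rho>) (z * cnj_vec \<xi>)) * f (scale_vec \<rho> \<xi>)" for \<rho> \<xi>
  define L where "L \<rho> = (\<integral>\<xi>. G \<rho> \<xi> \<partial>torus_measure)" for \<rho>
  define K where "K = ennreal ((2 ^ m * real m) ^ CARD('n))"
  define F where "F w = f w * cnj (g (scale_vec R z * cnj_vec w))" for w
  have F: "F \<in> hol_polydisc"
    unfolding F_def
    by (intro hol_polydisc_mult has_power_series_hol_polydisc[OF f]
        has_power_series_hol_polydisc[OF has_power_series_reflect[OF g scale_vec_in_polydisc[OF R z]]])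
  have GF: "norm (G \<rho> \<xi>) = norm (F (scale_vec \<rho> \<xi>))" for \<rho> \<xi>
  proof -
    have "scale_vec (R * \<rho>) (z * cnj_vec \<xi>) = scale_vec R z * cnj_vec (scale_vec \<rho> \<xi>)"
      by (simp add: vec_eq_iff)
    then show ?thesis by (simp add: G_def F_def norm_mult)
  qed
  note formula = multiplier_formula[OF f g h m R z, folded V_def G_def, folded L_def]
  have V: "ennreal (norm (V \<rho>)) \<le> K * wt \<rho> (real m - 1)" if \<rho>: "\<rho> \<in> unit_cube" for \<rho>
  proof -
    have "norm (V \<rho>) = (\<Prod>j\<in>(UNIV :: 'n set). norm (2 * real m * \<rho> $ j * (1 - (\<rho> $ j)\<^sup>2) ^ (m - 1)))"
      unfolding V_def by (simp add: prod_norm[symmetric] del: of_real_mult of_real_power of_real_diff)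
    also have "\<dots> \<le> (\<Prod>j\<in>(UNIV :: 'n set). (2 ^ m * real m) * (1 - \<rho> $ j) powr (real m - 1))"
    proof (intro prod_mono conjI)
      fix j
      have r: "0 \<le> \<rho> $ j" "\<rho> $ j < 1" using \<rho> by (auto simp: unit_cube_def)
      have "1 - (\<rho> $ j)\<^sup>2 = (1 + \<rho> $ j) * (1 - \<rho> $ j)" by (simp add: power2_eq_square algebra_simps)
      also have "\<dots> \<le> 2 * (1 - \<rho> $ j)" using r by (intro mult_right_mono) auto
      finally have "(1 - (\<rho> $ j)\<^sup>2) ^ (m - 1) \<le> (2 * (1 - \<rho> $ j)) ^ (m - 1)"
        using r by (intro power_mono) (auto simp: abs_square_le_1)
      also have "\<dots> = 2 ^ (m - 1) * (1 - \<rho> $ j) powr (real m - 1)"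
      proof -
        have "(1 - \<rho> $ j) ^ (m - 1) = (1 - \<rho> $ j) powr (real (m - 1))" using r by (intro powr_realpow[symmetric]) auto
        then show ?thesis by (simp only: power_mult_distrib of_nat_diff[OF m] of_nat_1)
      qed
      finally have 1: "(1 - (\<rho> $ j)\<^sup>2) ^ (m - 1) \<le> 2 ^ (m - 1) * (1 - \<rho> $ j) powr (real m - 1)" .
      have nn: "0 \<le> (1 - (\<rho> $ j)\<^sup>2) ^ (m - 1)" using r by (auto simp: abs_square_le_1)
      have "\<rho> $ j * (1 - (\<rho> $ j)\<^sup>2) ^ (m - 1) \<le> 1 * (2 ^ (m - 1) * (1 - \<rho> $ j) powr (real m - 1))"
        using r 1 nn by (intro mult_mono) auto
      then have "2 * real m * (\<rho> $ j * (1 - (\<rho> $ j)\<^sup>2) ^ (m - 1)) \<le> 2 * real m * (2 ^ (m - 1) * (1 - \<rho> $ j) powr (real m - 1))"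
        by (intro mult_left_mono) auto
      also have "\<dots> = (2 ^ m * real m) * (1 - \<rho> $ j) powr (real m - 1)"
        using m power_Suc[of "2 :: real" "m - 1"] by simp
      finally have "2 * real m * \<rho> $ j * (1 - (\<rho> $ j)\<^sup>2) ^ (m - 1) \<le> (2 ^ m * real m) * (1 - \<rho> $ j) powr (real m - 1)"
        by (simp only: mult.assoc)
      moreover have "0 \<le> 2 * real m * \<rho> $ j * (1 - (\<rho> $ j)\<^sup>2) ^ (m - 1)" using r nn by simp
      ultimately show "norm (2 * real m * \<rho> $ j * (1 - (\<rho> $ j)\<^sup>2) ^ (m - 1)) \<le> (2 ^ m * real m) * (1 - \<rho> $ j) powr (real m - 1)"
        by (simp only: real_norm_def abs_of_nonneg)
    qed simp
    also have "\<dots> = (2 ^ m * real m) ^ CARD('n) * radial_weight \<rho> (real m - 1)"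
      by (simp add: prod.distrib radial_weight_def)
    finally show ?thesis by (simp add: K_def ennreal_leI flip: ennreal_mult)
  qed
  have "ennreal (norm (h (scale_vec R z))) \<le> (\<integral>\<^sup>+\<rho>. ennreal (norm (V \<rho> * L \<rho>)) \<partial>cube_measure)"
    unfolding formula(2) by (rule integral_norm_bound_ennreal[OF formula(1)])
  also have "\<dots> \<le> (\<integral>\<^sup>+\<rho>. K * (\<integral>\<^sup>+\<xi>. ennreal (norm (F (scale_vec \<rho> \<xi>))) * wt \<rho> (real m - 1) \<partial>torus_measure) \<partial>cube_measure)"
  proof (rule nn_integral_mono)
    fix \<rho> :: "real ^ 'n" assume "\<rho> \<in> space cube_measure"
    then have \<rho>: "\<rho> \<in> unit_cube" by simp
    have [measurable]: "(\<lambda>\<xi>. F (scale_vec \<rho> \<xi>)) \<in> borel_measurable torus_measure" by (rule measurable_hol_fixed[OF F \<rho>])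
    have "ennreal (norm (V \<rho> * L \<rho>)) = ennreal (norm (V \<rho>)) * ennreal (norm (L \<rho>))"
      by (simp add: norm_mult ennreal_mult)
    also have "\<dots> \<le> (K * wt \<rho> (real m - 1)) * (\<integral>\<^sup>+\<xi>. ennreal (norm (G \<rho> \<xi>)) \<partial>torus_measure)"
      by (intro mult_mono V \<rho>) (auto simp: L_def intro!: integral_norm_bound_ennreal formula(3) \<rho>)
    also have "\<dots> = K * ((\<integral>\<^sup>+\<xi>. ennreal (norm (F (scale_vec \<rho> \<xi>))) \<partial>torus_measure) * wt \<rho> (real m - 1))"
      by (simp add: GF mult_ac)
    also have "(\<integral>\<^sup>+\<xi>. ennreal (norm (F (scale_vec \<rho> \<xi>))) \<partial>torus_measure) * wt \<rho> (real m - 1)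
      = (\<integral>\<^sup>+\<xi>. ennreal (norm (F (scale_vec \<rho> \<xi>))) * wt \<rho> (real m - 1) \<partial>torus_measure)"
      by (rule nn_integral_multc[symmetric]) measurable
    finally show "ennreal (norm (V \<rho> * L \<rho>)) \<le> K * (\<integral>\<^sup>+\<xi>. ennreal (norm (F (scale_vec \<rho> \<xi>))) * wt \<rho> (real m - 1) \<partial>torus_measure)" .
  qed
  also have "\<dots> = K * (\<integral>\<^sup>+\<rho>. \<integral>\<^sup>+\<xi>. ennreal (norm (F (scale_vec \<rho> \<xi>))) * wt \<rho> (real m - 1) \<partial>torus_measure \<partial>cube_measure)"
  proof (rule nn_integral_cmult)
    have [measurable]: "(\<lambda>(R, \<xi>). F (scale_vec R \<xi>)) \<in> borel_measurable (cube_measure \<Otimes>\<^sub>M torus_measure)"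
      by (rule measurable_hol_cube_torus[OF F])
    show "(\<lambda>\<rho>. \<integral>\<^sup>+\<xi>. ennreal (norm (F (scale_vec \<rho> \<xi>))) * wt \<rho> (real m - 1) \<partial>torus_measure) \<in> borel_measurable cube_measure"
      by (rule torus.borel_measurable_nn_integral) measurable
  qed
  finally show ?thesis by (simp add: K_def F_def)
qed

text \<open>After the power t has been taken inside, integrate over z on the torus first: by
  rotation invariance the integral of the g-factor no longer depends on \<xi>, so the two functions
  decouple into a product of means.\<close>

lemma multiplier_mean_le:
  fixes f g h :: "complex ^ 'n \<Rightarrow> complex"
  assumes f: "has_power_series f a" and g: "has_power_series g (\<lambda>k. of_real (binom_coeff m k) * c k)"
    and h: "has_power_series h (\<lambda>k. c k * a k)" and t: "0 < t" "t \<le> 1" and m: "2 < t * (real m + 1)"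
  obtains K where "K < top" "\<And>R. R \<in> unit_cube \<Longrightarrow> power_mean t h R
    \<le> K * (\<integral>\<^sup>+\<rho>. power_mean t f \<rho> * power_mean t g (R * \<rho>) * wt \<rho> (real m * t + t - 2) \<partial>cube_measure)"
proof -
  interpret CT: pair_sigma_finite "cube_measure :: (real ^ 'n) measure" "torus_measure :: (complex ^ 'n) measure" ..
  interpret TT: pair_sigma_finite "torus_measure :: (complex ^ 'n) measure" "torus_measure :: (complex ^ 'n) measure" ..
  interpret TC: pair_sigma_finite "torus_measure :: (complex ^ 'n) measure" "cube_measure :: (real ^ 'n) measure" ..
  have m1: "1 \<le> m"
  proof (rule ccontr)
    assume "\<not> 1 \<le> m"
    then have "m = 0" by simp
    then show False using m t by simp
  qed
  have hf: "f \<in> hol_polydisc" and hg: "g \<in> hol_polydisc" and hh: "h \<in> hol_polydisc"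
    using f g h by (auto intro: has_power_series_hol_polydisc)
  define b where "b = real m * t + t - 2"
  define C where "C = ennpowr (4 ^ CARD('n) * ennreal (((real m * t + t - 1) * 2 powr (real m * t + t - 1)) ^ CARD('n))) (1 - t)"
  define C1 where "C1 = ennpowr (ennreal ((2 ^ m * real m) ^ CARD('n))) t"
  define K where "K = C1 * C"
  have "K < top" by (simp add: K_def C_def C1_def ennreal_mult_less_top power_const_less_top)
  moreover have "power_mean t h R \<le> K * (\<integral>\<^sup>+\<rho>. power_mean t f \<rho> * power_mean t g (R * \<rho>) * wt \<rho> b \<partial>cube_measure)"
    if R: "R \<in> unit_cube" for R
  proof -
    define \<psi> where "\<psi> z \<rho> \<xi> = ennreal (norm (f (scale_vec \<rho> \<xi>)) powr t) * ennreal (norm (g (scale_vec (R * \<rho>) (z * cnj_vec \<xi>))) powr t)" for z \<rho> \<xi>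
    have fm: "(\<lambda>x. f (scale_vec (\<rho> x) (\<xi> x))) \<in> borel_measurable M" if "\<rho> \<in> M \<rightarrow>\<^sub>M cube_measure" "\<xi> \<in> M \<rightarrow>\<^sub>M torus_measure" for M :: "'z measure" and \<rho> \<xi>
      by (rule measurable_hol_scale_vec[OF hf that])
    have \<psi>m: "(\<lambda>x. \<psi> (z x) (\<rho> x) (\<xi> x)) \<in> borel_measurable M"
      if "z \<in> M \<rightarrow>\<^sub>M torus_measure" "\<rho> \<in> M \<rightarrow>\<^sub>M cube_measure" "\<xi> \<in> M \<rightarrow>\<^sub>M torus_measure" for M :: "'z measure" and z \<rho> \<xi>
    proof -
      have [measurable]: "(\<lambda>x. f (scale_vec (\<rho> x) (\<xi> x))) \<in> borel_measurable M"
        by (rule measurable_hol_scale_vec[OF hf that(2,3)])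
      have [measurable]: "(\<lambda>x. g (scale_vec (R * \<rho> x) (z x * cnj_vec (\<xi> x)))) \<in> borel_measurable M"
        by (rule measurable_hol_scale_vec[OF hg]) (intro measurable_times_cube R measurable_torus_mult measurable_cnj_vec that)+
      show ?thesis unfolding \<psi>_def by measurable
    qed
    have point: "ennreal (norm (h (scale_vec R z)) powr t) \<le> K * (\<integral>\<^sup>+\<rho>. (\<integral>\<^sup>+\<xi>. \<psi> z \<rho> \<xi> \<partial>torus_measure) * wt \<rho> b \<partial>cube_measure)"
      if z: "z \<in> unit_torus" for z
    proof -
      define F where "F w = f w * cnj (g (scale_vec R z * cnj_vec w))" for w
      have F: "F \<in> hol_polydisc"
        unfolding F_def
        by (intro hol_polydisc_mult hf
            has_power_series_hol_polydisc[OF has_power_series_reflect[OF g scale_vec_in_polydisc[OF R z]]])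
      have "ennreal (norm (h (scale_vec R z)) powr t) = ennpowr (ennreal (norm (h (scale_vec R z)))) t"
        by (simp add: ennpowr_ennreal)
      also have "\<dots> \<le> ennpowr (ennreal ((2 ^ m * real m) ^ CARD('n)) * (\<integral>\<^sup>+\<rho>. \<integral>\<^sup>+\<xi>. ennreal (norm (F (scale_vec \<rho> \<xi>))) * wt \<rho> (real m - 1) \<partial>torus_measure \<partial>cube_measure)) t"
        using norm_multiplier_le[OF f g h m1 R z, folded F_def] t by (intro ennpowr_mono) auto
      also have "\<dots> = C1 * ennpowr (\<integral>\<^sup>+\<rho>. \<integral>\<^sup>+\<xi>. ennreal (norm (F (scale_vec \<rho> \<xi>))) * wt \<rho> (real m - 1) \<partial>torus_measure \<partial>cube_measure) t"
        by (simp only: ennpowr_mult C1_def)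
      also have "\<dots> \<le> C1 * (C * (\<integral>\<^sup>+\<rho>. power_mean t F \<rho> * wt \<rho> b \<partial>cube_measure))"
        unfolding C_def b_def by (intro mult_left_mono integral_power_le_mean F t m) simp
      also have "(\<integral>\<^sup>+\<rho>. power_mean t F \<rho> * wt \<rho> b \<partial>cube_measure) = (\<integral>\<^sup>+\<rho>. (\<integral>\<^sup>+\<xi>. \<psi> z \<rho> \<xi> \<partial>torus_measure) * wt \<rho> b \<partial>cube_measure)"
      proof -
        have "ennreal (norm (F (scale_vec \<rho> \<xi>)) powr t) = \<psi> z \<rho> \<xi>" for \<rho> \<xi>
        proof -
          have "scale_vec (R * \<rho>) (z * cnj_vec \<xi>) = scale_vec R z * cnj_vec (scale_vec \<rho> \<xi>)"
            by (simp add: vec_eq_iff)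
          then show ?thesis by (simp add: F_def \<psi>_def norm_mult powr_mult flip: ennreal_mult)
        qed
        then show ?thesis by (simp add: power_mean_def)
      qed
      finally show ?thesis by (simp add: K_def mult.assoc)
    qed
    have pm: "(\<lambda>(z, \<rho>). \<integral>\<^sup>+\<xi>. \<psi> z \<rho> \<xi> \<partial>torus_measure) \<in> borel_measurable (torus_measure \<Otimes>\<^sub>M cube_measure)"
      unfolding split_beta'
      by (rule torus.borel_measurable_nn_integral) (simp add: split_beta', rule \<psi>m, measurable)
    have "power_mean t h R \<le> (\<integral>\<^sup>+z. K * (\<integral>\<^sup>+\<rho>. (\<integral>\<^sup>+\<xi>. \<psi> z \<rho> \<xi> \<partial>torus_measure) * wt \<rho> b \<partial>cube_measure) \<partial>torus_measure)"
      unfolding power_mean_def using point by (intro nn_integral_mono) simp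
    also have "\<dots> = K * (\<integral>\<^sup>+z. \<integral>\<^sup>+\<rho>. (\<integral>\<^sup>+\<xi>. \<psi> z \<rho> \<xi> \<partial>torus_measure) * wt \<rho> b \<partial>cube_measure \<partial>torus_measure)"
      using pm by (intro nn_integral_cmult cube.borel_measurable_nn_integral) (simp add: split_beta')
    also have "(\<integral>\<^sup>+z. \<integral>\<^sup>+\<rho>. (\<integral>\<^sup>+\<xi>. \<psi> z \<rho> \<xi> \<partial>torus_measure) * wt \<rho> b \<partial>cube_measure \<partial>torus_measure)
      = (\<integral>\<^sup>+\<rho>. \<integral>\<^sup>+z. (\<integral>\<^sup>+\<xi>. \<psi> z \<rho> \<xi> \<partial>torus_measure) * wt \<rho> b \<partial>torus_measure \<partial>cube_measure)"
      using pm by (intro TC.Fubini'[symmetric]) (simp add: split_beta')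
    also have "\<dots> = (\<integral>\<^sup>+\<rho>. power_mean t f \<rho> * power_mean t g (R * \<rho>) * wt \<rho> b \<partial>cube_measure)"
    proof (rule nn_integral_cong)
      fix \<rho> :: "real ^ 'n" assume "\<rho> \<in> space cube_measure"
      then have \<rho>: "\<rho> \<in> unit_cube" by simp
      have R\<rho>: "R * \<rho> \<in> unit_cube" by (rule times_cube[OF R \<rho>])
      have [measurable]: "(\<lambda>\<xi>. f (scale_vec \<rho> \<xi>)) \<in> borel_measurable torus_measure" by (rule measurable_hol_fixed[OF hf \<rho>])
      have \<psi>2: "(\<lambda>x. \<psi> (fst x) \<rho> (snd x)) \<in> borel_measurable (torus_measure \<Otimes>\<^sub>M torus_measure)"
        by (rule \<psi>m) (use \<rho> in auto)
      have "(\<integral>\<^sup>+z. (\<integral>\<^sup>+\<xi>. \<psi> z \<rho> \<xi> \<partial>torus_measure) * wt \<rho> b \<partial>torus_measure) = (\<integral>\<^sup>+z. \<integral>\<^sup>+\<xi>. \<psi> z \<rho> \<xi> \<partial>torus_measure \<partial>torus_measure) * wt \<rho> b"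
        using \<psi>2 by (intro nn_integral_multc torus.borel_measurable_nn_integral) (simp add: split_beta')
      also have "(\<integral>\<^sup>+z. \<integral>\<^sup>+\<xi>. \<psi> z \<rho> \<xi> \<partial>torus_measure \<partial>torus_measure) = (\<integral>\<^sup>+\<xi>. \<integral>\<^sup>+z. \<psi> z \<rho> \<xi> \<partial>torus_measure \<partial>torus_measure)"
        using \<psi>2 by (intro TT.Fubini'[symmetric]) (simp add: split_beta')
      also have "\<dots> = (\<integral>\<^sup>+\<xi>. ennreal (norm (f (scale_vec \<rho> \<xi>)) powr t) * power_mean t g (R * \<rho>) \<partial>torus_measure)"
      proof (rule nn_integral_cong)
        fix \<xi> :: "complex ^ 'n" assume "\<xi> \<in> space torus_measure"
        then have \<xi>: "cnj_vec \<xi> \<in> unit_torus" by (simp add: cnj_vec_torus)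
        have "(\<lambda>z. g (scale_vec (R * \<rho>) (z * cnj_vec \<xi>))) \<in> borel_measurable torus_measure"
          by (rule measurable_compose[OF measurable_unit_torus_rotate[OF \<xi>] measurable_hol_fixed[OF hg R\<rho>]])
        then have "(\<integral>\<^sup>+z. \<psi> z \<rho> \<xi> \<partial>torus_measure) = ennreal (norm (f (scale_vec \<rho> \<xi>)) powr t) * (\<integral>\<^sup>+z. ennreal (norm (g (scale_vec (R * \<rho>) (z * cnj_vec \<xi>))) powr t) \<partial>torus_measure)"
          unfolding \<psi>_def by (intro nn_integral_cmult) simp
        also have "(\<integral>\<^sup>+z. ennreal (norm (g (scale_vec (R * \<rho>) (z * cnj_vec \<xi>))) powr t) \<partial>torus_measure) = power_mean t g (R * \<rho>)"
          using power_mean_rotate[OF hg R\<rho> \<xi>] by (simp add: mult.commute)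
        finally show "(\<integral>\<^sup>+z. \<psi> z \<rho> \<xi> \<partial>torus_measure) = ennreal (norm (f (scale_vec \<rho> \<xi>)) powr t) * power_mean t g (R * \<rho>)" .
      qed
      also have "\<dots> = power_mean t f \<rho> * power_mean t g (R * \<rho>)"
        unfolding power_mean_def[of t f] by (rule nn_integral_multc) measurable
      finally show "(\<integral>\<^sup>+z. (\<integral>\<^sup>+\<xi>. \<psi> z \<rho> \<xi> \<partial>torus_measure) * wt \<rho> b \<partial>torus_measure) = power_mean t f \<rho> * power_mean t g (R * \<rho>) * wt \<rho> b" .
    qed
    finally show ?thesis .
  qed
  ultimately show ?thesis unfolding b_def by (rule that)
qed

lemma measurable_cube_mult [measurable]:
  assumes f: "f \<in> M \<rightarrow>\<^sub>M cube_measure" and g: "g \<in> M \<rightarrow>\<^sub>M cube_measure"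
  shows "(\<lambda>x. f x * g x) \<in> M \<rightarrow>\<^sub>M cube_measure"
  unfolding measurable_cong_sets[OF refl sets_cube_measure]
proof (intro measurable_restrict_space2)
  show "(\<lambda>x. f x * g x) \<in> space M \<rightarrow> unit_cube"
    using measurable_space[OF f] measurable_space[OF g] by (auto intro: times_cube)
  have [measurable]: "(\<lambda>x. f x $ j) \<in> borel_measurable M" "(\<lambda>x. g x $ j) \<in> borel_measurable M" for j
    using measurable_compose[OF f measurable_cube_nth_borel] measurable_compose[OF g measurable_cube_nth_borel] by auto
  show "(\<lambda>x. f x * g x) \<in> borel_measurable M"
    unfolding times_vec_def by (rule measurable_vec_lambda_borel) measurable
qed

text \<open>The assumption on \<open>g\<close> replaces its mean at \<open>R * \<rho>\<close> by a
  negative power of 1 - R\<rho>. The device for exponents below 1, now with \<sigma> = s/t, moves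
  the outer power inside the radial integral. By Tonelli the integral over \<open>R\<close> is then
  a radial kernel integral, convergent because \<beta> < \<kappa>, and the powers of 1 - \<rho> add
  up to the weight of the space containing \<open>f\<close>.\<close>

lemma sufficiency:
  fixes f g h :: "complex ^ 'n \<Rightarrow> complex"
  assumes f: "has_power_series f a" and g: "has_power_series g (\<lambda>k. of_real (binom_coeff m k) * c k)"
    and h: "has_power_series h (\<lambda>k. c k * a k)"
    and t: "0 < t" "t \<le> 1" and s: "0 < s" "s \<le> t" and m: "2 < t * (real m + 1)" and \<beta>: "0 < \<beta>"
    and \<gamma>: "\<beta> < \<kappa>" "\<kappa> = real m + 1 - 1 / t + \<beta> - \<gamma>"
    and S: "S < top" "\<And>r. r \<in> unit_cube \<Longrightarrow> power_mean t g r * wt r (t * \<kappa>) \<le> S"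
    and fin: "A_norm_pow t s \<gamma> f < \<infinity>"
  shows "A_norm_pow t s \<beta> h < \<infinity>"
proof -
  interpret pair_sigma_finite "cube_measure :: (real ^ 'n) measure" "cube_measure :: (real ^ 'n) measure" ..
  have hf: "f \<in> hol_polydisc" and hg: "g \<in> hol_polydisc" and hh: "h \<in> hol_polydisc"
    using f g h by (auto intro: has_power_series_hol_polydisc)
  obtain K where K: "K < top" "\<And>R. R \<in> unit_cube \<Longrightarrow> power_mean t h R
    \<le> K * (\<integral>\<^sup>+\<rho>. power_mean t f \<rho> * power_mean t g (R * \<rho>) * wt \<rho> (real m * t + t - 2) \<partial>cube_measure)"
    by (rule multiplier_mean_le[OF f g h t m], rule that)
  have [measurable]: "power_mean t f \<in> borel_measurable cube_measure" by (rule measurable_power_mean[OF hf])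
  have \<kappa>: "0 < \<kappa>" using \<beta> \<gamma> by simp
  define e where "e = real m * t + t - 1"
  have e: "0 < e" using m by (simp add: e_def algebra_simps)
  define \<sigma> where "\<sigma> = s / t"
  have \<sigma>: "0 < \<sigma>" "\<sigma> \<le> 1" using s t by (auto simp: \<sigma>_def)
  have wm: "(\<lambda>\<rho>. wt (R * \<rho>) x) \<in> borel_measurable cube_measure" if R: "R \<in> unit_cube" for R :: "real ^ 'n" and x
    by (rule measurable_compose[OF measurable_times_cube[OF R measurable_ident_sets[OF refl]]]) measurable
  define M where "M \<rho> = ennpowr (power_mean t f \<rho>) \<sigma>" for \<rho>
  have [measurable]: "M \<in> borel_measurable cube_measure" unfolding M_def by measurable
  define C where "C = ennreal ((e * \<sigma> * 2 powr (e * \<sigma>)) ^ CARD('n))"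
  define D where "D = ennpowr K \<sigma> * ennpowr S \<sigma> * ennpowr C (1 - \<sigma>)"
  have D: "D < top" using K S by (simp add: D_def C_def ennreal_mult_less_top)
  have mean: "ennpowr (power_mean t h R) \<sigma> \<le> D * (\<integral>\<^sup>+\<rho>. M \<rho> * (wt (R * \<rho>) (- (s * \<kappa>)) * wt \<rho> (e * \<sigma> - 1)) \<partial>cube_measure)"
    if R: "R \<in> unit_cube" for R
  proof -
    define \<phi> where "\<phi> \<rho> = power_mean t f \<rho> * wt (R * \<rho>) (- (t * \<kappa>))" for \<rho>
    have \<phi>m [measurable]: "\<phi> \<in> borel_measurable cube_measure"
      using wm[OF R] unfolding \<phi>_def by measurable
    define J where "J = (\<integral>\<^sup>+\<rho>. ennpowr (\<phi> \<rho>) \<sigma> * wt \<rho> (e * \<sigma> - 1) \<partial>cube_measure)"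
    have "power_mean t h R \<le> K * (\<integral>\<^sup>+\<rho>. power_mean t f \<rho> * power_mean t g (R * \<rho>) * wt \<rho> (real m * t + t - 2) \<partial>cube_measure)"
      by (rule K(2)[OF R])
    also have "\<dots> \<le> K * (\<integral>\<^sup>+\<rho>. S * (\<phi> \<rho> * wt \<rho> (e - 1)) \<partial>cube_measure)"
    proof (intro mult_left_mono nn_integral_mono)
      fix \<rho> :: "real ^ 'n" assume "\<rho> \<in> space cube_measure"
      then have R\<rho>: "R * \<rho> \<in> unit_cube" using times_cube[OF R] by simp
      have "power_mean t g (R * \<rho>) = power_mean t g (R * \<rho>) * wt (R * \<rho>) (t * \<kappa>) * wt (R * \<rho>) (- (t * \<kappa>))"
        using wt_cancel[OF R\<rho>, of "t * \<kappa>"] by (simp add: mult.assoc)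
      also have "\<dots> \<le> S * wt (R * \<rho>) (- (t * \<kappa>))"
        by (intro mult_right_mono S(2) R\<rho>) simp
      finally have "power_mean t f \<rho> * power_mean t g (R * \<rho>) * wt \<rho> (e - 1) \<le> power_mean t f \<rho> * (S * wt (R * \<rho>) (- (t * \<kappa>))) * wt \<rho> (e - 1)"
        by (intro mult_right_mono mult_left_mono) auto
      moreover have "real m * t + t - 2 = e - 1" by (simp add: e_def)
      ultimately show "power_mean t f \<rho> * power_mean t g (R * \<rho>) * wt \<rho> (real m * t + t - 2) \<le> S * (\<phi> \<rho> * wt \<rho> (e - 1))"
        by (simp add: \<phi>_def mult_ac)
    qed simp
    also have "\<dots> = K * S * (\<integral>\<^sup>+\<rho>. \<phi> \<rho> * wt \<rho> (e - 1) \<partial>cube_measure)"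
      by (subst nn_integral_cmult) (auto simp: mult.assoc)
    finally have "ennpowr (power_mean t h R) \<sigma> \<le> ennpowr (K * S * (\<integral>\<^sup>+\<rho>. \<phi> \<rho> * wt \<rho> (e - 1) \<partial>cube_measure)) \<sigma>"
      using \<sigma> by (intro ennpowr_mono) auto
    also have "\<dots> = ennpowr K \<sigma> * ennpowr S \<sigma> * ennpowr (\<integral>\<^sup>+\<rho>. \<phi> \<rho> * wt \<rho> (e - 1) \<partial>cube_measure) \<sigma>"
      by (simp add: ennpowr_mult)
    also have "\<dots> \<le> ennpowr K \<sigma> * ennpowr S \<sigma> * (ennpowr C (1 - \<sigma>) * J)"
    proof (intro mult_left_mono ennpowr_nn_integral_le[OF \<sigma> _ _ _ J_def])
      \<comment> \<open>The division of the weight demanded by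
        \<open>ennpowr_nn_integral_le\<close>, with \<open>y\<close> the weight of exponent
        \<open>e\<close>.\<close>
      show "wt \<rho> (e - 1) = wt \<rho> (e * \<sigma> - 1) * ennpowr (wt \<rho> e) (1 - \<sigma>)" for \<rho> :: "real ^ 'n"
      proof -
        have "e - 1 = (e * \<sigma> - 1) + e * (1 - \<sigma>)" by (simp add: algebra_simps)
        then show ?thesis by (simp only: ennpowr_radial_weight ennreal_radial_weight_add)
      qed
      show "ennpowr (\<phi> \<rho> * wt \<rho> e) \<sigma> \<le> C * J" if "\<rho> \<in> space cube_measure" for \<rho>
      proof -
        have \<rho>: "\<rho> \<in> unit_cube" using that by simp
        have "ennpowr (\<phi> \<rho>) \<sigma> * wt \<rho> (e * \<sigma>) \<le> C * J"
          unfolding C_def J_def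
        proof (rule weighted_integral_ge[OF _ \<rho>])
          fix R' assume R': "R' \<in> unit_cube" and le: "\<And>j. (1 + \<rho> $ j) / 2 \<le> R' $ j"
          \<comment> \<open>Having a negative exponent this weight increases with \<rho>, as the
            mean of \<open>f\<close> does. So \<open>\<phi>\<close> is monotone and its value is
            controlled by its own weighted integral, without subharmonicity being used a second time
            for \<open>g\<close>.\<close>
          have "wt (R * \<rho>) (- (t * \<kappa>)) \<le> wt (R * R') (- (t * \<kappa>))"
            unfolding wt_prod
          proof (intro prod_mono_ennreal ennreal_leI powr_mono2')
            fix j
            have r: "0 \<le> R $ j" "R $ j < 1" "R' $ j < 1" "0 \<le> \<rho> $ j" "\<rho> $ j < R' $ j"
              using R R' half_less[OF \<rho> le] by (auto simp: unit_cube_def)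
            have "(R * R') $ j < 1" using times_cube[OF R R'] by (simp add: unit_cube_def)
            then show "0 < 1 - (R * R') $ j" by simp
            show "1 - (R * R') $ j \<le> 1 - (R * \<rho>) $ j"
              using r by (simp add: mult_left_mono)
          qed (use t \<kappa> in simp)
          then show "ennpowr (\<phi> \<rho>) \<sigma> \<le> ennpowr (\<phi> R') \<sigma>"
            unfolding \<phi>_def using \<sigma>
            by (intro ennpowr_mono mult_mono power_mean_mono_half[OF hf t(1) \<rho> R' le]) auto
        qed (use e \<sigma> in auto)
        then show ?thesis by (simp add: ennpowr_mult ennpowr_radial_weight)
      qed
    qed auto
    also have "J = (\<integral>\<^sup>+\<rho>. M \<rho> * (wt (R * \<rho>) (- (s * \<kappa>)) * wt \<rho> (e * \<sigma> - 1)) \<partial>cube_measure)"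
    proof -
      have "- (t * \<kappa>) * \<sigma> = - (s * \<kappa>)" using t by (simp add: \<sigma>_def)
      then show ?thesis
        unfolding J_def \<phi>_def M_def by (simp only: ennpowr_mult ennpowr_radial_weight mult.assoc)
    qed
    finally show ?thesis by (simp add: D_def mult.assoc)
  qed
  \<comment> \<open>The constant of \<open>nn_integral_radial_kernel_le\<close> for b = \<beta>s and
    c = s\<kappa>, which is applied below with u = 1.\<close>
  define E where "E = (1 / (\<beta> * s) + 1 / (s * \<kappa> - \<beta> * s)) * 2 powr (s * \<kappa> - \<beta> * s)"
  have bs: "0 < \<beta> * s" "\<beta> * s < s * \<kappa>" using \<beta> s \<gamma> by (simp_all add: mult.commute)
  have inner: "(\<integral>\<^sup>+R. wt R (\<beta> * s - 1) * wt (R * \<rho>) (- (s * \<kappa>)) \<partial>cube_measure) \<le> ennreal (E ^ CARD('n)) * wt \<rho> (\<beta> * s - s * \<kappa>)"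
    if \<rho>: "\<rho> \<in> unit_cube" for \<rho> :: "real ^ 'n"
  proof -
    have r: "0 \<le> \<rho> $ j" "\<rho> $ j < 1" for j using \<rho> by (auto simp: unit_cube_def)
    let ?h = "\<lambda>j x. ennreal ((1 - x) powr (\<beta> * s - 1)) * ennreal ((1 - x * \<rho> $ j) powr (- (s * \<kappa>)))"
    have "(\<integral>\<^sup>+R. wt R (\<beta> * s - 1) * wt (R * \<rho>) (- (s * \<kappa>)) \<partial>cube_measure) = (\<integral>\<^sup>+R. (\<Prod>j\<in>UNIV. ?h j (R $ j)) \<partial>cube_measure)"
      by (simp add: wt_prod prod.distrib)
    also have "\<dots> = (\<Prod>j\<in>(UNIV :: 'n set). \<integral>\<^sup>+x. ?h j x \<partial>unit_interval_measure)"
      by (rule nn_integral_cube_prod, rule measurable_unit_intervalI) measurable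
    also have "\<dots> \<le> (\<Prod>j\<in>(UNIV :: 'n set). ennreal E * ennreal ((1 - \<rho> $ j) powr (\<beta> * s - s * \<kappa>)))"
    proof (rule prod_mono_ennreal)
      fix j
      have "(\<integral>\<^sup>+x. ?h j x \<partial>unit_interval_measure)
        = (\<integral>\<^sup>+x. ennreal ((1 - x) powr (\<beta> * s - 1) * norm (1 - of_real (\<rho> $ j * x) * (1 :: complex)) powr (- (s * \<kappa>))) \<partial>unit_interval_measure)"
      proof (rule nn_integral_cong)
        fix x assume "x \<in> space unit_interval_measure"
        then have "\<rho> $ j * x \<le> 1" using r[of j] by (intro mult_le_one) auto
        then have "norm (1 - of_real (\<rho> $ j * x) * (1 :: complex)) = 1 - x * \<rho> $ j"
          using norm_of_real[of "1 - \<rho> $ j * x", where 'a = complex] by (simp add: mult.commute)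
        then show "?h j x = ennreal ((1 - x) powr (\<beta> * s - 1) * norm (1 - of_real (\<rho> $ j * x) * (1 :: complex)) powr (- (s * \<kappa>)))"
          by (simp only:) (simp add: ennreal_mult)
      qed
      also have "\<dots> \<le> ennreal (E * norm (1 - of_real (\<rho> $ j) * (1 :: complex)) powr (\<beta> * s - s * \<kappa>))"
        unfolding E_def by (rule nn_integral_radial_kernel_le) (use bs r in auto)
      also have "norm (1 - of_real (\<rho> $ j) * (1 :: complex)) = 1 - \<rho> $ j"
        using norm_of_real[of "1 - \<rho> $ j", where 'a = complex] r[of j] by simp
      also have "ennreal (E * (1 - \<rho> $ j) powr (\<beta> * s - s * \<kappa>)) = ennreal E * ennreal ((1 - \<rho> $ j) powr (\<beta> * s - s * \<kappa>))"
        using bs by (intro ennreal_mult) (auto simp: E_def)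
      finally show "(\<integral>\<^sup>+x. ?h j x \<partial>unit_interval_measure) \<le> ennreal E * ennreal ((1 - \<rho> $ j) powr (\<beta> * s - s * \<kappa>))" .
    qed
    also have "\<dots> = ennreal (E ^ CARD('n)) * wt \<rho> (\<beta> * s - s * \<kappa>)"
      using bs by (simp add: prod.distrib wt_prod ennreal_power E_def)
    finally show ?thesis .
  qed
  have wm2: "(\<lambda>(R, \<rho>). wt (R * \<rho>) x) \<in> borel_measurable (cube_measure \<Otimes>\<^sub>M (cube_measure :: (real ^ 'n) measure))" for x
  proof -
    have "(\<lambda>z. (1 - (fst z * snd z) $ j) powr x) \<in> borel_measurable (cube_measure \<Otimes>\<^sub>M (cube_measure :: (real ^ 'n) measure))" for j :: 'n
      by simp
    then show ?thesis unfolding radial_weight_def split_beta' by measurable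
  qed
  have "A_norm_pow t s \<beta> h = (\<integral>\<^sup>+R. ennpowr (power_mean t h R) \<sigma> * wt R (\<beta> * s - 1) \<partial>cube_measure)"
    by (simp add: A_norm_pow_eq[OF t(1)] \<sigma>_def)
  also have "\<dots> \<le> (\<integral>\<^sup>+R. (D * (\<integral>\<^sup>+\<rho>. M \<rho> * (wt (R * \<rho>) (- (s * \<kappa>)) * wt \<rho> (e * \<sigma> - 1)) \<partial>cube_measure)) * wt R (\<beta> * s - 1) \<partial>cube_measure)"
    by (intro nn_integral_mono mult_right_mono mean) auto
  also have "\<dots> = (\<integral>\<^sup>+R. D * (\<integral>\<^sup>+\<rho>. (M \<rho> * wt \<rho> (e * \<sigma> - 1)) * (wt R (\<beta> * s - 1) * wt (R * \<rho>) (- (s * \<kappa>))) \<partial>cube_measure) \<partial>cube_measure)"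
  proof (rule nn_integral_cong)
    fix R :: "real ^ 'n" assume "R \<in> space cube_measure"
    then have [measurable]: "(\<lambda>\<rho>. wt (R * \<rho>) x) \<in> borel_measurable cube_measure" for x using wm[of R] by simp
    show "(D * (\<integral>\<^sup>+\<rho>. M \<rho> * (wt (R * \<rho>) (- (s * \<kappa>)) * wt \<rho> (e * \<sigma> - 1)) \<partial>cube_measure)) * wt R (\<beta> * s - 1)
      = D * (\<integral>\<^sup>+\<rho>. (M \<rho> * wt \<rho> (e * \<sigma> - 1)) * (wt R (\<beta> * s - 1) * wt (R * \<rho>) (- (s * \<kappa>))) \<partial>cube_measure)"
    proof -
      have "(\<integral>\<^sup>+\<rho>. M \<rho> * (wt (R * \<rho>) (- (s * \<kappa>)) * wt \<rho> (e * \<sigma> - 1)) \<partial>cube_measure) * wt R (\<beta> * s - 1)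
        = (\<integral>\<^sup>+\<rho>. M \<rho> * (wt (R * \<rho>) (- (s * \<kappa>)) * wt \<rho> (e * \<sigma> - 1)) * wt R (\<beta> * s - 1) \<partial>cube_measure)"
        by (rule nn_integral_multc[symmetric]) measurable
      also have "\<dots> = (\<integral>\<^sup>+\<rho>. (M \<rho> * wt \<rho> (e * \<sigma> - 1)) * (wt R (\<beta> * s - 1) * wt (R * \<rho>) (- (s * \<kappa>))) \<partial>cube_measure)"
        by (intro nn_integral_cong) (simp only: mult_ac)
      finally show ?thesis by (simp only: mult.assoc)
    qed
  qed
  also have "\<dots> = D * (\<integral>\<^sup>+R. \<integral>\<^sup>+\<rho>. (M \<rho> * wt \<rho> (e * \<sigma> - 1)) * (wt R (\<beta> * s - 1) * wt (R * \<rho>) (- (s * \<kappa>))) \<partial>cube_measure \<partial>cube_measure)"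
    using wm2 by (intro nn_integral_cmult cube.borel_measurable_nn_integral) measurable
  also have "(\<integral>\<^sup>+R. \<integral>\<^sup>+\<rho>. (M \<rho> * wt \<rho> (e * \<sigma> - 1)) * (wt R (\<beta> * s - 1) * wt (R * \<rho>) (- (s * \<kappa>))) \<partial>cube_measure \<partial>cube_measure)
     = (\<integral>\<^sup>+\<rho>. \<integral>\<^sup>+R. (M \<rho> * wt \<rho> (e * \<sigma> - 1)) * (wt R (\<beta> * s - 1) * wt (R * \<rho>) (- (s * \<kappa>))) \<partial>cube_measure \<partial>cube_measure)"
    using wm2 by (intro Fubini'[symmetric]) measurable
  also have "\<dots> \<le> (\<integral>\<^sup>+\<rho>. ennreal (E ^ CARD('n)) * (M \<rho> * wt \<rho> (\<gamma> * s - 1)) \<partial>cube_measure)"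
  proof (rule nn_integral_mono)
    fix \<rho> :: "real ^ 'n" assume "\<rho> \<in> space cube_measure"
    then have \<rho>: "\<rho> \<in> unit_cube" by simp
    have [measurable]: "(\<lambda>R. wt (R * \<rho>) x) \<in> borel_measurable cube_measure" for x using wm[OF \<rho>] by (simp add: mult.commute)
    have "(\<integral>\<^sup>+R. (M \<rho> * wt \<rho> (e * \<sigma> - 1)) * (wt R (\<beta> * s - 1) * wt (R * \<rho>) (- (s * \<kappa>))) \<partial>cube_measure)
       = (M \<rho> * wt \<rho> (e * \<sigma> - 1)) * (\<integral>\<^sup>+R. wt R (\<beta> * s - 1) * wt (R * \<rho>) (- (s * \<kappa>)) \<partial>cube_measure)"
      by (rule nn_integral_cmult) measurable
    also have "\<dots> \<le> (M \<rho> * wt \<rho> (e * \<sigma> - 1)) * (ennreal (E ^ CARD('n)) * wt \<rho> (\<beta> * s - s * \<kappa>))"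
      by (intro mult_left_mono inner \<rho>) simp
    also have "\<dots> = ennreal (E ^ CARD('n)) * (M \<rho> * (wt \<rho> (e * \<sigma> - 1) * wt \<rho> (\<beta> * s - s * \<kappa>)))"
      by (simp add: mult_ac)
    also have "wt \<rho> (e * \<sigma> - 1) * wt \<rho> (\<beta> * s - s * \<kappa>) = wt \<rho> (\<gamma> * s - 1)"
    proof -
      \<comment> \<open>This balance is what determines \<kappa> in terms of m, t, \<beta> and
        \<gamma>.\<close>
      have "e * \<sigma> - 1 + (\<beta> * s - s * \<kappa>) = \<gamma> * s - 1"
        using t by (simp add: e_def \<sigma>_def \<gamma>(2) field_simps)
      then show ?thesis by (simp only: ennreal_radial_weight_add[symmetric])
    qed
    finally show "(\<integral>\<^sup>+R. (M \<rho> * wt \<rho> (e * \<sigma> - 1)) * (wt R (\<beta> * s - 1) * wt (R * \<rho>) (- (s * \<kappa>))) \<partial>cube_measure) \<le> ennreal (E ^ CARD('n)) * (M \<rho> * wt \<rho> (\<gamma> * s - 1))" .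
  qed
  also have "\<dots> = ennreal (E ^ CARD('n)) * A_norm_pow t s \<gamma> f"
    unfolding A_norm_pow_eq[OF t(1)] M_def \<sigma>_def by (rule nn_integral_cmult) measurable
  finally have "A_norm_pow t s \<beta> h \<le> D * (ennreal (E ^ CARD('n)) * A_norm_pow t s \<gamma> f)"
    by (simp add: mult_left_mono)
  also have "\<dots> < \<infinity>" using D fin by (simp add: ennreal_mult_less_top)
  finally show ?thesis .
qed

section \<open>Necessity\<close>

lemma suminf_ennreal_geometric:
  assumes "0 \<le> \<delta>" "\<delta> < 1"
  shows "(\<Sum>i. ennreal (\<delta> ^ i)) = ennreal (1 / (1 - \<delta>))"
  by (rule suminf_ennreal_eq) (use assms in \<open>auto intro!: geometric_sums\<close>)

lemma powr_lt_one: "0 \<le> x \<Longrightarrow> x < 1 \<Longrightarrow> 0 < a \<Longrightarrow> x powr a < (1 :: real)"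
  using powr_less_mono2[of a x 1] by simp

text \<open>A countable triangle inequality that holds for every positive exponent, convex or
  concave. The geometric weight is split in two: one factor \<delta>^i makes the series converge,
  the other keeps the exponentiated sum on the right under control.\<close>

lemma ennpowr_suminf_le:
  fixes H :: "nat \<Rightarrow> ennreal"
  assumes a: "0 < a" and \<delta>: "0 < \<delta>" "\<delta> < 1"
  shows "ennpowr (\<Sum>i. ennreal ((\<delta> * \<delta>) ^ i) * H i) a
    \<le> ennpowr (ennreal (1 / (1 - \<delta>))) a * (\<Sum>i. ennreal ((\<delta> powr a) ^ i) * ennpowr (H i) a)"
proof -
  define T where "T = (\<Sum>i. ennreal ((\<delta> powr a) ^ i) * ennpowr (H i) a)"
  \<comment> \<open>A single term is at most the whole sum \<open>T\<close> after exponentiation, so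
    after taking the root all terms share one bound and only a geometric series is left.\<close>
  have each: "ennreal (\<delta> ^ i) * H i \<le> ennpowr T (1 / a)" for i
  proof -
    have "ennpowr (ennreal (\<delta> ^ i) * H i) a = ennreal ((\<delta> powr a) ^ i) * ennpowr (H i) a"
    proof -
      have "(\<delta> ^ i) powr a = (\<delta> powr a) ^ i"
      proof -
        have "(\<delta> ^ i) powr a = (\<delta> powr real i) powr a" using \<delta> by (simp add: powr_realpow)
        also have "\<dots> = (\<delta> powr a) powr real i" by (simp add: powr_powr mult.commute)
        also have "\<dots> = (\<delta> powr a) ^ i" using \<delta> by (intro powr_realpow) simp
        finally show ?thesis .
      qed
      then show ?thesis using \<delta> by (simp add: ennpowr_mult ennpowr_ennreal)
    qed
    also have "\<dots> \<le> T"
      unfolding T_def using sum_le_suminf[of "\<lambda>i. ennreal ((\<delta> powr a) ^ i) * ennpowr (H i) a" "{i}"] by simp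
    finally have "ennpowr (ennpowr (ennreal (\<delta> ^ i) * H i) a) (1 / a) \<le> ennpowr T (1 / a)"
      using a by (intro ennpowr_mono) auto
    then show ?thesis using a by (simp add: ennpowr_ennpowr)
  qed
  have "(\<Sum>i. ennreal ((\<delta> * \<delta>) ^ i) * H i) \<le> (\<Sum>i. ennreal (\<delta> ^ i) * ennpowr T (1 / a))"
  proof (rule suminf_le)
    fix i
    have "ennreal ((\<delta> * \<delta>) ^ i) * H i = ennreal (\<delta> ^ i) * (ennreal (\<delta> ^ i) * H i)"
      using \<delta> by (simp add: power_mult_distrib ennreal_mult mult.assoc)
    also have "\<dots> \<le> ennreal (\<delta> ^ i) * ennpowr T (1 / a)"
      by (intro mult_left_mono each) simp
    finally show "ennreal ((\<delta> * \<delta>) ^ i) * H i \<le> ennreal (\<delta> ^ i) * ennpowr T (1 / a)" .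
  qed auto
  also have "\<dots> = ennreal (1 / (1 - \<delta>)) * ennpowr T (1 / a)"
    unfolding ennreal_suminf_multc using \<delta> by (subst suminf_ennreal_geometric) auto
  finally have "ennpowr (\<Sum>i. ennreal ((\<delta> * \<delta>) ^ i) * H i) a \<le> ennpowr (ennreal (1 / (1 - \<delta>)) * ennpowr T (1 / a)) a"
    using a by (intro ennpowr_mono) auto
  also have "\<dots> = ennpowr (ennreal (1 / (1 - \<delta>))) a * T"
    using a by (simp add: ennpowr_mult ennpowr_ennpowr)
  finally show ?thesis by (simp add: T_def)
qed

text \<open>Two rounds of \<open>ennpowr_suminf_le\<close>, one for the inner exponent and one for
  the outer. The measure spaces are abstract so that the statement covers the F-norm (torus outside,
  cube inside) and the A-norm (the reverse).\<close>

lemma mixed_norm_superposition: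
  assumes a: "0 < a" and b: "0 < b"
    and Gm: "\<And>i x. x \<in> space M1 \<Longrightarrow> (\<lambda>y. G i x y) \<in> borel_measurable M2"
    and v: "v \<in> borel_measurable M2" and w: "w \<in> borel_measurable M1"
    and Nm: "\<And>i. (\<lambda>x. \<integral>\<^sup>+y. v y * ennpowr (G i x y) a \<partial>M2) \<in> borel_measurable M1"
    and le: "\<And>x y. x \<in> space M1 \<Longrightarrow> y \<in> space M2 \<Longrightarrow> H x y \<le> (\<Sum>i. ennreal ((1 / 4) ^ i) * G i x y)"
    and N: "\<And>i. (\<integral>\<^sup>+x. w x * ennpowr (\<integral>\<^sup>+y. v y * ennpowr (G i x y) a \<partial>M2) b \<partial>M1) \<le> C" and C: "C < top"
  shows "(\<integral>\<^sup>+x. w x * ennpowr (\<integral>\<^sup>+y. v y * ennpowr (H x y) a \<partial>M2) b \<partial>M1) < top"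
proof -
  \<comment> \<open>The first round turns 1/4 = 1/2 * 1/2 into the ratio (1/2)^a; \<delta> is its
    square root, so that a square is again available for the second round.\<close>
  define \<delta> where "\<delta> = (1 / 2) powr (a / 2)"
  have \<delta>: "0 < \<delta>" "\<delta> < 1" using a powr_lt_one[of "1/2" "a/2"] by (auto simp: \<delta>_def)
  have \<delta>2: "(1 / 2 :: real) powr a = \<delta> * \<delta>" by (simp add: \<delta>_def flip: powr_add)
  define c1 where "c1 = ennpowr (ennreal (1 / (1 - 1 / 2))) a"
  define c2 where "c2 = ennpowr (ennreal (1 / (1 - \<delta>))) b"
  define N1 where "N1 i x = (\<integral>\<^sup>+y. v y * ennpowr (G i x y) a \<partial>M2)" for i x
  have [measurable]: "w \<in> borel_measurable M1" "v \<in> borel_measurable M2" by (fact w, fact v)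
  have N1m [measurable]: "N1 i \<in> borel_measurable M1" for i unfolding N1_def by (rule Nm)
  have inner: "(\<integral>\<^sup>+y. v y * ennpowr (H x y) a \<partial>M2) \<le> c1 * (\<Sum>i. ennreal ((\<delta> * \<delta>) ^ i) * N1 i x)"
    if x: "x \<in> space M1" for x
  proof -
    note [measurable] = Gm[OF x]
    have "(\<integral>\<^sup>+y. v y * ennpowr (H x y) a \<partial>M2) \<le> (\<integral>\<^sup>+y. c1 * (\<Sum>i. ennreal ((\<delta> * \<delta>) ^ i) * (v y * ennpowr (G i x y) a)) \<partial>M2)"
    proof (rule nn_integral_mono)
      fix y assume y: "y \<in> space M2"
      have "ennpowr (H x y) a \<le> ennpowr (\<Sum>i. ennreal ((1 / 2 * (1 / 2)) ^ i) * G i x y) a"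
        using le[OF x y] a by (intro ennpowr_mono) auto
      also have "\<dots> \<le> c1 * (\<Sum>i. ennreal (((1 / 2) powr a) ^ i) * ennpowr (G i x y) a)"
        unfolding c1_def by (rule ennpowr_suminf_le[OF a]) auto
      finally have "v y * ennpowr (H x y) a \<le> v y * (c1 * (\<Sum>i. ennreal ((\<delta> * \<delta>) ^ i) * ennpowr (G i x y) a))"
        unfolding \<delta>2 by (rule mult_left_mono) simp
      also have "\<dots> = c1 * (\<Sum>i. v y * (ennreal ((\<delta> * \<delta>) ^ i) * ennpowr (G i x y) a))"
        by (simp add: ennreal_suminf_cmult mult_ac)
      finally show "v y * ennpowr (H x y) a \<le> c1 * (\<Sum>i. ennreal ((\<delta> * \<delta>) ^ i) * (v y * ennpowr (G i x y) a))"
        by (simp add: mult_ac)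
    qed
    also have "\<dots> = c1 * (\<integral>\<^sup>+y. (\<Sum>i. ennreal ((\<delta> * \<delta>) ^ i) * (v y * ennpowr (G i x y) a)) \<partial>M2)"
      by (rule nn_integral_cmult) measurable
    also have "(\<integral>\<^sup>+y. (\<Sum>i. ennreal ((\<delta> * \<delta>) ^ i) * (v y * ennpowr (G i x y) a)) \<partial>M2) = (\<Sum>i. \<integral>\<^sup>+y. ennreal ((\<delta> * \<delta>) ^ i) * (v y * ennpowr (G i x y) a) \<partial>M2)"
      by (rule nn_integral_suminf) measurable
    also have "\<dots> = (\<Sum>i. ennreal ((\<delta> * \<delta>) ^ i) * N1 i x)"
      unfolding N1_def by (intro suminf_cong nn_integral_cmult) measurable
    finally show ?thesis .
  qed
  define K where "K = ennpowr c1 b * c2"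
  have K: "K < top" by (simp add: K_def c1_def c2_def ennreal_mult_less_top)
  have "(\<integral>\<^sup>+x. w x * ennpowr (\<integral>\<^sup>+y. v y * ennpowr (H x y) a \<partial>M2) b \<partial>M1)
     \<le> (\<integral>\<^sup>+x. K * (\<Sum>i. ennreal ((\<delta> powr b) ^ i) * (w x * ennpowr (N1 i x) b)) \<partial>M1)"
  proof (rule nn_integral_mono)
    fix x assume x: "x \<in> space M1"
    have "ennpowr (\<integral>\<^sup>+y. v y * ennpowr (H x y) a \<partial>M2) b \<le> ennpowr (c1 * (\<Sum>i. ennreal ((\<delta> * \<delta>) ^ i) * N1 i x)) b"
      using b by (intro ennpowr_mono inner x) auto
    also have "\<dots> = ennpowr c1 b * ennpowr (\<Sum>i. ennreal ((\<delta> * \<delta>) ^ i) * N1 i x) b"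
      by (rule ennpowr_mult)
    also have "\<dots> \<le> ennpowr c1 b * (c2 * (\<Sum>i. ennreal ((\<delta> powr b) ^ i) * ennpowr (N1 i x) b))"
      unfolding c2_def by (intro mult_left_mono ennpowr_suminf_le b \<delta>) simp
    finally have "w x * ennpowr (\<integral>\<^sup>+y. v y * ennpowr (H x y) a \<partial>M2) b
      \<le> w x * (ennpowr c1 b * (c2 * (\<Sum>i. ennreal ((\<delta> powr b) ^ i) * ennpowr (N1 i x) b)))"
      by (rule mult_left_mono) simp
    also have "\<dots> = K * (\<Sum>i. w x * (ennreal ((\<delta> powr b) ^ i) * ennpowr (N1 i x) b))"
      by (simp add: K_def ennreal_suminf_cmult mult_ac)
    finally show "w x * ennpowr (\<integral>\<^sup>+y. v y * ennpowr (H x y) a \<partial>M2) b \<le> K * (\<Sum>i. ennreal ((\<delta> powr b) ^ i) * (w x * ennpowr (N1 i x) b))"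
      by (simp add: mult_ac)
  qed
  also have "\<dots> = K * (\<integral>\<^sup>+x. (\<Sum>i. ennreal ((\<delta> powr b) ^ i) * (w x * ennpowr (N1 i x) b)) \<partial>M1)"
    by (rule nn_integral_cmult) measurable
  also have "(\<integral>\<^sup>+x. (\<Sum>i. ennreal ((\<delta> powr b) ^ i) * (w x * ennpowr (N1 i x) b)) \<partial>M1) = (\<Sum>i. \<integral>\<^sup>+x. ennreal ((\<delta> powr b) ^ i) * (w x * ennpowr (N1 i x) b) \<partial>M1)"
    by (rule nn_integral_suminf) measurable
  also have "\<dots> = (\<Sum>i. ennreal ((\<delta> powr b) ^ i) * (\<integral>\<^sup>+x. w x * ennpowr (N1 i x) b \<partial>M1))"
    by (intro suminf_cong nn_integral_cmult) measurable
  also have "\<dots> \<le> (\<Sum>i. ennreal ((\<delta> powr b) ^ i) * C)"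
    unfolding N1_def by (intro suminf_le mult_left_mono N) auto
  also have "\<dots> = ennreal (1 / (1 - \<delta> powr b)) * C"
    unfolding ennreal_suminf_multc using \<delta> b powr_lt_one[of \<delta> b] by (subst suminf_ennreal_geometric) auto
  finally have "(\<integral>\<^sup>+x. w x * ennpowr (\<integral>\<^sup>+y. v y * ennpowr (H x y) a \<partial>M2) b \<partial>M1) \<le> K * (ennreal (1 / (1 - \<delta> powr b)) * C)"
    by (simp add: mult_left_mono)
  also have "\<dots> < top" using K C by (simp add: ennreal_mult_less_top)
  finally show ?thesis .
qed

text \<open>This is D^m of the Cauchy kernel. Its coefficients are \<open>binom_coeff m\<close>, so
  a multiplier \<open>c\<close> maps it to D^m g, where g has the coefficients
  \<open>c\<close>.\<close>

definition kernel :: "nat \<Rightarrow> complex ^ 'n \<Rightarrow> complex" where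
  "kernel m z = (\<Prod>j\<in>UNIV. 1 / (1 - z $ j) ^ (m + 1))"

lemma kernel_has_power_series: "has_power_series (kernel m) (\<lambda>k. of_real (binom_coeff m k))"
  unfolding has_power_series_def monom_pow_def kernel_def
  by (intro ballI has_sum_binom_coeff) (simp add: polydisc_def)

lemma norm_kernel_powr:
  assumes "\<And>j. norm (z $ j) < 1"
  shows "norm (kernel m z) powr \<kappa> = (\<Prod>j\<in>UNIV. norm (1 - z $ j) powr (- ((real m + 1) * \<kappa>)))"
proof -
  have prod: "(\<Prod>j\<in>A. x j) powr \<kappa> = (\<Prod>j\<in>A. x j powr \<kappa>)" if "\<And>j. 0 \<le> x j" "finite A" for A and x :: "'a \<Rightarrow> real"
    using that(2) by (induction A rule: finite_induct) (auto simp: powr_mult prod_nonneg that)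
  have pos: "0 < norm (1 - z $ j)" for j
  proof -
    have "1 - z $ j \<noteq> 0" using assms[of j] by auto
    then show ?thesis by simp
  qed
  have "norm (1 / (1 - z $ j) ^ (m + 1)) = norm (1 - z $ j) powr (- (real m + 1))" for j
  proof -
    have "norm (1 - z $ j) ^ (m + 1) = norm (1 - z $ j) powr (real m + 1)"
      using powr_realpow[OF pos[of j], of "m + 1"] by (simp add: add.commute)
    then show ?thesis by (simp only: norm_divide norm_power norm_one powr_minus_divide)
  qed
  then have "norm (kernel m z) = (\<Prod>j\<in>UNIV. norm (1 - z $ j) powr (- (real m + 1)))"
    by (simp only: kernel_def prod_norm[symmetric])
  then show ?thesis by (simp only:) (simp add: prod powr_powr algebra_simps)
qed

text \<open>The radial integral first leaves |1 - \<rho>\<xi>|^(-(m+1-\<alpha>)q), and the outer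
  power changes q to p. The exponent b = (m + 1 - \<alpha>)p exceeds 1 exactly under the assumption
  on m, so the circle integral is of order (1 - \<rho>)^(1-b). The bound does not depend on \<rho>.
  The redundant factor 1 matches the shape of \<open>mixed_norm_superposition\<close>.\<close>

lemma kernel_F_bound:
  fixes \<rho> :: "real ^ 'n"
  assumes p: "0 < p" and q: "0 < q" and \<alpha>: "0 < \<alpha>" and m: "\<alpha> + 1 / p < real m + 1" and \<rho>: "\<rho> \<in> unit_cube"
  defines "e \<equiv> real m + 1 - \<alpha> - 1 / p"
  shows "(\<integral>\<^sup>+\<xi>. 1 * ennpowr (\<integral>\<^sup>+R. wt R (\<alpha> * q - 1) * ennpowr (wt \<rho> e * ennreal (norm (kernel m (scale_vec \<rho> (scale_vec R \<xi>))))) q \<partial>cube_measure) (p / q) \<partial>torus_measure)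
    \<le> ennreal ((((1 / (\<alpha> * q) + 1 / ((real m + 1) * q - \<alpha> * q)) * 2 powr ((real m + 1) * q - \<alpha> * q)) powr (p / q)
       * (pi powr ((real m + 1 - \<alpha>) * p - 1) * (1 + 1 / ((real m + 1 - \<alpha>) * p - 1)))) ^ CARD('n))"
proof -
  define c1 where "c1 = (1 / (\<alpha> * q) + 1 / ((real m + 1) * q - \<alpha> * q)) * 2 powr ((real m + 1) * q - \<alpha> * q)"
  define b where "b = (real m + 1 - \<alpha>) * p"
  define c2 where "c2 = pi powr (b - 1) * (1 + 1 / (b - 1))"
  have m\<alpha>: "\<alpha> < real m + 1" using m p by (smt (verit) divide_pos_pos)
  have "1 / p < real m + 1 - \<alpha>" using m by simp
  then have b: "1 < b" using p by (simp add: b_def field_simps)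
  have \<alpha>q: "0 < \<alpha> * q" "\<alpha> * q < (real m + 1) * q" using \<alpha> q m\<alpha> by auto
  have c1: "0 \<le> c1" using \<alpha>q by (simp add: c1_def)
  have c2: "0 \<le> c2" using b by (simp add: c2_def)
  have r: "0 \<le> \<rho> $ j" "\<rho> $ j < 1" for j using \<rho> by (auto simp: unit_cube_def)
  let ?K = "\<lambda>R \<xi>. ennreal (norm (kernel m (scale_vec \<rho> (scale_vec R \<xi>))))"
  have inner: "(\<integral>\<^sup>+R. wt R (\<alpha> * q - 1) * ennpowr (wt \<rho> e * ?K R \<xi>) q \<partial>cube_measure)
     \<le> wt \<rho> (e * q) * (\<Prod>j\<in>UNIV. ennreal (c1 * norm (1 - of_real (\<rho> $ j) * \<xi> $ j) powr (\<alpha> * q - (real m + 1) * q)))"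
    if \<xi>: "\<xi> \<in> unit_torus" for \<xi>
  proof -
    have \<xi>1: "norm (\<xi> $ j) = 1" for j using \<xi> by (simp add: unit_torus_def)
    let ?h = "\<lambda>j x. ennreal ((1 - x) powr (\<alpha> * q - 1) * norm (1 - of_real (\<rho> $ j * x) * \<xi> $ j) powr (- ((real m + 1) * q)))"
    have "(\<integral>\<^sup>+R. wt R (\<alpha> * q - 1) * ennpowr (wt \<rho> e * ?K R \<xi>) q \<partial>cube_measure)
       = (\<integral>\<^sup>+R. wt \<rho> (e * q) * (\<Prod>j\<in>UNIV. ?h j (R $ j)) \<partial>cube_measure)"
    proof (rule nn_integral_cong)
      fix R :: "real ^ 'n" assume "R \<in> space cube_measure"
      then have R: "0 \<le> R $ j" "R $ j < 1" for j by (auto simp: unit_cube_def)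
      have lt: "\<rho> $ j * R $ j < 1" for j
        using mult_left_le[of "R $ j" "\<rho> $ j"] R[of j] r[of j] by linarith
      have "norm (scale_vec \<rho> (scale_vec R \<xi>) $ j) < 1" for j
        using lt[of j] R[of j] r[of j] by (simp add: norm_mult \<xi>1)
      from norm_kernel_powr[OF this, of m q]
      have "ennpowr (?K R \<xi>) q = (\<Prod>j\<in>UNIV. ennreal (norm (1 - of_real (\<rho> $ j * R $ j) * \<xi> $ j) powr (- ((real m + 1) * q))))"
        by (simp add: ennpowr_ennreal prod_ennreal mult.assoc)
      then show "wt R (\<alpha> * q - 1) * ennpowr (wt \<rho> e * ?K R \<xi>) q = wt \<rho> (e * q) * (\<Prod>j\<in>UNIV. ?h j (R $ j))"
        by (simp add: ennpowr_mult ennpowr_radial_weight wt_prod[of R] prod.distrib ennreal_mult mult_ac)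
    qed
    also have "\<dots> = wt \<rho> (e * q) * (\<integral>\<^sup>+R. (\<Prod>j\<in>UNIV. ?h j (R $ j)) \<partial>cube_measure)"
      by (rule nn_integral_cmult) measurable
    also have "(\<integral>\<^sup>+R. (\<Prod>j\<in>UNIV. ?h j (R $ j)) \<partial>cube_measure) = (\<Prod>j\<in>UNIV. \<integral>\<^sup>+x. ?h j x \<partial>unit_interval_measure)"
      by (rule nn_integral_cube_prod, rule measurable_unit_intervalI) measurable
    finally have 1: "(\<integral>\<^sup>+R. wt R (\<alpha> * q - 1) * ennpowr (wt \<rho> e * ?K R \<xi>) q \<partial>cube_measure)
       = wt \<rho> (e * q) * (\<Prod>j\<in>UNIV. \<integral>\<^sup>+x. ?h j x \<partial>unit_interval_measure)" .
    have "(\<Prod>j\<in>UNIV. \<integral>\<^sup>+x. ?h j x \<partial>unit_interval_measure) \<le> (\<Prod>j\<in>UNIV. ennreal (c1 * norm (1 - of_real (\<rho> $ j) * \<xi> $ j) powr (\<alpha> * q - (real m + 1) * q)))"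
      unfolding c1_def by (intro prod_mono_ennreal nn_integral_radial_kernel_le \<alpha>q r \<xi>1)
    then show ?thesis unfolding 1 by (rule mult_left_mono) simp
  qed
  let ?k = "\<lambda>j u. ennreal (c1 powr (p / q)) * ennreal (norm (1 - of_real (\<rho> $ j) * u) powr (- b))"
  have "(\<integral>\<^sup>+\<xi>. 1 * ennpowr (\<integral>\<^sup>+R. wt R (\<alpha> * q - 1) * ennpowr (wt \<rho> e * ?K R \<xi>) q \<partial>cube_measure) (p / q) \<partial>torus_measure)
     \<le> (\<integral>\<^sup>+\<xi>. wt \<rho> (e * p) * (\<Prod>j\<in>UNIV. ?k j (\<xi> $ j)) \<partial>torus_measure)"
  proof (rule nn_integral_mono)
    fix \<xi> :: "complex ^ 'n" assume "\<xi> \<in> space torus_measure"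
    then have \<xi>: "\<xi> \<in> unit_torus" by simp
    have "1 * ennpowr (\<integral>\<^sup>+R. wt R (\<alpha> * q - 1) * ennpowr (wt \<rho> e * ?K R \<xi>) q \<partial>cube_measure) (p / q)
       \<le> ennpowr (wt \<rho> (e * q) * (\<Prod>j\<in>UNIV. ennreal (c1 * norm (1 - of_real (\<rho> $ j) * \<xi> $ j) powr (\<alpha> * q - (real m + 1) * q)))) (p / q)"
      unfolding mult_1 using p q by (intro ennpowr_mono inner \<xi>) auto
    also have "\<dots> = wt \<rho> (e * p) * (\<Prod>j\<in>UNIV. ?k j (\<xi> $ j))"
    proof -
      have "(\<alpha> * q - (real m + 1) * q) * (p / q) = - b" using q by (simp add: b_def field_simps)
      then have "ennpowr (ennreal (c1 * norm (1 - of_real (\<rho> $ j) * \<xi> $ j) powr (\<alpha> * q - (real m + 1) * q))) (p / q) = ?k j (\<xi> $ j)" for j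
      proof -
        have "ennpowr (ennreal (c1 * norm (1 - of_real (\<rho> $ j) * \<xi> $ j) powr (\<alpha> * q - (real m + 1) * q))) (p / q)
          = ennreal ((c1 * norm (1 - of_real (\<rho> $ j) * \<xi> $ j) powr (\<alpha> * q - (real m + 1) * q)) powr (p / q))"
          using c1 by (intro ennpowr_ennreal) simp
        also have "(c1 * norm (1 - of_real (\<rho> $ j) * \<xi> $ j) powr (\<alpha> * q - (real m + 1) * q)) powr (p / q)
          = c1 powr (p / q) * norm (1 - of_real (\<rho> $ j) * \<xi> $ j) powr (- b)"
          using \<open>(\<alpha> * q - (real m + 1) * q) * (p / q) = - b\<close> c1 by (simp only: powr_mult powr_powr)
        finally show ?thesis by (simp only: ennreal_mult powr_ge_zero)
      qed
      then show ?thesis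
        using q by (simp add: ennpowr_mult ennpowr_radial_weight ennpowr_prod)
    qed
    finally show "1 * ennpowr (\<integral>\<^sup>+R. wt R (\<alpha> * q - 1) * ennpowr (wt \<rho> e * ?K R \<xi>) q \<partial>cube_measure) (p / q) \<le> wt \<rho> (e * p) * (\<Prod>j\<in>UNIV. ?k j (\<xi> $ j))" .
  qed
  also have "\<dots> = wt \<rho> (e * p) * (\<integral>\<^sup>+\<xi>. (\<Prod>j\<in>UNIV. ?k j (\<xi> $ j)) \<partial>torus_measure)"
    by (rule nn_integral_cmult) measurable
  also have "(\<integral>\<^sup>+\<xi>. (\<Prod>j\<in>UNIV. ?k j (\<xi> $ j)) \<partial>torus_measure) = (\<Prod>j\<in>UNIV. \<integral>\<^sup>+u. ?k j u \<partial>circle_measure)"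
    by (rule nn_integral_torus_prod, rule measurable_circle_borelI) measurable
  also have "wt \<rho> (e * p) * (\<Prod>j\<in>UNIV. \<integral>\<^sup>+u. ?k j u \<partial>circle_measure)
    \<le> wt \<rho> (e * p) * (\<Prod>j\<in>(UNIV :: 'n set). ennreal (c1 powr (p / q) * c2) * ennreal ((1 - \<rho> $ j) powr (1 - b)))"
  proof (rule mult_left_mono[OF prod_mono_ennreal])
    fix j
    have "(\<integral>\<^sup>+u. ?k j u \<partial>circle_measure) = ennreal (c1 powr (p / q)) * (\<integral>\<^sup>+u. ennreal (norm (1 - of_real (\<rho> $ j) * u) powr (- b)) \<partial>circle_measure)"
      by (rule nn_integral_cmult, rule measurable_circle_borelI) measurable
    also have "\<dots> \<le> ennreal (c1 powr (p / q)) * ennreal (c2 * (1 - \<rho> $ j) powr (1 - b))"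
      unfolding c2_def by (intro mult_left_mono nn_integral_circle_kernel_le b r) simp
    also have "\<dots> = ennreal (c1 powr (p / q) * c2) * ennreal ((1 - \<rho> $ j) powr (1 - b))"
      using c2 by (simp add: ennreal_mult mult.assoc)
    finally show "(\<integral>\<^sup>+u. ?k j u \<partial>circle_measure) \<le> ennreal (c1 powr (p / q) * c2) * ennreal ((1 - \<rho> $ j) powr (1 - b))" .
  qed simp
  also have "(\<Prod>j\<in>(UNIV :: 'n set). ennreal (c1 powr (p / q) * c2) * ennreal ((1 - \<rho> $ j) powr (1 - b)))
    = ennreal ((c1 powr (p / q) * c2) ^ CARD('n)) * wt \<rho> (1 - b)"
    using c2 by (simp add: prod.distrib wt_prod ennreal_power)
  also have "wt \<rho> (e * p) * (ennreal ((c1 powr (p / q) * c2) ^ CARD('n)) * wt \<rho> (1 - b)) = ennreal ((c1 powr (p / q) * c2) ^ CARD('n))"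
  proof -
    \<comment> \<open>The normalising exponent \<open>e\<close> is defined by this
      cancellation.\<close>
    have "1 - b = - (e * p)" using p by (simp add: b_def e_def field_simps)
    then show ?thesis
      unfolding mult.left_commute[of "wt \<rho> (e * p)"] using wt_cancel[OF \<rho>, of "e * p"] by simp
  qed
  finally show ?thesis unfolding c1_def c2_def b_def .
qed

text \<open>The same two integrals in the opposite order: on the circle with exponent (m + 1)p,
  which exceeds 1, then radially. The normalisation \<open>e\<close> is the one of the F-norm, since
  it depends on \<alpha> + 1/p only.\<close>

lemma kernel_A_bound:
  fixes \<rho> :: "real ^ 'n"
  assumes p: "0 < p" and q: "0 < q" and \<alpha>: "0 < \<alpha>" and m: "\<alpha> + 1 / p < real m + 1" and \<rho>: "\<rho> \<in> unit_cube"
  defines "e \<equiv> real m + 1 - \<alpha> - 1 / p"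
  shows "(\<integral>\<^sup>+R. wt R (\<alpha> * q - 1) * ennpowr (\<integral>\<^sup>+\<xi>. 1 * ennpowr (wt \<rho> e * ennreal (norm (kernel m (scale_vec \<rho> (scale_vec R \<xi>))))) p \<partial>torus_measure) (q / p) \<partial>cube_measure)
    \<le> ennreal (((pi powr ((real m + 1) * p - 1) * (1 + 1 / ((real m + 1) * p - 1))) powr (q / p)
       * ((1 / (\<alpha> * q) + 1 / (e * q)) * 2 powr (e * q))) ^ CARD('n))"
proof -
  define b where "b = (real m + 1) * p"
  define c1 where "c1 = pi powr (b - 1) * (1 + 1 / (b - 1))"
  define d where "d = (b - 1) * (q / p)"
  define c2 where "c2 = (1 / (\<alpha> * q) + 1 / (e * q)) * 2 powr (e * q)"
  have e: "0 < e" using m by (simp add: e_def)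
  have "1 / p < real m + 1" using m \<alpha> by simp
  then have b: "1 < b" using p by (simp add: b_def field_simps)
  have \<alpha>q: "0 < \<alpha> * q" using \<alpha> q by simp
  \<comment> \<open>The surplus of the kernel exponent over the weight is positive because
    \<open>e\<close> is; it is the power of 1 - \<rho> that the normalisation cancels.\<close>
  have d: "d - \<alpha> * q = e * q" using p by (simp add: d_def b_def e_def field_simps)
  have dlt: "\<alpha> * q < d" using d mult_pos_pos[OF e q] by simp
  have c1: "0 \<le> c1" using b by (simp add: c1_def)
  have c2: "0 \<le> c2" using \<alpha>q e q by (simp add: c2_def)
  have r: "0 \<le> \<rho> $ j" "\<rho> $ j < 1" for j using \<rho> by (auto simp: unit_cube_def)
  let ?K = "\<lambda>R \<xi>. ennreal (norm (kernel m (scale_vec \<rho> (scale_vec R \<xi>))))"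
  let ?h = "\<lambda>j x. ennreal (c1 powr (q / p)) * ennreal ((1 - x) powr (\<alpha> * q - 1) * (1 - \<rho> $ j * x) powr (- d))"
  have inner: "(\<integral>\<^sup>+\<xi>. 1 * ennpowr (wt \<rho> e * ?K R \<xi>) p \<partial>torus_measure)
     \<le> wt \<rho> (e * p) * (\<Prod>j\<in>UNIV. ennreal (c1 * (1 - \<rho> $ j * R $ j) powr (1 - b)))"
    if "R \<in> unit_cube" for R
  proof -
    have R: "0 \<le> R $ j" "R $ j < 1" for j using that by (auto simp: unit_cube_def)
    have lt: "\<rho> $ j * R $ j < 1" for j
      using mult_left_le[of "R $ j" "\<rho> $ j"] R[of j] r[of j] by linarith
    let ?k = "\<lambda>j u. ennreal (norm (1 - of_real (\<rho> $ j * R $ j) * u) powr (- b))"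
    have "(\<integral>\<^sup>+\<xi>. 1 * ennpowr (wt \<rho> e * ?K R \<xi>) p \<partial>torus_measure) = (\<integral>\<^sup>+\<xi>. wt \<rho> (e * p) * (\<Prod>j\<in>UNIV. ?k j (\<xi> $ j)) \<partial>torus_measure)"
    proof (rule nn_integral_cong)
      fix \<xi> :: "complex ^ 'n" assume "\<xi> \<in> space torus_measure"
      then have \<xi>1: "norm (\<xi> $ j) = 1" for j by (simp add: unit_torus_def)
      have "norm (scale_vec \<rho> (scale_vec R \<xi>) $ j) < 1" for j
        using lt[of j] R[of j] r[of j] by (simp add: norm_mult \<xi>1)
      from norm_kernel_powr[OF this, of m p]
      have "ennpowr (?K R \<xi>) p = (\<Prod>j\<in>UNIV. ?k j (\<xi> $ j))"
        by (simp add: ennpowr_ennreal prod_ennreal mult.assoc b_def)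
      then show "1 * ennpowr (wt \<rho> e * ?K R \<xi>) p = wt \<rho> (e * p) * (\<Prod>j\<in>UNIV. ?k j (\<xi> $ j))"
        by (simp add: ennpowr_mult ennpowr_radial_weight)
    qed
    also have "\<dots> = wt \<rho> (e * p) * (\<integral>\<^sup>+\<xi>. (\<Prod>j\<in>UNIV. ?k j (\<xi> $ j)) \<partial>torus_measure)"
      by (rule nn_integral_cmult) measurable
    also have "(\<integral>\<^sup>+\<xi>. (\<Prod>j\<in>UNIV. ?k j (\<xi> $ j)) \<partial>torus_measure) = (\<Prod>j\<in>UNIV. \<integral>\<^sup>+u. ?k j u \<partial>circle_measure)"
      by (rule nn_integral_torus_prod, rule measurable_circle_borelI) measurable
    finally have 1: "(\<integral>\<^sup>+\<xi>. 1 * ennpowr (wt \<rho> e * ?K R \<xi>) p \<partial>torus_measure) = wt \<rho> (e * p) * (\<Prod>j\<in>UNIV. \<integral>\<^sup>+u. ?k j u \<partial>circle_measure)" .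
    have "(\<Prod>j\<in>UNIV. \<integral>\<^sup>+u. ?k j u \<partial>circle_measure) \<le> (\<Prod>j\<in>UNIV. ennreal (c1 * (1 - \<rho> $ j * R $ j) powr (1 - b)))"
      unfolding c1_def using lt R r by (intro prod_mono_ennreal nn_integral_circle_kernel_le b) auto
    then show ?thesis unfolding 1 by (rule mult_left_mono) simp
  qed
  have "(\<integral>\<^sup>+R. wt R (\<alpha> * q - 1) * ennpowr (\<integral>\<^sup>+\<xi>. 1 * ennpowr (wt \<rho> e * ?K R \<xi>) p \<partial>torus_measure) (q / p) \<partial>cube_measure)
     \<le> (\<integral>\<^sup>+R. wt \<rho> (e * q) * (\<Prod>j\<in>UNIV. ?h j (R $ j)) \<partial>cube_measure)"
  proof (rule nn_integral_mono)
    fix R :: "real ^ 'n" assume "R \<in> space cube_measure"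
    then have R: "R \<in> unit_cube" by simp
    have "ennpowr (\<integral>\<^sup>+\<xi>. 1 * ennpowr (wt \<rho> e * ?K R \<xi>) p \<partial>torus_measure) (q / p)
       \<le> ennpowr (wt \<rho> (e * p) * (\<Prod>j\<in>UNIV. ennreal (c1 * (1 - \<rho> $ j * R $ j) powr (1 - b)))) (q / p)"
      using p q by (intro ennpowr_mono inner R) auto
    also have "\<dots> = wt \<rho> (e * q) * (\<Prod>j\<in>UNIV. ennreal (c1 powr (q / p)) * ennreal ((1 - \<rho> $ j * R $ j) powr (- d)))"
    proof -
      have "ennpowr (ennreal (c1 * (1 - \<rho> $ j * R $ j) powr (1 - b))) (q / p) = ennreal (c1 powr (q / p)) * ennreal ((1 - \<rho> $ j * R $ j) powr (- d))" for j
      proof -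
        have "ennpowr (ennreal (c1 * (1 - \<rho> $ j * R $ j) powr (1 - b))) (q / p) = ennreal ((c1 * (1 - \<rho> $ j * R $ j) powr (1 - b)) powr (q / p))"
          using c1 by (intro ennpowr_ennreal) simp
        also have "(c1 * (1 - \<rho> $ j * R $ j) powr (1 - b)) powr (q / p) = c1 powr (q / p) * (1 - \<rho> $ j * R $ j) powr (- d)"
        proof -
          have "(1 - b) * (q / p) = - d" unfolding d_def using mult_minus_left[of "b - 1" "q / p"] by simp
          then show ?thesis using c1 by (simp only: powr_mult powr_powr)
        qed
        finally show ?thesis by (simp only: ennreal_mult powr_ge_zero)
      qed
      then show ?thesis using p by (simp add: ennpowr_mult ennpowr_radial_weight ennpowr_prod)
    qed
    finally have "wt R (\<alpha> * q - 1) * ennpowr (\<integral>\<^sup>+\<xi>. 1 * ennpowr (wt \<rho> e * ?K R \<xi>) p \<partial>torus_measure) (q / p)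
      \<le> wt R (\<alpha> * q - 1) * (wt \<rho> (e * q) * (\<Prod>j\<in>UNIV. ennreal (c1 powr (q / p)) * ennreal ((1 - \<rho> $ j * R $ j) powr (- d))))"
      by (rule mult_left_mono) simp
    also have "\<dots> = wt \<rho> (e * q) * (\<Prod>j\<in>UNIV. ?h j (R $ j))"
      by (simp add: wt_prod[of R] prod.distrib ennreal_mult mult_ac)
    finally show "wt R (\<alpha> * q - 1) * ennpowr (\<integral>\<^sup>+\<xi>. 1 * ennpowr (wt \<rho> e * ?K R \<xi>) p \<partial>torus_measure) (q / p) \<le> wt \<rho> (e * q) * (\<Prod>j\<in>UNIV. ?h j (R $ j))" .
  qed
  also have "\<dots> = wt \<rho> (e * q) * (\<integral>\<^sup>+R. (\<Prod>j\<in>UNIV. ?h j (R $ j)) \<partial>cube_measure)"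
    by (rule nn_integral_cmult) measurable
  also have "(\<integral>\<^sup>+R. (\<Prod>j\<in>UNIV. ?h j (R $ j)) \<partial>cube_measure) = (\<Prod>j\<in>UNIV. \<integral>\<^sup>+x. ?h j x \<partial>unit_interval_measure)"
    by (rule nn_integral_cube_prod, rule measurable_unit_intervalI) measurable
  also have "wt \<rho> (e * q) * (\<Prod>j\<in>UNIV. \<integral>\<^sup>+x. ?h j x \<partial>unit_interval_measure)
    \<le> wt \<rho> (e * q) * (\<Prod>j\<in>(UNIV :: 'n set). ennreal (c1 powr (q / p) * c2) * ennreal ((1 - \<rho> $ j) powr (- (e * q))))"
  proof (rule mult_left_mono[OF prod_mono_ennreal])
    fix j
    have "(\<integral>\<^sup>+x. ?h j x \<partial>unit_interval_measure) = ennreal (c1 powr (q / p)) * (\<integral>\<^sup>+x. ennreal ((1 - x) powr (\<alpha> * q - 1) * (1 - \<rho> $ j * x) powr (- d)) \<partial>unit_interval_measure)"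
      by (rule nn_integral_cmult, rule measurable_unit_intervalI) measurable
    also have "(\<integral>\<^sup>+x. ennreal ((1 - x) powr (\<alpha> * q - 1) * (1 - \<rho> $ j * x) powr (- d)) \<partial>unit_interval_measure)
      = (\<integral>\<^sup>+x. ennreal ((1 - x) powr (\<alpha> * q - 1) * norm (1 - of_real (\<rho> $ j * x) * (1 :: complex)) powr (- d)) \<partial>unit_interval_measure)"
    proof (rule nn_integral_cong)
      fix x assume "x \<in> space unit_interval_measure"
      then have "\<rho> $ j * x \<le> 1" using r[of j] by (intro mult_le_one) auto
      then have "norm (1 - of_real (\<rho> $ j * x) * (1 :: complex)) = 1 - \<rho> $ j * x"
        using norm_of_real[of "1 - \<rho> $ j * x", where 'a = complex] by simp
      then show "ennreal ((1 - x) powr (\<alpha> * q - 1) * (1 - \<rho> $ j * x) powr (- d)) = ennreal ((1 - x) powr (\<alpha> * q - 1) * norm (1 - of_real (\<rho> $ j * x) * (1 :: complex)) powr (- d))"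
        by (simp only:)
    qed
    finally have 1: "(\<integral>\<^sup>+x. ?h j x \<partial>unit_interval_measure) = ennreal (c1 powr (q / p)) *
       (\<integral>\<^sup>+x. ennreal ((1 - x) powr (\<alpha> * q - 1) * norm (1 - of_real (\<rho> $ j * x) * (1 :: complex)) powr (- d)) \<partial>unit_interval_measure)" .
    have "(\<integral>\<^sup>+x. ennreal ((1 - x) powr (\<alpha> * q - 1) * norm (1 - of_real (\<rho> $ j * x) * (1 :: complex)) powr (- d)) \<partial>unit_interval_measure)
      \<le> ennreal ((1 / (\<alpha> * q) + 1 / (d - \<alpha> * q)) * 2 powr (d - \<alpha> * q) * norm (1 - of_real (\<rho> $ j) * (1 :: complex)) powr (\<alpha> * q - d))"
      by (rule nn_integral_radial_kernel_le) (use \<alpha>q dlt r in auto)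
    also have "norm (1 - of_real (\<rho> $ j) * (1 :: complex)) = 1 - \<rho> $ j"
      using norm_of_real[of "1 - \<rho> $ j", where 'a = complex] r[of j] by simp
    also have "\<alpha> * q - d = - (e * q)" using d by simp
    finally have "(\<integral>\<^sup>+x. ennreal ((1 - x) powr (\<alpha> * q - 1) * norm (1 - of_real (\<rho> $ j * x) * (1 :: complex)) powr (- d)) \<partial>unit_interval_measure)
      \<le> ennreal (c2 * (1 - \<rho> $ j) powr (- (e * q)))" unfolding d c2_def .
    then have "(\<integral>\<^sup>+x. ?h j x \<partial>unit_interval_measure) \<le> ennreal (c1 powr (q / p)) * ennreal (c2 * (1 - \<rho> $ j) powr (- (e * q)))"
      unfolding 1 by (rule mult_left_mono) simp
    also have "\<dots> = ennreal (c1 powr (q / p) * c2) * ennreal ((1 - \<rho> $ j) powr (- (e * q)))"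
      using c2 by (simp add: ennreal_mult mult.assoc)
    finally show "(\<integral>\<^sup>+x. ?h j x \<partial>unit_interval_measure) \<le> ennreal (c1 powr (q / p) * c2) * ennreal ((1 - \<rho> $ j) powr (- (e * q)))" .
  qed simp
  also have "(\<Prod>j\<in>(UNIV :: 'n set). ennreal (c1 powr (q / p) * c2) * ennreal ((1 - \<rho> $ j) powr (- (e * q))))
    = ennreal ((c1 powr (q / p) * c2) ^ CARD('n)) * wt \<rho> (- (e * q))"
    using c2 by (simp add: prod.distrib wt_prod ennreal_power)
  also have "wt \<rho> (e * q) * (ennreal ((c1 powr (q / p) * c2) ^ CARD('n)) * wt \<rho> (- (e * q))) = ennreal ((c1 powr (q / p) * c2) ^ CARD('n))"
    unfolding mult.left_commute[of "wt \<rho> (e * q)"] using wt_cancel[OF \<rho>, of "e * q"] by simp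
  finally show ?thesis unfolding c1_def c2_def b_def .
qed

lemma scale_vec_scale_vec: "scale_vec r (scale_vec R \<xi>) = scale_vec (r * R) \<xi>"
  by (simp add: vec_eq_iff)

text \<open>Since the kernel bounds are uniform in the polyradius, a superposition with weights
  4^(-i) lies in both spaces at once, and a single function can test either multiplier
  property.\<close>

lemma kernel_superposition:
  fixes f :: "complex ^ 'n \<Rightarrow> complex"
  assumes f: "f \<in> hol_polydisc" and p: "0 < p" and q: "0 < q" and \<alpha>: "0 < \<alpha>" and m: "\<alpha> + 1 / p < real m + 1"
    and \<rho>: "\<And>i. \<rho> i \<in> unit_cube"
    and le: "\<And>z. z \<in> polydisc \<Longrightarrow> ennreal (norm (f z)) \<le> (\<Sum>i. ennreal ((1 / 4) ^ i) *
      (wt (\<rho> i) (real m + 1 - \<alpha> - 1 / p) * ennreal (norm (kernel m (scale_vec (\<rho> i) z)))))"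
  shows "f \<in> F_space p q \<alpha>" "f \<in> A_space p q \<alpha>"
proof -
  define e where "e = real m + 1 - \<alpha> - 1 / p"
  have K: "kernel m \<in> (hol_polydisc :: (complex ^ 'n \<Rightarrow> complex) set)"
    by (rule has_power_series_hol_polydisc[OF kernel_has_power_series])
  have Km: "(\<lambda>x. kernel m (scale_vec (\<rho> i) (scale_vec (R x) (\<xi> x)))) \<in> borel_measurable M"
    if "R \<in> M \<rightarrow>\<^sub>M cube_measure" "\<xi> \<in> M \<rightarrow>\<^sub>M torus_measure" for i R \<xi> and M :: "'z measure"
    unfolding scale_vec_scale_vec by (intro measurable_hol_scale_vec[OF K] measurable_times_cube \<rho> that)
  have "(\<integral>\<^sup>+\<xi>. 1 * ennpowr (\<integral>\<^sup>+R. wt R (\<alpha> * q - 1) * ennpowr (ennreal (norm (f (scale_vec R \<xi>)))) q \<partial>cube_measure) (p / q) \<partial>torus_measure) < top"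
  proof (rule mixed_norm_superposition[where G = "\<lambda>i \<xi> R. wt (\<rho> i) e * ennreal (norm (kernel m (scale_vec (\<rho> i) (scale_vec R \<xi>))))"])
    show "(\<lambda>R. wt (\<rho> i) e * ennreal (norm (kernel m (scale_vec (\<rho> i) (scale_vec R \<xi>))))) \<in> borel_measurable cube_measure"
      if "\<xi> \<in> space torus_measure" for i and \<xi> :: "complex ^ 'n"
    proof -
      have [measurable]: "(\<lambda>R. kernel m (scale_vec (\<rho> i) (scale_vec R \<xi>))) \<in> borel_measurable cube_measure"
        by (rule Km) (use that in auto)
      show ?thesis by measurable
    qed
    show "(\<lambda>\<xi>. \<integral>\<^sup>+R. wt R (\<alpha> * q - 1) * ennpowr (wt (\<rho> i) e * ennreal (norm (kernel m (scale_vec (\<rho> i) (scale_vec R \<xi>))))) q \<partial>cube_measure) \<in> borel_measurable torus_measure" for i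
    proof -
      have [measurable]: "(\<lambda>x. kernel m (scale_vec (\<rho> i) (scale_vec (snd x) (fst x)))) \<in> borel_measurable (torus_measure \<Otimes>\<^sub>M cube_measure)"
        by (rule Km) auto
      show ?thesis by (rule cube.borel_measurable_nn_integral) (simp add: split_beta')
    qed
    show "ennreal (norm (f (scale_vec R \<xi>))) \<le> (\<Sum>i. ennreal ((1 / 4) ^ i) * (wt (\<rho> i) e * ennreal (norm (kernel m (scale_vec (\<rho> i) (scale_vec R \<xi>))))))"
      if "\<xi> \<in> space torus_measure" "R \<in> space cube_measure" for \<xi> :: "complex ^ 'n" and R
      unfolding e_def by (rule le) (use that scale_vec_in_polydisc in auto)
  qed (use p q kernel_F_bound[OF p q \<alpha> m \<rho>] in \<open>auto simp: e_def\<close>)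
  then show "f \<in> F_space p q \<alpha>"
    using f by (simp add: F_space_def F_norm_pow_eq ennpowr_ennreal mult.commute)
  have "(\<integral>\<^sup>+R. wt R (\<alpha> * q - 1) * ennpowr (\<integral>\<^sup>+\<xi>. 1 * ennpowr (ennreal (norm (f (scale_vec R \<xi>)))) p \<partial>torus_measure) (q / p) \<partial>cube_measure) < top"
  proof (rule mixed_norm_superposition[where G = "\<lambda>i R \<xi>. wt (\<rho> i) e * ennreal (norm (kernel m (scale_vec (\<rho> i) (scale_vec R \<xi>))))"])
    show "(\<lambda>\<xi>. wt (\<rho> i) e * ennreal (norm (kernel m (scale_vec (\<rho> i) (scale_vec R \<xi>))))) \<in> borel_measurable torus_measure"
      if "R \<in> space cube_measure" for i and R :: "real ^ 'n"
    proof -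
      have [measurable]: "(\<lambda>\<xi>. kernel m (scale_vec (\<rho> i) (scale_vec R \<xi>))) \<in> borel_measurable torus_measure"
        by (rule Km) (use that in auto)
      show ?thesis by measurable
    qed
    show "(\<lambda>R. \<integral>\<^sup>+\<xi>. 1 * ennpowr (wt (\<rho> i) e * ennreal (norm (kernel m (scale_vec (\<rho> i) (scale_vec R \<xi>))))) p \<partial>torus_measure) \<in> borel_measurable cube_measure" for i
    proof -
      have [measurable]: "(\<lambda>x. kernel m (scale_vec (\<rho> i) (scale_vec (fst x) (snd x)))) \<in> borel_measurable (cube_measure \<Otimes>\<^sub>M torus_measure)"
        by (rule Km) auto
      show ?thesis by (rule torus.borel_measurable_nn_integral) (simp add: split_beta')
    qed
    show "ennreal (norm (f (scale_vec R \<xi>))) \<le> (\<Sum>i. ennreal ((1 / 4) ^ i) * (wt (\<rho> i) e * ennreal (norm (kernel m (scale_vec (\<rho> i) (scale_vec R \<xi>))))))"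
      if "R \<in> space cube_measure" "\<xi> \<in> space torus_measure" for R and \<xi> :: "complex ^ 'n"
      unfolding e_def by (rule le) (use that scale_vec_in_polydisc in auto)
  qed (use p q kernel_A_bound[OF p q \<alpha> m \<rho>] in \<open>auto simp: e_def\<close>)
  then show "f \<in> A_space p q \<alpha>"
    using f p by (simp add: A_space_def A_norm_pow_eq power_mean_def ennpowr_ennreal mult.commute)
qed

text \<open>Point masses on the naturals, so that a weighted series is a Bochner integral.
  Interchange with power series, norm bounds and the default value for divergent series then come
  from integration theory.\<close>

definition weights :: "(nat \<Rightarrow> real) \<Rightarrow> nat measure" where
  "weights l = density (count_space UNIV) (\<lambda>i. ennreal (l i))"

lemma sets_weights [simp, measurable_cong]: "sets (weights l) = UNIV"
  and space_weights [simp]: "space (weights l) = UNIV"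
  by (simp_all add: weights_def)

lemma borel_measurable_weights [simp]: "f \<in> borel_measurable (weights l)"
  by (simp add: measurable_def)

lemma nn_integral_weights: "(\<integral>\<^sup>+i. u i \<partial>weights l) = (\<Sum>i. ennreal (l i) * u i)"
  by (simp add: weights_def nn_integral_density nn_integral_count_space_nat)

lemma finite_measure_weights:
  assumes "\<And>i. 0 \<le> l i" "summable l"
  shows "finite_measure (weights l)"
proof
  have "emeasure (weights l) (space (weights l)) = (\<integral>\<^sup>+i. 1 \<partial>weights l)" by simp
  also have "\<dots> = ennreal (\<Sum>i. l i)"
    unfolding nn_integral_weights using assms by (simp add: suminf_ennreal2)
  finally show "emeasure (weights l) (space (weights l)) \<noteq> \<infinity>" by simp
qed

lemma norm_integral_weights_le:
  fixes v :: "nat \<Rightarrow> complex"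
  shows "ennreal (norm (\<integral>i. v i \<partial>weights l)) \<le> (\<Sum>i. ennreal (l i) * ennreal (norm (v i)))"
proof (cases "integrable (weights l) v")
  case True
  then show ?thesis using integral_norm_bound_ennreal[OF True] by (simp add: nn_integral_weights)
qed (simp add: not_integrable_integral_eq)

text \<open>The term of index \<open>j\<close> is the total minus the integral of the remaining
  terms, the latter being estimated absolutely.\<close>

lemma weighted_term_le:
  fixes v :: "nat \<Rightarrow> complex"
  assumes l: "\<And>i. 0 \<le> l i" and v: "integrable (weights l) v"
  shows "ennreal (l j * norm (v j)) \<le> ennreal (norm (\<integral>i. v i \<partial>weights l)) + (\<Sum>i. ennreal (l i) * (if i = j then 0 else ennreal (norm (v i))))"
proof -
  let ?u = "\<lambda>i. if i = j then 0 else v i"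
  have ind: "integrable (weights l) (\<lambda>i. indicator {j} i *\<^sub>R v i)"
    by (intro integrable_mult_indicator v) simp
  have "measure (weights l) {j} = l j"
  proof -
    have "emeasure (weights l) {j} = (\<integral>\<^sup>+i. ennreal (l i) * indicator {j} i \<partial>count_space UNIV)"
      by (simp add: weights_def emeasure_density)
    also have "\<dots> = ennreal (l j)" by (simp add: nn_integral_count_space_indicator[symmetric] nn_integral_count_space_finite)
    finally show ?thesis using l by (simp add: measure_def)
  qed
  moreover have "emeasure (weights l) {j} < \<infinity>"
    by (simp add: weights_def emeasure_density nn_integral_count_space_indicator[symmetric] nn_integral_count_space_finite)
  moreover have "(\<integral>i. indicator {j} i *\<^sub>R v i \<partial>weights l) = (\<integral>i. indicator {j} i *\<^sub>R v j \<partial>weights l)"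
    by (intro Bochner_Integration.integral_cong) (auto simp: indicator_def)
  ultimately have 1: "(\<integral>i. indicator {j} i *\<^sub>R v i \<partial>weights l) = l j *\<^sub>R v j" by simp
  have "(\<integral>i. ?u i \<partial>weights l) = (\<integral>i. v i - indicator {j} i *\<^sub>R v i \<partial>weights l)"
    by (intro Bochner_Integration.integral_cong) (auto simp: indicator_def)
  also have "\<dots> = (\<integral>i. v i \<partial>weights l) - l j *\<^sub>R v j"
    unfolding Bochner_Integration.integral_diff[OF v ind] 1 ..
  finally have "norm (l j *\<^sub>R v j) \<le> norm (\<integral>i. v i \<partial>weights l) + norm (\<integral>i. ?u i \<partial>weights l)"
    using norm_triangle_ineq4[of "\<integral>i. v i \<partial>weights l" "\<integral>i. ?u i \<partial>weights l"] by simp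
  then have "ennreal (l j * norm (v j)) \<le> ennreal (norm (\<integral>i. v i \<partial>weights l)) + ennreal (norm (\<integral>i. ?u i \<partial>weights l))"
    using l[of j] by (simp flip: ennreal_plus)
  also have "ennreal (norm (\<integral>i. ?u i \<partial>weights l)) \<le> (\<Sum>i. ennreal (l i) * ennreal (norm (?u i)))"
    by (rule norm_integral_weights_le)
  also have "(\<lambda>i. ennreal (l i) * ennreal (norm (?u i))) = (\<lambda>i. ennreal (l i) * (if i = j then 0 else ennreal (norm (v i))))"
    by (rule ext) simp
  finally show ?thesis by (simp add: add_left_mono)
qed

text \<open>Dilating and averaging multiplies the coefficient of index k by the same number for
  every function \<open>h\<close>. Superposition therefore commutes with coefficient
  multipliers.\<close>

lemma superposition:
  fixes h :: "complex ^ 'n \<Rightarrow> complex"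
  assumes h: "has_power_series h b" and l: "\<And>i. 0 \<le> l i" "summable l"
    and W: "\<And>i. 0 \<le> W i" "\<And>i. W i \<le> 1" and \<rho>: "\<And>i. \<rho> i \<in> unit_cube"
  shows "has_power_series (\<lambda>z. \<integral>i. of_real (W i) * h (scale_vec (\<rho> i) z) \<partial>weights l)
      (\<lambda>k. b k * (\<integral>i. of_real (W i * (\<Prod>j\<in>UNIV. \<rho> i $ j ^ (k $ j))) \<partial>weights l))"
    and "z \<in> polydisc \<Longrightarrow> integrable (weights l) (\<lambda>i. of_real (W i) * h (scale_vec (\<rho> i) z))"
proof -
  let ?F = "\<lambda>z k i. b k * monom_pow z k * of_real (W i * (\<Prod>j\<in>UNIV. \<rho> i $ j ^ (k $ j)))"
  have R: "0 \<le> \<rho> i $ j" "\<rho> i $ j \<le> 1" for i j using \<rho>[of i] by (auto simp: unit_cube_def less_imp_le)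
  have bound: "norm (?F z k i) \<le> norm (b k * monom_pow z k)" for z k i
  proof -
    have "W i * (\<Prod>j\<in>UNIV. \<rho> i $ j ^ (k $ j)) \<le> 1"
      by (intro mult_le_one W prod_le_1 prod_nonneg conjI zero_le_power power_le_one R ballI)
    moreover have "0 \<le> W i * (\<Prod>j\<in>UNIV. \<rho> i $ j ^ (k $ j))"
      by (intro mult_nonneg_nonneg W prod_nonneg zero_le_power R ballI)
    ultimately have "norm (of_real (W i * (\<Prod>j\<in>UNIV. \<rho> i $ j ^ (k $ j))) :: complex) \<le> 1"
      by (simp only: norm_of_real abs_of_nonneg)
    then show ?thesis unfolding norm_mult[of "b k * monom_pow z k"] by (intro mult_left_le) auto
  qed
  have sum: "(\<lambda>k. norm (b k * monom_pow z k)) summable_on UNIV" if "z \<in> polydisc" for z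
    using h that by (auto simp: has_power_series_def has_sum_imp_summable simp flip: summable_on_iff_abs_summable_on_complex)
  have hs: "((\<lambda>k. ?F z k i) has_sum of_real (W i) * h (scale_vec (\<rho> i) z)) UNIV" if z: "z \<in> polydisc" for z i
  proof -
    have "norm (scale_vec (\<rho> i) z $ j) < 1" for j
    proof -
      have "\<rho> i $ j * norm (z $ j) \<le> norm (z $ j)" by (intro mult_left_le_one_le R) simp
      moreover have "norm (z $ j) < 1" using z by (simp add: polydisc_def)
      ultimately show ?thesis using R[of i j] by (simp add: norm_mult)
    qed
    then have "scale_vec (\<rho> i) z \<in> polydisc" by (simp add: polydisc_def)
    then have "((\<lambda>k. b k * monom_pow (scale_vec (\<rho> i) z) k) has_sum h (scale_vec (\<rho> i) z)) UNIV"
      using h by (simp add: has_power_series_def)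
    from has_sum_cmult_right[OF this, of "of_real (W i)"] show ?thesis
      by (simp add: monom_pow_scale_vec mult_ac)
  qed
  note I = has_sum_integral[OF finite_measure_weights[OF l] _ bound sum hs]
  show "integrable (weights l) (\<lambda>i. of_real (W i) * h (scale_vec (\<rho> i) z))" if "z \<in> polydisc"
    by (rule I(1)) (use that in \<open>simp_all only: borel_measurable_weights\<close>)
  show "has_power_series (\<lambda>z. \<integral>i. of_real (W i) * h (scale_vec (\<rho> i) z) \<partial>weights l)
      (\<lambda>k. b k * (\<integral>i. of_real (W i * (\<Prod>j\<in>UNIV. \<rho> i $ j ^ (k $ j))) \<partial>weights l))"
    unfolding has_power_series_def
  proof
    fix z :: "complex ^ 'n" assume z: "z \<in> polydisc"
    have "((\<lambda>k. \<integral>i. ?F z k i \<partial>weights l) has_sum (\<integral>i. of_real (W i) * h (scale_vec (\<rho> i) z) \<partial>weights l)) UNIV"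
      by (rule I(2)) (use z in \<open>simp_all only: borel_measurable_weights\<close>)
    then show "((\<lambda>k. b k * (\<integral>i. of_real (W i * (\<Prod>j\<in>UNIV. \<rho> i $ j ^ (k $ j))) \<partial>weights l) * monom_pow z k) has_sum (\<integral>i. of_real (W i) * h (scale_vec (\<rho> i) z) \<partial>weights l)) UNIV"
      unfolding integral_mult_right_zero by (simp only: mult_ac)
  qed
qed

text \<open>The absolute coefficient sum serves as a bound on the closed polydisc of polyradius
  \<open>r\<close> that depends on the polyradius alone.\<close>

lemma norm_power_series_le:
  fixes D :: "complex ^ 'n \<Rightarrow> complex"
  assumes D: "has_power_series D d" and r: "r \<in> unit_cube" and z: "\<And>j. norm (z $ j) \<le> r $ j"
  shows "norm (D z) \<le> (\<Sum>\<^sub>\<infinity>k. norm (d k) * (\<Prod>j\<in>UNIV. r $ j ^ (k $ j)))"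
proof -
  have "norm (z $ j) < 1" for j using z[of j] r by (simp add: unit_cube_def) (metis le_less_trans)
  then have zp: "z \<in> polydisc" by (simp add: polydisc_def)
  have S: "(\<lambda>k. norm (d k) * (\<Prod>j\<in>UNIV. r $ j ^ (k $ j))) summable_on UNIV"
    by (rule subexponential_summable_vec[OF has_power_series_subexponential[OF D] r])
  have hs: "((\<lambda>k. d k * monom_pow z k) has_sum D z) UNIV" using D zp by (simp add: has_power_series_def)
  have le: "norm (d k * monom_pow z k) \<le> norm (d k) * (\<Prod>j\<in>UNIV. r $ j ^ (k $ j))" for k
    unfolding norm_mult norm_monom_pow
    by (intro mult_left_mono prod_mono conjI power_mono z zero_le_power) auto
  have "norm (D z) \<le> (\<Sum>\<^sub>\<infinity>k. norm (d k) * (\<Prod>j\<in>UNIV. r $ j ^ (k $ j)))"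
    using norm_infsum_le[OF hs has_sum_infsum[OF S]] le by simp
  then show ?thesis .
qed

section \<open>The gliding hump\<close>

lemma radial_weight_le_1:
  assumes "R \<in> unit_cube" "0 \<le> a"
  shows "radial_weight R a \<le> 1"
  unfolding radial_weight_def
proof (intro prod_le_1 conjI)
  fix j
  show "(1 - R $ j) powr a \<le> 1"
    using assms by (intro powr_le1) (auto simp: unit_cube_def less_imp_le)
qed simp

lemma ennpowr_add_le:
  assumes "0 < a" "a \<le> 1"
  shows "ennpowr (x + y) a \<le> 2 * (ennpowr x a + ennpowr y a)"
proof -
  have "ennpowr (x + y) a \<le> ennpowr (2 * max x y) a"
    using assms unfolding mult_2 by (intro ennpowr_mono add_mono) auto
  also have "\<dots> = ennreal (2 powr a) * ennpowr (max x y) a"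
    unfolding ennpowr_mult using ennpowr_ennreal[of 2 a] by simp
  also have "\<dots> \<le> 2 * ennpowr (max x y) a"
  proof (rule mult_right_mono)
    have "2 powr a \<le> 2 powr (1 :: real)" using assms by (intro powr_mono) auto
    then show "ennreal (2 powr a) \<le> 2" using ennreal_leI[of "2 powr a" 2] by simp
  qed simp
  also have "\<dots> \<le> 2 * (ennpowr x a + ennpowr y a)"
    by (intro mult_left_mono) (auto simp: max_def)
  finally show ?thesis .
qed

text \<open>Gliding hump: the radii are chosen one after the other so that at the radius \<open>\<rho> j\<close> the
  \<open>j\<close>-th term of the superposition dominates all the others.\<close>

lemma gliding_hump:
  fixes Q :: "'r \<Rightarrow> ennreal"
  assumes unb: "\<And>B. B < top \<Longrightarrow> \<exists>\<rho>\<in>X. B < Q \<rho>" and S: "\<And>\<rho>. \<rho> \<in> X \<Longrightarrow> 0 \<le> S \<rho>" and t: "0 < t"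
  obtains \<rho> :: "nat \<Rightarrow> 'r" and A :: "nat \<Rightarrow> real" where
    "\<And>j. \<rho> j \<in> X" "\<And>j. 1 \<le> A j" "\<And>j. A (Suc j) = A j + S (\<rho> j)"
    "\<And>j. ennreal (2 * real j + 2 * (2 * A j) powr t) \<le> ennreal (((1 / 4) ^ j / A j) powr t) * Q (\<rho> j)"
proof -
  \<comment> \<open>The state is the chosen radius together with the running sum \<open>A\<close> of
    the bounds \<open>S\<close> of all earlier radii. In the inequality to be achieved,
    \<open>2 * A\<close> stands for everything the other terms can contribute, the leading factors 2
    come from the quasi-triangle inequality for the power t, and \<open>2 * real j\<close> is the
    excess that produces the contradiction.\<close>
  let ?P = "\<lambda>j x. fst x \<in> X \<and> 1 \<le> (snd x :: real) \<and> ennreal (2 * real j + 2 * (2 * snd x) powr t) \<le> ennreal (((1 / 4) ^ j / snd x) powr t) * Q (fst x)"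
  have ex: "\<exists>r\<in>X. ennreal (2 * real j + 2 * (2 * a) powr t) \<le> ennreal (((1 / 4) ^ j / a) powr t) * Q r"
    if a: "1 \<le> a" for j :: nat and a :: real
  proof -
    let ?c = "((1 / 4) ^ j / a) powr t" and ?b = "2 * real j + 2 * (2 * a) powr t"
    have c: "0 < ?c" using a by simp
    \<comment> \<open>The inequality solved for \<open>Q\<close>: unboundedness supplies a radius
      beyond the finite threshold \<open>?b / ?c\<close>.\<close>
    obtain r where r: "r \<in> X" "ennreal (?b / ?c) < Q r" using unb[of "ennreal (?b / ?c)"] by auto
    have "ennreal ?b = ennreal ?c * ennreal (?b / ?c)"
      using c by (subst ennreal_mult'[symmetric]) (auto simp only: less_imp_le nonzero_mult_div_cancel_left times_divide_eq_right)
    also have "\<dots> \<le> ennreal ?c * Q r"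
      by (rule mult_left_mono[OF less_imp_le[OF r(2)]]) simp
    finally show ?thesis using r(1) by blast
  qed
  have "\<exists>x. ?P 0 x"
  proof -
    obtain r where "r \<in> X" "ennreal (2 * real 0 + 2 * (2 * 1) powr t) \<le> ennreal (((1 / 4) ^ 0 / 1) powr t) * Q r"
      using ex[of 1 0] by blast
    then show ?thesis by (intro exI[of _ "(r, 1)"]) simp
  qed
  moreover have "\<exists>y. ?P (Suc j) y \<and> snd y = snd x + S (fst x)" if "?P j x" for x j
  proof -
    have "1 \<le> snd x + S (fst x)" using that S[of "fst x"] by simp
    with ex[OF this, of "Suc j"] show ?thesis by auto
  qed
  ultimately obtain \<phi> where \<phi>: "\<And>j. ?P j (\<phi> j) \<and> snd (\<phi> (Suc j)) = snd (\<phi> j) + S (fst (\<phi> j))"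
    using dependent_nat_choice[of ?P "\<lambda>_ x y. snd y = snd x + S (fst x)"] by metis
  show thesis by (rule that[of "\<lambda>j. fst (\<phi> j)" "\<lambda>j. snd (\<phi> j)"]) (use \<phi> in auto)
qed

text \<open>Earlier terms contribute at most their own bounds, which sum to A_j - A_0. Later ones
  carry the weight 4^(-i)/A_i, and A_i has by then absorbed the bound \<sigma>_j, so they contribute
  at most 4^(-i). The total A_j - A_0 + 4/3 is at most 2 A_j as A_0 and A_j are at least 1.\<close>

lemma off_diagonal_sum_le:
  assumes A: "\<And>j. 1 \<le> A j" "\<And>j. A (Suc j) = A j + (\<sigma> j :: real)" and \<sigma>: "\<And>j. 0 \<le> \<sigma> j"
    and l: "\<And>j. l j = (1 / 4) ^ j / A j"
    and v: "\<And>i. 0 \<le> v i" "\<And>i. v i \<le> \<sigma> i" "\<And>i. v i \<le> \<sigma> j"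
  shows "(\<Sum>i. ennreal (l i) * (if i = j then 0 else ennreal (v i))) \<le> ennreal (2 * A j)"
proof -
  have mono: "A i \<le> A k" if "i \<le> k" for i k
    using that by (rule lift_Suc_mono_le[rotated]) (use A(2) \<sigma> in simp)
  have l0: "0 \<le> l i" and l1: "l i \<le> 1" for i
  proof -
    have "(1 / 4) ^ i \<le> (1 :: real)" by (simp add: power_le_one)
    also have "1 \<le> A i" by (rule A)
    finally show "0 \<le> l i" "l i \<le> 1" using A(1)[of i] by (simp_all add: l)
  qed
  have bound: "l i * v i \<le> (if i < j then \<sigma> i else 0) + (1 / 4) ^ i" if ij: "i \<noteq> j" for i
  proof (cases "i < j")
    case True
    have "l i * v i \<le> 1 * v i" by (intro mult_right_mono l1 v)
    also have "\<dots> \<le> \<sigma> i + 0" using v(2)[of i] by simp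
    also have "\<dots> \<le> \<sigma> i + (1 / 4) ^ i" by (rule add_left_mono) simp
    finally show ?thesis using True by simp
  next
    case False
    \<comment> \<open>For i > j the bound by \<sigma>_j is the useful one; it is contained in
      A_(j+1), hence in A_i.\<close>
    then have "A (Suc j) \<le> A i" using ij by (intro mono) simp
    then have "v i \<le> A i" using A(1)[of j] A(2)[of j] v(3)[of i] by simp
    then have "v i / A i \<le> 1" using A(1)[of i] by (simp add: divide_le_eq)
    then have "(1 / 4) ^ i * (v i / A i) \<le> (1 / 4) ^ i * 1" by (intro mult_left_mono) simp_all
    then show ?thesis using False by (simp add: l)
  qed
  have sA: "(\<Sum>i<j. \<sigma> i) = A j - A 0"
    by (induction j) (simp_all add: A(2))
  have "(\<Sum>i. ennreal (l i) * (if i = j then 0 else ennreal (v i))) \<le> (\<Sum>i. ennreal (if i < j then \<sigma> i else 0) + ennreal ((1 / 4) ^ i))"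
  proof (rule suminf_le)
    fix i
    show "ennreal (l i) * (if i = j then 0 else ennreal (v i)) \<le> ennreal (if i < j then \<sigma> i else 0) + ennreal ((1 / 4) ^ i)"
    proof (cases "i = j")
      case False
      then have "ennreal (l i) * (if i = j then 0 else ennreal (v i)) = ennreal (l i * v i)"
        using l0 v by (simp add: ennreal_mult)
      also have "\<dots> \<le> ennreal ((if i < j then \<sigma> i else 0) + (1 / 4) ^ i)"
        by (intro ennreal_leI bound False)
      finally show ?thesis using \<sigma> by (simp add: ennreal_plus)
    qed simp
  qed auto
  also have "\<dots> = (\<Sum>i. ennreal (if i < j then \<sigma> i else 0)) + (\<Sum>i. ennreal ((1 / 4) ^ i))"
    by (rule suminf_add[symmetric]) auto
  also have "(\<Sum>i. ennreal (if i < j then \<sigma> i else 0)) = (\<Sum>i<j. ennreal (\<sigma> i))"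
    by (subst suminf_finite[of "{..<j}"]) auto
  also have "\<dots> = ennreal (A j - A 0)" using \<sigma> by (simp add: sA sum_ennreal)
  also have "(\<Sum>i. ennreal ((1 / 4) ^ i)) = ennreal (4 / 3)"
    by (subst suminf_ennreal_geometric) auto
  also have "ennreal (A j - A 0) + ennreal (4 / 3) = ennreal (A j - A 0 + 4 / 3)"
    using mono[of 0 j] by (simp add: ennreal_plus)
  also have "\<dots> \<le> ennreal (2 * A j)" using A(1)[of 0] A(1)[of j] by (intro ennreal_leI) simp
  finally show ?thesis .
qed

lemma A_space_mean_bound:
  fixes h :: "complex ^ 'n \<Rightarrow> complex"
  assumes h: "h \<in> A_space t s \<beta>" and t: "0 < t" and s: "0 < s" and \<beta>: "0 < \<beta>"
  obtains B where "B < top" "\<And>r. r \<in> unit_cube \<Longrightarrow> power_mean t h r * wt r (\<beta> * t) \<le> B"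
proof -
  define B where "B = ennreal ((\<beta> * s * 2 powr (\<beta> * s)) ^ CARD('n)) * A_norm_pow t s \<beta> h"
  have hh: "h \<in> hol_polydisc" and fin: "A_norm_pow t s \<beta> h < top" using h by (auto simp: A_space_def)
  have B: "B < top" using fin by (simp add: B_def ennreal_mult_less_top)
  show thesis
  proof (rule that)
    show "ennpowr B (t / s) < top" using B by simp
    fix r :: "real ^ 'n" assume "r \<in> unit_cube"
    then have "ennpowr (ennpowr (power_mean t h r) (s / t) * wt r (\<beta> * s)) (t / s) \<le> ennpowr B (t / s)"
      unfolding B_def using t s by (intro ennpowr_mono power_mean_A_growth hh \<beta>) auto
    then show "power_mean t h r * wt r (\<beta> * t) \<le> ennpowr B (t / s)"
      using t s by (simp add: ennpowr_mult ennpowr_ennpowr ennpowr_radial_weight)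
  qed
qed

text \<open>If the quantity were unbounded, the gliding hump would give a superposition
  \<open>f\<close> of normalised kernels in both spaces whose image \<open>h\<close> is the same
  superposition of dilates of \<open>D\<close>. On the torus of polyradius \<rho>_j the j-th term,
  evaluated at \<rho>_j * \<rho>_j, exceeds the growth allowed to members of the target space. The
  multiplier assumption is required only on the intersection of the spaces, so that one argument
  serves both equivalences.\<close>

lemma necessity:
  fixes D :: "complex ^ 'n \<Rightarrow> complex"
  assumes D: "has_power_series D (\<lambda>k. of_real (binom_coeff m k) * c k)"
    and t: "0 < t" "t \<le> 1" and s: "0 < s" and \<beta>: "0 < \<beta>" and p: "0 < p" and q: "0 < q" and \<alpha>: "0 < \<alpha>"
    and m: "\<alpha> + 1 / p < real m + 1"
    and mult: "\<And>f. f \<in> F_space p q \<alpha> \<Longrightarrow> f \<in> A_space p q \<alpha> \<Longrightarrow>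
      \<exists>h\<in>A_space t s \<beta>. has_power_series h (\<lambda>k. c k * power_coeffs f k)"
  shows "\<exists>B<top. \<forall>\<rho>\<in>unit_cube. power_mean t D (\<rho> * \<rho>) * wt \<rho> (t * (real m + 1 - 1 / p + \<beta> - \<alpha>)) \<le> B"
proof (rule ccontr)
  define e where "e = real m + 1 - \<alpha> - 1 / p"
  define Q where "Q \<rho> = power_mean t D (\<rho> * \<rho>) * wt \<rho> (t * (real m + 1 - 1 / p + \<beta> - \<alpha>))" for \<rho>
  define S where "S r = (\<Sum>\<^sub>\<infinity>k. norm (of_real (binom_coeff m k) * c k) * (\<Prod>j\<in>UNIV. r $ j ^ (k $ j)))" for r :: "real ^ 'n"
  assume "\<not> ?thesis"
  then have unb: "\<exists>\<rho>\<in>unit_cube. B < Q \<rho>" if "B < top" for B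
    using that unfolding Q_def by (meson not_le)
  have hD: "D \<in> hol_polydisc" by (rule has_power_series_hol_polydisc[OF D])
  have e: "0 < e" using m by (simp add: e_def)
  have S0: "0 \<le> S r" if "r \<in> unit_cube" for r
    unfolding S_def using that by (intro infsum_nonneg mult_nonneg_nonneg prod_nonneg ballI zero_le_power) (auto simp: unit_cube_def)
  obtain \<rho> :: "nat \<Rightarrow> real ^ 'n" and A :: "nat \<Rightarrow> real" where
    \<rho>: "\<And>j. \<rho> j \<in> unit_cube" and A: "\<And>j. 1 \<le> A j" "\<And>j. A (Suc j) = A j + S (\<rho> j)"
    and hump: "\<And>j. ennreal (2 * real j + 2 * (2 * A j) powr t) \<le> ennreal (((1 / 4) ^ j / A j) powr t) * Q (\<rho> j)"
    by (rule gliding_hump[of unit_cube Q S t, OF unb S0 t(1)]) (assumption+, rule that)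
  define l where "l j = (1 / 4) ^ j / A j" for j
  define W where "W j = radial_weight (\<rho> j) e" for j
  have l0: "0 \<le> l j" and l4: "l j \<le> (1 / 4) ^ j" for j
    using A(1)[of j] by (simp_all add: l_def divide_le_eq)
  have l: "summable l"
    by (rule summable_comparison_test'[of "\<lambda>j. (1 / 4) ^ j" 0]) (use l0 l4 in auto)
  have W0: "0 \<le> W j" and W1: "W j \<le> 1" for j
    using e \<rho>[of j] by (simp_all add: W_def radial_weight_le_1)
  define super where "super u z = (\<integral>i. of_real (W i) * u (scale_vec (\<rho> i) z) \<partial>weights l)" for u :: "complex ^ 'n \<Rightarrow> complex" and z
  define \<tau> where "\<tau> k = (\<integral>i. complex_of_real (W i * (\<Prod>j\<in>UNIV. \<rho> i $ j ^ (k $ j))) \<partial>weights l)" for k :: "nat ^ 'n"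
  have super: "has_power_series (super u) (\<lambda>k. b k * \<tau> k)"
    and super_int: "z \<in> polydisc \<Longrightarrow> integrable (weights l) (\<lambda>i. of_real (W i) * u (scale_vec (\<rho> i) z))"
    if "has_power_series u b" for u b z
    unfolding super_def[abs_def] \<tau>_def by (rule superposition[OF that l0 l W0 W1 \<rho>], assumption?)+
  define f where "f = (super (kernel m) :: complex ^ 'n \<Rightarrow> complex)"
  have fs: "has_power_series f (\<lambda>k. of_real (binom_coeff m k) * \<tau> k)"
    unfolding f_def by (rule super[OF kernel_has_power_series])
  have "ennreal (norm (f z)) \<le> (\<Sum>i. ennreal ((1 / 4) ^ i) *
      (wt (\<rho> i) (real m + 1 - \<alpha> - 1 / p) * ennreal (norm (kernel m (scale_vec (\<rho> i) z)))))" for z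
  proof -
    have "ennreal (norm (f z)) \<le> (\<Sum>i. ennreal (l i) * ennreal (norm (of_real (W i) * kernel m (scale_vec (\<rho> i) z))))"
      unfolding f_def super_def by (rule norm_integral_weights_le)
    also have "\<dots> \<le> (\<Sum>i. ennreal ((1 / 4) ^ i) * ennreal (norm (of_real (W i) * kernel m (scale_vec (\<rho> i) z))))"
      by (intro suminf_le mult_right_mono ennreal_leI l4) auto
    finally show ?thesis using W0 by (simp add: norm_mult W_def e_def ennreal_mult)
  qed
  with \<rho> have "f \<in> F_space p q \<alpha>" "f \<in> A_space p q \<alpha>"
    using kernel_superposition[OF has_power_series_hol_polydisc[OF fs] p q \<alpha> m, of \<rho>] by blast+
  from mult[OF this] obtain h where h: "h \<in> A_space t s \<beta>" and hs: "has_power_series h (\<lambda>k. c k * power_coeffs f k)"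
    by blast
  \<comment> \<open>The factor \<open>\<tau>\<close> is common to the superpositions of the kernel
    and of \<open>D\<close>, so \<open>h\<close> and the superposition of \<open>D\<close> have the
    same power series. Outside the polydisc the two total functions need not agree.\<close>
  have hsuper: "h z = super D z" if "z \<in> polydisc" for z
  proof -
    have "((\<lambda>k. of_real (binom_coeff m k) * c k * \<tau> k * monom_pow z k) has_sum h z) UNIV"
      using hs that unfolding has_power_series_def power_coeffs_eqI[OF fs] by (simp add: mult_ac)
    moreover have "((\<lambda>k. of_real (binom_coeff m k) * c k * \<tau> k * monom_pow z k) has_sum super D z) UNIV"
      using super[OF D] that unfolding has_power_series_def by simp
    ultimately show ?thesis by (rule has_sum_unique)
  qed
  have hh: "h \<in> hol_polydisc" using h by (simp add: A_space_def)
  obtain B where B: "B < top" "\<And>r. r \<in> unit_cube \<Longrightarrow> power_mean t h r * wt r (\<beta> * t) \<le> B"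
    by (rule A_space_mean_bound[OF h t(1) s \<beta>], rule that)
  have "of_nat j \<le> B" for j :: nat
  proof -
    have pt: "ennreal (l j powr t) * (wt (\<rho> j) (e * t) * ennreal (norm (D (scale_vec (\<rho> j * \<rho> j) \<xi>)) powr t))
       \<le> 2 * (ennreal (norm (h (scale_vec (\<rho> j) \<xi>)) powr t) + ennreal ((2 * A j) powr t))"
      if \<xi>: "\<xi> \<in> unit_torus" for \<xi>
    proof -
      let ?z = "scale_vec (\<rho> j) \<xi>"
      have z: "?z \<in> polydisc" by (rule scale_vec_in_polydisc[OF \<rho> \<xi>])
      have \<xi>1: "norm (\<xi> $ k) = 1" for k using \<xi> by (simp add: unit_torus_def)
      have r: "0 \<le> \<rho> i $ k" "\<rho> i $ k \<le> 1" for i k using \<rho>[of i] by (auto simp: unit_cube_def less_imp_le)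
      \<comment> \<open>The i-th term is evaluated at \<rho>_i \<rho>_j \<xi>, whose coordinates are
        bounded by those of \<rho>_i and also by those of \<rho>_j. Both bounds are needed, the
        first for terms before j and the second for terms after it.\<close>
      have v: "norm (of_real (W i) * D (scale_vec (\<rho> i) ?z)) \<le> S (\<rho> i')" if i': "i' = i \<or> i' = j" for i i'
      proof -
        have "norm (of_real (W i) * D (scale_vec (\<rho> i) ?z)) \<le> norm (D (scale_vec (\<rho> i) ?z))"
          using W0[of i] W1[of i] by (simp add: norm_mult mult_left_le_one_le)
        also have "\<dots> \<le> S (\<rho> i')"
          unfolding S_def
        proof (rule norm_power_series_le[OF D \<rho>])
          fix k
          show "norm (scale_vec (\<rho> i) ?z $ k) \<le> \<rho> i' $ k"
            using i' r[of i k] r[of j k] by (auto simp: norm_mult \<xi>1 mult_left_le mult_left_le_one_le)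
        qed
        finally show ?thesis .
      qed
      have "ennreal (l j * norm (of_real (W j) * D (scale_vec (\<rho> j) ?z)))
        \<le> ennreal (norm (super D ?z)) + (\<Sum>i. ennreal (l i) * (if i = j then 0 else ennreal (norm (of_real (W i) * D (scale_vec (\<rho> i) ?z)))))"
        unfolding super_def by (rule weighted_term_le[OF l0 super_int[OF D z]])
      also have "(\<Sum>i. ennreal (l i) * (if i = j then 0 else ennreal (norm (of_real (W i) * D (scale_vec (\<rho> i) ?z))))) \<le> ennreal (2 * A j)"
        by (rule off_diagonal_sum_le[where \<sigma> = "\<lambda>i. S (\<rho> i)"]) (use A S0 \<rho> v in \<open>auto simp: l_def\<close>)
      finally have "ennreal (l j * norm (of_real (W j) * D (scale_vec (\<rho> j) ?z))) \<le> ennreal (norm (h ?z)) + ennreal (2 * A j)"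
        unfolding hsuper[OF z] by (simp add: add_left_mono)
      then have "ennpowr (ennreal (l j * norm (of_real (W j) * D (scale_vec (\<rho> j) ?z)))) t \<le> ennpowr (ennreal (norm (h ?z)) + ennreal (2 * A j)) t"
        using t by (intro ennpowr_mono) auto
      also have "\<dots> \<le> 2 * (ennpowr (ennreal (norm (h ?z))) t + ennpowr (ennreal (2 * A j)) t)"
        by (rule ennpowr_add_le[OF t])
      also have "ennpowr (ennreal (norm (h ?z))) t + ennpowr (ennreal (2 * A j)) t = ennreal (norm (h ?z) powr t) + ennreal ((2 * A j) powr t)"
        using A(1)[of j] by (simp only: ennpowr_ennreal norm_ge_zero)
      also have "ennpowr (ennreal (l j * norm (of_real (W j) * D (scale_vec (\<rho> j) ?z)))) t
        = ennreal (l j powr t) * (wt (\<rho> j) (e * t) * ennreal (norm (D (scale_vec (\<rho> j * \<rho> j) \<xi>)) powr t))"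
        using l0[of j] W0[of j]
        by (simp add: norm_mult ennpowr_mult ennreal_mult ennpowr_radial_weight W_def scale_vec_scale_vec ennpowr_ennreal)
      finally show ?thesis .
    qed
    note [measurable] = measurable_hol_fixed[OF hD times_cube[OF \<rho>[of j] \<rho>[of j]]] measurable_hol_fixed[OF hh \<rho>[of j]]
    have "ennreal (l j powr t) * (wt (\<rho> j) (e * t) * power_mean t D (\<rho> j * \<rho> j))
      = (\<integral>\<^sup>+\<xi>. ennreal (l j powr t) * (wt (\<rho> j) (e * t) * ennreal (norm (D (scale_vec (\<rho> j * \<rho> j) \<xi>)) powr t)) \<partial>torus_measure)"
      unfolding power_mean_def by (simp add: nn_integral_cmult)
    also have "\<dots> \<le> (\<integral>\<^sup>+\<xi>. 2 * (ennreal (norm (h (scale_vec (\<rho> j) \<xi>)) powr t) + ennreal ((2 * A j) powr t)) \<partial>torus_measure)"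
      by (intro nn_integral_mono pt) simp
    also have "\<dots> = 2 * (power_mean t h (\<rho> j) + ennreal ((2 * A j) powr t))"
      unfolding power_mean_def by (simp add: nn_integral_cmult nn_integral_add)
    finally have 1: "ennreal (l j powr t) * (wt (\<rho> j) (e * t) * power_mean t D (\<rho> j * \<rho> j)) \<le> 2 * (power_mean t h (\<rho> j) + ennreal ((2 * A j) powr t))" .
    have w1: "wt (\<rho> j) (\<beta> * t) \<le> 1"
      using \<beta> t ennreal_leI[OF radial_weight_le_1[OF \<rho>[of j], of "\<beta> * t"]] by simp
    have "ennreal (l j powr t) * Q (\<rho> j) = (ennreal (l j powr t) * (wt (\<rho> j) (e * t) * power_mean t D (\<rho> j * \<rho> j))) * wt (\<rho> j) (\<beta> * t)"
    proof -
      \<comment> \<open>The exponent of the criterion has two origins: \<open>e\<close> from the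
        normalisation of the kernels and \<beta> from the growth permitted in the target
        space.\<close>
      have "t * (real m + 1 - 1 / p + \<beta> - \<alpha>) = e * t + \<beta> * t" by (simp add: e_def algebra_simps)
      then show ?thesis by (simp add: Q_def ennreal_radial_weight_add mult_ac)
    qed
    also have "\<dots> \<le> (2 * (power_mean t h (\<rho> j) + ennreal ((2 * A j) powr t))) * wt (\<rho> j) (\<beta> * t)"
      by (rule mult_right_mono[OF 1]) simp
    also have "\<dots> = 2 * (power_mean t h (\<rho> j) * wt (\<rho> j) (\<beta> * t) + ennreal ((2 * A j) powr t) * wt (\<rho> j) (\<beta> * t))"
      by (simp only: distrib_right mult.assoc)
    also have "\<dots> \<le> 2 * (B + ennreal ((2 * A j) powr t) * 1)"
      by (intro mult_left_mono add_mono B \<rho> w1) auto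
    finally have "ennreal (l j powr t) * Q (\<rho> j) \<le> 2 * (B + ennreal ((2 * A j) powr t))" by simp
    with hump[of j] have 2: "ennreal (2 * real j + 2 * (2 * A j) powr t) \<le> 2 * (B + ennreal ((2 * A j) powr t))"
      unfolding l_def by (rule order_trans)
    show ?thesis
    proof (cases B)
      case (real b)
      then have "2 * (B + ennreal ((2 * A j) powr t)) = ennreal (2 * (b + (2 * A j) powr t))"
        by (subst ennreal_mult') (simp_all add: ennreal_plus)
      with 2 have "2 * real j + 2 * (2 * A j) powr t \<le> 2 * (b + (2 * A j) powr t)"
        using real(1) by (simp only: ennreal_le_iff mult_nonneg_nonneg add_nonneg_nonneg powr_ge_zero zero_le_numeral)
      then show ?thesis using real by (simp add: ennreal_of_nat_eq_real_of_nat ennreal_leI)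
    qed (use B in simp)
  qed
  moreover obtain j :: nat where "B < of_nat j"
  proof (cases B)
    case (real b)
    obtain n :: nat where "b < real n" using reals_Archimedean2 by blast
    then show thesis using real by (intro that[of n]) (simp add: ennreal_of_nat_eq_real_of_nat ennreal_less_iff)
  qed (use B in simp)
  ultimately show False using leD by blast
qed

text \<open>Every \<open>r\<close> is a square \<rho> * \<rho> with \<rho> in the cube, and 1 - r_j
  = (1 + \<rho>_j)(1 - \<rho>_j) is at most 2(1 - \<rho>_j), so the weight at \<open>r\<close> costs
  only the factor 2^\<kappa> per coordinate.\<close>

lemma SUP_integral_mean_finite:
  fixes D :: "complex ^ 'n \<Rightarrow> complex"
  assumes t: "0 < t" and \<kappa>: "0 \<le> \<kappa>" and B: "B < top"
    and le: "\<And>\<rho>. \<rho> \<in> unit_cube \<Longrightarrow> power_mean t D (\<rho> * \<rho>) * wt \<rho> (t * \<kappa>) \<le> B"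
  shows "(SUP r\<in>unit_cube. integral_mean t D r * wt r \<kappa>) < \<infinity>"
proof -
  have "integral_mean t D r * wt r \<kappa> \<le> ennreal ((2 powr \<kappa>) ^ CARD('n)) * ennpowr B (1 / t)" if r: "r \<in> unit_cube" for r
  proof -
    define \<rho> :: "real ^ 'n" where "\<rho> = (\<chi> j. sqrt (r $ j))"
    have r01: "0 \<le> r $ j" "r $ j < 1" for j using r by (auto simp: unit_cube_def)
    have \<rho>: "\<rho> \<in> unit_cube" using r01 by (simp add: unit_cube_def \<rho>_def real_less_lsqrt)
    have \<rho>r: "\<rho> * \<rho> = r" using r01 by (simp add: vec_eq_iff \<rho>_def)
    have "radial_weight r \<kappa> \<le> (\<Prod>j\<in>(UNIV :: 'n set). 2 powr \<kappa> * (1 - \<rho> $ j) powr \<kappa>)"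
      unfolding radial_weight_def
    proof (intro prod_mono conjI)
      fix j
      have x: "0 \<le> \<rho> $ j" "\<rho> $ j < 1" using \<rho> by (auto simp: unit_cube_def)
      have "1 - r $ j = (1 + \<rho> $ j) * (1 - \<rho> $ j)" by (simp add: algebra_simps flip: \<rho>r)
      also have "\<dots> \<le> 2 * (1 - \<rho> $ j)" using x by (intro mult_right_mono) auto
      finally have "(1 - r $ j) powr \<kappa> \<le> (2 * (1 - \<rho> $ j)) powr \<kappa>"
        using r01(2)[of j] \<kappa> by (intro powr_mono2) auto
      then show "(1 - r $ j) powr \<kappa> \<le> 2 powr \<kappa> * (1 - \<rho> $ j) powr \<kappa>" by (simp only: powr_mult)
    qed simp
    then have w: "wt r \<kappa> \<le> ennreal ((2 powr \<kappa>) ^ CARD('n)) * wt \<rho> \<kappa>"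
      using ennreal_leI by (fastforce simp: prod.distrib radial_weight_def ennreal_mult prod_nonneg)
    have "integral_mean t D r * wt \<rho> \<kappa> = ennpowr (power_mean t D (\<rho> * \<rho>) * wt \<rho> (t * \<kappa>)) (1 / t)"
      using t by (simp add: integral_mean_def power_mean_def \<rho>r ennpowr_mult ennpowr_radial_weight)
    also have "\<dots> \<le> ennpowr B (1 / t)" using t by (intro ennpowr_mono le \<rho>) simp
    finally have i: "integral_mean t D r * wt \<rho> \<kappa> \<le> ennpowr B (1 / t)" .
    have "integral_mean t D r * wt r \<kappa> \<le> integral_mean t D r * (ennreal ((2 powr \<kappa>) ^ CARD('n)) * wt \<rho> \<kappa>)"
      by (rule mult_left_mono[OF w]) simp
    also have "\<dots> = ennreal ((2 powr \<kappa>) ^ CARD('n)) * (integral_mean t D r * wt \<rho> \<kappa>)"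
      by (rule mult.left_commute)
    also have "\<dots> \<le> ennreal ((2 powr \<kappa>) ^ CARD('n)) * ennpowr B (1 / t)"
      by (rule mult_left_mono[OF i]) simp
    finally show ?thesis .
  qed
  then have "(SUP r\<in>unit_cube. integral_mean t D r * wt r \<kappa>) \<le> ennreal ((2 powr \<kappa>) ^ CARD('n)) * ennpowr B (1 / t)"
    by (rule SUP_least)
  also have "\<dots> < \<infinity>" using B by (simp add: ennreal_mult_less_top)
  finally show ?thesis .
qed

theorem theorem1:
  fixes g :: "complex ^ 'n \<Rightarrow> complex"
    and c :: "nat ^ 'n \<Rightarrow> complex"
    and \<alpha> \<beta> p q s t :: real
    and m :: nat
  assumes "g \<in> hol_polydisc"
    and "has_power_series g c"
    and "\<alpha> > 0" and "\<beta> > 0"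
    and "p > 0" and "q > 0" and "s > 0" and "t > 0"
    and "t \<le> 1"
    and "t / 2 < s" and "s \<le> t"
    and "max p q \<le> s"
    and "\<beta> + 1 / t < \<alpha> + 1 / p" and "\<alpha> + 1 / p < 2 / t"
    and "real m > 2 / t - 1"
  shows "(c \<in> multipliers (F_space p q \<alpha>) (A_space t s \<beta>) \<longleftrightarrow>
           (SUP r\<in>unit_cube. integral_mean t (frac_deriv (real m) g) r
              * ennreal (radial_weight r (real m + 1 - 1 / p + \<beta> - \<alpha>))) < \<infinity>)
       \<and> (c \<in> multipliers (A_space p q \<alpha>) (A_space t s \<beta>) \<longleftrightarrow>
           (SUP r\<in>unit_cube. integral_mean t (frac_deriv (real m) g) r
              * ennreal (radial_weight r (real m + 1 - 1 / p + \<beta> - \<alpha>))) < \<infinity>)"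
proof -
  define \<kappa> where "\<kappa> = real m + 1 - 1 / p + \<beta> - \<alpha>"
  \<comment> \<open>The index of the space with exponents t and s into which both source spaces
    embed.\<close>
  define \<gamma> where "\<gamma> = \<alpha> + 1 / p - 1 / t"
  define D where "D = frac_deriv (real m) g"
  let ?S = "SUP r\<in>unit_cube. integral_mean t D r * wt r \<kappa>"
  have D: "has_power_series D (\<lambda>k. of_real (binom_coeff m k) * c k)"
    unfolding D_def by (rule has_power_series_frac_deriv[OF assms(2)])
  \<comment> \<open>The hypotheses meet at 2/t: \<alpha> + 1/p lies below it and m + 1 above it. The
    resulting inequality is equivalent to \<beta> < \<kappa>.\<close>
  have m: "\<alpha> + 1 / p < real m + 1" using assms(14,15) by simp
  have "2 / t < real m + 1" using assms(15) by simp
  then have tm: "2 < t * (real m + 1)" using assms(8) by (simp add: field_simps)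
  have \<kappa>: "\<beta> < \<kappa>" "\<kappa> = real m + 1 - 1 / t + \<beta> - \<gamma>" using m by (simp_all add: \<kappa>_def \<gamma>_def)
  have pq: "p \<le> t" "p \<le> s" "q \<le> s" using assms(11,12) by auto
  \<comment> \<open>Stated for any source \<open>X\<close> inside the larger space with index
    \<gamma>, to cover both equivalences. The image is defined by its power series, which converges
    because subexponential sequences are closed under products.\<close>
  have suff: "c \<in> multipliers X (A_space t s \<beta>)"
    if S: "?S < \<infinity>" and X: "\<And>f. f \<in> X \<Longrightarrow> f \<in> hol_polydisc \<and> A_norm_pow t s \<gamma> f < \<infinity>" for X
    unfolding multipliers_def
  proof (intro CollectI ballI)
    fix f assume "f \<in> X"
    from X[OF this] have f: "f \<in> hol_polydisc" and fin: "A_norm_pow t s \<gamma> f < \<infinity>" by auto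
    obtain a where a: "has_power_series f a" using hol_polydisc_has_power_series[OF f] by blast
    define h where "h z = (\<Sum>\<^sub>\<infinity>k. c k * a k * monom_pow z k)" for z
    have h: "has_power_series h (\<lambda>k. c k * a k)"
      unfolding h_def[abs_def]
      by (intro has_power_series_infsum subexponential_mult has_power_series_subexponential[OF assms(2)] has_power_series_subexponential[OF a])
    have le: "power_mean t D r * wt r (t * \<kappa>) \<le> ennpowr ?S t" if r: "r \<in> unit_cube" for r
    proof -
      have "integral_mean t D r * wt r \<kappa> \<le> ?S" by (rule SUP_upper[OF r])
      then have "ennpowr (integral_mean t D r * wt r \<kappa>) t \<le> ennpowr ?S t"
        using assms(8) by (intro ennpowr_mono) simp_all
      then show ?thesis
        using assms(8) by (simp add: ennpowr_mult ennpowr_integral_mean ennpowr_radial_weight mult.commute)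
    qed
    have "ennpowr ?S t < top" using S by simp
    then have "A_norm_pow t s \<beta> h < \<infinity>"
      using assms(4,7-11) by (intro sufficiency[OF a D h _ _ _ _ tm _ \<kappa> _ le fin]) auto
    then have "h \<in> A_space t s \<beta>" using has_power_series_hol_polydisc[OF h] by (simp add: A_space_def)
    then show "\<exists>h\<in>A_space t s \<beta>. has_power_series h (\<lambda>k. c k * power_coeffs f k)"
      using h unfolding power_coeffs_eqI[OF a] by blast
  qed
  \<comment> \<open>The test functions lie in both spaces, so it is enough that \<open>X\<close>
    contains their intersection.\<close>
  have nec: "?S < \<infinity>" if X: "F_space p q \<alpha> \<inter> A_space p q \<alpha> \<subseteq> X" "c \<in> multipliers X (A_space t s \<beta>)" for X
  proof -
    have "\<exists>B<top. \<forall>\<rho>\<in>unit_cube. power_mean t D (\<rho> * \<rho>) * wt \<rho> (t * (real m + 1 - 1 / p + \<beta> - \<alpha>)) \<le> B"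
      by (rule necessity[OF D assms(8,9,7,4,5,6,3) m]) (use X in \<open>auto simp: multipliers_def\<close>)
    then obtain B where B: "B < top" "\<And>\<rho>. \<rho> \<in> unit_cube \<Longrightarrow> power_mean t D (\<rho> * \<rho>) * wt \<rho> (t * \<kappa>) \<le> B"
      unfolding \<kappa>_def by blast
    show ?thesis using \<kappa>(1) assms(4) by (intro SUP_integral_mean_finite[OF assms(8) _ B]) auto
  qed
  have F: "f \<in> hol_polydisc \<and> A_norm_pow t s \<gamma> f < \<infinity>" if "f \<in> F_space p q \<alpha>" for f
    using that F_space_embedding[of f p t q s \<alpha>] assms(3,5,6,12) pq by (auto simp: F_space_def \<gamma>_def)
  have A: "f \<in> hol_polydisc \<and> A_norm_pow t s \<gamma> f < \<infinity>" if "f \<in> A_space p q \<alpha>" for f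
    using that A_space_embedding[of f p t q s \<alpha>] assms(3,5,6,12) pq by (auto simp: A_space_def \<gamma>_def)
  show ?thesis
    unfolding \<kappa>_def[symmetric] D_def[symmetric]
    using suff[OF _ F] suff[OF _ A] nec[of "F_space p q \<alpha>"] nec[of "A_space p q \<alpha>"] by blast
qed

end
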